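(* For every $h\in\mathcal H$ the following hold: (a) $\underline I^k_{\mathrm{grad},h}\,\mathbb R=\operatorname{Ker}\underline G^k_h$, where $\mathbb R$ denotes the constant functions on $\Omega$; (b) $\operatorname{Im}\underline G^k_h\subset\operatorname{Ker}\underline C^k_h$; (c) $\operatorname{Im}\underline C^k_h\subset\operatorname{Ker}\underline D^k_h$; (d) $\operatorname{Im}\underline D^k_h=\mathcal P^k(\mathcal T_h)$, where $\mathcal P^k(\mathcal T_h)=\{q\in L^2(\Omega): q_{|T}\in\mathcal P^k(T)\ \forall T\in\mathcal T_h\}$ is identified with $\underline X^k_{L^2,h}$.
   Context: Mesh. $\Omega\subset\mathbb R^3$ is a polyhedral domain (open, bounded, connected); $h_Y$ is the diameter of a set $Y$. $(\mathcal M_h)_{h\in\mathcal H}$, $\mathcal M_h=\mathcal T_h\cup\mathcal F_h\cup\mathcal E_h\cup\mathcal V_h$, is a sequence of meshes of $\Omega$: $\mathcal T_h$ is a finite collection of disjoint open convex polyhedra (cells) with $\overline\Omega=\bigcup_{T\in\mathcal T_h}\overline T$ and $h=\max_T h_T>0$; $\mathcal F_h,\mathcal E_h,\mathcal V_h$ are the collections of open polygonal faces, open edges, and vertices. The sequence is regular with parameter $\rho\in(0,1)$: each $\mathcal T_h$ has a matching simplicial submesh in which every simplex $S$ has inradius $\ge\rho h_S$, and $\rho h_T\le h_S$ for every simplex $S\subset T\in\mathcal T_h$. $\mathcal F_T,\mathcal E_T$ are the faces and edges of $T$, $\mathcal E_F$ the edges of $F$, $\mathcal V_E$ the endpoints of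 $E$; $x_V$ is the position of the vertex $V$. Each face has a fixed unit normal $n_F$, each edge a fixed unit tangent $t_E$. For $E\in\mathcal E_F$, $n_{FE}$ is the unit vector normal to $E$ in the plane of $F$ with $(t_E,n_{FE},n_F)$ right-handed; $\omega_{FE},\omega_{TF}\in\{-1,1\}$ are such that $\omega_{FE}n_{FE}$ points out of $F$ and $\omega_{TF}n_F$ points out of $T$. An integer $k\ge0$ is fixed. $x_T\in T$ is a point with $B(x_T,\rho h_T)\subset T$; $x_F\in F$ is chosen similarly. Polynomials. $\mathcal P^l(X)$: polynomials of total degree $\le l$ on $X$ ($\{0\}$ if $l<0$); $\mathcal P^{0,l}(X)$: those of zero mean; $\boldsymbol{\mathcal P}^l(T)=\mathcal P^l(T)^3$; $\boldsymbol{\mathcal P}^l(E)=\mathcal P^l(E)^3$; $\boldsymbol{\mathcal P}^l(F)$: tangential ($2$-component) polynomial fields on $F$. On a face with tangential coordinates $(y_1,y_2)$ oriented by $n_F$: $\mathbf{rot}\,q=(\partial_2q,-\partial_1q)$, $\operatorname{rot}r=\partial_1r_2-\partial_2r_1$; ${}^\perp$ is rotation by $\pi/2$ in $F$; grad and div on $F$ are tangential. Define $\mathcal G^l(T)=\operatorname{grad}\mathcal P^{l+1}(T)$, $\mathcal G^{c,l}(T)=(x-x_T)\times\boldsymbol{\mathcal P}^{l-1}(T)$, $\mathcal R^l(T)=\operatorname{curl}\boldsymbol{\mathcal P}^{l+1}(T)$, $\mathcal R^{c,l}(T)=(x-x_T)\mathcal P^{l-1}(T)$; $\mathcal G^l(F)=\operatorname{grad}\mathcal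 P^{l+1}(F)$, $\mathcal G^{c,l}(F)=(x-x_F)^\perp\mathcal P^{l-1}(F)$, $\mathcal R^l(F)=\mathbf{rot}\,\mathcal P^{l+1}(F)$, $\mathcal R^{c,l}(F)=(x-x_F)\mathcal P^{l-1}(F)$. $\pi^l_{\mathcal P,X},\pi^l_{\mathcal G,X},\pi^{c,l}_{\mathcal G,X},\pi^l_{\mathcal R,X},\pi^{c,l}_{\mathcal R,X}$ are the $L^2(X)$-orthogonal projectors on $\mathcal P^l(X)$ (or its vector version), $\mathcal G^l(X)$, $\mathcal G^{c,l}(X)$, $\mathcal R^l(X)$, $\mathcal R^{c,l}(X)$. A prime is the derivative along $E$ in direction $t_E$. Discrete spaces. $\underline X^k_{\mathrm{grad},h}$: families $\underline q_h=((G_{q,V})_V,(q_E,G_{q,E})_E,(q_F,G_{q,F})_F,(q_T)_T)$ with $G_{q,V}\in\mathbb R^3$; $q_E\in\mathcal P^{k+1}(E)$ with values coinciding at shared vertices; $G_{q,E}\in\boldsymbol{\mathcal P}^k(E)$ orthogonal to $t_E$; $q_F,G_{q,F}\in\mathcal P^{k-1}(F)$; $q_T\in\mathcal P^{k-1}(T)$. $\underline X^k_{\mathrm{curl},h}$: families $\underline v_h=((R_{v,V})_V,(v_E,R_{v,E})_E,(v_{\mathcal R,F},v^c_{\mathcal R,F},v_F,R_{v,\mathcal G,F},R^c_{v,\mathcal G,F})_F,(v_{\mathcal R,T},v^c_{\mathcal R,T})_T)$ with $R_{v,V}\in\mathbb R^3$; $v_E\in\boldsymbol{\mathcal P}^{k+2}(E)$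 with values coinciding at shared vertices; $R_{v,E}\in\boldsymbol{\mathcal P}^{k+1}(E)$; $v_{\mathcal R,F}\in\mathcal R^{k-1}(F)$, $v^c_{\mathcal R,F}\in\mathcal R^{c,k}(F)$, $v_F\in\mathcal P^{k-1}(F)$, $R_{v,\mathcal G,F}\in\mathcal G^k(F)$, $R^c_{v,\mathcal G,F}\in\mathcal G^{c,k}(F)$; $v_{\mathcal R,T}\in\mathcal R^{k-1}(T)$, $v^c_{\mathcal R,T}\in\mathcal R^{c,k}(T)$. $\underline X^k_{\nabla,h}$: families $\underline w_h=((w_E)_E,(w_F,w_{\mathcal G,F},w^c_{\mathcal G,F})_F,(w_{\mathcal G,T},w^c_{\mathcal G,T})_T)$ with $w_E\in\boldsymbol{\mathcal P}^{k+3}(E)$ with values coinciding at shared vertices; $w_F\in\mathcal P^k(F)$, $w_{\mathcal G,F}\in\mathcal G^k(F)$, $w^c_{\mathcal G,F}\in\mathcal G^{c,k}(F)$; $w_{\mathcal G,T}\in\mathcal G^{k-1}(T)$, $w^c_{\mathcal G,T}\in\mathcal G^{c,k}(T)$. $\underline X^k_{L^2,h}$: families $(q_T)_T$ with $q_T\in\mathcal P^k(T)$. Interpolator. For $q\in C^1(\overline\Omega)$, $\underline I^k_{\mathrm{grad},h}q=((\operatorname{grad}q(x_V))_V,(q_E,\pi^k_{\mathcal P,E}(t_E\times(\operatorname{grad}q\times t_E)))_E,(\pi^{k-1}_{\mathcal P,F}q,\pi^{k-1}_{\mathcal P,F}(\operatorname{grad}q\cdot n_F))_F,(\pi^{k-1}_{\mathcal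 P,T}q)_T)$ with $\pi^{k-1}_{\mathcal P,E}q_E=\pi^{k-1}_{\mathcal P,E}q$ and $q_E(x_V)=q(x_V)$ for $V\in\mathcal V_E$. Gradient $\underline G^k_h:\underline X^k_{\mathrm{grad},h}\to\underline X^k_{\mathrm{curl},h}$. Given $\underline q_h$, its image has the components: - vertices: $R_V=0$; edges: $(v_E,v_E'\times t_E)$ where $\pi^k_{\mathcal P,E}v_E=q_E't_E+G_{q,E}$ and $v_E(x_V)=G_{q,V}$ for $V\in\mathcal V_E$; - faces: $(\pi^{k-1}_{\mathcal R,F}G_F,\pi^{c,k}_{\mathcal R,F}G_F,G_{q,F},\pi^k_{\mathcal G,F}G_F^\perp,\pi^{c,k}_{\mathcal G,F}G_F^\perp)$, where $G_F,G_F^\perp\in\boldsymbol{\mathcal P}^k(F)$ satisfy, for all $r\in\boldsymbol{\mathcal P}^k(F)$, $\int_FG_F\cdot r=-\int_Fq_F\operatorname{div}r+\sum_{E\in\mathcal E_F}\omega_{FE}\int_Eq_E\,r\cdot n_{FE}$ and $\int_FG_F^\perp\cdot r=-\int_FG_{q,F}\operatorname{rot}r-\sum_{E\in\mathcal E_F}\omega_{FE}\int_E(G_{q,E}\cdot n_F)(r\cdot t_E)$; - cells: $(\pi^{k-1}_{\mathcal R,T}G_T,\pi^{c,k}_{\mathcal R,T}G_T)$, where $G_T\in\boldsymbol{\mathcal P}^k(T)$ satisfies $\int_TG_T\cdot r=-\int_Tq_T\operatorname{div}r+\sum_{F\in\mathcal F_T}\omega_{TF}\int_F\gamma_F\,r\cdot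 n_F$ for all $r\in\boldsymbol{\mathcal P}^k(T)$, and $\gamma_F\in\mathcal P^{k+1}(F)$ is defined by $\int_F\gamma_F\operatorname{div}r=-\int_FG_F\cdot r+\sum_{E\in\mathcal E_F}\omega_{FE}\int_Eq_E\,r\cdot n_{FE}$ for all $r\in\mathcal R^{c,k+2}(F)$. Curl $\underline C^k_h:\underline X^k_{\mathrm{curl},h}\to\underline X^k_{\nabla,h}$. Given $\underline v_h$, its image has the components: - edges: $C_E\in\boldsymbol{\mathcal P}^{k+3}(E)$ with $\pi^{k+1}_{\mathcal P,E}C_E=R_{v,E}-v_E'\times t_E$ and $C_E(x_V)=R_{v,V}$ for $V\in\mathcal V_E$; - faces: $(C_F,\pi^k_{\mathcal G,F}\boldsymbol C_F+R_{v,\mathcal G,F},\pi^{c,k}_{\mathcal G,F}\boldsymbol C_F+R^c_{v,\mathcal G,F})$, where $C_F\in\mathcal P^k(F)$ and $\boldsymbol C_F\in\boldsymbol{\mathcal P}^k(F)$ satisfy $\int_FC_Fr=\int_Fv_{\mathcal R,F}\cdot\mathbf{rot}\,r-\sum_{E\in\mathcal E_F}\omega_{FE}\int_E(v_E\cdot t_E)r$ for all $r\in\mathcal P^k(F)$ and $\int_F\boldsymbol C_F\cdot r=\int_Fv_F\operatorname{rot}r+\sum_{E\in\mathcal E_F}\omega_{FE}\int_E(v_E\cdot n_F)(r\cdot t_E)$ for all $r\in\boldsymbol{\mathcal P}^k(F)$; - cells: $(\pi^{k-1}_{\mathcal G,T}C_T,\pi^{c,k}_{\mathcal G,T}C_T)$,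 where $C_T\in\boldsymbol{\mathcal P}^k(T)$ satisfies $\int_TC_T\cdot r=\int_Tv_{\mathcal R,T}\cdot\operatorname{curl}r+\sum_{F\in\mathcal F_T}\omega_{TF}\int_F\gamma_{t,F}\cdot(r\times n_F)$ for all $r\in\boldsymbol{\mathcal P}^k(T)$, and the tangential trace $\gamma_{t,F}\in\boldsymbol{\mathcal P}^k(F)$ is defined by $\int_F\gamma_{t,F}\cdot(\mathbf{rot}\,r+s)=\int_FC_Fr+\sum_{E\in\mathcal E_F}\omega_{FE}\int_E(v_E\cdot t_E)r+\int_Fv^c_{\mathcal R,F}\cdot s$ for all $(r,s)\in\mathcal P^{0,k+1}(F)\times\mathcal R^{c,k}(F)$. Divergence $\underline D^k_h:\underline X^k_{\nabla,h}\to\underline X^k_{L^2,h}$: $\underline D^k_h\underline w_h=(D_T)_T$, where $D_T\in\mathcal P^k(T)$ satisfies $\int_TD_Tq=-\int_Tw_{\mathcal G,T}\cdot\operatorname{grad}q+\sum_{F\in\mathcal F_T}\omega_{TF}\int_Fw_Fq$ for all $q\in\mathcal P^k(T)$. *)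

theory Defs
  imports "HOL-Analysis.Analysis"
begin

type_synonym point = "real^3"
type_synonym scalar_field = "point \<Rightarrow> real"
type_synonym vector_field = "point \<Rightarrow> real^3"

section \<open>Meshes\<close>

text \<open>
  Cells, faces and edges are point sets, vertices are points. The record also carries the choices
  attached to a mesh: the unit face normals \<open>n_F\<close>, the unit edge tangents \<open>t_E\<close>, and the points
  \<open>x_T\<close> and \<open>x_F\<close>.
\<close>

record mesh =
  cells :: "point set set"
  faces :: "point set set"
  edges :: "point set set"
  verts :: "point set"
  normal :: "point set \<Rightarrow> point"
  tangent :: "point set \<Rightarrow> point"
  cell_point :: "point set \<Rightarrow> point"
  face_point :: "point set \<Rightarrow> point"

definition polyhedral_domain :: "point set \<Rightarrow> bool" where
  "polyhedral_domain \<Omega> \<longleftrightarrow> open \<Omega> \<and> bounded \<Omega> \<and> connected \<Omega> \<and> \<Omega> \<noteq> {} \<and>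
     (\<exists>P. finite P \<and> (\<forall>p\<in>P. polytope p \<and> aff_dim p = 2) \<and> frontier \<Omega> = \<Union>P)"

definition cell_faces :: "mesh \<Rightarrow> point set \<Rightarrow> point set set" where
  "cell_faces M T = {F \<in> faces M. F \<subseteq> frontier T}"

definition face_edges :: "mesh \<Rightarrow> point set \<Rightarrow> point set set" where
  "face_edges M F = {E \<in> edges M. E \<subseteq> rel_frontier F}"

definition edge_verts :: "mesh \<Rightarrow> point set \<Rightarrow> point set" where
  "edge_verts M E = {V \<in> verts M. V \<in> rel_frontier E}"

text \<open>
  The boundary of a cell is tiled by mesh faces and the boundary of a face by mesh edges. Neighbouring
  faces of a cell may be coplanar and neighbouring edges of a face may be collinear, so a facet of a cell
  may be split into several mesh faces (hanging nodes are allowed).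
\<close>

definition polyhedral_mesh :: "point set \<Rightarrow> mesh \<Rightarrow> bool" where
  "polyhedral_mesh \<Omega> M \<longleftrightarrow>
     finite (cells M) \<and> finite (faces M) \<and> finite (edges M) \<and> finite (verts M) \<and>
     cells M \<noteq> {} \<and>
     (\<forall>T\<in>cells M. T \<noteq> {} \<and> open T \<and> convex T \<and> polytope (closure T)) \<and>
     (\<forall>F\<in>faces M. convex F \<and> rel_open F \<and> aff_dim F = 2 \<and> polytope (closure F)) \<and>
     (\<forall>E\<in>edges M. \<exists>a\<in>verts M. \<exists>b\<in>verts M. a \<noteq> b \<and> E = open_segment a b) \<and>
     pairwise disjnt (cells M \<union> faces M \<union> edges M \<union> (\<lambda>V. {V}) ` verts M) \<and>
     closure \<Omega> = (\<Union>T\<in>cells M. closure T) \<and>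
     (\<forall>T\<in>cells M. frontier T = (\<Union>F\<in>cell_faces M T. closure F)) \<and>
     (\<forall>F\<in>faces M. \<exists>T\<in>cells M. F \<in> cell_faces M T) \<and>
     (\<forall>F\<in>faces M. rel_frontier F = (\<Union>E\<in>face_edges M F. closure E)) \<and>
     (\<forall>E\<in>edges M. \<exists>F\<in>faces M. E \<in> face_edges M F) \<and>
     (\<forall>V\<in>verts M. \<exists>E\<in>edges M. V \<in> edge_verts M E)"

definition mesh_size :: "mesh \<Rightarrow> real" where
  "mesh_size M = Max (diameter ` cells M)"

definition oriented :: "mesh \<Rightarrow> bool" where
  "oriented M \<longleftrightarrow>
     (\<forall>F\<in>faces M. norm (normal M F) = 1 \<and> (\<forall>x\<in>F. \<forall>y\<in>F. normal M F \<bullet> (x - y) = 0)) \<and>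
     (\<forall>E\<in>edges M. norm (tangent M E) = 1 \<and> (\<forall>x\<in>E. \<forall>y\<in>E. cross3 (tangent M E) (x - y) = 0))"

definition inradius :: "point set \<Rightarrow> real" where
  "inradius S = Sup {r. 0 \<le> r \<and> (\<exists>c. cball c r \<subseteq> S)}"

text \<open>
  Simplices of the submesh are closed, as in the library, so that \<open>interior S \<subseteq> T\<close> is the inclusion of
  the open simplex in the open cell.
\<close>

definition matching_simplicial_submesh :: "mesh \<Rightarrow> point set set \<Rightarrow> bool" where
  "matching_simplicial_submesh M \<S> \<longleftrightarrow>
     triangulation \<S> \<and> \<Union>\<S> = (\<Union>T\<in>cells M. closure T) \<and>
     (\<forall>S\<in>\<S>. 3 simplex S \<and> (\<exists>T\<in>cells M. interior S \<subseteq> T)) \<and>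
     (\<forall>S\<in>\<S>. \<forall>\<sigma>. \<sigma> facet_of S \<longrightarrow>
        (\<forall>F\<in>faces M. disjnt (rel_interior \<sigma>) F \<or> rel_interior \<sigma> \<subseteq> F))"

definition regular_mesh :: "real \<Rightarrow> mesh \<Rightarrow> bool" where
  "regular_mesh \<rho> M \<longleftrightarrow>
     (\<exists>\<S>. matching_simplicial_submesh M \<S> \<and>
        (\<forall>S\<in>\<S>. \<rho> * diameter S \<le> inradius S) \<and>
        (\<forall>T\<in>cells M. \<forall>S\<in>\<S>. interior S \<subseteq> T \<longrightarrow> \<rho> * diameter T \<le> diameter S))"

definition admissible_points :: "real \<Rightarrow> mesh \<Rightarrow> bool" where
  "admissible_points \<rho> M \<longleftrightarrow>
     (\<forall>T\<in>cells M. cell_point M T \<in> T \<and> ball (cell_point M T) (\<rho> * diameter T) \<subseteq> T) \<and>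
     (\<forall>F\<in>faces M. face_point M F \<in> F \<and>
        ball (face_point M F) (\<rho> * diameter F) \<inter> affine hull F \<subseteq> F)"

definition regular_mesh_sequence :: "point set \<Rightarrow> real \<Rightarrow> real set \<Rightarrow> (real \<Rightarrow> mesh) \<Rightarrow> bool" where
  "regular_mesh_sequence \<Omega> \<rho> \<H> \<M> \<longleftrightarrow>
     (\<forall>h\<in>\<H>. polyhedral_mesh \<Omega> (\<M> h) \<and> mesh_size (\<M> h) = h \<and> oriented (\<M> h) \<and>
        regular_mesh \<rho> (\<M> h) \<and> admissible_points \<rho> (\<M> h))"

text \<open>
  \<open>n_FE\<close> is determined by right-handedness of \<open>(t_E, n_FE, n_F)\<close>, i.e. \<open>t_E \<times> n_FE = n_F\<close>.
\<close>

definition edge_normal :: "mesh \<Rightarrow> point set \<Rightarrow> point set \<Rightarrow> point" where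
  "edge_normal M F E = cross3 (normal M F) (tangent M E)"

definition points_out_of :: "point \<Rightarrow> point set \<Rightarrow> point set \<Rightarrow> bool" where
  "points_out_of n S A \<longleftrightarrow> (\<forall>x\<in>A. \<forall>\<^sub>F s in at_right 0. x + s *\<^sub>R n \<notin> closure S)"

definition outward_sign :: "point \<Rightarrow> point set \<Rightarrow> point set \<Rightarrow> real" where
  "outward_sign n S A = (THE w. w \<in> {-1, 1} \<and> points_out_of (w *\<^sub>R n) S A)"

definition omegaTF :: "mesh \<Rightarrow> point set \<Rightarrow> point set \<Rightarrow> real" where
  "omegaTF M T F = outward_sign (normal M F) T F"

definition omegaFE :: "mesh \<Rightarrow> point set \<Rightarrow> point set \<Rightarrow> real" where
  "omegaFE M F E = outward_sign (edge_normal M F E) F E"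

section \<open>Differential operators and integrals\<close>

definition grad_within :: "point set \<Rightarrow> scalar_field \<Rightarrow> vector_field" where
  "grad_within S q x = (\<chi> i. frechet_derivative q (at x within S) (axis i 1))"

abbreviation grad :: "scalar_field \<Rightarrow> vector_field" where
  "grad \<equiv> grad_within UNIV"

definition divg :: "vector_field \<Rightarrow> scalar_field" where
  "divg r x = (\<Sum>i\<in>UNIV. frechet_derivative r (at x) (axis i 1) $ i)"

definition curl :: "vector_field \<Rightarrow> vector_field" where
  "curl r x =
     (let D = (\<lambda>i j. frechet_derivative r (at x) (axis i 1) $ j)
      in vector [D 2 3 - D 3 2, D 3 1 - D 1 3, D 1 2 - D 2 1])"

text \<open>
  In an orthonormal basis \<open>(e\<^sub>1, e\<^sub>2, n)\<close> that is right-handed, fields that do not depend on the normal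
  coordinate satisfy \<open>grad q \<times> n = (\<partial>\<^sub>2 q, -\<partial>\<^sub>1 q)\<close>, \<open>curl r \<bullet> n = \<partial>\<^sub>1 r\<^sub>2 - \<partial>\<^sub>2 r\<^sub>1\<close>, and rotation by
  \<open>\<pi>/2\<close> is \<open>v \<mapsto> n \<times> v\<close>.
\<close>

definition vrot :: "point \<Rightarrow> scalar_field \<Rightarrow> vector_field" where
  "vrot n q x = cross3 (grad q x) n"

definition srot :: "point \<Rightarrow> vector_field \<Rightarrow> scalar_field" where
  "srot n r x = curl r x \<bullet> n"

definition edge_deriv :: "mesh \<Rightarrow> point set \<Rightarrow> (point \<Rightarrow> 'b::real_normed_vector) \<Rightarrow> point \<Rightarrow> 'b" where
  "edge_deriv M E f x = frechet_derivative f (at x) (tangent M E)"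

text \<open>
  Integrals over faces and edges with respect to the surface and the length measure are computed in
  Cartesian coordinates of the carrying plane or line; they do not depend on the isometry chosen.
\<close>

definition isometric_chart :: "point set \<Rightarrow> 'a::euclidean_space \<Rightarrow> point" where
  "isometric_chart X = (SOME \<phi>. (\<forall>x y. dist (\<phi> x) (\<phi> y) = dist x y) \<and> range \<phi> = affine hull X)"

definition cell_integral :: "point set \<Rightarrow> scalar_field \<Rightarrow> real" where
  "cell_integral T f = integral T f"

definition face_integral :: "point set \<Rightarrow> scalar_field \<Rightarrow> real" where
  "face_integral F f = integral (isometric_chart F -` F) (\<lambda>y::real^2. f (isometric_chart F y))"

definition edge_integral :: "point set \<Rightarrow> scalar_field \<Rightarrow> real" where
  "edge_integral E f = integral (isometric_chart E -` E) (\<lambda>y::real. f (isometric_chart E y))"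

text \<open>
  The orthogonal projection onto \<open>S\<close> for the inner product \<open>(f, g) \<mapsto> I (\<lambda>x. f x \<bullet> g x)\<close>.
\<close>

definition L2_proj ::
  "(scalar_field \<Rightarrow> real) \<Rightarrow> (point \<Rightarrow> 'b::real_inner) set \<Rightarrow> (point \<Rightarrow> 'b) \<Rightarrow> point \<Rightarrow> 'b" where
  "L2_proj I S f = (THE p. p \<in> S \<and> (\<forall>s\<in>S. I (\<lambda>x. p x \<bullet> s x) = I (\<lambda>x. f x \<bullet> s x)))"

section \<open>Polynomial spaces\<close>

definition poly3 :: "int \<Rightarrow> scalar_field set" where
  "poly3 l = {(\<lambda>x. \<Sum>\<alpha> | int (\<Sum>i\<in>UNIV. \<alpha> i) \<le> l. c \<alpha> * (\<Prod>i\<in>UNIV. x $ i ^ \<alpha> i)) | c :: (3 \<Rightarrow> nat) \<Rightarrow> real. True}"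

text \<open>
  A polynomial on a cell, face or edge \<open>X\<close> is represented by its unique extension to the whole space
  that is constant along the directions normal to \<open>X\<close>, i.e. that factors through the orthogonal
  projection onto the affine hull of \<open>X\<close>. Hence two polynomials on \<open>X\<close> are equal iff they agree on \<open>X\<close>,
  they have values on \<open>closure X\<close>, and the full-space differential operators applied to the
  representative give the tangential ones. For a cell the projection is the identity.
\<close>

definition hull_proj :: "point set \<Rightarrow> point \<Rightarrow> point" where
  "hull_proj X = closest_point (affine hull X)"

definition Poly :: "int \<Rightarrow> point set \<Rightarrow> scalar_field set" where
  "Poly l X = (\<lambda>p x. p (hull_proj X x)) ` poly3 l"

definition vPoly :: "int \<Rightarrow> point set \<Rightarrow> vector_field set" where
  "vPoly l X = {r. \<forall>i. (\<lambda>x. r x $ i) \<in> Poly l X}"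

definition tPoly :: "mesh \<Rightarrow> int \<Rightarrow> point set \<Rightarrow> vector_field set" where
  "tPoly M l F = {r \<in> vPoly l F. \<forall>x. r x \<bullet> normal M F = 0}"

definition Poly0_face :: "int \<Rightarrow> point set \<Rightarrow> scalar_field set" where
  "Poly0_face l F = {q \<in> Poly l F. face_integral F q = 0}"

definition Gcell :: "int \<Rightarrow> point set \<Rightarrow> vector_field set" where
  "Gcell l T = grad ` Poly (l + 1) T"

definition Gc_cell :: "mesh \<Rightarrow> int \<Rightarrow> point set \<Rightarrow> vector_field set" where
  "Gc_cell M l T = (\<lambda>p x. cross3 (x - cell_point M T) (p x)) ` vPoly (l - 1) T"

definition Rcell :: "int \<Rightarrow> point set \<Rightarrow> vector_field set" where
  "Rcell l T = curl ` vPoly (l + 1) T"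

definition Rc_cell :: "mesh \<Rightarrow> int \<Rightarrow> point set \<Rightarrow> vector_field set" where
  "Rc_cell M l T = (\<lambda>p x. p x *\<^sub>R (x - cell_point M T)) ` Poly (l - 1) T"

definition Gface :: "int \<Rightarrow> point set \<Rightarrow> vector_field set" where
  "Gface l F = grad ` Poly (l + 1) F"

definition Gc_face :: "mesh \<Rightarrow> int \<Rightarrow> point set \<Rightarrow> vector_field set" where
  "Gc_face M l F =
     (\<lambda>p x. p x *\<^sub>R cross3 (normal M F) (hull_proj F x - face_point M F)) ` Poly (l - 1) F"

definition Rface :: "mesh \<Rightarrow> int \<Rightarrow> point set \<Rightarrow> vector_field set" where
  "Rface M l F = vrot (normal M F) ` Poly (l + 1) F"

definition Rc_face :: "mesh \<Rightarrow> int \<Rightarrow> point set \<Rightarrow> vector_field set" where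
  "Rc_face M l F = (\<lambda>p x. p x *\<^sub>R (hull_proj F x - face_point M F)) ` Poly (l - 1) F"

section \<open>Discrete spaces\<close>

record dof_grad =
  q_GV :: "point \<Rightarrow> point"
  q_E :: "point set \<Rightarrow> scalar_field"
  q_GE :: "point set \<Rightarrow> vector_field"
  q_F :: "point set \<Rightarrow> scalar_field"
  q_GF :: "point set \<Rightarrow> scalar_field"
  q_T :: "point set \<Rightarrow> scalar_field"

record dof_curl =
  v_RV :: "point \<Rightarrow> point"
  v_E :: "point set \<Rightarrow> vector_field"
  v_RE :: "point set \<Rightarrow> vector_field"
  v_RF :: "point set \<Rightarrow> vector_field"
  v_RcF :: "point set \<Rightarrow> vector_field"
  v_F :: "point set \<Rightarrow> scalar_field"
  v_RGF :: "point set \<Rightarrow> vector_field"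
  v_RGcF :: "point set \<Rightarrow> vector_field"
  v_RT :: "point set \<Rightarrow> vector_field"
  v_RcT :: "point set \<Rightarrow> vector_field"

record dof_nabla =
  w_E :: "point set \<Rightarrow> vector_field"
  w_F :: "point set \<Rightarrow> scalar_field"
  w_GF :: "point set \<Rightarrow> vector_field"
  w_GcF :: "point set \<Rightarrow> vector_field"
  w_GT :: "point set \<Rightarrow> vector_field"
  w_GcT :: "point set \<Rightarrow> vector_field"

definition vertex_continuous :: "mesh \<Rightarrow> (point set \<Rightarrow> point \<Rightarrow> 'b) \<Rightarrow> bool" where
  "vertex_continuous M f \<longleftrightarrow>
     (\<forall>E\<in>edges M. \<forall>E'\<in>edges M. \<forall>V\<in>edge_verts M E \<inter> edge_verts M E'. f E V = f E' V)"

definition Xgrad :: "mesh \<Rightarrow> nat \<Rightarrow> dof_grad set" where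
  "Xgrad M k = {q.
     q_GV q \<in> (\<Pi>\<^sub>E V\<in>verts M. UNIV) \<and>
     q_E q \<in> (\<Pi>\<^sub>E E\<in>edges M. Poly (int k + 1) E) \<and> vertex_continuous M (q_E q) \<and>
     q_GE q \<in> (\<Pi>\<^sub>E E\<in>edges M. {g \<in> vPoly (int k) E. \<forall>x. g x \<bullet> tangent M E = 0}) \<and>
     q_F q \<in> (\<Pi>\<^sub>E F\<in>faces M. Poly (int k - 1) F) \<and>
     q_GF q \<in> (\<Pi>\<^sub>E F\<in>faces M. Poly (int k - 1) F) \<and>
     q_T q \<in> (\<Pi>\<^sub>E T\<in>cells M. Poly (int k - 1) T)}"

definition Xcurl :: "mesh \<Rightarrow> nat \<Rightarrow> dof_curl set" where
  "Xcurl M k = {v.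
     v_RV v \<in> (\<Pi>\<^sub>E V\<in>verts M. UNIV) \<and>
     v_E v \<in> (\<Pi>\<^sub>E E\<in>edges M. vPoly (int k + 2) E) \<and> vertex_continuous M (v_E v) \<and>
     v_RE v \<in> (\<Pi>\<^sub>E E\<in>edges M. vPoly (int k + 1) E) \<and>
     v_RF v \<in> (\<Pi>\<^sub>E F\<in>faces M. Rface M (int k - 1) F) \<and>
     v_RcF v \<in> (\<Pi>\<^sub>E F\<in>faces M. Rc_face M (int k) F) \<and>
     v_F v \<in> (\<Pi>\<^sub>E F\<in>faces M. Poly (int k - 1) F) \<and>
     v_RGF v \<in> (\<Pi>\<^sub>E F\<in>faces M. Gface (int k) F) \<and>
     v_RGcF v \<in> (\<Pi>\<^sub>E F\<in>faces M. Gc_face M (int k) F) \<and>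
     v_RT v \<in> (\<Pi>\<^sub>E T\<in>cells M. Rcell (int k - 1) T) \<and>
     v_RcT v \<in> (\<Pi>\<^sub>E T\<in>cells M. Rc_cell M (int k) T)}"

definition Xnabla :: "mesh \<Rightarrow> nat \<Rightarrow> dof_nabla set" where
  "Xnabla M k = {w.
     w_E w \<in> (\<Pi>\<^sub>E E\<in>edges M. vPoly (int k + 3) E) \<and> vertex_continuous M (w_E w) \<and>
     w_F w \<in> (\<Pi>\<^sub>E F\<in>faces M. Poly (int k) F) \<and>
     w_GF w \<in> (\<Pi>\<^sub>E F\<in>faces M. Gface (int k) F) \<and>
     w_GcF w \<in> (\<Pi>\<^sub>E F\<in>faces M. Gc_face M (int k) F) \<and>
     w_GT w \<in> (\<Pi>\<^sub>E T\<in>cells M. Gcell (int k - 1) T) \<and>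
     w_GcT w \<in> (\<Pi>\<^sub>E T\<in>cells M. Gc_cell M (int k) T)}"

definition XL2 :: "mesh \<Rightarrow> nat \<Rightarrow> (point set \<Rightarrow> scalar_field) set" where
  "XL2 M k = (\<Pi>\<^sub>E T\<in>cells M. Poly (int k) T)"

definition zero_curl :: "mesh \<Rightarrow> dof_curl" where
  "zero_curl M = \<lparr>
     v_RV = (\<lambda>V\<in>verts M. 0),
     v_E = (\<lambda>E\<in>edges M. \<lambda>x. 0), v_RE = (\<lambda>E\<in>edges M. \<lambda>x. 0),
     v_RF = (\<lambda>F\<in>faces M. \<lambda>x. 0), v_RcF = (\<lambda>F\<in>faces M. \<lambda>x. 0), v_F = (\<lambda>F\<in>faces M. \<lambda>x. 0),
     v_RGF = (\<lambda>F\<in>faces M. \<lambda>x. 0), v_RGcF = (\<lambda>F\<in>faces M. \<lambda>x. 0),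
     v_RT = (\<lambda>T\<in>cells M. \<lambda>x. 0), v_RcT = (\<lambda>T\<in>cells M. \<lambda>x. 0)\<rparr>"

definition zero_nabla :: "mesh \<Rightarrow> dof_nabla" where
  "zero_nabla M = \<lparr>
     w_E = (\<lambda>E\<in>edges M. \<lambda>x. 0),
     w_F = (\<lambda>F\<in>faces M. \<lambda>x. 0), w_GF = (\<lambda>F\<in>faces M. \<lambda>x. 0), w_GcF = (\<lambda>F\<in>faces M. \<lambda>x. 0),
     w_GT = (\<lambda>T\<in>cells M. \<lambda>x. 0), w_GcT = (\<lambda>T\<in>cells M. \<lambda>x. 0)\<rparr>"

definition zero_L2 :: "mesh \<Rightarrow> point set \<Rightarrow> scalar_field" where
  "zero_L2 M = (\<lambda>T\<in>cells M. \<lambda>x. 0)"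

text \<open>
  The broken polynomial space consists of representatives of classes in \<open>L\<^sup>2(\<Omega>)\<close>; \<open>restrictions\<close>
  identifies it with \<open>XL2\<close>.
\<close>

definition broken_Poly :: "point set \<Rightarrow> mesh \<Rightarrow> nat \<Rightarrow> scalar_field set" where
  "broken_Poly \<Omega> M k = {q.
     q \<in> borel_measurable (lebesgue_on \<Omega>) \<and> integrable (lebesgue_on \<Omega>) (\<lambda>x. (q x)\<^sup>2) \<and>
     (\<forall>T\<in>cells M. \<exists>p\<in>Poly (int k) T. AE x in lebesgue_on T. q x = p x)}"

definition restrictions :: "mesh \<Rightarrow> nat \<Rightarrow> scalar_field \<Rightarrow> point set \<Rightarrow> scalar_field" where
  "restrictions M k q =
     (\<lambda>T\<in>cells M. THE p. p \<in> Poly (int k) T \<and> (AE x in lebesgue_on T. q x = p x))"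

section \<open>Interpolator\<close>

text \<open>
  Meaningful for \<open>q\<close> continuously differentiable on \<open>closure \<Omega>\<close>; only the values of \<open>q\<close> there are used.
\<close>

definition interp_edge :: "mesh \<Rightarrow> nat \<Rightarrow> scalar_field \<Rightarrow> point set \<Rightarrow> scalar_field" where
  "interp_edge M k q E = (THE p. p \<in> Poly (int k + 1) E \<and>
     L2_proj (edge_integral E) (Poly (int k - 1) E) p = L2_proj (edge_integral E) (Poly (int k - 1) E) q \<and>
     (\<forall>V\<in>edge_verts M E. p V = q V))"

definition interp_grad :: "point set \<Rightarrow> mesh \<Rightarrow> nat \<Rightarrow> scalar_field \<Rightarrow> dof_grad" where
  "interp_grad \<Omega> M k q = (let dq = grad_within (closure \<Omega>) q in \<lparr>
     q_GV = (\<lambda>V\<in>verts M. dq V),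
     q_E = (\<lambda>E\<in>edges M. interp_edge M k q E),
     q_GE = (\<lambda>E\<in>edges M. L2_proj (edge_integral E) (vPoly (int k) E)
               (\<lambda>x. cross3 (tangent M E) (cross3 (dq x) (tangent M E)))),
     q_F = (\<lambda>F\<in>faces M. L2_proj (face_integral F) (Poly (int k - 1) F) q),
     q_GF = (\<lambda>F\<in>faces M. L2_proj (face_integral F) (Poly (int k - 1) F) (\<lambda>x. dq x \<bullet> normal M F)),
     q_T = (\<lambda>T\<in>cells M. L2_proj (cell_integral T) (Poly (int k - 1) T) q)\<rparr>)"

section \<open>Discrete gradient\<close>

definition grad_edge :: "mesh \<Rightarrow> nat \<Rightarrow> dof_grad \<Rightarrow> point set \<Rightarrow> vector_field" where
  "grad_edge M k q E = (THE v. v \<in> vPoly (int k + 2) E \<and>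
     L2_proj (edge_integral E) (vPoly (int k) E) v =
       (\<lambda>x. edge_deriv M E (q_E q E) x *\<^sub>R tangent M E + q_GE q E x) \<and>
     (\<forall>V\<in>edge_verts M E. v V = q_GV q V))"

definition grad_face :: "mesh \<Rightarrow> nat \<Rightarrow> dof_grad \<Rightarrow> point set \<Rightarrow> vector_field" where
  "grad_face M k q F = (THE g. g \<in> tPoly M (int k) F \<and> (\<forall>r\<in>tPoly M (int k) F.
     face_integral F (\<lambda>x. g x \<bullet> r x) =
       - face_integral F (\<lambda>x. q_F q F x * divg r x)
       + (\<Sum>E\<in>face_edges M F. omegaFE M F E *
            edge_integral E (\<lambda>x. q_E q E x * (r x \<bullet> edge_normal M F E)))))"

definition grad_perp_face :: "mesh \<Rightarrow> nat \<Rightarrow> dof_grad \<Rightarrow> point set \<Rightarrow> vector_field" where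
  "grad_perp_face M k q F = (THE g. g \<in> tPoly M (int k) F \<and> (\<forall>r\<in>tPoly M (int k) F.
     face_integral F (\<lambda>x. g x \<bullet> r x) =
       - face_integral F (\<lambda>x. q_GF q F x * srot (normal M F) r x)
       - (\<Sum>E\<in>face_edges M F. omegaFE M F E *
            edge_integral E (\<lambda>x. (q_GE q E x \<bullet> normal M F) * (r x \<bullet> tangent M E)))))"

definition grad_trace :: "mesh \<Rightarrow> nat \<Rightarrow> dof_grad \<Rightarrow> point set \<Rightarrow> scalar_field" where
  "grad_trace M k q F = (THE g. g \<in> Poly (int k + 1) F \<and> (\<forall>r\<in>Rc_face M (int k + 2) F.
     face_integral F (\<lambda>x. g x * divg r x) =
       - face_integral F (\<lambda>x. grad_face M k q F x \<bullet> r x)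
       + (\<Sum>E\<in>face_edges M F. omegaFE M F E *
            edge_integral E (\<lambda>x. q_E q E x * (r x \<bullet> edge_normal M F E)))))"

definition grad_cell :: "mesh \<Rightarrow> nat \<Rightarrow> dof_grad \<Rightarrow> point set \<Rightarrow> vector_field" where
  "grad_cell M k q T = (THE g. g \<in> vPoly (int k) T \<and> (\<forall>r\<in>vPoly (int k) T.
     cell_integral T (\<lambda>x. g x \<bullet> r x) =
       - cell_integral T (\<lambda>x. q_T q T x * divg r x)
       + (\<Sum>F\<in>cell_faces M T. omegaTF M T F *
            face_integral F (\<lambda>x. grad_trace M k q F x * (r x \<bullet> normal M F)))))"

definition discrete_grad :: "mesh \<Rightarrow> nat \<Rightarrow> dof_grad \<Rightarrow> dof_curl" where
  "discrete_grad M k q = \<lparr>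
     v_RV = (\<lambda>V\<in>verts M. 0),
     v_E = (\<lambda>E\<in>edges M. grad_edge M k q E),
     v_RE = (\<lambda>E\<in>edges M. \<lambda>x. cross3 (edge_deriv M E (grad_edge M k q E) x) (tangent M E)),
     v_RF = (\<lambda>F\<in>faces M. L2_proj (face_integral F) (Rface M (int k - 1) F) (grad_face M k q F)),
     v_RcF = (\<lambda>F\<in>faces M. L2_proj (face_integral F) (Rc_face M (int k) F) (grad_face M k q F)),
     v_F = (\<lambda>F\<in>faces M. q_GF q F),
     v_RGF = (\<lambda>F\<in>faces M. L2_proj (face_integral F) (Gface (int k) F) (grad_perp_face M k q F)),
     v_RGcF = (\<lambda>F\<in>faces M. L2_proj (face_integral F) (Gc_face M (int k) F) (grad_perp_face M k q F)),
     v_RT = (\<lambda>T\<in>cells M. L2_proj (cell_integral T) (Rcell (int k - 1) T) (grad_cell M k q T)),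
     v_RcT = (\<lambda>T\<in>cells M. L2_proj (cell_integral T) (Rc_cell M (int k) T) (grad_cell M k q T))\<rparr>"

definition ker_grad :: "mesh \<Rightarrow> nat \<Rightarrow> dof_grad set" where
  "ker_grad M k = {q \<in> Xgrad M k. discrete_grad M k q = zero_curl M}"

section \<open>Discrete curl\<close>

definition curl_edge :: "mesh \<Rightarrow> nat \<Rightarrow> dof_curl \<Rightarrow> point set \<Rightarrow> vector_field" where
  "curl_edge M k v E = (THE c. c \<in> vPoly (int k + 3) E \<and>
     L2_proj (edge_integral E) (vPoly (int k + 1) E) c =
       (\<lambda>x. v_RE v E x - cross3 (edge_deriv M E (v_E v E) x) (tangent M E)) \<and>
     (\<forall>V\<in>edge_verts M E. c V = v_RV v V))"

definition scurl_face :: "mesh \<Rightarrow> nat \<Rightarrow> dof_curl \<Rightarrow> point set \<Rightarrow> scalar_field" where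
  "scurl_face M k v F = (THE c. c \<in> Poly (int k) F \<and> (\<forall>r\<in>Poly (int k) F.
     face_integral F (\<lambda>x. c x * r x) =
       face_integral F (\<lambda>x. v_RF v F x \<bullet> vrot (normal M F) r x)
       - (\<Sum>E\<in>face_edges M F. omegaFE M F E *
            edge_integral E (\<lambda>x. (v_E v E x \<bullet> tangent M E) * r x))))"

definition vcurl_face :: "mesh \<Rightarrow> nat \<Rightarrow> dof_curl \<Rightarrow> point set \<Rightarrow> vector_field" where
  "vcurl_face M k v F = (THE c. c \<in> tPoly M (int k) F \<and> (\<forall>r\<in>tPoly M (int k) F.
     face_integral F (\<lambda>x. c x \<bullet> r x) =
       face_integral F (\<lambda>x. v_F v F x * srot (normal M F) r x)
       + (\<Sum>E\<in>face_edges M F. omegaFE M F E *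
            edge_integral E (\<lambda>x. (v_E v E x \<bullet> normal M F) * (r x \<bullet> tangent M E)))))"

definition curl_trace :: "mesh \<Rightarrow> nat \<Rightarrow> dof_curl \<Rightarrow> point set \<Rightarrow> vector_field" where
  "curl_trace M k v F = (THE g. g \<in> tPoly M (int k) F \<and>
     (\<forall>r\<in>Poly0_face (int k + 1) F. \<forall>s\<in>Rc_face M (int k) F.
        face_integral F (\<lambda>x. g x \<bullet> (vrot (normal M F) r x + s x)) =
          face_integral F (\<lambda>x. scurl_face M k v F x * r x)
          + (\<Sum>E\<in>face_edges M F. omegaFE M F E *
               edge_integral E (\<lambda>x. (v_E v E x \<bullet> tangent M E) * r x))
          + face_integral F (\<lambda>x. v_RcF v F x \<bullet> s x)))"

definition curl_cell :: "mesh \<Rightarrow> nat \<Rightarrow> dof_curl \<Rightarrow> point set \<Rightarrow> vector_field" where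
  "curl_cell M k v T = (THE c. c \<in> vPoly (int k) T \<and> (\<forall>r\<in>vPoly (int k) T.
     cell_integral T (\<lambda>x. c x \<bullet> r x) =
       cell_integral T (\<lambda>x. v_RT v T x \<bullet> curl r x)
       + (\<Sum>F\<in>cell_faces M T. omegaTF M T F *
            face_integral F (\<lambda>x. curl_trace M k v F x \<bullet> cross3 (r x) (normal M F)))))"

definition discrete_curl :: "mesh \<Rightarrow> nat \<Rightarrow> dof_curl \<Rightarrow> dof_nabla" where
  "discrete_curl M k v = \<lparr>
     w_E = (\<lambda>E\<in>edges M. curl_edge M k v E),
     w_F = (\<lambda>F\<in>faces M. scurl_face M k v F),
     w_GF = (\<lambda>F\<in>faces M. \<lambda>x.
               L2_proj (face_integral F) (Gface (int k) F) (vcurl_face M k v F) x + v_RGF v F x),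
     w_GcF = (\<lambda>F\<in>faces M. \<lambda>x.
               L2_proj (face_integral F) (Gc_face M (int k) F) (vcurl_face M k v F) x + v_RGcF v F x),
     w_GT = (\<lambda>T\<in>cells M. L2_proj (cell_integral T) (Gcell (int k - 1) T) (curl_cell M k v T)),
     w_GcT = (\<lambda>T\<in>cells M. L2_proj (cell_integral T) (Gc_cell M (int k) T) (curl_cell M k v T))\<rparr>"

definition ker_curl :: "mesh \<Rightarrow> nat \<Rightarrow> dof_curl set" where
  "ker_curl M k = {v \<in> Xcurl M k. discrete_curl M k v = zero_nabla M}"

section \<open>Discrete divergence\<close>

definition div_cell :: "mesh \<Rightarrow> nat \<Rightarrow> dof_nabla \<Rightarrow> point set \<Rightarrow> scalar_field" where
  "div_cell M k w T = (THE d. d \<in> Poly (int k) T \<and> (\<forall>q\<in>Poly (int k) T.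
     cell_integral T (\<lambda>x. d x * q x) =
       - cell_integral T (\<lambda>x. w_GT w T x \<bullet> grad q x)
       + (\<Sum>F\<in>cell_faces M T. omegaTF M T F * face_integral F (\<lambda>x. w_F w F x * q x))))"

definition discrete_div :: "mesh \<Rightarrow> nat \<Rightarrow> dof_nabla \<Rightarrow> point set \<Rightarrow> scalar_field" where
  "discrete_div M k w = (\<lambda>T\<in>cells M. div_cell M k w T)"

definition ker_div :: "mesh \<Rightarrow> nat \<Rightarrow> dof_nabla set" where
  "ker_div M k = {w \<in> Xnabla M k. discrete_div M k w = zero_L2 M}"

end

theory Submission
  imports Defs "HOL-Computational_Algebra.Polynomial"
begin

text \<open>
  Every discrete operator is a Riesz representative in a polynomial space, so the claims reduce to
  integration by parts on cells, faces and edges (the divergence theorem on convex polytopes, obtained by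
  integrating along lines) and to polynomial decompositions obtained from Euler operators.

  For an edge \<open>E\<close> of a cell \<open>T\<close>, the sum of \<open>\<omega>_TF \<omega>_FE\<close> over the faces of \<open>T\<close> containing \<open>E\<close> vanishes, since
  \<open>\<integral>_T div (curl r) = 0\<close> for all polynomial fields \<open>r\<close>. This makes the divergence of a curl vanish.
  For the curl of a gradient on \<open>T\<close>, write \<open>r \<times> n_F = rot p_F + s_F\<close> on every face with \<open>s_F\<close> in \<open>R^{c,k}(F)\<close>; the
  potentials on two faces sharing \<open>E\<close> differ there by a polynomial of degree \<open>k\<close>, to which
  \<open>v_E \<bullet> t_E - q_E'\<close> is orthogonal, so the edge contributions cancel as well.

  The divergence is onto because constant fluxes can realise any cell averages, the rest being a
  gradient on each cell. A kernel element of the gradient is constant on edges, and the constants agree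
  because the boundaries of faces and cells and the closed domain are connected.
\<close>

section \<open>Polynomials\<close>

text \<open>All operators are \<open>THE\<close> terms, so nothing can be said about them before
  unique existence is proved; this is why a representation theorem for spaces of functions precedes
  everything about meshes. Faces of a cell may be coplanar and edges of a face collinear, and the
  mesh axioms do not say that an edge of a cell bounds exactly two of its faces, nor that the edges
  of a face form a cycle. Such combinatorial facts are never derived from convex geometry: they are
  read off from vanishing integrals, because polynomials are dense enough to isolate a single edge
  or cell. The delicate point is the curl of a gradient on a cell: \<open>grad_edge\<close> has the
  moments of the edge gradient only up to degree \<open>k\<close>, whereas the potential of
  \<open>r \<times> n_F\<close> has degree \<open>k + 1\<close>. Hence no cancellation is available
  face by face; what can be shown is that the leftover edge term does not depend on the face from
  which it is computed.\<close>

notation scaleR (infixr "*R" 75)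

abbreviation cont :: "('a::topological_space => 'b::topological_space) => bool" where
  "cont \<equiv> continuous_on UNIV"

abbreviation dderiv :: "(point => 'b::real_normed_vector) => point => point => 'b" where
  "dderiv f v x \<equiv> frechet_derivative f (at x) v"

text \<open>Fields on the whole space, with no projection onto a hull, so that the calculus can be
  set up before any cell, face or edge is fixed.\<close>

definition vpoly3 :: "int => vector_field set" where
  "vpoly3 l = {r. \<forall>i. (%x. r x $ i) \<in> poly3 l}"

abbreviation monom3 :: "(3 => nat) => scalar_field" where
  "monom3 \<alpha> \<equiv> %x. \<Prod>i\<in>UNIV. x $ i ^ \<alpha> i"

section \<open>Algebra of the spaces \<open>poly3 l\<close> and induction over them\<close>

lemma finite_multi_indices: "finite {\<alpha> :: 3 => nat. int (\<Sum>i\<in>UNIV. \<alpha> i) \<le> l}"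
proof (rule finite_subset)
  show "{\<alpha> :: 3 => nat. int (\<Sum>i\<in>UNIV. \<alpha> i) \<le> l} \<subseteq> PiE UNIV (%_. {..nat l})"
  proof safe
    fix \<alpha> :: "3 => nat" and i assume "int (\<Sum>i\<in>UNIV. \<alpha> i) \<le> l"
    moreover have "\<alpha> i \<le> (\<Sum>i\<in>UNIV. \<alpha> i)" by (rule member_le_sum) auto
    ultimately show "\<alpha> i \<le> nat l" by linarith
  qed auto
  show "finite (PiE (UNIV :: 3 set) (%_. {..nat l}))" by (rule finite_PiE) auto
qed

lemma poly3_I:
  "f = (%x. \<Sum>\<alpha> | int (\<Sum>i\<in>UNIV. \<alpha> i) \<le> l. c \<alpha> * monom3 \<alpha> x) ==> f \<in> poly3 l"
  unfolding poly3_def by auto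

lemma poly3_E:
  assumes "f \<in> poly3 l"
  obtains c where "f = (%x. \<Sum>\<alpha> | int (\<Sum>i\<in>UNIV. \<alpha> i) \<le> l. c \<alpha> * monom3 \<alpha> x)"
  using assms unfolding poly3_def by auto

lemma poly3_0 [simp]: "(%x. 0) \<in> poly3 l"
  by (rule poly3_I[of _ "%_. 0"]) simp

lemma poly3_add: "f \<in> poly3 l ==> g \<in> poly3 l ==> (%x. f x + g x) \<in> poly3 l"
proof -
  assume "f \<in> poly3 l" "g \<in> poly3 l"
  obtain c where f: "f = (%x. \<Sum>\<alpha> | int (\<Sum>i\<in>UNIV. \<alpha> i) \<le> l. c \<alpha> * monom3 \<alpha> x)"
    by (rule poly3_E[OF \<open>f \<in> poly3 l\<close>])
  obtain d where g: "g = (%x. \<Sum>\<alpha> | int (\<Sum>i\<in>UNIV. \<alpha> i) \<le> l. d \<alpha> * monom3 \<alpha> x)"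
    by (rule poly3_E[OF \<open>g \<in> poly3 l\<close>])
  from f g show ?thesis
    by (intro poly3_I[of _ "%\<alpha>. c \<alpha> + d \<alpha>"]) (simp add: sum.distrib distrib_right)
qed

lemma poly3_cmult: "f \<in> poly3 l ==> (%x. a * f x) \<in> poly3 l"
proof -
  assume "f \<in> poly3 l"
  obtain c where f: "f = (%x. \<Sum>\<alpha> | int (\<Sum>i\<in>UNIV. \<alpha> i) \<le> l. c \<alpha> * monom3 \<alpha> x)"
    by (rule poly3_E[OF \<open>f \<in> poly3 l\<close>])
  from f show ?thesis
    by (intro poly3_I[of _ "%\<alpha>. a * c \<alpha>"]) (simp add: sum_distrib_left mult.assoc)
qed

lemma poly3_minus: "f \<in> poly3 l ==> (%x. - f x) \<in> poly3 l"
  using poly3_cmult[of f l "-1"] by simp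

lemma poly3_diff: "f \<in> poly3 l ==> g \<in> poly3 l ==> (%x. f x - g x) \<in> poly3 l"
  using poly3_add[OF _ poly3_minus, of f l g] by simp

lemma poly3_sum: "(!!i. i \<in> I ==> f i \<in> poly3 l) ==> (%x. \<Sum>i\<in>I. f i x) \<in> poly3 l"
  by (induction I rule: infinite_finite_induct) (auto intro: poly3_add)

lemma monom3_in: "int (\<Sum>i\<in>UNIV. \<alpha> i) \<le> l ==> monom3 \<alpha> \<in> poly3 l"
proof (rule poly3_I[of _ "%\<beta>. if \<beta> = \<alpha> then 1 else 0"])
  assume "int (\<Sum>i\<in>UNIV. \<alpha> i) \<le> l"
  then have "\<alpha> \<in> {\<beta>. int (\<Sum>i\<in>UNIV. \<beta> i) \<le> l}" by simp
  then show "monom3 \<alpha> =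
    (%x. \<Sum>\<beta> | int (\<Sum>i\<in>UNIV. \<beta> i) \<le> l. (if \<beta> = \<alpha> then 1 else 0) * monom3 \<beta> x)"
    by (intro ext, subst sum.remove[OF finite_multi_indices]) (auto intro!: sum.neutral)
qed

lemma poly3_const: "0 \<le> l ==> (%x. c) \<in> poly3 l"
  using poly3_cmult[OF monom3_in[of "%_. 0" l], of c] by simp

lemma poly3_mono: "l \<le> m ==> f \<in> poly3 l ==> f \<in> poly3 m"
proof -
  assume "l \<le> m" "f \<in> poly3 l"
  obtain c where f: "f = (%x. \<Sum>\<alpha> | int (\<Sum>i\<in>UNIV. \<alpha> i) \<le> l. c \<alpha> * monom3 \<alpha> x)"
    by (rule poly3_E[OF \<open>f \<in> poly3 l\<close>])
  show ?thesis unfolding f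
    by (rule poly3_sum, rule poly3_cmult, rule monom3_in) (use \<open>l \<le> m\<close> in auto)
qed

lemma monom3_Suc: "monom3 (\<alpha>(i := Suc (\<alpha> i))) x = x $ i * monom3 \<alpha> x"
proof -
  have "(\<Prod>j\<in>UNIV - {i}. x $ j ^ (\<alpha>(i := Suc (\<alpha> i))) j) = (\<Prod>j\<in>UNIV - {i}. x $ j ^ \<alpha> j)"
    by (rule prod.cong) auto
  then show ?thesis
    by (simp add: prod.remove[of UNIV i])
qed

lemma multi_index_Suc_sum: "(\<Sum>j\<in>UNIV. (\<alpha>(i := Suc (\<alpha> i))) j) = Suc (\<Sum>j\<in>UNIV. \<alpha> (j::3))"
proof -
  have "(\<Sum>j\<in>UNIV - {i}. (\<alpha>(i := Suc (\<alpha> i))) j) = (\<Sum>j\<in>UNIV - {i}. \<alpha> j)"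
    by (rule sum.cong) auto
  then show ?thesis by (simp add: sum.remove[of UNIV i])
qed

lemma poly3_coord_mult: "f \<in> poly3 l ==> (%x. x $ i * f x) \<in> poly3 (l + 1)"
proof -
  assume "f \<in> poly3 l"
  obtain c where f: "f = (%x. \<Sum>\<alpha> | int (\<Sum>i\<in>UNIV. \<alpha> i) \<le> l. c \<alpha> * monom3 \<alpha> x)"
    by (rule poly3_E[OF \<open>f \<in> poly3 l\<close>])
  have "(%x. \<Sum>\<alpha> | int (\<Sum>i\<in>UNIV. \<alpha> i) \<le> l. c \<alpha> * monom3 (\<alpha>(i := Suc (\<alpha> i))) x) \<in> poly3 (l + 1)"
    by (rule poly3_sum, rule poly3_cmult, rule monom3_in) (simp add: multi_index_Suc_sum del: fun_upd_apply)
  then show ?thesis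
    unfolding f monom3_Suc by (simp add: sum_distrib_left mult_ac)
qed

lemma poly3_induct [consumes 1, case_names const add mult]:
  assumes "f \<in> poly3 l"
    and const: "!!l c. 0 \<le> l \<or> c = 0 ==> P l (%x. c)"
    and add: "!!l f g. f \<in> poly3 l ==> g \<in> poly3 l ==> P l f ==> P l g ==> P l (%x. f x + g x)"
    and mult: "!!l f i. 0 \<le> l ==> f \<in> poly3 l ==> P l f ==> P (l + 1) (%x. x $ i * f x)"
  shows "P l f"
proof -
  \<comment> \<open>Peeling off one coordinate lowers the order \<open>n\<close> and the bound
    \<open>m\<close> together; the slack \<open>n \<le> m\<close> lets monomials of lower order
    count as members of the larger space.\<close>
  have mono: "P m (%x. c * monom3 \<alpha> x)" if "int n \<le> m" "(\<Sum>i\<in>UNIV. \<alpha> i) = n" for n m c \<alpha>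
    using that
  proof (induction n arbitrary: m \<alpha>)
    case 0
    then have "\<alpha> = (%_. 0)" by (auto simp: fun_eq_iff)
    then show ?case using const[of m c] 0 by simp
  next
    case (Suc n)
    then obtain i where i: "\<alpha> i > 0"
      by (metis Zero_not_Suc gr0I sum.neutral)
    define \<beta> where "\<beta> = \<alpha>(i := \<alpha> i - 1)"
    have \<alpha>: "\<alpha> = \<beta>(i := Suc (\<beta> i))" using i by (auto simp: \<beta>_def)
    have s: "(\<Sum>i\<in>UNIV. \<beta> i) = n"
      using Suc.prems(2) multi_index_Suc_sum[of \<beta> i] \<alpha> by simp
    have "P (m - 1) (%x. c * monom3 \<beta> x)" using Suc.IH[of "m - 1" \<beta>] Suc.prems s by simp
    moreover have "(%x. c * monom3 \<beta> x) \<in> poly3 (m - 1)"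
      by (rule poly3_cmult, rule monom3_in) (use s Suc.prems in simp)
    ultimately have "P (m - 1 + 1) (%x. x $ i * (c * monom3 \<beta> x))"
      using mult[of "m - 1"] Suc.prems by simp
    then show ?case by (subst \<alpha>, subst monom3_Suc) (simp add: mult_ac)
  qed
  obtain c where f: "f = (%x. \<Sum>\<alpha> | int (\<Sum>i\<in>UNIV. \<alpha> i) \<le> l. c \<alpha> * monom3 \<alpha> x)"
    by (rule poly3_E[OF assms(1)])
  have "P l (%x. \<Sum>\<alpha>\<in>A. c \<alpha> * monom3 \<alpha> x)" if "A \<subseteq> {\<alpha>. int (\<Sum>i\<in>UNIV. \<alpha> i) \<le> l}" for A
    using finite_subset[OF that finite_multi_indices] that
  proof (induction A rule: finite_induct)
    case empty
    then show ?case using const[of l 0] by simp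
  next
    case (insert \<alpha> A)
    have "P l (%x. c \<alpha> * monom3 \<alpha> x + (\<Sum>\<alpha>\<in>A. c \<alpha> * monom3 \<alpha> x))"
    proof (rule add)
      show "(%x. c \<alpha> * monom3 \<alpha> x) \<in> poly3 l"
        using insert.prems by (intro poly3_cmult monom3_in) auto
      show "(%x. \<Sum>\<alpha>\<in>A. c \<alpha> * monom3 \<alpha> x) \<in> poly3 l"
        using insert.prems by (intro poly3_sum poly3_cmult monom3_in) auto
      show "P l (%x. c \<alpha> * monom3 \<alpha> x)" using insert.prems by (intro mono) auto
      show "P l (%x. \<Sum>\<alpha>\<in>A. c \<alpha> * monom3 \<alpha> x)" using insert by auto
    qed
    then show ?case using insert by simp
  qed
  then show ?thesis using f by auto
qed

lemma poly3_mult: "f \<in> poly3 l ==> g \<in> poly3 m ==> (%x. f x * g x) \<in> poly3 (l + m)"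
proof (induction l f rule: poly3_induct)
  case (const l c)
  then show ?case by (cases "c = 0") (auto intro: poly3_cmult poly3_mono[of m "l + m"])
next
  case (add l f h)
  then show ?case by (simp add: distrib_right poly3_add)
next
  case (mult l f i)
  have "(%x. x $ i * (f x * g x)) \<in> poly3 (l + m + 1)" using mult by (intro poly3_coord_mult) auto
  then show ?case by (simp add: mult.assoc add_ac)
qed

lemma poly3_linear: "linear L ==> 1 \<le> l ==> (%x. L x) \<in> poly3 l" for L :: "point => real"
proof -
  assume L: "linear L" "1 \<le> l"
  have e: "L x = (\<Sum>i\<in>UNIV. L (axis i 1) * (x $ i * 1))" for x
  proof -
    have "L x = L (\<Sum>i\<in>UNIV. (x $ i) *R axis i 1)"
      using basis_expansion[of x] by (simp add: scalar_mult_eq_scaleR)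
    also have "... = (\<Sum>i\<in>UNIV. L (axis i 1) * (x $ i * 1))"
      unfolding linear_sum[OF L(1)] linear_cmul[OF L(1)] by (simp add: mult.commute)
    finally show ?thesis .
  qed
  have "(%x. x $ i * 1) \<in> poly3 l" for i
    using poly3_coord_mult[OF poly3_const[of "l - 1" 1], of i] L(2) by simp
  then have m: "(%x. \<Sum>i\<in>UNIV. L (axis i 1) * (x $ i * 1)) \<in> poly3 l"
    by (intro poly3_sum poly3_cmult) blast
  show ?thesis by (subst e) (rule m)
qed

lemma poly3_inner: "1 \<le> l ==> (%x. x \<bullet> a) \<in> poly3 l"
  by (rule poly3_linear) (auto simp: linear_iff inner_left_distrib)

lemma poly3_coord: "1 \<le> l ==> (%x. x $ i) \<in> poly3 l"
  by (rule poly3_linear) (auto simp: linear_iff)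

text \<open>Applied to the orthogonal projection onto the hull of a piece, this shows that the
  representatives in \<open>Poly\<close> keep their degree on the whole space.\<close>

lemma poly3_comp_affine:
  assumes "f \<in> poly3 l" "linear L"
  shows "(%x. f (a + L x)) \<in> poly3 l"
  using assms(1)
proof (induction l f rule: poly3_induct)
  case (const l c)
  then show ?case by (auto intro: poly3_const)
next
  case (add l f g)
  then show ?case by (auto intro: poly3_add)
next
  case (mult l f i)
  have "(%x. a $ i + L x $ i) \<in> poly3 1"
    using assms(2) by (intro poly3_add poly3_const poly3_linear) (auto simp: linear_iff)
  from poly3_mult[OF this mult.IH] show ?case by (simp add: add.commute)
qed

text \<open>Differentiability and the degree bound have to pass through the induction together;
  \<open>frechet_derivative\<close> is identified with \<open>D\<close> afterwards by
  uniqueness.\<close>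

lemma poly3_has_derivative:
  assumes "f \<in> poly3 l"
  shows "\<exists>D. (\<forall>x. (f has_derivative D x) (at x)) \<and> (\<forall>v. (%x. D x v) \<in> poly3 (l - 1))"
  using assms
proof (induction l f rule: poly3_induct)
  case (const l c)
  show ?case by (rule exI[of _ "%x v. 0"]) auto
next
  case (add l f g)
  then obtain D E where
    "(\<forall>x. (f has_derivative D x) (at x)) \<and> (\<forall>v. (%x. D x v) \<in> poly3 (l - 1))"
    "(\<forall>x. (g has_derivative E x) (at x)) \<and> (\<forall>v. (%x. E x v) \<in> poly3 (l - 1))"
    by auto
  then show ?case
    by (intro exI[of _ "%x v. D x v + E x v"]) (auto intro: poly3_add derivative_eq_intros)
next
  case (mult l f i)
  then obtain D where D:
    "\<forall>x. (f has_derivative D x) (at x)" "\<forall>v. (%x. D x v) \<in> poly3 (l - 1)" by auto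
  show ?case
  proof (intro exI[of _ "%x v. x $ i * D x v + v $ i * f x"] conjI allI)
    fix x :: point
    have "((%x. x $ i) has_derivative (%v. v $ i)) (at x)"
      by (rule bounded_linear.has_derivative[OF bounded_linear_vec_nth]) simp
    from has_derivative_mult[OF this D(1)[rule_format]]
    show "((%x. x $ i * f x) has_derivative (%v. x $ i * D x v + v $ i * f x)) (at x)" .
  next
    fix v :: point
    show "(%x. x $ i * D x v + v $ i * f x) \<in> poly3 (l + 1 - 1)"
      using poly3_coord_mult[of "%x. D x v" "l - 1" i] D(2) mult.hyps
      by (intro poly3_add poly3_cmult) auto
  qed
qed

lemma poly3_has_dderiv: "f \<in> poly3 l ==> (f has_derivative frechet_derivative f (at x)) (at x)"
  by (metis poly3_has_derivative frechet_derivative_at)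

lemma poly3_dderiv: "f \<in> poly3 l ==> (%x. dderiv f v x) \<in> poly3 (l - 1)"
proof -
  assume "f \<in> poly3 l"
  from poly3_has_derivative[OF this] obtain D where
    D: "\<forall>x. (f has_derivative D x) (at x)" "\<forall>v. (%x. D x v) \<in> poly3 (l - 1)" by auto
  then have "D = (%x. frechet_derivative f (at x))" using frechet_derivative_at by blast
  with D(2) show ?thesis by auto
qed

lemma poly3_differentiable: "f \<in> poly3 l ==> f differentiable at x"
  using poly3_has_dderiv differentiable_def by blast

lemma poly3_linear_dderiv: "f \<in> poly3 l ==> linear (%v. dderiv f v x)"
  using poly3_has_dderiv has_derivative_linear by blast

lemma poly3_continuous: "f \<in> poly3 l ==> cont f"
  by (metis poly3_has_dderiv has_derivative_continuous continuous_at_imp_continuous_on)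

section \<open>Rules for directional derivatives\<close>

lemma dderiv_eq: "(f has_derivative D) (at x) ==> dderiv f v x = D v"
  using frechet_derivative_at by metis

lemma dderiv_add:
  "f differentiable at x ==> g differentiable at x ==>
    dderiv (%x. f x + g x) v x = dderiv f v x + dderiv g v x"
  by (rule dderiv_eq) (auto intro!: derivative_eq_intros simp: frechet_derivative_works)

lemma dderiv_sum:
  "(!!i. i \<in> I ==> f i differentiable at x) ==>
    dderiv (%x. \<Sum>i\<in>I. f i x) v x = (\<Sum>i\<in>I. dderiv (f i) v x)"
  by (rule dderiv_eq[OF has_derivative_sum]) (auto simp: frechet_derivative_works)

lemma dderiv_diff:
  "f differentiable at x ==> g differentiable at x ==>
    dderiv (%x. f x - g x) v x = dderiv f v x - dderiv g v x"
  by (rule dderiv_eq) (auto intro!: derivative_eq_intros simp: frechet_derivative_works)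

lemma dderiv_scaleR:
  "f differentiable at x ==> dderiv (%x. c *R f x) v x = c *R dderiv f v x"
  by (rule dderiv_eq) (auto intro!: derivative_eq_intros simp: frechet_derivative_works)

lemma dderiv_cmult:
  "f differentiable at x ==> dderiv (%x. c * f x :: real) v x = c * dderiv f v x"
  by (rule dderiv_eq) (auto intro!: derivative_eq_intros simp: frechet_derivative_works)

lemma dderiv_mult:
  "f differentiable at x ==> g differentiable at x ==>
    dderiv (%x. f x * g x :: real) v x = f x * dderiv g v x + dderiv f v x * g x"
  by (rule dderiv_eq) (auto intro!: derivative_eq_intros simp: frechet_derivative_works)

lemma dderiv_const: "dderiv (%x. c) v x = 0"
  by (rule dderiv_eq) simp

lemma dderiv_linear: "linear L ==> dderiv (%x. L x) v x = L v" for L :: "point => 'b::real_normed_vector"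
  by (rule dderiv_eq) (simp add: linear_imp_has_derivative)

lemma linear_differentiable: "linear L ==> (%x. L x) differentiable at x"
  for L :: "point => 'b::real_normed_vector"
  using linear_imp_has_derivative differentiable_def by blast

lemma dderiv_comp_affine:
  assumes "f differentiable at (a + L x)" "linear L"
  shows "dderiv (%x. f (a + L x)) v x = dderiv f (L v) (a + L x)"
proof (rule dderiv_eq)
  have 1: "((%x. a + L x) has_derivative L) (at x)"
    using linear_imp_has_derivative[OF assms(2), of "at x"] by (auto intro!: derivative_eq_intros)
  have "((f \<circ> (%x. a + L x)) has_derivative (frechet_derivative f (at (a + L x)) \<circ> L)) (at x)"
    by (rule diff_chain_at[OF 1]) (use assms in "simp add: frechet_derivative_works")
  then show "((%x. f (a + L x)) has_derivative (%v. dderiv f (L v) (a + L x))) (at x)"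
    by (simp add: o_def)
qed

text \<open>For \<open>x $ i * f x\<close> the product rule leaves, besides the second derivative of
  \<open>f\<close>, the term \<open>v $ i\<close> times the derivative along \<open>w\<close> and
  the same term with \<open>v\<close> and \<open>w\<close> exchanged; their sum is symmetric, so the
  induction goes through.\<close>

lemma poly3_dderiv_commute:
  assumes "f \<in> poly3 l"
  shows "dderiv (%x. dderiv f v x) w x = dderiv (%x. dderiv f w x) v x"
  using assms
proof (induction l f arbitrary: x rule: poly3_induct)
  case (const l c)
  then show ?case by (simp add: dderiv_const)
next
  case (add l f g)
  note d = poly3_differentiable[OF add.hyps(1)] poly3_differentiable[OF add.hyps(2)]
    poly3_differentiable[OF poly3_dderiv[OF add.hyps(1)]] poly3_differentiable[OF poly3_dderiv[OF add.hyps(2)]]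
  show ?case by (simp add: dderiv_add d add.IH)
next
  case (mult l f i)
  have L: "linear (%x::point. x $ i)" by (simp add: linear_iff)
  note d = poly3_differentiable[OF mult.hyps(2)] poly3_differentiable[OF poly3_dderiv[OF mult.hyps(2)]]
    linear_differentiable[OF L]
  have e: "(%x. v $ i * f x) differentiable at x" "(%x. x $ i * dderiv f v x) differentiable at x" for v x
    by (rule poly3_differentiable[OF poly3_cmult[OF mult.hyps(2)]],
        rule poly3_differentiable[OF poly3_coord_mult[OF poly3_dderiv[OF mult.hyps(2)]]])
  show ?case
    by (simp add: dderiv_mult d dderiv_linear[OF L] dderiv_add e dderiv_cmult mult.IH)
qed

subsection \<open>Vector fields with polynomial components\<close>

lemma vpoly3_differentiable: "r \<in> vpoly3 l ==> r differentiable at x"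
proof -
  assume "r \<in> vpoly3 l"
  then have "(%x. r x $ i) differentiable at x" for i
    unfolding vpoly3_def using poly3_differentiable by blast
  then have "(%x. r x \<bullet> b) differentiable at x" if "b \<in> Basis" for b
    using that by (auto simp: Basis_vec_def inner_axis)
  then show ?thesis using differentiable_componentwise_within by blast
qed

lemma dderiv_nth: "r differentiable at x ==> dderiv r v x $ i = dderiv (%x. r x $ i) v x"
  by (rule dderiv_eq[symmetric], rule bounded_linear.has_derivative[OF bounded_linear_vec_nth])
    (simp add: frechet_derivative_works)

lemma dderiv_inner: "r differentiable at x ==> dderiv r v x \<bullet> a = dderiv (%x. r x \<bullet> a) v x"
  for r :: vector_field
  by (rule dderiv_eq[symmetric], rule bounded_linear.has_derivative[OF bounded_linear_inner_left])
    (simp add: frechet_derivative_works)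

lemma linear_dderiv: "f differentiable at x ==> linear (%v. dderiv f v x)"
  by (metis frechet_derivative_works has_derivative_linear)

lemma vpoly3_nth: "r \<in> vpoly3 l ==> (%x. r x $ i) \<in> poly3 l"
  by (simp add: vpoly3_def)

lemma vpoly3_inner: "r \<in> vpoly3 l ==> (%x. r x \<bullet> a) \<in> poly3 l"
proof -
  assume "r \<in> vpoly3 l"
  then have "(%x. \<Sum>i\<in>UNIV. a $ i * r x $ i) \<in> poly3 l"
    by (intro poly3_sum poly3_cmult) (simp add: vpoly3_def)
  then show ?thesis by (simp add: inner_vec_def mult.commute)
qed

lemma vpoly3_linear: "r \<in> vpoly3 l ==> linear L ==> (%x. L (r x)) \<in> vpoly3 l"
  for L :: "point => point"
proof -
  assume r: "r \<in> vpoly3 l" and L: "linear L"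
  have "L (r x) $ i = r x \<bullet> adjoint L (axis i 1)" for x i
    using adjoint_works[OF L, of "r x" "axis i 1"] by (simp add: inner_axis)
  then show ?thesis using vpoly3_inner[OF r] by (simp add: vpoly3_def)
qed

lemma vpoly3_add: "f \<in> vpoly3 l ==> g \<in> vpoly3 l ==> (%x. f x + g x) \<in> vpoly3 l"
  by (auto simp: vpoly3_def intro: poly3_add)

lemma vpoly3_diff: "f \<in> vpoly3 l ==> g \<in> vpoly3 l ==> (%x. f x - g x) \<in> vpoly3 l"
  by (auto simp: vpoly3_def intro: poly3_diff)

lemma vpoly3_0 [simp]: "(%x. 0) \<in> vpoly3 l"
  by (auto simp: vpoly3_def)

lemma vpoly3_mult: "p \<in> poly3 l ==> r \<in> vpoly3 m ==> (%x. p x *R r x) \<in> vpoly3 (l + m)"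
  by (auto simp: vpoly3_def intro: poly3_mult)

lemma vpoly3_dot: "p \<in> vpoly3 l ==> r \<in> vpoly3 m ==> (%x. p x \<bullet> r x) \<in> poly3 (l + m)"
  by (auto simp: vpoly3_def inner_vec_def intro!: poly3_mult poly3_sum)

lemma vpoly3_mono: "l \<le> m ==> f \<in> vpoly3 l ==> f \<in> vpoly3 m"
  by (auto simp: vpoly3_def intro: poly3_mono)

lemma vpoly3_const: "0 \<le> l ==> (%x. c) \<in> vpoly3 l"
  by (auto simp: vpoly3_def intro: poly3_const)

lemma vpoly3_const_mult: "p \<in> poly3 l ==> (%x. p x *R c) \<in> vpoly3 l"
  using vpoly3_mult[OF _ vpoly3_const[of 0 c]] by simp

lemma vpoly3_dderiv: "r \<in> vpoly3 l ==> (%x. dderiv r v x) \<in> vpoly3 (l - 1)"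
  by (auto simp: vpoly3_def dderiv_nth vpoly3_differentiable poly3_dderiv)

lemma vpoly3_comp_affine: "r \<in> vpoly3 l ==> linear L ==> (%x. r (a + L x)) \<in> vpoly3 l"
  using poly3_comp_affine[where f = "%x. r x $ _"] by (auto simp: vpoly3_def)

lemma vpoly3_ident: "1 \<le> l ==> (%x. a + x) \<in> vpoly3 l"
  by (auto simp: vpoly3_def intro!: poly3_add poly3_const poly3_coord)

lemma vpoly3_continuous: "r \<in> vpoly3 l ==> cont r"
  by (metis vpoly3_differentiable differentiable_imp_continuous_within continuous_at_imp_continuous_on)

lemma dderiv_bounded_linear:
  "r differentiable at x ==> bounded_linear L ==> dderiv (%x. L (r x)) v x = L (dderiv r v x)"
  by (rule dderiv_eq, erule bounded_linear.has_derivative)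
    (simp add: frechet_derivative_works)

subsection \<open>Gradient, divergence and curl\<close>

lemma axis_sum: "(\<Sum>i\<in>UNIV. (x $ i) *R axis i 1) = (x :: real^'n)"
  using basis_expansion[of x] by (simp add: scalar_mult_eq_scaleR)

lemma grad_inner: "q differentiable at x ==> grad q x \<bullet> v = dderiv q v x"
proof -
  assume q: "q differentiable at x"
  note L = linear_dderiv[OF q]
  have "dderiv q v x = dderiv q (\<Sum>i\<in>UNIV. (v $ i) *R axis i 1) x" by (simp add: axis_sum)
  also have "... = (\<Sum>i\<in>UNIV. v $ i * dderiv q (axis i 1) x)"
    by (simp add: linear_sum[OF L] linear_cmul[OF L])
  finally show ?thesis by (simp add: grad_within_def inner_vec_def mult.commute)
qed

lemma grad_vpoly3: "q \<in> poly3 l ==> grad q \<in> vpoly3 (l - 1)"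
  by (auto simp: vpoly3_def grad_within_def poly3_dderiv)

lemma divg_poly3: "r \<in> vpoly3 l ==> divg r \<in> poly3 (l - 1)"
  using vpoly3_dderiv unfolding divg_def[abs_def] by (intro poly3_sum) (simp add: vpoly3_def)

lemma curl_vpoly3: "r \<in> vpoly3 l ==> curl r \<in> vpoly3 (l - 1)"
proof -
  assume r: "r \<in> vpoly3 l"
  have 1: "(%x. dderiv r v x $ i) \<in> poly3 (l - 1)" for v i
    using vpoly3_dderiv[OF r] by (simp add: vpoly3_def)
  show ?thesis
    by (auto simp: vpoly3_def curl_def Let_def forall_3 intro!: poly3_diff 1)
qed

lemma cross3_nth:
  "cross3 a b $ 1 = a $ 2 * b $ 3 - a $ 3 * b $ 2"
  "cross3 a b $ 2 = a $ 3 * b $ 1 - a $ 1 * b $ 3"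
  "cross3 a b $ 3 = a $ 1 * b $ 2 - a $ 2 * b $ 1"
  by (simp_all add: cross3_def)

text \<open>The curl is the axial vector of the antisymmetric part of the derivative. In this
  coordinate-free form it can be evaluated in a frame adapted to a face.\<close>

lemma curl_cross:
  assumes "r differentiable at x"
  shows "curl r x \<bullet> cross3 a b = dderiv r a x \<bullet> b - dderiv r b x \<bullet> a"
proof -
  note L = linear_dderiv[OF assms]
  define D where "D i j = dderiv r (axis i 1) x $ j" for i j
  have e: "dderiv r a x $ j = (\<Sum>i\<in>UNIV. a $ i * D i j)" for a j
  proof -
    have "dderiv r a x = dderiv r (\<Sum>i\<in>UNIV. (a $ i) *R axis i 1) x" by (simp add: axis_sum)
    also have "... = (\<Sum>i\<in>UNIV. (a $ i) *R dderiv r (axis i 1) x)"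
      by (simp add: linear_sum[OF L] linear_cmul[OF L])
    finally show ?thesis by (simp add: D_def)
  qed
  have c: "curl r x $ 1 = D 2 3 - D 3 2" "curl r x $ 2 = D 3 1 - D 1 3" "curl r x $ 3 = D 1 2 - D 2 1"
    by (simp_all add: curl_def Let_def D_def)
  show ?thesis
    unfolding inner_vec_def sum_3 e c cross3_nth by (simp add: algebra_simps)
qed

lemma curl_nth:
  assumes "r differentiable at x"
  shows "curl r x $ 1 = dderiv r (axis 2 1) x $ 3 - dderiv r (axis 3 1) x $ 2"
    "curl r x $ 2 = dderiv r (axis 3 1) x $ 1 - dderiv r (axis 1 1) x $ 3"
    "curl r x $ 3 = dderiv r (axis 1 1) x $ 2 - dderiv r (axis 2 1) x $ 1"
  by (simp_all add: curl_def Let_def)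

lemma divg_nth: "r \<in> vpoly3 l ==> divg r x = (\<Sum>i\<in>UNIV. dderiv (%x. r x $ i) (axis i 1) x)"
  by (simp add: divg_def dderiv_nth vpoly3_differentiable)

lemma divg_curl: "r \<in> vpoly3 l ==> divg (curl r) x = 0"
proof -
  assume r: "r \<in> vpoly3 l"
  note d = vpoly3_differentiable[OF r]
  have c: "(%x. curl r x $ 1) = (%x. dderiv (%x. r x $ 3) (axis 2 1) x - dderiv (%x. r x $ 2) (axis 3 1) x)"
    "(%x. curl r x $ 2) = (%x. dderiv (%x. r x $ 1) (axis 3 1) x - dderiv (%x. r x $ 3) (axis 1 1) x)"
    "(%x. curl r x $ 3) = (%x. dderiv (%x. r x $ 2) (axis 1 1) x - dderiv (%x. r x $ 1) (axis 2 1) x)"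
    by (simp_all add: fun_eq_iff curl_nth[OF d] dderiv_nth[OF d])
  note s = poly3_dderiv_commute[OF vpoly3_nth[OF r]]
  have dd: "(%x. dderiv (%x. r x $ i) v x) differentiable at x" for i v x
    by (rule poly3_differentiable[OF poly3_dderiv[OF vpoly3_nth[OF r]]])
  show ?thesis
    by (simp add: divg_nth[OF curl_vpoly3[OF r]] sum_3 c dderiv_diff dd
        s[of 3, where v = "axis 2 1" and w = "axis 1 1"] s[of 2, where v = "axis 3 1" and w = "axis 1 1"]
        s[of 1, where v = "axis 3 1" and w = "axis 2 1"])
qed

lemma curl_grad: "q \<in> poly3 l ==> curl (grad q) x = 0"
proof -
  assume q: "q \<in> poly3 l"
  note g = vpoly3_differentiable[OF grad_vpoly3[OF q]]
  have e: "(%x. grad q x $ i) = (%x. dderiv q (axis i 1) x)" for i by (simp add: grad_within_def)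
  show ?thesis
    by (simp add: vec_eq_iff forall_3 curl_nth[OF g] dderiv_nth[OF g] e
        poly3_dderiv_commute[OF q, where v = "axis 1 1"]
        poly3_dderiv_commute[OF q, where v = "axis 3 1" and w = "axis 2 1"])
qed

section \<open>Finite-dimensional function spaces\<close>

text \<open>The generating family need not be independent: only induction on its length is used, and
  images of such spaces under linear maps are again of this form without a choice of basis.\<close>

definition fspan :: "nat => (nat => 'p => 'b::real_vector) => ('p => 'b) set" where
  "fspan n b = {%x. \<Sum>i<n. c i *R b i x | c. True}"

definition fdim :: "('p => 'b::real_vector) set => bool" where
  "fdim S \<longleftrightarrow> (\<exists>n b. S = fspan n b)"

definition linear_on_space ::
  "('p => 'b::real_vector) set => (('p => 'b) => 'c::real_vector) => bool" where
  "linear_on_space S \<phi> \<longleftrightarrow>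
     (\<forall>f\<in>S. \<forall>g\<in>S. \<phi> (%x. f x + g x) = \<phi> f + \<phi> g) \<and> (\<forall>c. \<forall>f\<in>S. \<phi> (%x. c *R f x) = c *R \<phi> f)"

lemma fspan_combination: "(%x. \<Sum>i<n. c i *R b i x) \<in> fspan n b"
  unfolding fspan_def by blast

lemma fspan_E:
  assumes "f \<in> fspan n b"
  obtains c where "f = (%x. \<Sum>i<n. c i *R b i x)"
  using assms unfolding fspan_def by blast

lemma fspan_add: "f \<in> fspan n b ==> g \<in> fspan n b ==> (%x. f x + g x) \<in> fspan n b"
proof -
  assume "f \<in> fspan n b" "g \<in> fspan n b"
  obtain c where f: "f = (%x. \<Sum>i<n. c i *R b i x)" by (rule fspan_E[OF \<open>f \<in> fspan n b\<close>])
  obtain d where g: "g = (%x. \<Sum>i<n. d i *R b i x)" by (rule fspan_E[OF \<open>g \<in> fspan n b\<close>])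
  from f g show ?thesis
    using fspan_combination[where c = "%i. c i + d i" and n = n and b = b]
    by (simp add: scaleR_left_distrib sum.distrib)
qed

lemma fspan_scaleR: "f \<in> fspan n b ==> (%x. a *R f x) \<in> fspan n b"
proof -
  assume "f \<in> fspan n b"
  then obtain c where "f = (%x. \<Sum>i<n. c i *R b i x)" by (rule fspan_E)
  then show ?thesis
    using fspan_combination[where c = "%i. a * c i" and n = n and b = b] by (simp add: scaleR_sum_right)
qed

lemma fspan_basis: "i < n ==> b i \<in> fspan n b"
  using fspan_combination[where c = "%j. if j = i then 1 else 0" and n = n and b = b]
  by (simp add: if_distrib[of "%u. u *R _"] cong: if_cong)

lemma fspan_Suc: "fspan (Suc n) b = {%x. f x + a *R b n x | f a. f \<in> fspan n b}"
proof safe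
  fix f assume "f \<in> fspan (Suc n) b"
  then obtain c where "f = (%x. \<Sum>i<Suc n. c i *R b i x)" by (rule fspan_E)
  then show "\<exists>g a. f = (%x. g x + a *R b n x) \<and> g \<in> fspan n b"
    using fspan_combination[where c = c and n = n and b = b] by auto
next
  fix f a assume "f \<in> fspan n b"
  then obtain c where "f = (%x. \<Sum>i<n. c i *R b i x)" by (rule fspan_E)
  moreover have "(\<Sum>i<n. (c(n := a)) i *R b i x) = (\<Sum>i<n. c i *R b i x)" for x
    by (rule sum.cong) auto
  ultimately show "(%x. f x + a *R b n x) \<in> fspan (Suc n) b"
    using fspan_combination[where c = "c(n := a)" and n = "Suc n" and b = b] by simp
qed

lemma fdim_add: "fdim S ==> f \<in> S ==> g \<in> S ==> (%x. f x + g x) \<in> S"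
  unfolding fdim_def using fspan_add by auto

lemma fdim_scaleR: "fdim S ==> f \<in> S ==> (%x. c *R f x) \<in> S"
  unfolding fdim_def using fspan_scaleR by auto

lemma fdim_0: "fdim S ==> (%x. 0) \<in> S"
  unfolding fdim_def using fspan_combination[where c = "%_. 0"] by auto

lemma fdim_sum: "fdim S ==> (!!i. i \<in> I ==> f i \<in> S) ==> (%x. \<Sum>i\<in>I. f i x) \<in> S"
  by (induction I rule: infinite_finite_induct) (auto intro: fdim_add fdim_0)

lemma fdim_diff: "fdim S ==> f \<in> S ==> g \<in> S ==> (%x. f x - g x) \<in> S"
  using fdim_add[of S f "%x. -1 *R g x"] fdim_scaleR[of S g "-1"] by auto

lemma linear_on_spaceD:
  assumes "linear_on_space S \<phi>"
  shows "f \<in> S ==> g \<in> S ==> \<phi> (%x. f x + g x) = \<phi> f + \<phi> g"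
    and "f \<in> S ==> \<phi> (%x. c *R f x) = c *R \<phi> f"
  using assms unfolding linear_on_space_def by auto

lemma linear_on_space_0: "linear_on_space S \<phi> ==> fdim S ==> \<phi> (%x. 0) = 0"
  using linear_on_spaceD(2)[of S \<phi> "%x. 0" 0] fdim_0 by auto

lemma linear_on_space_diff:
  "linear_on_space S \<phi> ==> fdim S ==> f \<in> S ==> g \<in> S ==> \<phi> (%x. f x - g x) = \<phi> f - \<phi> g"
  using linear_on_spaceD(1)[of S \<phi> f "%x. -1 *R g x"] linear_on_spaceD(2)[of S \<phi> g "-1"]
    fdim_scaleR[of S g "-1"] by auto

lemma linear_on_space_sum:
  assumes "linear_on_space S \<phi>" "fdim S" "finite I" "!!i. i \<in> I ==> f i \<in> S"
  shows "\<phi> (%x. \<Sum>i\<in>I. f i x) = (\<Sum>i\<in>I. \<phi> (f i))"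
  using assms(3,4)
proof (induction I rule: finite_induct)
  case empty
  then show ?case using linear_on_space_0 assms by auto
next
  case (insert i I)
  have "(%x. \<Sum>i\<in>I. f i x) \<in> S" by (rule fdim_sum[OF assms(2)]) (use insert in auto)
  then show ?case
    using linear_on_spaceD(1)[OF assms(1), of "f i" "%x. \<Sum>i\<in>I. f i x"] insert by simp
qed

lemma linear_on_space_subset: "linear_on_space S \<phi> ==> S' \<subseteq> S ==> linear_on_space S' \<phi>"
  unfolding linear_on_space_def by (meson subsetD)

lemma linear_on_space_plus:
  "linear_on_space S f ==> linear_on_space S g ==> linear_on_space S (%x. f x + g x)"
  unfolding linear_on_space_def by (simp add: algebra_simps)

lemma linear_on_space_minus:
  "linear_on_space S f ==> linear_on_space S g ==> linear_on_space S (%x. f x - g x)"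
  unfolding linear_on_space_def by (simp add: algebra_simps)

lemma linear_on_space_uminus: "linear_on_space S f ==> linear_on_space S (%x. - f x)"
  unfolding linear_on_space_def by (simp add: algebra_simps)

lemma linear_on_space_cmult:
  "linear_on_space S f ==> linear_on_space S (%x. c * f x :: real)"
  unfolding linear_on_space_def by (simp add: algebra_simps)

lemma linear_on_space_zero: "linear_on_space S (%x. 0)"
  unfolding linear_on_space_def by simp

lemma linear_on_space_setsum:
  "(!!i. i \<in> I ==> linear_on_space S (f i)) ==> linear_on_space S (%x. \<Sum>i\<in>I. f i x)"
  by (induction I rule: infinite_finite_induct) (auto intro: linear_on_space_plus linear_on_space_zero)

text \<open>
  Linear maps into a function space are described pointwise, since functions carry no vector space
  structure in the library.
\<close>

definition linear_into ::
  "('p => 'b::real_vector) set => (('p => 'b) => 'q => 'c::real_vector) => bool" where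
  "linear_into S A \<longleftrightarrow> (\<forall>x. linear_on_space S (%f. A f x))"

lemma linear_into_I:
  "(!!f g x. f \<in> S ==> g \<in> S ==> A (%x. f x + g x) x = A f x + A g x) ==>
   (!!c f x. f \<in> S ==> A (%x. c *R f x) x = c *R A f x) ==> linear_into S A"
  unfolding linear_into_def linear_on_space_def by auto

lemma linear_intoD:
  assumes "linear_into S A"
  shows "f \<in> S ==> g \<in> S ==> A (%x. f x + g x) = (%x. A f x + A g x)"
    and "f \<in> S ==> A (%x. c *R f x) = (%x. c *R A f x)"
  using assms unfolding linear_into_def linear_on_space_def by auto

lemma fdim_image:
  assumes "fdim S" "linear_into S A"
  shows "fdim (A ` S)"
proof -
  obtain n b where S: "S = fspan n b" using assms(1) unfolding fdim_def by blast
  have e: "A (%x. \<Sum>i<n. c i *R b i x) = (%x. \<Sum>i<n. c i *R A (b i) x)" for c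
  proof
    fix x
    have l: "linear_on_space S (%f. A f x)" using assms(2) unfolding linear_into_def by blast
    have "A (%x. \<Sum>i<n. c i *R b i x) x = (\<Sum>i<n. A (%x. c i *R b i x) x)"
      by (rule linear_on_space_sum[OF l assms(1)]) (auto simp: S fspan_basis fspan_scaleR)
    also have "... = (\<Sum>i<n. c i *R A (b i) x)"
      by (rule sum.cong) (auto simp: linear_on_spaceD(2)[OF l] S fspan_basis)
    finally show "A (%x. \<Sum>i<n. c i *R b i x) x = (\<Sum>i<n. c i *R A (b i) x)" .
  qed
  then have "A ` S = fspan n (%i. A (b i))"
    unfolding S fspan_def by (simp add: full_SetCompr_eq image_image)
  then show ?thesis unfolding fdim_def by blast
qed

lemma sum_lessThan_add: "(\<Sum>i<n + m. h i) = (\<Sum>i<n. h i) + (\<Sum>i<m. h (n + i))"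
  for h :: "nat => 'a::comm_monoid_add"
  by (induction m) (simp_all add: add.assoc)

lemma fspan_append:
  "{%x. f x + g x | f g. f \<in> fspan n b \<and> g \<in> fspan m d} =
    fspan (n + m) (%i. if i < n then b i else d (i - n))" (is "?L = fspan _ ?e")
proof (intro equalityI subsetI)
  have split: "(\<Sum>i<n + m. c i *R ?e i x) = (\<Sum>i<n. c i *R b i x) + (\<Sum>i<m. c (n + i) *R d i x)" for c x
    by (simp add: sum_lessThan_add)
  {
    fix u assume "u \<in> ?L"
    then obtain f g where u: "u = (%x. f x + g x)" "f \<in> fspan n b" "g \<in> fspan m d" by blast
    obtain c where c: "f = (%x. \<Sum>i<n. c i *R b i x)" by (rule fspan_E[OF u(2)])
    obtain k where k: "g = (%x. \<Sum>i<m. k i *R d i x)" by (rule fspan_E[OF u(3)])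
    have "u = (%x. \<Sum>i<n + m. (if i < n then c i else k (i - n)) *R ?e i x)"
      unfolding split u(1) c k by (auto intro!: ext arg_cong2[where f = "(+)"] sum.cong)
    then show "u \<in> fspan (n + m) ?e" by (rule ssubst) (rule fspan_combination)
  next
    fix u assume "u \<in> fspan (n + m) ?e"
    then obtain c where "u = (%x. \<Sum>i<n + m. c i *R ?e i x)" by (rule fspan_E)
    then have u: "u = (%x. (\<Sum>i<n. c i *R b i x) + (\<Sum>i<m. c (n + i) *R d i x))"
      unfolding split .
    show "u \<in> ?L" unfolding u
      by (rule CollectI, rule exI, rule exI, rule conjI[OF refl], rule conjI; rule fspan_combination)
  }
qed

lemma fdim_plus: "fdim S ==> fdim R ==> fdim {%x. f x + g x | f g. f \<in> S \<and> g \<in> R}"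
  unfolding fdim_def by (elim exE) (simp only: fspan_append, blast)

lemma fdim_span_family:
  assumes "finite A"
  shows "fdim {%x. \<Sum>a\<in>A. c a *R b a x | c. True}"
proof -
  obtain h where h: "bij_betw h {..<card A} A"
    using ex_bij_betw_nat_finite[OF assms] by (auto simp: atLeast0LessThan)
  have "(\<Sum>a\<in>A. c a *R b a x) = (\<Sum>i<card A. c (h i) *R b (h i) x)" for c x
    by (rule sum.reindex_bij_betw[OF h, symmetric])
  moreover have "\<exists>c. (\<forall>i<card A. c (h i) = d i)" for d :: "nat => real"
    using h by (intro exI[of _ "%a. d (the_inv_into {..<card A} h a)"])
      (auto simp: bij_betw_def the_inv_into_f_f)
  ultimately have "{%x. \<Sum>a\<in>A. c a *R b a x | c. True} = fspan (card A) (%i. b (h i))"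
    unfolding fspan_def
    apply (intro equalityI subsetI)
     apply fastforce
    apply clarsimp
    subgoal premises p for d
    proof -
      obtain c where "\<forall>i<card A. c (h i) = d i" using p by blast
      then show ?thesis using p(1) by (intro exI[of _ c]) (auto intro!: ext sum.cong)
    qed
    done
  then show ?thesis unfolding fdim_def by blast
qed

subsection \<open>Riesz representation\<close>

text \<open>Gram-Schmidt along the generating family: the new generator minus its representative
  \<open>p\<close> in the smaller span is orthogonal to that span, so beyond the induction
  hypothesis only one coefficient \<open>t\<close> has to be found. Dependent generators give
  \<open>e = 0\<close> and do no harm.\<close>

lemma riesz_fspan:
  fixes B :: "('p => 'b::real_vector) => ('p => 'b) => real"
  assumes lin: "!!f. f \<in> fspan n b ==> linear_on_space (fspan n b) (B f)"
    and sym: "!!f g. f \<in> fspan n b ==> g \<in> fspan n b ==> B f g = B g f"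
    and def: "!!f. f \<in> fspan n b ==> B f f = 0 ==> f = (%x. 0)"
    and l: "linear_on_space (fspan n b) \<phi>"
  shows "\<exists>p\<in>fspan n b. \<forall>s\<in>fspan n b. B p s = \<phi> s"
  using lin sym def l
proof (induction n arbitrary: \<phi>)
  case 0
  have fd: "fdim (fspan 0 b)" unfolding fdim_def by blast
  have "fspan 0 b = {%x. 0}" by (auto simp: fspan_def)
  then show ?case using linear_on_space_0[OF "0.prems"(1) fd] linear_on_space_0[OF "0.prems"(4) fd] by auto
next
  case (Suc n)
  let ?S = "fspan (Suc n) b"
  have fd: "fdim ?S" "fdim (fspan n b)" unfolding fdim_def by blast+
  have sub: "fspan n b \<subseteq> ?S"
  proof
    fix f assume "f \<in> fspan n b"
    moreover have "f = (%x. f x + 0 *R b n x)" by simp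
    ultimately show "f \<in> ?S" unfolding fspan_Suc by blast
  qed
  have bn: "b n \<in> ?S" by (rule fspan_basis) simp
  have IH: "\<exists>p\<in>fspan n b. \<forall>s\<in>fspan n b. B p s = \<phi> s" if "linear_on_space (fspan n b) \<phi>" for \<phi>
  proof (rule Suc.IH[OF _ _ _ that])
    show "linear_on_space (fspan n b) (B f)" if "f \<in> fspan n b" for f
      using linear_on_space_subset[OF Suc.prems(1) sub] that sub by blast
    show "B f g = B g f" if "f \<in> fspan n b" "g \<in> fspan n b" for f g
      by (rule Suc.prems(2)) (use that sub in blast)+
    show "f = (%x. 0)" if "f \<in> fspan n b" "B f f = 0" for f
      by (rule Suc.prems(3)) (use that sub in blast)+
  qed
  obtain p where p: "p \<in> fspan n b" "\<forall>s\<in>fspan n b. B p s = B (b n) s"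
    using IH[OF linear_on_space_subset[OF Suc.prems(1)[OF bn] sub]] by auto
  obtain q where q: "q \<in> fspan n b" "\<forall>s\<in>fspan n b. B q s = \<phi> s"
    using IH[OF linear_on_space_subset[OF Suc.prems(4) sub]] by auto
  define e where "e = (%x. b n x - p x)"
  have eS: "e \<in> ?S" unfolding e_def using fdim_diff[OF fd(1) bn] p sub by auto
  have orth: "B e s = 0" "B s e = 0" if "s \<in> fspan n b" for s
  proof -
    have s: "s \<in> ?S" using that sub by auto
    have "B s e = B s (b n) - B s p" unfolding e_def
      by (rule linear_on_space_diff[OF Suc.prems(1)[OF s] fd(1) bn]) (use p sub in auto)
    also have "... = 0" using p that Suc.prems(2)[OF s] bn sub by fastforce
    finally show "B s e = 0" .
    then show "B e s = 0" using Suc.prems(2)[OF s eS] by simp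
  qed
  have dec: "\<exists>f\<in>fspan n b. \<exists>a. s = (%x. f x + a *R e x)" if sS: "s \<in> ?S" for s
  proof -
    obtain f a where fa: "s = (%x. f x + a *R b n x)" "f \<in> fspan n b"
      using sS unfolding fspan_Suc by blast
    have "s = (%x. (f x + a *R p x) + a *R e x)" unfolding fa(1) e_def
      by (simp add: algebra_simps)
    moreover have "(%x. f x + a *R p x) \<in> fspan n b"
      using fa p fspan_add fspan_scaleR by blast
    ultimately show ?thesis by (intro bexI[of _ "%x. f x + a *R p x"] exI[of _ a]) auto
  qed
  \<comment> \<open>If \<open>B e e = 0\<close> the quotient is 0 by convention; then
    \<open>e\<close> is the zero function and \<open>\<phi> e = 0\<close>, so
    \<open>t * B e e = \<phi> e\<close> holds in either case.\<close>
  define t where "t = \<phi> e / B e e"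
  have te: "t * B e e = \<phi> e"
  proof (cases "B e e = 0")
    case True
    then have "e = (%x. 0)" using Suc.prems(3)[OF eS] by blast
    then have "\<phi> e = 0" using linear_on_space_0[OF Suc.prems(4) fd(1)] by simp
    with True show ?thesis by simp
  qed (simp add: t_def)
  have te_S: "(%x. t *R e x) \<in> ?S" using eS fspan_scaleR by blast
  let ?p = "%x. q x + t *R e x"
  have pS: "?p \<in> ?S" using fspan_add[OF _ te_S] q sub by auto
  have "B ?p s = \<phi> s" if sS: "s \<in> ?S" for s
  proof -
    obtain f a where fa: "f \<in> fspan n b" "s = (%x. f x + a *R e x)" using dec[OF sS] by blast
    have ae: "(%x. a *R e x) \<in> ?S" using eS fspan_scaleR by blast
    have f: "f \<in> ?S" using fa sub by auto
    have Bs: "B ?p s = B s q + t * B s e"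
      using Suc.prems(2)[OF pS sS] linear_on_spaceD(1)[OF Suc.prems(1)[OF sS], of q, OF _ te_S]
        linear_on_spaceD(2)[OF Suc.prems(1)[OF sS] eS] q sub by auto
    have "B q s = B q f + a * B q e"
      unfolding fa(2) using linear_on_spaceD(1)[OF Suc.prems(1) f ae]
        linear_on_spaceD(2)[OF Suc.prems(1) eS] q sub by auto
    also have "... = \<phi> f" using q fa orth by auto
    finally have 1: "B s q = \<phi> f" using Suc.prems(2)[OF sS] q sub by auto
    have "B e s = B e f + a * B e e"
      unfolding fa(2) using linear_on_spaceD(1)[OF Suc.prems(1)[OF eS] f ae]
        linear_on_spaceD(2)[OF Suc.prems(1)[OF eS] eS] by auto
    then have 2: "B s e = a * B e e" using orth fa Suc.prems(2)[OF sS eS] by simp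
    have "\<phi> s = \<phi> f + a * \<phi> e"
      unfolding fa(2) using linear_on_spaceD(1)[OF Suc.prems(4) f ae]
        linear_on_spaceD(2)[OF Suc.prems(4) eS] by auto
    then show ?thesis using Bs 1 2 te by (simp add: algebra_simps)
  qed
  then show ?case using pS by blast
qed

text \<open>The \<open>\<exists>!\<close> form is what unfolds a \<open>THE\<close>: every discrete
  operator gets its defining identity from here, and the identity also characterises it.\<close>

theorem riesz:
  fixes B :: "('p => 'b::real_vector) => ('p => 'b) => real"
  assumes fd: "fdim S"
    and lin: "!!f. f \<in> S ==> linear_on_space S (B f)"
    and sym: "!!f g. f \<in> S ==> g \<in> S ==> B f g = B g f"
    and def: "!!f. f \<in> S ==> B f f = 0 ==> f = (%x. 0)"
    and l: "linear_on_space S \<phi>"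
  shows "\<exists>!p. p \<in> S \<and> (\<forall>s\<in>S. B p s = \<phi> s)"
proof -
  obtain n b where S: "S = fspan n b" using fd unfolding fdim_def by blast
  obtain p where p: "p \<in> S" "\<forall>s\<in>S. B p s = \<phi> s"
    using riesz_fspan[of n b B \<phi>] assms unfolding S by blast
  show ?thesis
  proof (rule ex1I[of _ p])
    fix q assume q: "q \<in> S \<and> (\<forall>s\<in>S. B q s = \<phi> s)"
    let ?d = "%x. q x - p x"
    have d: "?d \<in> S" using fdim_diff fd p q by blast
    have "B ?d ?d = B ?d q - B ?d p"
      by (rule linear_on_space_diff[OF lin[OF d] fd]) (use p q in auto)
    also have "... = 0" using sym d p q by auto
    finally have "?d = (%x. 0)" using def d by blast
    then show "q = p" by (auto simp: fun_eq_iff)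
  qed (use p in auto)
qed

text \<open>
  The existence part needs no injectivity: it suffices that the functional is compatible with the
  linear structure that \<open>A\<close> transports to its image.
\<close>

lemma linear_on_space_via_surj:
  fixes A :: "'z => 'p => 'b::real_vector" and \<phi> :: "'z => real"
  assumes S: "fdim S" "A ` Z = S"
    and add: "!!u v w. u \<in> Z ==> v \<in> Z ==> w \<in> Z ==> A w = (%x. A u x + A v x) ==> \<phi> w = \<phi> u + \<phi> v"
    and cmult: "!!c u w. u \<in> Z ==> w \<in> Z ==> A w = (%x. c *R A u x) ==> \<phi> w = c * \<phi> u"
  shows "\<exists>m. linear_on_space S m \<and> (\<forall>z\<in>Z. m (A z) = \<phi> z)"
proof -
  define z where "z s = (SOME z. z \<in> Z \<and> A z = s)" for s
  have z: "z s \<in> Z" "A (z s) = s" if "s \<in> S" for s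
  proof -
    have "\<exists>z. z \<in> Z \<and> A z = s" using that S(2) by blast
    then have "z s \<in> Z \<and> A (z s) = s" unfolding z_def by (rule someI_ex)
    then show "z s \<in> Z" "A (z s) = s" by blast+
  qed
  have "linear_on_space S (%s. \<phi> (z s))"
    unfolding linear_on_space_def
  proof (intro conjI ballI allI)
    fix f g assume fg: "f \<in> S" "g \<in> S"
    have h: "(%x. f x + g x) \<in> S" using fdim_add[OF S(1) fg] .
    show "\<phi> (z (%x. f x + g x)) = \<phi> (z f) + \<phi> (z g)"
      by (rule add) (simp_all only: z fg h)
  next
    fix f c assume f: "f \<in> S"
    have h: "(%x. c *R f x) \<in> S" using fdim_scaleR[OF S(1) f] .
    have "\<phi> (z (%x. c *R f x)) = c * \<phi> (z f)"
      by (rule cmult) (simp_all only: z f h)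
    then show "\<phi> (z (%x. c *R f x)) = c *R \<phi> (z f)" by simp
  qed
  moreover have "\<phi> (z (A u)) = \<phi> u" if u: "u \<in> Z" for u
  proof -
    have Au: "A u \<in> S" using u S(2) by blast
    have "\<phi> (z (A u)) = 1 * \<phi> u"
      by (rule cmult) (simp_all add: z[OF Au] u)
    then show ?thesis by simp
  qed
  ultimately show ?thesis by (intro exI[of _ "%s. \<phi> (z s)"]) simp
qed

lemma fdim_poly3: "fdim (poly3 l)"
  using fdim_span_family[OF finite_multi_indices[of l], of monom3] by (simp add: poly3_def)

section \<open>Polynomials and integrals on flat pieces\<close>

lemma isometry_inner:
  fixes \<phi> :: "'a::euclidean_space => 'c::euclidean_space"
  assumes "!!x y. dist (\<phi> x) (\<phi> y) = dist x y"
  shows "(\<phi> x - \<phi> 0) \<bullet> (\<phi> y - \<phi> 0) = x \<bullet> y"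
proof -
  have n: "norm (\<phi> x - \<phi> y) = norm (x - y)" for x y using assms by (simp add: dist_norm)
  show ?thesis
    using n[of x 0] n[of y 0] n[of x y] by (simp add: dot_norm_neg)
qed

text \<open>By polarisation an isometry preserves inner products of differences, so the defect of
  additivity or homogeneity has norm zero. No surjectivity is involved, hence the charts of planes
  and lines in space are covered.\<close>

lemma isometry_linear_part:
  fixes \<phi> :: "'a::euclidean_space => 'c::euclidean_space"
  assumes "!!x y. dist (\<phi> x) (\<phi> y) = dist x y"
  shows "linear (%z. \<phi> z - \<phi> 0)"
proof
  define b where "b z = \<phi> z - \<phi> 0" for z
  have i: "b x \<bullet> b y = x \<bullet> y" for x y unfolding b_def by (rule isometry_inner[OF assms])
  fix x y :: 'a and c :: real
  have "(b (x + y) - (b x + b y)) \<bullet> (b (x + y) - (b x + b y)) = 0"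
    by (simp add: inner_diff_left inner_diff_right inner_add_left inner_add_right i)
  then show "\<phi> (x + y) - \<phi> 0 = \<phi> x - \<phi> 0 + (\<phi> y - \<phi> 0)"
    by (simp only: inner_eq_zero_iff right_minus_eq b_def[symmetric])
  have "(b (c *R x) - c *R b x) \<bullet> (b (c *R x) - c *R b x) = 0"
    by (simp add: inner_diff_left inner_diff_right i)
  then show "\<phi> (c *R x) - \<phi> 0 = c *R (\<phi> x - \<phi> 0)"
    by (simp only: inner_eq_zero_iff right_minus_eq b_def[symmetric])
qed

text \<open>Reduces identities between polynomials to one variable, where finiteness of the root set
  decides. The last clause is there because \<open>nat l = 0\<close> for negative
  \<open>l\<close>.\<close>

lemma poly3_on_line:
  assumes "f \<in> poly3 l"
  shows "\<exists>p. (\<forall>t. f (a + t *R b) = poly p t) \<and> degree p \<le> nat l \<and> (l < 0 \<longrightarrow> p = 0)"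
  using assms
proof (induction l f rule: poly3_induct)
  case (const l c)
  then show ?case by (intro exI[of _ "[:c:]"]) auto
next
  case (add l f g)
  then obtain p q where "(\<forall>t. f (a + t *R b) = poly p t) \<and> degree p \<le> nat l \<and> (l < 0 \<longrightarrow> p = 0)"
    "(\<forall>t. g (a + t *R b) = poly q t) \<and> degree q \<le> nat l \<and> (l < 0 \<longrightarrow> q = 0)" by blast
  then show ?case by (intro exI[of _ "p + q"]) (auto intro: degree_add_le)
next
  case (mult l f i)
  then obtain p where p: "(\<forall>t. f (a + t *R b) = poly p t) \<and> degree p \<le> nat l \<and> (l < 0 \<longrightarrow> p = 0)"
    by blast
  have "degree ([:a $ i, b $ i:] * p) \<le> 1 + degree p"
    by (rule order.trans[OF degree_mult_le]) simp
  also have "... \<le> nat (l + 1)" using p mult.hyps by linarith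
  finally have "degree ([:a $ i, b $ i:] * p) \<le> nat (l + 1)" .
  then show ?case using p mult.hyps
    by (intro exI[of _ "[:a $ i, b $ i:] * p"]) (auto simp: algebra_simps)
qed

lemma rel_open_segment:
  fixes X :: "point set"
  assumes "rel_open X" "x \<in> X" "y \<in> affine hull X"
  shows "\<exists>e>0. \<forall>t. \<bar>t\<bar> < e \<longrightarrow> x + t *R (y - x) \<in> X"
proof -
  have "x \<in> rel_interior X" using assms(1,2) by (simp add: rel_open_def)
  then obtain T where T: "open T" "x \<in> T" "T \<inter> affine hull X \<subseteq> X"
    by (auto simp: mem_rel_interior)
  have a: "x + t *R (y - x) \<in> affine hull X" for t
    using mem_affine[OF affine_affine_hull[of X] hull_inc[OF assms(2)] assms(3), of "1 - t" t]
    by (simp add: algebra_simps)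
  have "isCont (%t. x + t *R (y - x)) 0" by (intro continuous_intros)
  then have "eventually (%t. x + t *R (y - x) \<in> T) (at (0::real))"
    using T(1,2) by (intro topological_tendstoD[of "%t. x + t *R (y - x)" x]) (auto simp: isCont_def)
  then obtain e where e: "e > 0" "\<forall>t. t \<noteq> 0 \<and> dist t 0 < e \<longrightarrow> x + t *R (y - x) \<in> T"
    by (auto simp: eventually_at)
  show ?thesis
  proof (intro exI[of _ e] conjI allI impI)
    fix t :: real assume "\<bar>t\<bar> < e"
    then have "x + t *R (y - x) \<in> T" using e(2) T(2) by (cases "t = 0") (auto simp: dist_real_def)
    with T(3) a show "x + t *R (y - x) \<in> X" by blast
  qed (rule e(1))
qed

text \<open>Cells, faces and edges are treated alike: a bounded convex relatively open set together
  with a Cartesian chart of its affine hull. For a cell the chart is the identity, so that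
  \<open>I\<close> is the ordinary integral.\<close>

locale piece =
  fixes X :: "point set" and \<phi> :: "'a::euclidean_space => point"
  assumes iso: "dist (\<phi> x) (\<phi> y) = dist x y"
    and rng: "range \<phi> = affine hull X"
    and ropen: "rel_open X" and conv: "convex X" and bdd: "bounded X" and ne: "X \<noteq> {}"
begin

text \<open>\<open>B\<close> is the linear part of the chart. Since \<open>adjoint B\<close> is a
  left inverse of \<open>B\<close>, the map \<open>L\<close> is the orthogonal projection onto the
  direction space of the hull.\<close>

definition B where "B z = \<phi> z - \<phi> 0"
definition L where "L x = B (adjoint B x)"
definition I :: "scalar_field => real" where "I f = integral (\<phi> -` X) (%y. f (\<phi> y))"

lemma linear_B: "linear B"
  unfolding B_def[abs_def] by (rule isometry_linear_part) (rule iso)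

lemma B_inner: "B x \<bullet> B y = x \<bullet> y"
  unfolding B_def by (rule isometry_inner) (rule iso)

lemma \<phi>_B: "\<phi> z = \<phi> 0 + B z" by (simp add: B_def)

lemma adjoint_B: "adjoint B (B z) = z"
proof -
  have "w \<bullet> adjoint B (B z) = w \<bullet> z" for w
    using adjoint_works[OF linear_B, of w "B z"] by (simp add: B_inner)
  then show ?thesis by (metis vector_eq_ldot)
qed

lemma linear_adjoint_B: "linear (adjoint B)"
  by (rule adjoint_linear[OF linear_B])

lemma linear_L: "linear L"
  unfolding L_def[abs_def] using linear_compose[OF linear_adjoint_B linear_B] by (simp add: o_def)

lemma L_B: "L (B z) = B z" by (simp add: L_def adjoint_B)

lemma L_inner: "L x \<bullet> y = x \<bullet> L y"
  unfolding L_def by (metis adjoint_works[OF linear_B] inner_commute)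

lemma L_idem: "L (L x) = L x" by (simp add: L_def adjoint_B)

text \<open>Pythagoras: the residual is orthogonal to all differences of points of the hull. The
  formula turns the closest-point map into an affine map, which can be differentiated.\<close>

lemma hull_proj_eq: "hull_proj X x = \<phi> 0 + L (x - \<phi> 0)"
proof -
  let ?p = "\<phi> 0 + L (x - \<phi> 0)"
  have p: "?p = \<phi> (adjoint B (x - \<phi> 0))" by (simp add: L_def \<phi>_B[of "adjoint B (x - \<phi> 0)"])
  have "?p = closest_point (affine hull X) x"
  proof (rule closest_point_unique)
    show "convex (affine hull X)" "closed (affine hull X)"
      by (simp_all add: affine_imp_convex)
    show "?p \<in> affine hull X" using p rng by (metis rangeI)
    show "\<forall>z\<in>affine hull X. dist x ?p \<le> dist x z"
    proof
      fix z assume "z \<in> affine hull X"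
      then obtain w where z: "z = \<phi> w" using rng by (metis imageE)
      define d where "d = ?p - z"
      have d: "d = B (adjoint B (x - \<phi> 0) - w)"
        unfolding d_def z p by (simp add: B_def linear_diff[OF linear_B, unfolded B_def])
      have "(x - ?p) \<bullet> d = (x - \<phi> 0) \<bullet> d - L (x - \<phi> 0) \<bullet> d" by (simp add: algebra_simps)
      also have "... = 0" unfolding d L_inner L_B by simp
      finally have "(x - ?p) \<bullet> d = 0" .
      then have "(norm (x - z))\<^sup>2 = (norm (x - ?p))\<^sup>2 + (norm d)\<^sup>2"
        using norm_add_Pythagorean[of "x - ?p" d] by (simp add: orthogonal_def d_def)
      then show "dist x ?p \<le> dist x z"
        unfolding dist_norm by (metis le_add_same_cancel1 norm_ge_zero power2_le_imp_le zero_le_power2)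
    qed
  qed
  then show ?thesis by (simp add: hull_proj_def)
qed

lemma hull_proj_affine: "hull_proj X x = (\<phi> 0 - L (\<phi> 0)) + L x"
  by (simp add: hull_proj_eq linear_diff[OF linear_L])

lemma hull_proj_in: "hull_proj X x \<in> affine hull X"
  using rng by (metis L_def \<phi>_B hull_proj_eq rangeI)

lemma hull_proj_id: "x \<in> affine hull X ==> hull_proj X x = x"
  by (simp add: hull_proj_def closest_point_self)

lemma hull_proj_idem [simp]: "hull_proj X (hull_proj X x) = hull_proj X x"
  by (rule hull_proj_id[OF hull_proj_in])

lemma hull_proj_X: "x \<in> X ==> hull_proj X x = x"
  by (rule hull_proj_id) (rule hull_inc)

lemma hull_proj_diff: "hull_proj X x - hull_proj X y = L (x - y)"
  by (simp add: hull_proj_affine linear_diff[OF linear_L])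

lemma L_tangent: "x \<in> affine hull X ==> y \<in> affine hull X ==> L (x - y) = x - y"
  by (metis hull_proj_diff hull_proj_id)

lemma L_is_tangent: "\<exists>x\<in>affine hull X. \<exists>y\<in>affine hull X. L v = x - y"
  using hull_proj_diff[of v 0] hull_proj_in by (metis diff_zero)

lemma L_normal: "(!!x y. x \<in> X ==> y \<in> X ==> n \<bullet> (x - y) = 0) ==> n \<bullet> L v = 0"
proof -
  assume n: "!!x y. x \<in> X ==> y \<in> X ==> n \<bullet> (x - y) = 0"
  obtain x0 where x0: "x0 \<in> X" using ne by auto
  have "n \<bullet> x = n \<bullet> x0" if "x \<in> X" for x using n[OF that x0] by (simp add: inner_diff_right)
  then have "affine hull X \<subseteq> {x. n \<bullet> x = n \<bullet> x0}"
    by (intro hull_minimal subsetI CollectI) (auto intro: affine_hyperplane)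
  then have "n \<bullet> x = n \<bullet> x0" if "x \<in> affine hull X" for x using that by auto
  then show ?thesis using L_is_tangent[of v] by (metis inner_diff_right right_minus_eq)
qed

subsection \<open>Polynomials on a piece\<close>

text \<open>Separates the two aspects of a representative, its degree on the whole space and its
  invariance under the projection. Closure under the algebraic operations then follows for each
  aspect separately.\<close>

lemma Poly_iff: "f \<in> Poly l X \<longleftrightarrow> f \<in> poly3 l \<and> (\<forall>x. f (hull_proj X x) = f x)"
proof
  assume "f \<in> Poly l X"
  then obtain p where p: "p \<in> poly3 l" "f = (%x. p (hull_proj X x))" unfolding Poly_def by auto
  then show "f \<in> poly3 l \<and> (\<forall>x. f (hull_proj X x) = f x)"
    using poly3_comp_affine[OF p(1) linear_L, of "\<phi> 0 - L (\<phi> 0)"]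
    by (simp add: hull_proj_affine[symmetric])
next
  assume "f \<in> poly3 l \<and> (\<forall>x. f (hull_proj X x) = f x)"
  then show "f \<in> Poly l X" unfolding Poly_def by (intro image_eqI[of _ _ f]) auto
qed

lemma Poly_restrict: "f \<in> poly3 l ==> (%x. f (hull_proj X x)) \<in> Poly l X"
  unfolding Poly_def by auto

lemma Poly_poly3: "f \<in> Poly l X ==> f \<in> poly3 l" by (simp add: Poly_iff)

lemma Poly_hull_proj: "f \<in> Poly l X ==> f (hull_proj X x) = f x" by (simp add: Poly_iff)

lemma Poly_0: "(%x. 0) \<in> Poly l X" by (simp add: Poly_iff)

lemma Poly_add: "f \<in> Poly l X ==> g \<in> Poly l X ==> (%x. f x + g x) \<in> Poly l X"
  by (simp add: Poly_iff poly3_add)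

lemma Poly_diff: "f \<in> Poly l X ==> g \<in> Poly l X ==> (%x. f x - g x) \<in> Poly l X"
  by (simp add: Poly_iff poly3_diff)

lemma Poly_cmult: "f \<in> Poly l X ==> (%x. c * f x) \<in> Poly l X"
  by (simp add: Poly_iff poly3_cmult)

lemma Poly_mult: "f \<in> Poly l X ==> g \<in> Poly m X ==> (%x. f x * g x) \<in> Poly (l + m) X"
  by (simp add: Poly_iff poly3_mult)

lemma Poly_const: "0 \<le> l ==> (%x. c) \<in> Poly l X"
  by (simp add: Poly_iff poly3_const)

lemma Poly_mono: "l \<le> m ==> f \<in> Poly l X ==> f \<in> Poly m X"
  using poly3_mono by (auto simp: Poly_iff)

lemma Poly_sum: "(!!i. i \<in> J ==> f i \<in> Poly l X) ==> (%x. \<Sum>i\<in>J. f i x) \<in> Poly l X"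
  by (simp add: Poly_iff poly3_sum)

lemma Poly_continuous: "f \<in> Poly l X ==> cont f"
  using Poly_poly3 poly3_continuous by blast

lemma Poly_differentiable: "f \<in> Poly l X ==> f differentiable at x"
  using Poly_poly3 poly3_differentiable by blast

text \<open>The chain rule applied to \<open>f (hull_proj X x) = f x\<close>: only the tangential
  part of the direction and the projected base point matter. This is why full-space operators on
  representatives are the tangential ones.\<close>

lemma invariant_dderiv:
  fixes f :: "point => 'b::real_normed_vector"
  assumes d: "!!x. f differentiable at x" and inv: "!!x. f (hull_proj X x) = f x"
  shows "dderiv f v x = dderiv f (L v) (hull_proj X x)"
    and "dderiv f (L v) x = dderiv f v x" and "dderiv f v (hull_proj X x) = dderiv f v x"
proof -
  have e: "(%x. f ((\<phi> 0 - L (\<phi> 0)) + L x)) = f" using inv by (simp add: hull_proj_affine)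
  have 1: "dderiv f v x = dderiv f (L v) (hull_proj X x)" for v x
    using dderiv_comp_affine[OF d linear_L, of "\<phi> 0 - L (\<phi> 0)" x v]
    unfolding e hull_proj_affine .
  show "dderiv f v x = dderiv f (L v) (hull_proj X x)" by (rule 1)
  show "dderiv f (L v) x = dderiv f v x" using 1[of x "L v"] unfolding L_idem by (rule trans) (rule 1[symmetric])
  show "dderiv f v (hull_proj X x) = dderiv f v x" using 1[of "hull_proj X x" v] unfolding hull_proj_idem by (rule trans) (rule 1[symmetric])
qed

lemma Poly_dderiv: "f \<in> Poly l X ==> (%x. dderiv f v x) \<in> Poly (l - 1) X"
  using invariant_dderiv(3)[of f] Poly_differentiable[of f l]
  by (simp add: Poly_iff poly3_dderiv)

lemma Poly_dderiv_L: "f \<in> Poly l X ==> dderiv f (L v) x = dderiv f v x"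
  using invariant_dderiv(2)[of f] Poly_differentiable[of f l] by (simp add: Poly_iff)

lemma vPoly_iff: "r \<in> vPoly l X \<longleftrightarrow> r \<in> vpoly3 l \<and> (\<forall>x. r (hull_proj X x) = r x)"
  unfolding vPoly_def vpoly3_def by (auto simp: Poly_iff vec_eq_iff)

lemma vPoly_vpoly3: "r \<in> vPoly l X ==> r \<in> vpoly3 l" by (simp add: vPoly_iff)

lemma vPoly_hull_proj: "r \<in> vPoly l X ==> r (hull_proj X x) = r x" by (simp add: vPoly_iff)

lemma vPoly_restrict: "r \<in> vpoly3 l ==> (%x. r (hull_proj X x)) \<in> vPoly l X"
  using vpoly3_comp_affine[OF _ linear_L, of r l "\<phi> 0 - L (\<phi> 0)"]
  by (simp add: vPoly_iff hull_proj_affine[symmetric])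

lemma vPoly_inner: "r \<in> vPoly l X ==> (%x. r x \<bullet> a) \<in> Poly l X"
  by (simp add: vPoly_iff Poly_iff vpoly3_inner)

lemma vPoly_add: "f \<in> vPoly l X ==> g \<in> vPoly l X ==> (%x. f x + g x) \<in> vPoly l X"
  by (simp add: vPoly_iff vpoly3_add)

lemma vPoly_diff: "f \<in> vPoly l X ==> g \<in> vPoly l X ==> (%x. f x - g x) \<in> vPoly l X"
  by (simp add: vPoly_iff vpoly3_diff)

lemma vPoly_0: "(%x. 0) \<in> vPoly l X" by (simp add: vPoly_iff)

lemma vPoly_mult: "p \<in> Poly l X ==> r \<in> vPoly m X ==> (%x. p x *R r x) \<in> vPoly (l + m) X"
  by (simp add: vPoly_iff Poly_iff vpoly3_mult)

lemma vPoly_const_mult: "p \<in> Poly l X ==> (%x. p x *R c) \<in> vPoly l X"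
  by (simp add: vPoly_iff Poly_iff vpoly3_const_mult)

lemma vPoly_linear: "r \<in> vPoly l X ==> linear A ==> (%x. A (r x)) \<in> vPoly l X"
  for A :: "point => point"
  by (simp add: vPoly_iff vpoly3_linear)

lemma vPoly_mono: "l \<le> m ==> f \<in> vPoly l X ==> f \<in> vPoly m X"
  using vpoly3_mono by (auto simp: vPoly_iff)

lemma vPoly_differentiable: "f \<in> vPoly l X ==> f differentiable at x"
  using vPoly_vpoly3 vpoly3_differentiable by blast

lemma vPoly_continuous: "f \<in> vPoly l X ==> cont f"
  using vPoly_vpoly3 vpoly3_continuous by blast

lemma vPoly_dderiv: "r \<in> vPoly l X ==> (%x. dderiv r v x) \<in> vPoly (l - 1) X"
  using invariant_dderiv(3)[of r] vPoly_differentiable[of r l]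
  by (simp add: vPoly_iff vpoly3_dderiv)

lemma vPoly_dderiv_L: "f \<in> vPoly l X ==> dderiv f (L v) x = dderiv f v x"
  using invariant_dderiv(2)[of f] vPoly_differentiable[of f l] by (simp add: vPoly_iff)

lemma vPoly_radial:
  assumes "x0 \<in> affine hull X" "p \<in> Poly l X"
  shows "(%x. p x *R (hull_proj X x - x0)) \<in> vPoly (l + 1) X"
proof (rule vPoly_mult[OF assms(2)])
  show "(%x. hull_proj X x - x0) \<in> vPoly 1 X"
    using vPoly_restrict[OF vpoly3_ident[of 1 "- x0"]] by simp
qed

lemma grad_vPoly: "q \<in> Poly l X ==> grad q \<in> vPoly (l - 1) X"
  using Poly_dderiv by (simp add: vPoly_def grad_within_def)

lemma divg_Poly:
  assumes "r \<in> vPoly l X"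
  shows "divg r \<in> Poly (l - 1) X"
proof -
  have "(%x. dderiv r v x $ i) \<in> Poly (l - 1) X" for v i
    using vPoly_dderiv[OF assms] by (simp add: vPoly_def)
  then show ?thesis unfolding divg_def[abs_def] by (intro Poly_sum)
qed

lemma curl_vPoly: "r \<in> vPoly l X ==> curl r \<in> vPoly (l - 1) X"
proof -
  assume r: "r \<in> vPoly l X"
  have 1: "(%x. dderiv r v x $ i) \<in> Poly (l - 1) X" for v i
    using vPoly_dderiv[OF r] by (simp add: vPoly_def)
  show ?thesis
    by (auto simp: vPoly_def curl_def Let_def forall_3 intro!: Poly_diff 1)
qed

text \<open>The line from a point of \<open>X\<close> to \<open>y\<close> stays in \<open>X\<close>
  for a short time, so the restriction of \<open>f\<close> to that line has infinitely many
  roots.\<close>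

lemma poly3_zero_on_hull:
  assumes f: "f \<in> poly3 l" and z: "!!x. x \<in> X ==> f x = 0" and y: "y \<in> affine hull X"
  shows "f y = 0"
proof -
  obtain x where x: "x \<in> X" using ne by auto
  obtain e where e: "e > 0" "!!t. \<bar>t\<bar> < e ==> x + t *R (y - x) \<in> X"
    using rel_open_segment[OF ropen x y] by auto
  obtain p where p: "!!t. f (x + t *R (y - x)) = poly p t"
    using poly3_on_line[OF f, of x "y - x"] by blast
  have "p = 0"
  proof (rule ccontr)
    assume "p \<noteq> 0"
    then have "finite {t. poly p t = 0}" by (rule poly_roots_finite)
    moreover have "{0<..<e} \<subseteq> {t. poly p t = 0}" using e(2) z p by (auto simp: p[symmetric])
    ultimately show False using infinite_Ioo[OF e(1)] finite_subset by blast
  qed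
  then show ?thesis using p[of 1] by simp
qed

lemma Poly_zero: "f \<in> Poly l X ==> (!!x. x \<in> X ==> f x = 0) ==> f = (%x. 0)"
proof
  fix x assume f: "f \<in> Poly l X" and z: "!!x. x \<in> X ==> f x = 0"
  have "f (hull_proj X x) = 0" by (rule poly3_zero_on_hull[OF Poly_poly3[OF f] z hull_proj_in])
  then show "f x = 0" by (simp add: Poly_hull_proj[OF f])
qed

lemma Poly_eqI: "f \<in> Poly l X ==> g \<in> Poly l X ==> (!!x. x \<in> X ==> f x = g x) ==> f = g"
  using Poly_zero[OF Poly_diff, of f l g] by (simp add: fun_eq_iff)

lemma vPoly_zero: "f \<in> vPoly l X ==> (!!x. x \<in> X ==> f x = 0) ==> f = (%x. 0)"
proof -
  assume f: "f \<in> vPoly l X" and z: "!!x. x \<in> X ==> f x = 0"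
  have "(%x. f x $ i) = (%x. 0)" for i
    by (rule Poly_zero[of _ l]) (use f z in "auto simp: vPoly_def")
  then show ?thesis by (simp add: fun_eq_iff vec_eq_iff)
qed

lemma fdim_Poly: "fdim (Poly l X)"
  unfolding Poly_def by (rule fdim_image[OF fdim_poly3]) (rule linear_into_I, auto)

lemma fdim_vPoly: "fdim (vPoly l X)"
proof -
  define P where "P i = (%p x. p x *R (axis i 1 :: point)) ` Poly l X" for i :: 3
  have P: "fdim (P i)" for i
    unfolding P_def by (rule fdim_image[OF fdim_Poly]) (rule linear_into_I, auto simp: scaleR_left_distrib)
  have "vPoly l X = {%x. f x + g x | f g. f \<in> {%x. f x + g x | f g. f \<in> P 1 \<and> g \<in> P 2} \<and> g \<in> P 3}"
    (is "_ = ?R")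
  proof (intro equalityI subsetI)
    fix r assume r: "r \<in> vPoly l X"
    have "r x = (r x $ 1 *R axis 1 1 + r x $ 2 *R axis 2 1) + r x $ 3 *R axis 3 1" for x
      using axis_sum[of "r x"] by (simp add: sum_3)
    then have e: "r = (%x. (r x $ 1 *R axis 1 1 + r x $ 2 *R axis 2 1) + r x $ 3 *R axis 3 1)"
      by (rule ext)
    have m: "(%x. r x $ i *R axis i 1) \<in> P i" for i
      unfolding P_def using r by (intro image_eqI[of _ _ "%x. r x $ i"]) (auto simp: vPoly_def)
    show "r \<in> ?R"
      by (subst e, rule CollectI, rule exI, rule exI, rule conjI[OF refl], rule conjI[OF _ m],
          rule CollectI, rule exI, rule exI, rule conjI[OF refl], rule conjI[OF m m])
  next
    fix r assume "r \<in> ?R"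
    then obtain f g h where r: "r = (%x. (f x + g x) + h x)" "f \<in> P 1" "g \<in> P 2" "h \<in> P 3" by blast
    have "P i \<subseteq> vPoly l X" for i unfolding P_def using vPoly_const_mult by blast
    then show "r \<in> vPoly l X" unfolding r(1) using r by (intro vPoly_add) auto
  qed
  moreover have "fdim ?R" by (intro fdim_plus P)
  ultimately show ?thesis by simp
qed

subsection \<open>Integration over a piece\<close>

abbreviation "D \<equiv> \<phi> -` X"

lemma continuous_\<phi>: "continuous_on S \<phi>"
  by (rule continuous_on_subset[of UNIV])
    (auto simp: continuous_on_iff iso intro: exI)

lemma open_D: "open D"
proof -
  have "openin (top_of_set (affine hull X)) X"
    using ropen rel_open_def openin_rel_interior by metis
  then obtain T where T: "open T" "X = affine hull X \<inter> T" by (metis openin_open)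
  have "D = \<phi> -` T" using T(2) rng by (metis Int_iff rangeI subsetI subset_antisym vimage_eq)
  then show ?thesis using open_vimage[OF T(1) continuous_\<phi>] by simp
qed

lemma image_D: "\<phi> ` D = X"
  using rng hull_subset[of X affine] by auto

lemma nonempty_D: "D \<noteq> {}"
  using image_D ne by (metis image_is_empty)

lemma convex_D: "convex D"
proof -
  have "D = B -` ((%x. x - \<phi> 0) ` X)" unfolding B_def by (auto simp: image_iff)
  moreover have "convex ((%x. x - \<phi> 0) ` X)" using conv by (simp add: convex_translation_subtract)
  ultimately show ?thesis using convex_linear_vimage[OF linear_B] by simp
qed

lemma bounded_D: "bounded D"
proof -
  obtain c e where "\<forall>y\<in>X. dist c y \<le> e" using bdd unfolding bounded_def by blast
  then have "\<forall>x\<in>D. \<forall>y\<in>D. dist x y \<le> 2 * e"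
    using dist_triangle3 by (metis iso mult_2 add_mono order.trans vimageE)
  moreover obtain x where "x \<in> D" using nonempty_D by blast
  ultimately show ?thesis unfolding bounded_def by blast
qed

lemma integrable_D:
  assumes "cont f"
  shows "(%y. f (\<phi> y) :: real) absolutely_integrable_on D"
proof -
  obtain a b where ab: "D \<subseteq> cbox a b" using bounded_subset_cbox_symmetric[OF bounded_D] by blast
  have c: "continuous_on (cbox a b) (%y. f (\<phi> y))"
    by (rule continuous_on_compose2[OF assms continuous_\<phi>]) auto
  show ?thesis
    by (rule set_integrable_subset[OF absolutely_integrable_continuous[OF c] _ ab])
      (simp add: open_D)
qed

lemma integrable_on_D: "cont f ==> (%y. f (\<phi> y) :: real) integrable_on D"
  using integrable_D set_lebesgue_integral_eq_integral(1) by blast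

lemma I_add: "cont f ==> cont g ==> I (%x. f x + g x) = I f + I g"
  unfolding I_def by (rule integral_add; rule integrable_on_D)

lemma I_diff: "cont f ==> cont g ==> I (%x. f x - g x) = I f - I g"
  unfolding I_def by (rule integral_diff; rule integrable_on_D)

lemma I_cmult: "I (%x. c * f x) = c * I f"
  unfolding I_def by simp

lemma I_0: "I (%x. 0) = 0"
  unfolding I_def by simp

lemma I_sum: "finite J ==> (!!i. i \<in> J ==> cont (f i)) ==> I (%x. \<Sum>i\<in>J. f i x) = (\<Sum>i\<in>J. I (f i))"
  unfolding I_def by (rule integral_sum) (auto intro: integrable_on_D)

lemma I_cong: "(!!x. x \<in> X ==> f x = g x) ==> I f = I g"
  unfolding I_def by (rule integral_cong) simp

lemma measure_D_pos: "measure lebesgue D > 0"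
proof -
  have "D \<in> lmeasurable" by (rule bounded_set_imp_lmeasurable[OF bounded_D]) (simp add: open_D)
  moreover have "\<not> negligible D" using open_not_negligible[OF open_D nonempty_D] .
  ultimately show ?thesis using negligible_iff_measure0 zero_less_measure_iff by blast
qed

lemma I_bound:
  assumes "cont f" "!!x. x \<in> X ==> \<bar>f x\<bar> \<le> e"
  shows "\<bar>I f\<bar> \<le> I (%x. 1) * e"
proof -
  have "norm (integral D (%y. f (\<phi> y))) \<le> integral D (%y. e :: real)"
    by (rule integral_norm_bound_integral)
      (use assms in \<open>auto intro: integrable_on_D integrable_on_D[of "%x. e"]\<close>)
  also have "integral D (%y. e) = e * integral D (%y. 1 :: real)"
    using integral_mult_right[of D e "%y. 1 :: real"] by (simp only: mult_1_right)
  finally show ?thesis unfolding I_def by (simp add: mult.commute)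
qed

lemma I_1_pos: "I (%x. 1) > 0"
proof -
  have "D \<in> lmeasurable" by (rule bounded_set_imp_lmeasurable[OF bounded_D]) (simp add: open_D)
  then have "integral D (%y. 1 :: real) = measure lebesgue D" by (simp add: lmeasure_integral)
  then show ?thesis unfolding I_def using measure_D_pos by simp
qed

text \<open>A positive value persists on a small box inside the open chart domain, and that box
  alone would make the integral positive.\<close>

lemma I_definite:
  assumes "cont f" "!!x. x \<in> X ==> f x \<ge> 0" "I f = 0" "x \<in> X"
  shows "f x = 0"
proof (rule ccontr)
  assume "f x \<noteq> 0"
  obtain y where y: "\<phi> y = x" "y \<in> D" using image_D assms(4) by (metis imageE)
  have c: "cont (%y. f (\<phi> y))"
    by (rule continuous_on_compose2[OF assms(1) continuous_\<phi>]) auto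
  have fx: "f x > 0" using \<open>f x \<noteq> 0\<close> assms(2,4) by fastforce
  have "open {y. f (\<phi> y) > f x / 2}"
    using open_Collect_less[OF continuous_on_const c, of "f x / 2"] .
  then have "open (D \<inter> {y. f (\<phi> y) > f x / 2})" using open_D by blast
  moreover have "y \<in> D \<inter> {y. f (\<phi> y) > f x / 2}" using y fx by auto
  ultimately obtain a b where ab: "y \<in> box a b" "box a b \<subseteq> D \<inter> {y. f (\<phi> y) > f x / 2}"
    by (metis open_contains_box)
  have ib: "(%y. f (\<phi> y)) integrable_on box a b"
    by (rule set_lebesgue_integral_eq_integral(1), rule set_integrable_subset[OF integrable_D[OF assms(1)]])
      (use ab in auto)
  have "0 < measure lborel (cbox a b)" using ab(1) by (intro content_pos_lt) (auto simp: mem_box intro: less_trans)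
  then have "0 < f x / 2 * measure lborel (cbox a b)" using fx by simp
  also have "... = integral (box a b) (%y. f x / 2)"
    unfolding integral_open_interval integral_const by simp
  also have "... \<le> integral (box a b) (%y. f (\<phi> y))"
  proof (rule integral_le)
    show "(%y. f (\<phi> y)) integrable_on box a b" by (rule ib)
    show "(%y. f x / 2) integrable_on box a b" unfolding integrable_on_open_interval by (rule integrable_const)
  qed (use ab in auto)
  also have "... \<le> integral D (%y. f (\<phi> y))"
    by (rule integral_subset_le)
      (use ab assms(2) ib in "auto intro: integrable_on_D[OF assms(1)]")
  finally show False using assms(3) unfolding I_def by simp
qed

lemma I_pos:
  assumes "cont f" "!!x. x \<in> X ==> f x \<ge> 0" "x \<in> X" "f x \<noteq> 0"
  shows "I f > 0"
proof -
  have "I f \<ge> 0" unfolding I_def by (rule integral_nonneg) (use assms in "auto intro: integrable_on_D")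
  then show ?thesis using I_definite[OF assms(1,2) _ assms(3)] assms(4) by fastforce
qed

subsection \<open>Orthogonal projections on a piece\<close>

text \<open>Continuity on the whole space makes all integrals over \<open>X\<close> exist; the
  second condition makes the product \<open>I (%x. f x \<bullet> g x)\<close> definite, since the
  integral sees values on \<open>X\<close> only while the members are functions on the whole
  space.\<close>

definition test_space :: "(point => 'b::real_inner) set => bool" where
  "test_space S \<longleftrightarrow> fdim S \<and> (\<forall>f\<in>S. cont f \<and> ((\<forall>x\<in>X. f x = 0) \<longrightarrow> f = (%x. 0)))"

lemma test_space_Poly: "fdim S ==> S \<subseteq> Poly l X ==> test_space S"
  unfolding test_space_def using Poly_continuous Poly_zero by blast

lemma test_space_vPoly: "fdim S ==> S \<subseteq> vPoly l X ==> test_space S"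
  unfolding test_space_def using vPoly_continuous vPoly_zero by blast

lemma linear_on_space_I:
  assumes "linear_into S A" "cont f" "!!s. s \<in> S ==> cont (A s)"
  shows "linear_on_space S (%s. I (%x. f x \<bullet> A s x))"
  unfolding linear_on_space_def
proof (intro conjI ballI allI)
  have c: "cont (%x. f x \<bullet> A s x)" if "s \<in> S" for s
    by (rule continuous_on_inner[OF assms(2) assms(3)[OF that]])
  show "I (%x. f x \<bullet> A (%x. g x + h x) x) = I (%x. f x \<bullet> A g x) + I (%x. f x \<bullet> A h x)"
    if "g \<in> S" "h \<in> S" for g h
    unfolding linear_intoD(1)[OF assms(1) that] inner_add_right by (rule I_add) (rule c[OF that(1)], rule c[OF that(2)])
  show "I (%x. f x \<bullet> A (%x. k *R g x) x) = k *R I (%x. f x \<bullet> A g x)" if "g \<in> S" for g k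
    unfolding linear_intoD(2)[OF assms(1) that] inner_scaleR_right I_cmult by simp
qed

lemma linear_on_space_I_id:
  assumes "test_space S" "cont f"
  shows "linear_on_space S (%s. I (%x. f x \<bullet> s x))"
  by (rule linear_on_space_I[where A = "%s. s"])
    (use assms in "auto simp: test_space_def intro: linear_into_I")

text \<open>The weight will be the bubble function of an edge; weight 1 gives the usual
  representation in the \<open>L2\<close> product.\<close>

lemma weighted_riesz:
  assumes S: "test_space S" and l: "linear_on_space S \<psi>"
    and w: "cont w" "!!x. x \<in> X ==> w x > 0"
  shows "\<exists>!p. p \<in> S \<and> (\<forall>s\<in>S. I (%x. w x * (p x \<bullet> s x)) = \<psi> s)"
proof (rule riesz)
  have c: "cont f" if "f \<in> S" for f using S that test_space_def by blast
  show "fdim S" using S test_space_def by blast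
  show "linear_on_space S \<psi>" by (rule l)
  show "linear_on_space S (%s. I (%x. w x * (f x \<bullet> s x)))" if "f \<in> S" for f
    using linear_on_space_I_id[OF S continuous_on_scaleR[OF w(1) c[OF that]]] by simp
  show "I (%x. w x * (f x \<bullet> g x)) = I (%x. w x * (g x \<bullet> f x))" for f g
    by (simp add: inner_commute)
  fix f assume f: "f \<in> S" "I (%x. w x * (f x \<bullet> f x)) = 0"
  have "f x = 0" if "x \<in> X" for x
  proof -
    have "w x * (f x \<bullet> f x) = 0"
    proof (rule I_definite[OF _ _ f(2) that])
      show "cont (%x. w x * (f x \<bullet> f x))" using w(1) c[OF f(1)] by (intro continuous_intros)
    qed (use w(2) in "auto simp: less_imp_le")
    then show ?thesis using w(2)[OF that] by simp
  qed
  then show "f = (%x. 0)" using S f(1) test_space_def by blast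
qed

lemma L2_riesz:
  assumes S: "test_space S" and l: "linear_on_space S \<psi>"
  shows "\<exists>!p. p \<in> S \<and> (\<forall>s\<in>S. I (%x. p x \<bullet> s x) = \<psi> s)"
  using weighted_riesz[OF assms, of "%x. 1"] by simp

lemma L2_proj_spec:
  assumes "test_space S" "cont f"
  shows "L2_proj I S f \<in> S" "s \<in> S ==> I (%x. L2_proj I S f x \<bullet> s x) = I (%x. f x \<bullet> s x)"
  using theI'[OF L2_riesz[OF assms(1) linear_on_space_I_id[OF assms]]] unfolding L2_proj_def by blast+

lemma test_space_unique:
  assumes "test_space S" "p \<in> S" "q \<in> S" "!!s. s \<in> S ==> I (%x. p x \<bullet> s x) = I (%x. q x \<bullet> s x)"
  shows "p = q"
proof -
  have "cont q" using assms(1,3) test_space_def by blast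
  from L2_riesz[OF assms(1) linear_on_space_I_id[OF assms(1) this]] show ?thesis using assms by blast
qed

lemma L2_proj_eqI:
  assumes "test_space S" "p \<in> S" "!!s. s \<in> S ==> I (%x. p x \<bullet> s x) = I (%x. f x \<bullet> s x)"
  shows "L2_proj I S f = p"
  unfolding L2_proj_def
proof (rule the_equality)
  fix q assume "q \<in> S \<and> (\<forall>s\<in>S. I (%x. q x \<bullet> s x) = I (%x. f x \<bullet> s x))"
  then show "q = p" using test_space_unique[OF assms(1), of q p] assms by simp
qed (use assms in auto)

end

section \<open>The divergence theorem on convex polytopes\<close>

subsection \<open>Linear isometries preserve Lebesgue measure\<close>

text \<open>Relabelling coordinates maps boxes to boxes of equal volume. It bridges distinct types
  of equal dimension, such as a product and \<open>real^'n\<close>, before an orthogonal map of a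
  single space comes into play.\<close>

lemma lborel_distr_coordinates:
  assumes "DIM('c::euclidean_space) = DIM('d::euclidean_space)"
  shows "\<exists>J :: 'c => 'd. linear J \<and> (\<forall>x. norm (J x) = norm x) \<and> distr lborel borel J = lborel"
proof -
  obtain h where h: "bij_betw h (Basis :: 'c set) (Basis :: 'd set)"
    using finite_same_card_bij[OF finite_Basis finite_Basis assms] by blast
  define J where "J x = (\<Sum>b\<in>Basis. (x \<bullet> b) *R h b)" for x :: 'c
  have lin: "linear J" unfolding J_def[abs_def]
    by (rule linearI) (simp_all add: inner_add_left scaleR_left_distrib sum.distrib scaleR_sum_right)
  have hB: "h b \<in> Basis" if "b \<in> Basis" for b using h that bij_betwE by blast
  have Jh: "J x \<bullet> h b = x \<bullet> b" if b: "b \<in> Basis" for x b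
  proof -
    have "h a \<bullet> h b = (if a = b then 1 else 0)" if "a \<in> Basis" for a
      using b that hB h by (auto simp: inner_Basis bij_betw_def inj_on_def)
    then show ?thesis
      by (simp add: J_def inner_sum_left b if_distrib[of "%u. _ * u"] cong: sum.cong if_cong)
  qed
  have nrm: "norm (J x) = norm x" for x
  proof -
    have "J x \<bullet> J x = (\<Sum>d\<in>Basis. (J x \<bullet> d) * (J x \<bullet> d))" by (rule euclidean_inner)
    also have "... = (\<Sum>b\<in>Basis. (J x \<bullet> h b) * (J x \<bullet> h b))"
      by (rule sum.reindex_bij_betw[OF h, symmetric])
    also have "... = (\<Sum>b\<in>Basis. (x \<bullet> b) * (x \<bullet> b))" by (rule sum.cong) (simp_all add: Jh)
    also have "... = x \<bullet> x" by (rule euclidean_inner[symmetric])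
    finally show ?thesis by (simp add: norm_eq)
  qed
  have meas: "J \<in> borel_measurable borel"
    by (rule borel_measurable_continuous_onI) (rule linear_continuous_on, rule linear_conv_bounded_linear[THEN iffD1, OF lin])
  have "lborel = distr lborel borel J"
  proof (rule lborel_eqI)
    fix l u :: 'd assume lu: "!!b. b \<in> Basis ==> l \<bullet> b \<le> u \<bullet> b"
    define l' where "l' = (\<Sum>b\<in>Basis. (l \<bullet> h b) *R b)"
    define u' where "u' = (\<Sum>b\<in>Basis. (u \<bullet> h b) *R b)"
    have l': "l' \<bullet> b = l \<bullet> h b" and u': "u' \<bullet> b = u \<bullet> h b" if "b \<in> Basis" for b
      unfolding l'_def u'_def using that by simp_all
    have hs: "h ` Basis = Basis" using h by (simp add: bij_betw_def)
    have "J x \<in> box l u \<longleftrightarrow> (\<forall>b\<in>h ` Basis. l \<bullet> b < J x \<bullet> b \<and> J x \<bullet> b < u \<bullet> b)" for x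
      by (simp add: mem_box hs)
    then have "J -` box l u = box l' u'" by (auto simp: mem_box Jh l' u')
    then have "emeasure (distr lborel borel J) (box l u) = emeasure lborel (box l' u')"
      using meas by (subst emeasure_distr) auto
    also have "... = (\<Prod>b\<in>Basis. (u' - l') \<bullet> b)"
      by (rule emeasure_lborel_box) (use lu l' u' hB in auto)
    also have "... = (\<Prod>b\<in>Basis. (u - l) \<bullet> h b)"
      by (rule arg_cong[of _ _ ennreal], rule prod.cong) (simp_all add: inner_diff_left l' u')
    also have "... = (\<Prod>b\<in>Basis. (u - l) \<bullet> b)"
      by (rule arg_cong[of _ _ ennreal], rule prod.reindex_bij_betw[OF h])
    finally show "emeasure (distr lborel borel J) (box l u) = (\<Prod>b\<in>Basis. (u - l) \<bullet> b)" .
  qed simp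
  then show ?thesis using lin nrm by metis
qed

lemma lborel_distr_orthogonal:
  fixes f :: "real^'n::{finite,wellorder} => real^'n::_"
  assumes f: "orthogonal_transformation f"
  shows "distr lborel borel f = lborel"
proof -
  have meas: "f \<in> borel_measurable borel"
    by (rule borel_measurable_continuous_onI)
      (rule linear_continuous_on, rule linear_conv_bounded_linear[THEN iffD1, OF orthogonal_transformation_linear[OF f]])
  have "lborel = distr lborel borel f"
  proof (rule lborel_eqI)
    fix l u :: "real^'n::_" assume lu: "!!b. b \<in> Basis ==> l \<bullet> b \<le> u \<bullet> b"
    have fi: "orthogonal_transformation (inv f)" by (rule orthogonal_transformation_inv[OF f])
    have v: "f -` box l u = inv f ` box l u"
      using bij_vimage_eq_inv_image[OF orthogonal_transformation_bij[OF f]] .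
    have bl: "box l u \<in> lmeasurable" by simp
    have "emeasure (distr lborel borel f) (box l u) = emeasure lborel (f -` box l u)"
      using meas by (subst emeasure_distr) auto
    also have "... = emeasure lebesgue (f -` box l u)"
      using measurable_sets_borel[OF meas, of "box l u"] by simp
    also have "... = ennreal (measure lebesgue (inv f ` box l u))"
      unfolding v using measurable_orthogonal_image[OF fi bl] by (simp add: emeasure_eq_measure2)
    also have "... = ennreal (measure lebesgue (box l u))"
      using measure_orthogonal_image[OF fi bl] by simp
    also have "... = (\<Prod>b\<in>Basis. (u - l) \<bullet> b)"
      using lu by (simp add: measure_lborel_box_eq)
    finally show "emeasure (distr lborel borel f) (box l u) = (\<Prod>b\<in>Basis. (u - l) \<bullet> b)" .
  qed simp
  then show ?thesis by simp
qed

lemma linear_inj_imp_surj_same_dim: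
  fixes f :: "'c::euclidean_space => 'd::euclidean_space"
  assumes "linear f" "inj f" "DIM('c) = DIM('d)"
  shows "surj f"
proof -
  have "dim (range f) = dim (UNIV :: 'c set)"
    by (rule dim_image_eq) (use assms in "auto intro: inj_on_subset")
  then have "span (range f) = UNIV" using assms(3) by (simp add: dim_eq_full)
  moreover have "span (range f) = range f"
    using linear_subspace_image[OF assms(1), of UNIV] by (simp add: span_eq_iff)
  ultimately show ?thesis by simp
qed

text \<open>\<open>J\<close> identifies the coordinates of the two types, and \<open>M\<close>
  differs from it by an orthogonal map of \<open>real^'n\<close>, which preserves volume.\<close>

lemma lborel_distr_isometry:
  fixes M :: "'c::euclidean_space => real^'n::{finite,wellorder}"
  assumes "linear M" "!!x. norm (M x) = norm x" "DIM('c) = CARD('n)"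
  shows "distr lborel borel M = lborel" "bij M"
proof -
  obtain J :: "'c => real^'n::_" where J: "linear J" "!!x. norm (J x) = norm x" "distr lborel borel J = lborel"
    using lborel_distr_coordinates[where 'c = 'c and 'd = "real^'n::_"] assms(3) by auto
  have inj: "inj J" "inj M"
    using J(1,2) assms(1,2) by (metis linear_injective_0 norm_eq_zero)+
  have d: "DIM('c) = DIM(real^'n::_)" using assms(3) by simp
  have surj: "surj J" by (rule linear_inj_imp_surj_same_dim[OF J(1) inj(1) d])
  define N where "N = M \<circ> inv J"
  have Jinv: "J (inv J y) = y" for y using surj by (simp add: surj_f_inv_f)
  have li: "linear (inv J)"
  proof
    show "inv J (x + y) = inv J x + inv J y" for x y
      by (rule inv_f_eq[OF inj(1)]) (simp add: linear_add[OF J(1)] Jinv)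
    show "inv J (c *R x) = c *R inv J x" for c x
      by (rule inv_f_eq[OF inj(1)]) (simp add: linear_cmul[OF J(1)] Jinv)
  qed
  have "norm (inv J y) = norm y" for y using J(2)[of "inv J y"] by (simp add: Jinv)
  then have "orthogonal_transformation N"
    unfolding orthogonal_transformation N_def using assms(2) linear_compose[OF li assms(1)] by simp
  then have N: "distr lborel borel N = lborel" by (rule lborel_distr_orthogonal)
  have NJ: "N \<circ> J = M" using inj by (auto simp: N_def fun_eq_iff)
  have meas: "h \<in> borel_measurable borel" if "linear h" for h :: "'x::euclidean_space => real^'n::_"
    by (rule borel_measurable_continuous_onI)
      (rule linear_continuous_on, rule linear_conv_bounded_linear[THEN iffD1, OF that])
  have lN: "linear N" unfolding N_def using linear_compose[OF li assms(1)] .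
  have "distr lborel borel M = distr (distr lborel borel J) borel N"
    unfolding NJ[symmetric] by (rule distr_distr[symmetric]) (use meas lN J in auto)
  then show "distr lborel borel M = lborel" using J N by simp
  show "bij M" unfolding bij_def using inj \<open>orthogonal_transformation N\<close> NJ surj
    by (metis comp_surj orthogonal_transformation_surj)
qed

text \<open>
  Sweeping a hyperplane in direction \<open>v\<close>: compared with the orthogonal direction \<open>n\<close> this is a shear,
  which does not change volumes, combined with the factor \<open>\<bar>n \<bullet> v\<bar>\<close>.
\<close>

lemma lborel_sweep:
  fixes A :: "'b::euclidean_space => real^'n::{finite,wellorder}"
  assumes A: "linear A" "!!w. norm (A w) = norm w" and n: "norm n = 1" "!!w. n \<bullet> A w = 0"
    and d: "DIM('b) + 1 = CARD('n)" and nz: "n \<bullet> v \<noteq> 0"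
  shows "lborel = density (distr (lborel :: ('b \<times> real) measure) borel (%(w, t). p + A w + t *R v)) (%_. ennreal \<bar>n \<bullet> v\<bar>)"
    and "surj (%(w, t). A w + t *R v)" and "inj (%(w, t). A w + t *R v)"
proof -
  define M where "M = (%(w, t). A w + t *R n)"
  have linM: "linear M" unfolding M_def
    by (rule linearI) (auto simp: linear_add[OF A(1)] linear_cmul[OF A(1)] algebra_simps)
  have nM: "norm (M x) = norm x" for x
  proof -
    obtain w t where x: "x = (w, t)" by (cases x)
    have "A w \<bullet> A w = w \<bullet> w" using A(2)[of w] by (simp add: norm_eq)
    moreover have "n \<bullet> n = 1" using n(1) by (simp add: norm_eq_1)
    ultimately have "M x \<bullet> M x = x \<bullet> x"
      unfolding x M_def using n(2)[of w] by (simp add: inner_add_left inner_add_right inner_commute)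
    then show ?thesis by (simp add: norm_eq)
  qed
  have dc: "DIM('b \<times> real) = CARD('n)" using d by simp
  note iso = lborel_distr_isometry[OF linM nM dc]
  obtain c \<beta> where v: "v = A c + \<beta> *R n"
  proof -
    obtain z where "M z = v" using iso(2) by (metis bij_pointE)
    then show ?thesis using that by (cases z) (auto simp: M_def)
  qed
  have \<beta>: "\<beta> = n \<bullet> v" unfolding v using n by (simp add: inner_add_right norm_eq_1)
  \<comment> \<open>In the orthonormal coordinates \<open>M\<close> the sweep is a shear by
    \<open>t *R c\<close> combined with stretching the last coordinate by \<open>\<beta>\<close>.
    The computation below removes the stretching by substitution in \<open>t\<close> and the shear
    by translation invariance in \<open>w\<close>, exchanging the order of integration in
    between.\<close>
  have sh: "A w + t *R v = M (w + t *R c, \<beta> * t)" for w t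
    unfolding v M_def by (simp add: linear_add[OF A(1)] linear_cmul[OF A(1)] algebra_simps)
  show "surj (%(w, t). A w + t *R v)"
  proof (rule surjI)
    fix y
    define z where "z = inv M y"
    have "M z = y" unfolding z_def using iso(2) by (simp add: bij_is_surj surj_f_inv_f)
    then show "(%(w, t). A w + t *R v) (fst (inv M y) - (snd (inv M y) / \<beta>) *R c, snd (inv M y) / \<beta>) = y"
      using nz \<beta> by (simp add: sh z_def)
  qed
  show "inj (%(w, t). A w + t *R v)"
  proof (rule injI, clarify)
    fix w t w' t' assume "A w + t *R v = A w' + t' *R v"
    then have "(w + t *R c, \<beta> * t) = (w' + t' *R c, \<beta> * t')"
      unfolding sh using iso(2) by (metis bij_is_inj injD)
    then show "w = w' \<and> t = t'" using nz \<beta> by auto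
  qed
  have cA: "continuous_on S A" for S by (rule linear_continuous_on, rule linear_conv_bounded_linear[THEN iffD1, OF A(1)])
  have measS: "(%(w, t). p + A w + t *R v) \<in> borel_measurable borel"
    by (rule borel_measurable_continuous_onI)
      (auto simp: split_beta intro!: continuous_intros continuous_on_compose2[OF cA[of UNIV]])
  have measM: "M \<in> borel_measurable borel"
    by (rule borel_measurable_continuous_onI)
      (rule linear_continuous_on, rule linear_conv_bounded_linear[THEN iffD1, OF linM])
  show "lborel = density (distr (lborel :: ('b \<times> real) measure) borel (%(w, t). p + A w + t *R v)) (%_. ennreal \<bar>n \<bullet> v\<bar>)"
  proof (rule measure_eqI)
    fix E :: "(real^'n::_) set" assume "E \<in> sets lborel"
    then have E: "E \<in> sets borel" by simp
    define E' where "E' = (%x. p + x) -` E"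
    have E': "E' \<in> sets borel" unfolding E'_def
      using measurable_sets_borel[of "(+) p" borel, OF _ E] by simp
    define F where "F w t = (indicator E' (M (w, t)) :: ennreal)" for w t
    have Fm: "(%z. F (fst z) (snd z)) \<in> borel_measurable (borel \<Otimes>\<^sub>M borel)"
      unfolding F_def prod.collapse borel_prod by (rule measurable_compose[OF measM]) (use E' in simp)
    have Fm1: "(%w. F (w + a) t) \<in> borel_measurable borel" for a t
      using measurable_compose[OF _ Fm, of "%w. (w + a, t)" borel] by simp
    have Fm2: "(%t. F w t) \<in> borel_measurable borel" for w
      using measurable_compose[OF _ Fm, of "%t. (w, t)" borel] by simp
    have Fm3: "(%(w, t). F w (\<beta> * t)) \<in> borel_measurable (lborel \<Otimes>\<^sub>M lborel)"
      using measurable_compose[OF _ Fm, of "%z. (fst z, \<beta> * snd z)" "borel \<Otimes>\<^sub>M borel"]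
      by (simp add: split_beta cong: measurable_cong_sets)
    have Fm4: "(%(w, t). F (w + t *R c) (\<beta> * t)) \<in> borel_measurable (lborel \<Otimes>\<^sub>M lborel)"
      using measurable_compose[OF _ Fm, of "%z. (fst z + snd z *R c, \<beta> * snd z)" "borel \<Otimes>\<^sub>M borel"]
      by (simp add: split_beta cong: measurable_cong_sets)
    have Fm5: "(%(w, t). F w t) \<in> borel_measurable (lborel \<Otimes>\<^sub>M lborel)"
      using Fm by (simp add: split_beta cong: measurable_cong_sets)
    have "emeasure lborel E = emeasure lborel E'"
    proof -
      have "emeasure lborel E = emeasure (distr lborel borel ((+) p)) E" by (simp add: lborel_distr_plus)
      also have "... = emeasure lborel E'" using E by (subst emeasure_distr) (auto simp: E'_def)
      finally show ?thesis .
    qed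
    also have "... = emeasure (distr lborel borel M) E'" by (simp add: iso(1))
    also have "... = (\<integral>\<^sup>+z. F (fst z) (snd z) \<partial>(lborel :: ('b \<times> real) measure))"
      using E' measM by (subst emeasure_distr)
        (auto simp: F_def nn_integral_indicator[symmetric] indicator_vimage[symmetric] vimage_def indicator_def
          simp flip: nn_integral_indicator intro!: nn_integral_cong)
    also have "... = (\<integral>\<^sup>+w. \<integral>\<^sup>+t. F w t \<partial>lborel \<partial>lborel)"
      unfolding lborel_prod[symmetric] using lborel.nn_integral_fst[OF Fm5] by (simp add: case_prod_unfold)
    also have "... = (\<integral>\<^sup>+w. ennreal \<bar>\<beta>\<bar> * (\<integral>\<^sup>+t. F w (\<beta> * t) \<partial>lborel) \<partial>lborel)"
      using nn_integral_real_affine[OF Fm2, of \<beta> _ 0] nz \<beta> by (intro nn_integral_cong) simp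
    also have "... = ennreal \<bar>\<beta>\<bar> * (\<integral>\<^sup>+w. \<integral>\<^sup>+t. F w (\<beta> * t) \<partial>lborel \<partial>lborel)"
      using lborel.borel_measurable_nn_integral[OF Fm3] by (intro nn_integral_cmult) simp
    also have "(\<integral>\<^sup>+w. \<integral>\<^sup>+t. F w (\<beta> * t) \<partial>lborel \<partial>lborel) = (\<integral>\<^sup>+t. \<integral>\<^sup>+w. F w (\<beta> * t) \<partial>lborel \<partial>lborel)"
      by (rule lborel_pair.Fubini'[OF Fm3, symmetric])
    also have "... = (\<integral>\<^sup>+t. \<integral>\<^sup>+w. F (w + t *R c) (\<beta> * t) \<partial>lborel \<partial>lborel)"
    proof (rule nn_integral_cong)
      fix t :: real
      have "(\<integral>\<^sup>+w. F w (\<beta> * t) \<partial>lborel) = (\<integral>\<^sup>+w. F w (\<beta> * t) \<partial>distr lborel borel ((+) (t *R c)))"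
        by (simp add: lborel_distr_plus)
      also have "... = (\<integral>\<^sup>+w. F (t *R c + w) (\<beta> * t) \<partial>lborel)"
        using Fm1[of 0] by (subst nn_integral_distr) auto
      finally show "(\<integral>\<^sup>+w. F w (\<beta> * t) \<partial>lborel) = (\<integral>\<^sup>+w. F (w + t *R c) (\<beta> * t) \<partial>lborel)"
        by (simp add: add.commute)
    qed
    also have "... = (\<integral>\<^sup>+w. \<integral>\<^sup>+t. F (w + t *R c) (\<beta> * t) \<partial>lborel \<partial>lborel)"
      by (rule lborel_pair.Fubini'[OF Fm4])
    also have "... = (\<integral>\<^sup>+z. F (fst z + snd z *R c) (\<beta> * snd z) \<partial>(lborel :: ('b \<times> real) measure))"
      unfolding lborel_prod[symmetric] using lborel.nn_integral_fst[OF Fm4] by (simp add: case_prod_unfold)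
    also have "... = (\<integral>\<^sup>+z. indicator E ((%(w, t). p + A w + t *R v) z) \<partial>(lborel :: ('b \<times> real) measure))"
      by (rule nn_integral_cong) (auto simp: F_def sh[symmetric] E'_def indicator_def add.assoc)
    also have "... = (\<integral>\<^sup>+x. indicator E x \<partial>distr (lborel :: ('b \<times> real) measure) borel (%(w, t). p + A w + t *R v))"
      using measS E by (subst nn_integral_distr) auto
    finally show "emeasure lborel E = emeasure (density (distr (lborel :: ('b \<times> real) measure) borel
        (%(w, t). p + A w + t *R v)) (%_. ennreal \<bar>n \<bullet> v\<bar>)) E"
      using E by (subst emeasure_density) (auto simp: \<beta> nn_integral_cmult)
  qed simp
qed

subsection \<open>Lines through a convex polytope\<close>

text \<open>One more direction leaves a set of codimension at least two inside a hyperplane, and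
  that hyperplane is parallel to \<open>v\<close>, so the whole sweep stays in it.\<close>

lemma negligible_affine_sweep:
  fixes A :: "'a::euclidean_space set"
  assumes "affine A" "aff_dim A + 2 \<le> int DIM('a)"
  shows "negligible {x. \<exists>t. x + t *R v \<in> A}"
proof (cases "A = {}")
  case False
  then obtain a where a: "a \<in> A" by blast
  have "aff_dim (insert (a + v) A) < int DIM('a)"
    using assms(2) by (simp add: aff_dim_insert)
  then obtain c b where c: "c \<noteq> 0" "insert (a + v) A \<subseteq> {x. c \<bullet> x = b}"
    by (rule aff_lowdim_subset_hyperplane)
  have "c \<bullet> v = 0" using c(2) a by (auto simp: inner_add_right)
  then have "{x. \<exists>t. x + t *R v \<in> A} \<subseteq> {x. c \<bullet> x = b}" using c(2) by (auto simp: inner_add_right)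
  then show ?thesis using negligible_hyperplane[of c b] c(1) negligible_subset by blast
qed simp

lemma set_integrable_continuous_open:
  fixes u :: "'a::euclidean_space => real"
  assumes "cont u" "open S" "bounded S"
  shows "set_integrable lborel S u"
proof -
  obtain a b where ab: "S \<subseteq> cbox a b" using bounded_subset_cbox_symmetric[OF assms(3)] by blast
  have "set_integrable lborel (cbox a b) u"
    unfolding set_integrable_def
    by (rule borel_integrable_compact) (auto intro: continuous_on_subset[OF assms(1)])
  then show ?thesis by (rule set_integrable_subset) (use assms(2) ab in auto)
qed

lemma integrable_on_continuous_open:
  fixes u :: "'a::euclidean_space => real"
  assumes "cont u" "open S" "bounded S"
  shows "u integrable_on S"
  using set_borel_integral_eq_integral(1)[OF set_integrable_continuous_open[OF assms]] .

text \<open>A convex domain whose boundary is tiled by flat sets of one dimension less; neighbouring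
  tiles may lie in the same hyperplane. The sets in \<open>\<A>\<close> have codimension at least
  two and absorb the relative boundaries of the tiles. It is used in dimension 3 for cells and, in
  chart coordinates, in dimension 2 for faces.\<close>

locale faceted_domain =
  fixes K :: "(real^'n::{finite,wellorder}) set" and J :: "'i set"
    and \<psi> :: "'i => 'b::euclidean_space => real^'n::_" and D :: "'i => 'b set"
    and \<nu> :: "'i => real^'n::_" and \<A> :: "(real^'n::_) set set"
  assumes K: "open K" "convex K" "bounded K" "K \<noteq> {}" and fin: "finite J"
    and iso: "i \<in> J ==> dist (\<psi> i x) (\<psi> i y) = dist x y"
    and nrm: "i \<in> J ==> norm (\<nu> i) = 1" and perp: "i \<in> J ==> \<nu> i \<bullet> (\<psi> i x - \<psi> i y) = 0"
    and D: "i \<in> J ==> open (D i)" "i \<in> J ==> bounded (D i)"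
    and front: "frontier K = (\<Union>i\<in>J. closure (\<psi> i ` D i))"
    and disj: "i \<in> J ==> j \<in> J ==> i \<noteq> j ==> \<psi> i ` D i \<inter> \<psi> j ` D j = {}"
    and out: "i \<in> J ==> z \<in> K ==> \<nu> i \<bullet> (z - \<psi> i x) < 0"
    and \<A>: "finite \<A>" "A \<in> \<A> ==> affine A" "A \<in> \<A> ==> aff_dim A + 2 \<le> int CARD('n)"
    and thin: "i \<in> J ==> closure (\<psi> i ` D i) - \<psi> i ` D i \<subseteq> \<Union>\<A>"
    and dims: "DIM('b) + 1 = CARD('n)"
begin

definition lin where "lin i w = \<psi> i w - \<psi> i 0"

lemma linear_lin: "i \<in> J ==> linear (lin i)"
  unfolding lin_def[abs_def] by (rule isometry_linear_part) (rule iso)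

lemma norm_lin: "i \<in> J ==> norm (lin i w) = norm w"
  using iso[of i w 0] by (simp add: lin_def dist_norm)

lemma perp_lin: "i \<in> J ==> \<nu> i \<bullet> lin i w = 0"
  unfolding lin_def by (rule perp)

lemma \<psi>_lin: "\<psi> i w = \<psi> i 0 + lin i w" by (simp add: lin_def)

lemma continuous_\<psi>: "i \<in> J ==> continuous_on S (\<psi> i)"
  by (auto simp: continuous_on_iff iso intro: exI)

lemma perp_in_range:
  assumes i: "i \<in> J" and c: "\<nu> i \<bullet> c = 0"
  shows "\<exists>w. lin i w = c"
proof -
  have "\<nu> i \<bullet> \<nu> i \<noteq> 0" using nrm[OF i] by auto
  then obtain w t where wt: "lin i w + t *R \<nu> i = c"
    using lborel_sweep(2)[OF linear_lin[OF i] norm_lin[OF i] nrm[OF i] perp_lin[OF i] dims, of "\<nu> i"]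
    by (metis (mono_tags, lifting) case_prod_conv surj_def surj_pair)
  then have "\<nu> i \<bullet> (lin i w + t *R \<nu> i) = 0" using c by simp
  then have "t = 0" using perp_lin[OF i] \<open>\<nu> i \<bullet> \<nu> i \<noteq> 0\<close> by (simp add: inner_add_right)
  with wt show ?thesis by auto
qed

text \<open>Write \<open>v\<close> as a positive multiple of the direction to an inner point
  \<open>y\<close> plus a tangential vector \<open>c\<close>. Moving within the tile along
  \<open>c\<close> and then shrinking towards \<open>y\<close> reaches
  \<open>\<psi> i w + s *R v\<close>, and shrinking a closure point of a convex set towards an
  interior point lands in the interior.\<close>

lemma enters:
  assumes i: "i \<in> J" and w: "w \<in> D i" and v: "\<nu> i \<bullet> v < 0"
  shows "\<exists>e>0. \<forall>s. 0 < s \<and> s < e \<longrightarrow> \<psi> i w + s *R v \<in> K"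
proof -
  obtain y where y: "y \<in> K" using K by blast
  define \<mu> where "\<mu> = \<nu> i \<bullet> v / (\<nu> i \<bullet> (y - \<psi> i w))"
  have \<mu>: "\<mu> > 0" unfolding \<mu>_def using v out[OF i y] by (simp add: divide_neg_neg)
  define c where "c = v - \<mu> *R (y - \<psi> i w)"
  have "\<nu> i \<bullet> c = 0" unfolding c_def \<mu>_def using out[OF i y, of w] by (simp add: inner_diff_right)
  then obtain u where u: "lin i u = c" using perp_in_range[OF i] by blast
  \<comment> \<open>Shrinking towards \<open>y\<close> scales the displacement on the tile by
    \<open>1 - s * \<mu>\<close>; dividing by this factor beforehand makes the total tangential
    displacement exactly \<open>s *R c\<close>.\<close>
  have "isCont (%s. w + (s / (1 - s * \<mu>)) *R u) 0" by (intro continuous_intros) auto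
  then have "eventually (%s. w + (s / (1 - s * \<mu>)) *R u \<in> D i) (at (0::real))"
    using D(1)[OF i] w
    by (intro topological_tendstoD[of "%s. w + (s / (1 - s * \<mu>)) *R u" w]) (auto simp: isCont_def)
  then obtain e where e: "e > 0" "\<forall>s. s \<noteq> 0 \<and> dist s 0 < e \<longrightarrow> w + (s / (1 - s * \<mu>)) *R u \<in> D i"
    by (auto simp: eventually_at)
  define e' where "e' = min e (1 / \<mu>)"
  have "\<psi> i w + s *R v \<in> K" if s: "0 < s" "s < e'" for s
  proof -
    have s1: "s * \<mu> < 1" using s \<mu> by (simp add: e'_def pos_less_divide_eq)
    define z where "z = \<psi> i (w + (s / (1 - s * \<mu>)) *R u)"
    have "z \<in> \<psi> i ` D i" unfolding z_def using e(2) s by (auto simp: e'_def dist_real_def)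
    then have "z \<in> closure K" using front i closure_subset[of "\<psi> i ` D i"] frontier_closures[of K] by auto
    then have "z - (s * \<mu>) *R (z - y) \<in> interior K"
      using mem_interior_closure_convex_shrink[OF K(2), of y z "s * \<mu>"] y K(1) s \<mu> s1
      by (simp add: interior_open)
    moreover have z: "z = \<psi> i w + (s / (1 - s * \<mu>)) *R c"
      unfolding z_def \<psi>_lin[of i "w + _"] \<psi>_lin[of i w]
      by (simp add: linear_add[OF linear_lin[OF i]] linear_cmul[OF linear_lin[OF i]] u)
    moreover have "z - (s * \<mu>) *R (z - y) = \<psi> i w + s *R v"
    proof -
      have "z - (s * \<mu>) *R (z - y) = (1 - s * \<mu>) *R z + (s * \<mu>) *R y" by (simp add: algebra_simps)
      also have "... = (1 - s * \<mu>) *R \<psi> i w + ((1 - s * \<mu>) * (s / (1 - s * \<mu>))) *R c + (s * \<mu>) *R y"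
        unfolding z by (simp add: scaleR_right_distrib)
      also have "(1 - s * \<mu>) * (s / (1 - s * \<mu>)) = s" using s1 by simp
      also have "(1 - s * \<mu>) *R \<psi> i w + s *R c + (s * \<mu>) *R y = \<psi> i w + s *R v"
        unfolding c_def by (simp add: algebra_simps)
      finally show ?thesis .
    qed
    ultimately show ?thesis using interior_subset[of K] by (metis subsetD)
  qed
  moreover have "e' > 0" using e(1) \<mu> by (simp add: e'_def)
  ultimately show ?thesis by blast
qed

text \<open>From a base point outside this null set, the line in direction \<open>v\<close> avoids
  the relative boundaries of all tiles and the planes of all tiles parallel to \<open>v\<close>, and
  the base point itself is not on the boundary.\<close>

definition exceptional where
  "exceptional v = frontier K \<union> (\<Union>A\<in>\<A>. {x. \<exists>t. x + t *R v \<in> A}) \<union>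
     (\<Union>i\<in>{i\<in>J. \<nu> i \<bullet> v = 0}. {x. \<nu> i \<bullet> x = \<nu> i \<bullet> \<psi> i 0})"

lemma negligible_exceptional: "negligible (exceptional v)"
proof -
  have "negligible {x. \<nu> i \<bullet> x = \<nu> i \<bullet> \<psi> i 0}" if "i \<in> J" for i
    by (rule negligible_hyperplane) (use nrm[OF that] in auto)
  moreover have "negligible {x. \<exists>t. x + t *R v \<in> A}" if "A \<in> \<A>" for A
    using \<A>(2,3)[OF that] by (intro negligible_affine_sweep) auto
  ultimately show ?thesis
    unfolding exceptional_def using negligible_convex_frontier[OF K(2)] fin \<A>(1)
    by (intro negligible_Un negligible_Union) auto
qed

definition hits where "hits v i x \<longleftrightarrow> (\<exists>t>0. x + t *R v \<in> \<psi> i ` D i)"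

text \<open>
  Along a generic line, \<open>K\<close> is an interval whose end points lie on exactly one entry and one exit face.
\<close>

lemma crossing_formula:
  assumes x: "x \<notin> exceptional v" and v: "v \<noteq> 0"
  shows "(indicator K x :: real) = (\<Sum>i\<in>{i\<in>J. \<nu> i \<bullet> v \<noteq> 0}. sgn (\<nu> i \<bullet> v) * of_bool (hits v i x))"
proof -
  define l where "l t = x + t *R v" for t
  define S where "S = {t. l t \<in> K}"
  have lc: "cont l" unfolding l_def by (intro continuous_intros)
  have ldiff: "l t - l s = (t - s) *R v" for t s unfolding l_def by (simp add: algebra_simps)
  have \<nu>l: "(t - s) * (\<nu> i \<bullet> v) < 0" if "i \<in> J" "l s \<in> \<psi> i ` D i" "t \<in> S" for i t s
  proof -
    obtain w where w: "l s = \<psi> i w" using \<open>l s \<in> \<psi> i ` D i\<close> by auto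
    have "\<nu> i \<bullet> (l t - \<psi> i w) < 0" using out[OF \<open>i \<in> J\<close>, of "l t" w] \<open>t \<in> S\<close> by (auto simp: S_def)
    then show ?thesis by (simp add: w[symmetric] ldiff)
  qed
  have near_exit: "\<exists>e>0. \<forall>s. 0 < s \<and> s < e \<longrightarrow> t - s \<in> S" if "i \<in> J" "l t \<in> \<psi> i ` D i" "\<nu> i \<bullet> v > 0" for i t
  proof -
    obtain w where w: "w \<in> D i" "l t = \<psi> i w" using \<open>l t \<in> \<psi> i ` D i\<close> by auto
    obtain e where "e > 0" "\<forall>s. 0 < s \<and> s < e \<longrightarrow> \<psi> i w + s *R (- v) \<in> K"
      using enters[OF \<open>i \<in> J\<close> w(1), of "- v"] \<open>\<nu> i \<bullet> v > 0\<close> by auto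
    then show ?thesis unfolding S_def w(2)[symmetric] l_def by (auto simp: algebra_simps intro!: exI[of _ e])
  qed
  have near_entry: "\<exists>e>0. \<forall>s. 0 < s \<and> s < e \<longrightarrow> t + s \<in> S" if "i \<in> J" "l t \<in> \<psi> i ` D i" "\<nu> i \<bullet> v < 0" for i t
  proof -
    obtain w where w: "w \<in> D i" "l t = \<psi> i w" using \<open>l t \<in> \<psi> i ` D i\<close> by auto
    obtain e where "e > 0" "\<forall>s. 0 < s \<and> s < e \<longrightarrow> \<psi> i w + s *R v \<in> K"
      using enters[OF \<open>i \<in> J\<close> w(1), of "v"] \<open>\<nu> i \<bullet> v < 0\<close> by auto
    then show ?thesis unfolding S_def w(2)[symmetric] l_def by (auto simp: algebra_simps intro!: exI[of _ e])
  qed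
  have hits: "hits v i x \<longleftrightarrow> (\<exists>t>0. l t \<in> \<psi> i ` D i)" for i by (simp add: hits_def l_def)
  show ?thesis
  proof (cases "S = {}")
    case True
    \<comment> \<open>A transversal hit would put points of \<open>K\<close> on the line next to it,
      on the inner side of the tile.\<close>
    have "\<not> hits v i x" if i: "i \<in> J" "\<nu> i \<bullet> v \<noteq> 0" for i
    proof
      assume "hits v i x"
      then obtain t where t: "l t \<in> \<psi> i ` D i" using hits by blast
      consider "\<nu> i \<bullet> v > 0" | "\<nu> i \<bullet> v < 0" using i(2) by linarith
      then show False
      proof cases
        case 1
        then obtain e where "e > 0" "\<forall>s. 0 < s \<and> s < e \<longrightarrow> t - s \<in> S" using near_exit i(1) t by blast
        then have "t - e / 2 \<in> S" by auto
        with True show False by blast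
      next
        case 2
        then obtain e where "e > 0" "\<forall>s. 0 < s \<and> s < e \<longrightarrow> t + s \<in> S" using near_entry i(1) t by blast
        then have "t + e / 2 \<in> S" by auto
        with True show False by blast
      qed
    qed
    moreover have "x \<notin> K" using True by (auto simp: S_def l_def dest: spec[of _ 0])
    ultimately show ?thesis by simp
  next
    case False
    then have Sne: "S \<noteq> {}" .
    have Sopen: "open S" unfolding S_def using open_vimage[OF K(1) lc] by (simp add: vimage_def)
    have Sconv: "convex S"
    proof (rule convexI)
      fix s t a b :: real assume st: "s \<in> S" "t \<in> S" "0 \<le> a" "0 \<le> b" "a + b = 1"
      then have "a *R l s + b *R l t \<in> K" using K(2) by (auto simp: S_def convexD)
      moreover have "a *R l s + b *R l t = (a + b) *R x + (a * s + b * t) *R v"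
        unfolding l_def by (simp add: algebra_simps)
      ultimately show "a *R s + b *R t \<in> S" using st(5) by (simp add: S_def l_def)
    qed
    have Sbdd: "bounded S"
    proof -
      obtain B where B: "!!y. y \<in> K ==> norm y \<le> B" using K(3) bounded_iff by blast
      have "\<bar>t\<bar> \<le> (B + norm x) / norm v" if "t \<in> S" for t
      proof -
        have "\<bar>t\<bar> * norm v = norm (l t - x)" by (simp add: l_def)
        also have "... \<le> norm (l t) + norm x" by (rule norm_triangle_ineq4)
        also have "... \<le> B + norm x" using B that by (simp add: S_def)
        finally show ?thesis using v by (simp add: pos_le_divide_eq)
      qed
      then show ?thesis unfolding bounded_iff by auto
    qed
    define \<alpha> where "\<alpha> = Inf S"
    define \<beta> where "\<beta> = Sup S"
    have lt: "\<alpha> < t" "t < \<beta>" if tS: "t \<in> S" for t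
    proof -
      obtain e where e: "e > 0" "ball t e \<subseteq> S" using Sopen tS open_contains_ball by blast
      then have "t + e / 2 \<in> S" "t - e / 2 \<in> S" by (auto simp: dist_real_def subset_iff)
      then have "t + e / 2 \<le> \<beta>" "\<alpha> \<le> t - e / 2"
        unfolding \<alpha>_def \<beta>_def using Sbdd by (auto intro: cSup_upper cInf_lower bounded_imp_bdd_above bounded_imp_bdd_below)
      then show "\<alpha> < t" "t < \<beta>" using e(1) by linarith+
    qed
    have notS: "\<alpha> \<notin> S" "\<beta> \<notin> S" using lt by blast+
    have clS: "\<alpha> \<in> closure S" "\<beta> \<in> closure S"
      unfolding \<alpha>_def \<beta>_def using Sbdd False
      by (auto intro: closure_contains_Inf closure_contains_Sup bounded_imp_bdd_above bounded_imp_bdd_below)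
    have lfront: "l t \<in> frontier K" if "t \<in> closure S" "t \<notin> S" for t
    proof -
      have "l ` S \<subseteq> closure K" using closure_subset[of K] by (auto simp: S_def)
      then have "l ` closure S \<subseteq> closure K"
        by (intro image_closure_subset continuous_on_subset[OF lc]) auto
      then have "l t \<in> closure K" using that by blast
      then show ?thesis using that(2) K(1) by (simp add: frontier_def interior_open S_def)
    qed
    have face: "\<exists>i\<in>J. l t \<in> \<psi> i ` D i \<and> \<nu> i \<bullet> v \<noteq> 0" if ft: "t \<in> closure S" "t \<notin> S" for t
    proof -
      obtain i where i: "i \<in> J" "l t \<in> closure (\<psi> i ` D i)" using lfront[OF ft] front by blast
      have "l t \<notin> \<Union>\<A>" using x by (auto simp: exceptional_def l_def)
      then have li: "l t \<in> \<psi> i ` D i" using thin[OF i(1)] i(2) by blast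
      then obtain w where w: "l t = \<psi> i w" by blast
      have "\<nu> i \<bullet> v \<noteq> 0"
      proof
        assume 0: "\<nu> i \<bullet> v = 0"
        have "\<nu> i \<bullet> x = \<nu> i \<bullet> l t" using 0 by (simp add: l_def inner_add_right)
        also have "... = \<nu> i \<bullet> \<psi> i 0" using perp[OF i(1), of w 0] by (simp add: w inner_diff_right)
        finally show False using x 0 i(1) by (auto simp: exceptional_def)
      qed
      with i li show ?thesis by blast
    qed
    obtain s0 where s0: "s0 \<in> S" using False by blast
    obtain i1 where i1: "i1 \<in> J" "l \<beta> \<in> \<psi> i1 ` D i1" using face[OF clS(2) notS(2)] by blast
    obtain i2 where i2: "i2 \<in> J" "l \<alpha> \<in> \<psi> i2 ` D i2" using face[OF clS(1) notS(1)] by blast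
    have n1: "\<nu> i1 \<bullet> v > 0" using \<nu>l[OF i1 s0] lt(2)[OF s0] by (simp add: mult_less_0_iff)
    have n2: "\<nu> i2 \<bullet> v < 0" using \<nu>l[OF i2 s0] lt(1)[OF s0] by (simp add: mult_less_0_iff)
    have exit_time: "t = \<beta>" if hit: "i \<in> J" "l t \<in> \<psi> i ` D i" "\<nu> i \<bullet> v > 0" for i t
    proof -
      have up: "s < t" if "s \<in> S" for s using \<nu>l[OF \<open>i \<in> J\<close> \<open>l t \<in> \<psi> i ` D i\<close> that] \<open>\<nu> i \<bullet> v > 0\<close>
        by (simp add: mult_less_0_iff)
      then have "\<beta> \<le> t" unfolding \<beta>_def by (intro cSup_least) (use s0 in "auto simp: less_imp_le")
      obtain e where e: "e > 0" "\<forall>s. 0 < s \<and> s < e \<longrightarrow> t - s \<in> S" using near_exit[OF hit] by blast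
      have "t \<le> \<beta>"
      proof (rule ccontr)
        assume "\<not> t \<le> \<beta>"
        define r where "r = min (e / 2) (t - \<beta>)"
        have "t - r \<in> S" using e \<open>\<not> t \<le> \<beta>\<close> by (auto simp: r_def)
        then have "t - r < \<beta>" by (rule lt)
        then show False by (simp add: r_def)
      qed
      with \<open>\<beta> \<le> t\<close> show ?thesis by simp
    qed
    have entry_time: "t = \<alpha>" if hit: "i \<in> J" "l t \<in> \<psi> i ` D i" "\<nu> i \<bullet> v < 0" for i t
    proof -
      have up: "t < s" if "s \<in> S" for s using \<nu>l[OF \<open>i \<in> J\<close> \<open>l t \<in> \<psi> i ` D i\<close> that] \<open>\<nu> i \<bullet> v < 0\<close>
        by (simp add: mult_less_0_iff)
      then have "t \<le> \<alpha>" unfolding \<alpha>_def by (intro cInf_greatest) (use s0 in "auto simp: less_imp_le")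
      obtain e where e: "e > 0" "\<forall>s. 0 < s \<and> s < e \<longrightarrow> t + s \<in> S" using near_entry[OF hit] by blast
      have "\<alpha> \<le> t"
      proof (rule ccontr)
        assume "\<not> \<alpha> \<le> t"
        define r where "r = min (e / 2) (\<alpha> - t)"
        have "t + r \<in> S" using e \<open>\<not> \<alpha> \<le> t\<close> by (auto simp: r_def)
        then have "\<alpha> < t + r" by (rule lt)
        then show False by (simp add: r_def)
      qed
      with \<open>t \<le> \<alpha>\<close> show ?thesis by simp
    qed
    \<comment> \<open>The only transversal hits are at the exit time \<open>\<beta>\<close>, on tile
      \<open>i1\<close> with positive sign, and at the entry time \<open>\<alpha>\<close>, on tile
      \<open>i2\<close> with negative sign. Since \<open>hits\<close> counts positive times only,
      the sum becomes \<open>of_bool (0 < \<beta>) - of_bool (0 < \<alpha>)\<close>.\<close>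
    have summand: "sgn (\<nu> i \<bullet> v) * of_bool (hits v i x) =
        (if i = i1 then of_bool (0 < \<beta>) else 0) - (if i = i2 then of_bool (0 < \<alpha>) else 0)"
      if i: "i \<in> J" "\<nu> i \<bullet> v \<noteq> 0" for i
    proof (cases "\<nu> i \<bullet> v > 0")
      case True
      then have "i \<noteq> i2" using n2 by auto
      have "hits v i x \<longleftrightarrow> 0 < \<beta> \<and> l \<beta> \<in> \<psi> i ` D i" using exit_time[OF i(1) _ True] hits by auto
      also have "l \<beta> \<in> \<psi> i ` D i \<longleftrightarrow> i = i1" using disj[OF i(1) i1(1)] i1(2) by auto
      finally show ?thesis using True \<open>i \<noteq> i2\<close> by simp
    next
      case False
      then have neg: "\<nu> i \<bullet> v < 0" using i(2) by linarith
      then have "i \<noteq> i1" using n1 by auto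
      have "hits v i x \<longleftrightarrow> 0 < \<alpha> \<and> l \<alpha> \<in> \<psi> i ` D i" using entry_time[OF i(1) _ neg] hits by auto
      also have "l \<alpha> \<in> \<psi> i ` D i \<longleftrightarrow> i = i2" using disj[OF i(1) i2(1)] i2(2) by auto
      finally show ?thesis using neg \<open>i \<noteq> i1\<close> by simp
    qed
    have "(\<Sum>i\<in>{i\<in>J. \<nu> i \<bullet> v \<noteq> 0}. sgn (\<nu> i \<bullet> v) * of_bool (hits v i x)) =
        (\<Sum>i\<in>{i\<in>J. \<nu> i \<bullet> v \<noteq> 0}. (if i = i1 then of_bool (0 < \<beta>) else 0) - (if i = i2 then of_bool (0 < \<alpha>) else 0))"
      by (rule sum.cong) (auto simp: summand)
    also have "... = of_bool (0 < \<beta>) - (of_bool (0 < \<alpha>) :: real)"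
      using i1 i2 n1 n2 fin by (simp add: sum_subtractf)
    also have "... = indicator K x"
    proof -
      have l0: "l 0 = x" by (simp add: l_def)
      have "0 \<noteq> \<alpha>" using lfront[OF clS(1) notS(1)] x l0 by (auto simp: exceptional_def)
      show ?thesis
      proof (cases "x \<in> K")
        case True
        then have "0 \<in> S" by (simp add: S_def l0)
        from lt[OF this] show ?thesis using True by simp
      next
        case False
        then have nS: "0 \<notin> S" by (simp add: S_def l0)
        have iv: "is_interval S" using Sconv is_interval_convex_1 by blast
        have "0 < \<alpha> \<longleftrightarrow> 0 < \<beta>"
        proof
          assume "0 < \<alpha>" then show "0 < \<beta>" using lt[OF s0] by linarith
        next
          assume b: "0 < \<beta>"
          show "0 < \<alpha>"
          proof (rule ccontr)
            assume "\<not> 0 < \<alpha>"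
            then have "\<alpha> < 0" using \<open>0 \<noteq> \<alpha>\<close> by simp
            then obtain s where s: "s \<in> S" "s < 0" unfolding \<alpha>_def
              using cInf_lessD[OF Sne] by blast
            obtain t where t: "t \<in> S" "0 < t" using b less_cSupD[OF Sne] unfolding \<beta>_def by blast
            show False using mem_is_interval_1_I[OF iv s(1) t(1)] s t nS by auto
          qed
        qed
        then show ?thesis using False by simp
      qed
    qed
    finally show ?thesis ..
  qed
qed

subsection \<open>Integration along lines\<close>

abbreviation jump where
  "jump f v a i \<equiv> %w. f (\<psi> i w) - f (\<psi> i w - (\<psi> i w \<bullet> v - a) *R v)"

text \<open>\<open>C\<close> is the shadow of tile \<open>i\<close> in direction \<open>- v\<close>,
  cut off by the plane \<open>x \<bullet> v = a\<close>. In the coordinates (point of the tile,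
  distance from it) the inner integral is evaluated by the fundamental theorem of calculus, and
  \<open>lborel_sweep\<close> supplies the volume factor.\<close>

lemma sweep_integral:
  assumes i: "i \<in> J" and nz: "\<nu> i \<bullet> v \<noteq> 0" and v: "norm v = 1"
    and f: "cont f" and g: "cont g"
    and fg: "!!x t. ((%t. f (x + t *R v)) has_real_derivative g (x + t *R v)) (at t)"
    and a: "!!w. w \<in> D i ==> a < \<psi> i w \<bullet> v"
  defines "C \<equiv> {x. hits v i x \<and> a < x \<bullet> v}"
  shows "set_integrable lborel C g"
    and "(LINT x:C|lborel. g x) =
      \<bar>\<nu> i \<bullet> v\<bar> * integral (D i) (jump f v a i)"
proof -
  note l = linear_lin[OF i]
  define \<Theta> where "\<Theta> = (%(w, t). \<psi> i 0 + lin i w + t *R (- v))"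
  define O' where "O' = {z. fst z \<in> D i \<and> 0 < snd z \<and> snd z < \<psi> i (fst z) \<bullet> v - a}"
  have nz': "\<nu> i \<bullet> (- v) \<noteq> 0" using nz by simp
  note sweep = lborel_sweep[OF l norm_lin[OF i] nrm[OF i] perp_lin[OF i] dims nz']
  have \<Theta>: "\<Theta> (w, t) = \<psi> i w - t *R v" for w t unfolding \<Theta>_def by (simp add: \<psi>_lin[of i w])
  have vv: "v \<bullet> v = 1" using v by (simp add: norm_eq_1)
  have inj: "inj \<Theta>"
  proof (rule injI)
    fix y z assume "\<Theta> y = \<Theta> z"
    then have "(%(w, t). lin i w + t *R (- v)) y = (%(w, t). lin i w + t *R (- v)) z"
      by (simp add: \<Theta>_def case_prod_unfold)
    then show "y = z" by (rule injD[OF sweep(3)])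
  qed
  have C: "C = \<Theta> ` O'"
  proof (intro equalityI subsetI)
    fix x assume "x \<in> C"
    then obtain t w where t: "t > 0" "w \<in> D i" "x + t *R v = \<psi> i w" "a < x \<bullet> v"
      unfolding C_def hits_def by auto
    then have "x = \<Theta> (w, t)" by (simp add: \<Theta> flip: t(3))
    moreover have "\<psi> i w \<bullet> v = x \<bullet> v + t" by (simp add: t(3)[symmetric] inner_add_left vv)
    ultimately show "x \<in> \<Theta> ` O'" using t by (auto simp: O'_def intro!: image_eqI[of _ _ "(w, t)"])
  next
    fix x assume "x \<in> \<Theta> ` O'"
    then obtain w t where t: "x = \<psi> i w - t *R v" "w \<in> D i" "0 < t" "t < \<psi> i w \<bullet> v - a"
      by (auto simp: O'_def \<Theta>)
    then have "x + t *R v \<in> \<psi> i ` D i" "a < x \<bullet> v" by (auto simp: inner_diff_left vv)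
    then show "x \<in> C" unfolding C_def hits_def using t(3) by blast
  qed
  have c\<psi>: "cont (%z :: 'b \<times> real. \<psi> i (fst z))"
    by (rule continuous_on_compose2[OF continuous_\<psi>[OF i, of UNIV]]) (auto intro: continuous_intros)
  have c\<Theta>: "cont \<Theta>"
  proof -
    have "\<Theta> = (%z. \<psi> i (fst z) - snd z *R v)" using \<Theta> by auto
    then show ?thesis using continuous_\<psi>[OF i, of UNIV]
      by (auto intro!: continuous_intros continuous_on_compose2[of UNIV "\<psi> i"])
  qed
  have openO: "open O'"
  proof -
    have "open (D i \<times> {0::real<..})" using D(1)[OF i] by (intro open_Times) auto
    moreover have "open {z :: 'b \<times> real. snd z < \<psi> i (fst z) \<bullet> v - a}"
      by (intro open_Collect_less continuous_on_diff continuous_on_inner c\<psi> continuous_on_snd continuous_on_const continuous_on_id)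
    ultimately have "open ((D i \<times> {0<..}) \<inter> {z. snd z < \<psi> i (fst z) \<bullet> v - a})" by (rule open_Int)
    moreover have "O' = (D i \<times> {0<..}) \<inter> {z. snd z < \<psi> i (fst z) \<bullet> v - a}" by (auto simp: O'_def)
    ultimately show ?thesis by simp
  qed
  have bddO: "bounded O'"
  proof -
    obtain B where B: "!!w. w \<in> D i ==> norm w \<le> B" using D(2)[OF i] bounded_iff by blast
    have "O' \<subseteq> D i \<times> {0..norm (\<psi> i 0) + B + \<bar>a\<bar>}"
    proof
      fix z assume z: "z \<in> O'"
      then have w: "fst z \<in> D i" by (simp add: O'_def)
      have "\<psi> i (fst z) \<bullet> v \<le> norm (\<psi> i (fst z))" using norm_cauchy_schwarz[of "\<psi> i (fst z)" v] v by simp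
      also have "... \<le> norm (\<psi> i 0) + norm (fst z)"
        using norm_triangle_ineq[of "\<psi> i 0" "lin i (fst z)"] norm_lin[OF i] by (simp add: \<psi>_lin[of i "fst z"])
      finally show "z \<in> D i \<times> {0..norm (\<psi> i 0) + B + \<bar>a\<bar>}"
        using z B[OF w] w by (cases z) (auto simp: O'_def)
    qed
    then show ?thesis by (rule bounded_subset[rotated]) (intro bounded_Times D(2)[OF i] bounded_closed_interval)
  qed
  have openC: "open C"
  proof -
    have lin\<Theta>: "linear (%(w, t). lin i w + t *R (- v))"
      by (rule linearI) (auto simp: linear_add[OF l] linear_cmul[OF l] algebra_simps)
    have "open ((%(w, t). lin i w + t *R (- v)) ` O')"
      by (rule open_surjective_linear_image[OF openO lin\<Theta> sweep(2)])
    then have "open ((%x. \<psi> i 0 + x) ` (%(w, t). lin i w + t *R (- v)) ` O')" by (rule open_translation)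
    moreover have "(%x. \<psi> i 0 + x) ` (%(w, t). lin i w + t *R (- v)) ` O' = C"
      unfolding C image_image \<Theta>_def by (rule image_cong) (auto simp: add.assoc)
    ultimately show ?thesis by simp
  qed
  have bddC: "bounded C"
  proof -
    have "compact (\<Theta> ` closure O')"
      by (rule compact_continuous_image[OF continuous_on_subset[OF c\<Theta>]]) (use bddO in "auto simp: compact_closure")
    then show ?thesis unfolding C
      by (meson bounded_subset closure_subset compact_imp_bounded image_mono)
  qed
  show Cint: "set_integrable lborel C g" by (rule set_integrable_continuous_open[OF g openC bddC])
  have cg\<Theta>: "cont (%z. g (\<Theta> z))"
    by (rule continuous_on_compose2[OF g c\<Theta>]) auto
  have Oint: "set_integrable lborel O' (%z. g (\<Theta> z))"
    by (rule set_integrable_continuous_open[OF cg\<Theta> openO bddO])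
  have meas\<Theta>: "\<Theta> \<in> borel_measurable borel" by (rule borel_measurable_continuous_onI[OF c\<Theta>])
  have measg: "g \<in> borel_measurable borel" by (rule borel_measurable_continuous_onI[OF g])
  have measCg: "(%x. indicator C x *R g x) \<in> borel_measurable borel" using openC measg by auto
  have "(LINT x:C|lborel. g x) = integral\<^sup>L (density (distr lborel borel \<Theta>) (%_. ennreal \<bar>\<nu> i \<bullet> v\<bar>)) (%x. indicator C x *R g x)"
    unfolding set_lebesgue_integral_def using sweep(1)[of "\<psi> i 0"] by (simp add: \<Theta>_def)
  also have "... = (\<integral>x. \<bar>\<nu> i \<bullet> v\<bar> *R (indicator C x *R g x) \<partial>distr lborel borel \<Theta>)"
    by (rule integral_density) (use measCg in auto)
  also have "... = \<bar>\<nu> i \<bullet> v\<bar> * (\<integral>x. indicator C x *R g x \<partial>distr lborel borel \<Theta>)"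
    by simp
  also have "(\<integral>x. indicator C x *R g x \<partial>distr lborel borel \<Theta>) = (\<integral>z. indicator C (\<Theta> z) *R g (\<Theta> z) \<partial>lborel)"
    by (rule integral_distr) (use meas\<Theta> measCg in auto)
  also have "... = (\<integral>z. indicator O' z *R g (\<Theta> z) \<partial>lborel)"
    using inj by (intro Bochner_Integration.integral_cong) (auto simp: C indicator_def inj_image_mem_iff)
  also have "... = (\<integral>w. \<integral>t. indicator O' (w, t) *R g (\<Theta> (w, t)) \<partial>lborel \<partial>lborel)"
    using lborel_pair.integral_fst'[of "%z. indicator O' z *R g (\<Theta> z)"] Oint
    by (simp add: lborel_prod set_integrable_def)
  also have "... = (\<integral>w. indicator (D i) w *R (f (\<psi> i w) - f (\<psi> i w - (\<psi> i w \<bullet> v - a) *R v)) \<partial>lborel)"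
  proof (rule Bochner_Integration.integral_cong[OF refl])
    fix w
    show "(\<integral>t. indicator O' (w, t) *R g (\<Theta> (w, t)) \<partial>lborel) =
      indicator (D i) w *R (f (\<psi> i w) - f (\<psi> i w - (\<psi> i w \<bullet> v - a) *R v))"
    proof (cases "w \<in> D i")
      case False
      then show ?thesis by (simp add: O'_def)
    next
      case True
      define c where "c = \<psi> i w \<bullet> v - a"
      have c: "c > 0" using a[OF True] by (simp add: c_def)
      have "(\<integral>t. indicator O' (w, t) *R g (\<Theta> (w, t)) \<partial>lborel) = (LBINT t=0..c. g (\<psi> i w - t *R v))"
        unfolding interval_lebesgue_integral_def set_lebesgue_integral_def
        using c True by (simp add: zero_ereal_def \<Theta> O'_def c_def indicator_def cong: if_cong)
      also have "... = - f (\<psi> i w - c *R v) - (- f (\<psi> i w - 0 *R v))"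
        unfolding zero_ereal_def
      proof (rule interval_integral_FTC_finite)
        show "continuous_on {min 0 c..max 0 c} (%t. g (\<psi> i w - t *R v))"
          by (rule continuous_on_compose2[OF g]) (auto intro!: continuous_intros)
        fix t
        have "((%t. f (\<psi> i w + (- t) *R v)) has_real_derivative g (\<psi> i w + (- t) *R v) * (- 1)) (at t)"
          by (rule DERIV_chain2[OF fg]) (auto intro!: derivative_eq_intros)
        then have "((%t. - f (\<psi> i w - t *R v)) has_real_derivative g (\<psi> i w - t *R v)) (at t)"
          by (auto dest: DERIV_minus)
        then show "((%t. - f (\<psi> i w - t *R v)) has_vector_derivative g (\<psi> i w - t *R v)) (at t within {min 0 c..max 0 c})"
          by (simp add: has_real_derivative_iff_has_vector_derivative has_vector_derivative_at_within)
      qed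
      finally show ?thesis using True by (simp add: c_def)
    qed
  qed
  also have "... = (LINT w:D i|lborel. f (\<psi> i w) - f (\<psi> i w - (\<psi> i w \<bullet> v - a) *R v))"
    by (simp add: set_lebesgue_integral_def)
  also have "... = integral (D i) (jump f v a i)"
  proof (rule set_borel_integral_eq_integral(2), rule set_integrable_continuous_open)
    show "cont (jump f v a i)"
      using continuous_\<psi>[OF i, of UNIV]
      by (auto intro!: continuous_intros continuous_on_compose2[OF f])
  qed (use D i in auto)
  finally show "(LINT x:C|lborel. g x) =
      \<bar>\<nu> i \<bullet> v\<bar> * integral (D i) (jump f v a i)" .
qed

lemma face_in_closure: "i \<in> J ==> w \<in> D i ==> \<psi> i w \<in> closure K"
  using front closure_subset[of "\<psi> i ` D i"] frontier_closures[of K] by auto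

text \<open>Almost everywhere the indicator of \<open>K\<close> is a signed sum of indicators of
  shadows, by \<open>crossing_formula\<close>; integrating \<open>g\<close> against it and using
  \<open>sgn (\<nu> i \<bullet> v) * \<bar>\<nu> i \<bullet> v\<bar> = \<nu> i \<bullet> v\<close>
  gives the formula. The cut-off plane lies below \<open>K\<close>, so cutting the shadows there
  loses nothing.\<close>

lemma swept_divergence:
  assumes v: "norm v = 1" and f: "cont f" and g: "cont g"
    and fg: "!!x t. ((%t. f (x + t *R v)) has_real_derivative g (x + t *R v)) (at t)"
    and a: "!!x. x \<in> closure K ==> a < x \<bullet> v"
  shows "integral K g = (\<Sum>i\<in>J. \<nu> i \<bullet> v * integral (D i) (jump f v a i))"
proof -
  define C where "C i = {x. hits v i x \<and> a < x \<bullet> v}" for i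
  define J' where "J' = {i\<in>J. \<nu> i \<bullet> v \<noteq> 0}"
  have J': "i \<in> J" "\<nu> i \<bullet> v \<noteq> 0" if "i \<in> J'" for i using that by (auto simp: J'_def)
  have av: "a < \<psi> i w \<bullet> v" if "i \<in> J" "w \<in> D i" for i w using a face_in_closure[OF that] by blast
  have Cint: "set_integrable lborel (C i) g" if "i \<in> J'" for i
    unfolding C_def by (rule sweep_integral(1)[OF J'[OF that] v f g fg av[OF J'(1)[OF that]]])
  have Cval: "(LINT x:C i|lborel. g x) =
      \<bar>\<nu> i \<bullet> v\<bar> * integral (D i) (jump f v a i)" if "i \<in> J'" for i
    unfolding C_def by (rule sweep_integral(2)[OF J'[OF that] v f g fg av[OF J'(1)[OF that]]])
  have Kint: "set_integrable lborel K g" by (rule set_integrable_continuous_open[OF g K(1,3)])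
  have Ci: "integrable lborel (%x. sgn (\<nu> i \<bullet> v) * (indicator (C i) x *R g x))" if "i \<in> J'" for i
    using Cint[OF that] by (simp add: set_integrable_def)
  have sint: "integrable lborel (%x. \<Sum>i\<in>J'. sgn (\<nu> i \<bullet> v) * (indicator (C i) x *R g x))"
    by (rule Bochner_Integration.integrable_sum) (rule Ci)
  have "integral K g = (LINT x:K|lborel. g x)" using set_borel_integral_eq_integral(2)[OF Kint] by simp
  also have "... = (\<integral>x. indicator K x *R g x \<partial>lebesgue)"
    unfolding set_lebesgue_integral_def using Kint
    by (intro integral_completion[symmetric]) (auto simp: set_integrable_def)
  also have "... = (\<integral>x. (\<Sum>i\<in>J'. sgn (\<nu> i \<bullet> v) * (indicator (C i) x *R g x)) \<partial>lebesgue)"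
  proof (rule integral_cong_AE)
    show "(%x. indicator K x *R g x) \<in> borel_measurable lebesgue"
      using Kint by (intro measurable_completion) (auto simp: set_integrable_def)
    show "(%x. \<Sum>i\<in>J'. sgn (\<nu> i \<bullet> v) * (indicator (C i) x *R g x)) \<in> borel_measurable lebesgue"
      using sint by (intro measurable_completion) auto
    have "exceptional v \<in> null_sets lebesgue"
      using negligible_exceptional by (simp add: negligible_iff_null_sets)
    then have "AE x in lebesgue. x \<notin> exceptional v" by (rule AE_not_in)
    then show "AE x in lebesgue. indicator K x *R g x = (\<Sum>i\<in>J'. sgn (\<nu> i \<bullet> v) * (indicator (C i) x *R g x))"
    proof (eventually_elim)
      case (elim x)
      have v0: "v \<noteq> 0" using v by auto
      note cf = crossing_formula[OF elim v0, folded J'_def]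
      show ?case
      proof (cases "a < x \<bullet> v")
        case True
        then have "indicator (C i) x = (of_bool (hits v i x) :: real)" for i by (simp add: C_def indicator_def)
        then show ?thesis unfolding cf by (simp add: sum_distrib_right mult.assoc)
      next
        case False
        then have "x \<notin> K" using a closure_subset[of K] by blast
        moreover have "x \<notin> C i" for i using False by (simp add: C_def)
        ultimately show ?thesis by simp
      qed
    qed
  qed
  also have "... = (\<integral>x. (\<Sum>i\<in>J'. sgn (\<nu> i \<bullet> v) * (indicator (C i) x *R g x)) \<partial>lborel)"
    using sint by (intro integral_completion) auto
  also have "... = (\<Sum>i\<in>J'. \<integral>x. sgn (\<nu> i \<bullet> v) * (indicator (C i) x *R g x) \<partial>lborel)"
    by (rule Bochner_Integration.integral_sum) (rule Ci)
  also have "... = (\<Sum>i\<in>J'. \<nu> i \<bullet> v * integral (D i) (jump f v a i))"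
  proof (rule sum.cong[OF refl])
    fix i assume i: "i \<in> J'"
    have "(\<integral>x. sgn (\<nu> i \<bullet> v) * (indicator (C i) x *R g x) \<partial>lborel) = sgn (\<nu> i \<bullet> v) * (LINT x:C i|lborel. g x)"
      unfolding set_lebesgue_integral_def by simp
    also have "... = (sgn (\<nu> i \<bullet> v) * \<bar>\<nu> i \<bullet> v\<bar>) *
        integral (D i) (jump f v a i)"
      unfolding Cval[OF i] by (simp only: mult.assoc)
    finally show "(\<integral>x. sgn (\<nu> i \<bullet> v) * (indicator (C i) x *R g x) \<partial>lborel) =
        \<nu> i \<bullet> v * integral (D i) (jump f v a i)"
      by (simp add: sgn_mult_abs)
  qed
  also have "... = (\<Sum>i\<in>J. \<nu> i \<bullet> v * integral (D i) (jump f v a i))"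
    by (rule sum.mono_neutral_left) (use fin in "auto simp: J'_def")
  finally show ?thesis .
qed

text \<open>
  The traces on the entry side, which depend only on the line, cancel: applying the swept formula to
  \<open>h x * (x \<bullet> v - a)\<close> for two values of \<open>a\<close> and a function \<open>h\<close> constant along \<open>v\<close> gives the same left side.
\<close>

theorem divergence:
  assumes v: "norm v = 1" and f: "cont f" and g: "cont g"
    and fg: "!!x t. ((%t. f (x + t *R v)) has_real_derivative g (x + t *R v)) (at t)"
  shows "integral K g = (\<Sum>i\<in>J. \<nu> i \<bullet> v * integral (D i) (%w. f (\<psi> i w)))"
proof -
  have vv: "v \<bullet> v = 1" using v by (simp add: norm_eq_1)
  obtain B where B: "!!x. x \<in> closure K ==> norm x \<le> B" using bounded_closure[OF K(3)] bounded_iff by blast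
  define a where "a = - B - 1"
  have a: "b < x \<bullet> v" if "x \<in> closure K" "b \<le> a" for x b
    using B[OF that(1)] Cauchy_Schwarz_ineq2[of x v] v that(2) by (simp add: a_def)
  \<comment> \<open>The value of \<open>f\<close> where the line through \<open>x\<close> meets the
    cut-off plane: on a tile this is the subtracted term of \<open>jump\<close>.\<close>
  define h where "h x = f (x - (x \<bullet> v - a) *R v)" for x
  have hv: "h (x + t *R v) = h x" for x t
    unfolding h_def by (rule arg_cong[of _ _ f]) (simp add: inner_add_left vv algebra_simps)
  have ch: "cont h"
    unfolding h_def by (rule continuous_on_compose2[OF f]) (auto intro!: continuous_intros)
  have inth: "cont u ==> i \<in> J ==> (%w. u (\<psi> i w) :: real) integrable_on D i" for u i
    by (rule integrable_on_continuous_open) (auto intro: continuous_on_compose2[OF _ continuous_\<psi>] D)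
  have E: "integral K h = (\<Sum>i\<in>J. \<nu> i \<bullet> v * (integral (D i) (%w. h (\<psi> i w) * (\<psi> i w \<bullet> v)) - b * integral (D i) (%w. h (\<psi> i w))))"
    if b: "b \<le> a" for b
  proof -
    have "integral K h = (\<Sum>i\<in>J. \<nu> i \<bullet> v * integral (D i) (%w. h (\<psi> i w) * (\<psi> i w \<bullet> v - b) -
        h (\<psi> i w - (\<psi> i w \<bullet> v - b) *R v) * ((\<psi> i w - (\<psi> i w \<bullet> v - b) *R v) \<bullet> v - b)))"
    proof (rule swept_divergence[OF v _ ch])
      show "cont (%x. h x * (x \<bullet> v - b))" using ch by (intro continuous_intros)
      show "((%t. h (x + t *R v) * ((x + t *R v) \<bullet> v - b)) has_real_derivative h (x + t *R v)) (at t)" for x t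
        unfolding hv inner_add_left inner_scaleR_left vv by (auto intro!: derivative_eq_intros)
    qed (use a b in auto)
    also have "... = (\<Sum>i\<in>J. \<nu> i \<bullet> v * (integral (D i) (%w. h (\<psi> i w) * (\<psi> i w \<bullet> v)) - b * integral (D i) (%w. h (\<psi> i w))))"
    proof (rule sum.cong[OF refl])
      fix i assume i: "i \<in> J"
      have "integral (D i) (%w. h (\<psi> i w) * (\<psi> i w \<bullet> v - b) -
          h (\<psi> i w - (\<psi> i w \<bullet> v - b) *R v) * ((\<psi> i w - (\<psi> i w \<bullet> v - b) *R v) \<bullet> v - b)) =
        integral (D i) (%w. h (\<psi> i w) * (\<psi> i w \<bullet> v) - b * h (\<psi> i w))"
        by (rule integral_cong) (simp add: inner_diff_left vv algebra_simps)
      also have "... = integral (D i) (%w. h (\<psi> i w) * (\<psi> i w \<bullet> v)) - integral (D i) (%w. b * h (\<psi> i w))"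
        by (intro integral_diff inth[of "%x. h x * (x \<bullet> v)", OF _ i] inth[of "%x. b * h x", OF _ i]
            continuous_intros ch)
      finally show "\<nu> i \<bullet> v * integral (D i) (%w. h (\<psi> i w) * (\<psi> i w \<bullet> v - b) -
          h (\<psi> i w - (\<psi> i w \<bullet> v - b) *R v) * ((\<psi> i w - (\<psi> i w \<bullet> v - b) *R v) \<bullet> v - b)) =
        \<nu> i \<bullet> v * (integral (D i) (%w. h (\<psi> i w) * (\<psi> i w \<bullet> v)) - b * integral (D i) (%w. h (\<psi> i w)))"
        by simp
    qed
    finally show ?thesis .
  qed
  \<comment> \<open>The right side of \<open>E\<close> is affine in \<open>b\<close> while the left
    side does not contain \<open>b\<close>, so the slope vanishes.\<close>
  have "(\<Sum>i\<in>J. \<nu> i \<bullet> v * integral (D i) (%w. h (\<psi> i w))) = 0"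
    using E[of a] E[of "a - 1"] by (simp add: algebra_simps sum.distrib sum_subtractf)
  moreover have "integral K g = (\<Sum>i\<in>J. \<nu> i \<bullet> v * (integral (D i) (%w. f (\<psi> i w)) - integral (D i) (%w. h (\<psi> i w))))"
  proof -
    have "integral (D i) (%w. f (\<psi> i w) - h (\<psi> i w)) = integral (D i) (%w. f (\<psi> i w)) - integral (D i) (%w. h (\<psi> i w))"
      if "i \<in> J" for i using inth[OF f that] inth[OF ch that] by (rule integral_diff)
    moreover have "integral K g = (\<Sum>i\<in>J. \<nu> i \<bullet> v * integral (D i) (%w. f (\<psi> i w) - h (\<psi> i w)))"
      unfolding h_def by (rule swept_divergence[OF v f g fg]) (rule a, simp_all)
    ultimately show ?thesis by simp
  qed
  ultimately show ?thesis by (simp add: right_diff_distrib sum_subtractf)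
qed

end

subsection \<open>The divergence theorem on a piece\<close>

text \<open>Transport through the chart of \<open>S\<close>: \<open>\<iota>\<close> inverts it on
  the hull, so the boundary pieces become tiles in coordinate space and
  \<open>faceted_domain\<close> applies. A tangential vector \<open>v\<close> of arbitrary length is
  reduced to a unit vector by scaling.\<close>

lemma piece_divergence:
  fixes \<phi> :: "real^'n::{finite,wellorder} => point" and \<xi> :: "'i => 'b::euclidean_space => point"
  assumes S: "piece S \<phi>" and A: "!!j. j \<in> J ==> piece (A j) (\<xi> j)" and fin: "finite J"
    and dims: "DIM('b) + 1 = CARD('n)"
    and front: "closure S - S = (\<Union>j\<in>J. closure (A j))"
    and disj: "!!i j. i \<in> J ==> j \<in> J ==> i \<noteq> j ==> A i \<inter> A j = {}"
    and \<nu>: "!!j. j \<in> J ==> norm (\<nu> j) = 1" "!!j. j \<in> J ==> piece.L \<phi> (\<nu> j) = \<nu> j"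
    and perp: "!!j x y. j \<in> J ==> x \<in> affine hull A j ==> y \<in> affine hull A j ==> \<nu> j \<bullet> (x - y) = 0"
    and out: "!!j x y. j \<in> J ==> x \<in> affine hull A j ==> y \<in> S ==> \<nu> j \<bullet> (y - x) < 0"
    and \<A>: "finite \<A>" "!!Q. Q \<in> \<A> ==> affine Q" "!!Q. Q \<in> \<A> ==> aff_dim Q + 2 \<le> int CARD('n)"
    and thin: "!!j. j \<in> J ==> closure (A j) - A j \<subseteq> \<phi> ` \<Union>\<A>"
    and f: "f \<in> poly3 l" and v: "piece.L \<phi> v = v"
  shows "piece.I S \<phi> (%x. dderiv f v x) = (\<Sum>j\<in>J. (\<nu> j \<bullet> v) * piece.I (A j) (\<xi> j) f)"
proof -
  interpret S: piece S \<phi> by (rule S)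
  define \<iota> where "\<iota> x = adjoint S.B (x - \<phi> 0)" for x
  have \<phi>\<iota>: "\<phi> (\<iota> x) = x" if "x \<in> affine hull S" for x
  proof -
    obtain z where z: "x = \<phi> z" using \<open>x \<in> affine hull S\<close> S.rng by (metis imageE)
    then have "x - \<phi> 0 = S.B z" by (simp add: S.B_def)
    then show ?thesis by (simp add: \<iota>_def S.adjoint_B z)
  qed
  have injphi: "\<phi> x = \<phi> y \<longleftrightarrow> x = y" for x y using S.iso[of x y] by (metis dist_eq_0_iff)
  have clS: "closure S \<subseteq> affine hull S" by (metis affine_affine_hull closed_affine_hull closure_minimal hull_subset)
  have Asub: "affine hull A j \<subseteq> affine hull S" if "j \<in> J" for j
    by (rule hull_minimal) (use front that closure_subset[of "A j"] clS in auto)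
  have \<xi>in: "\<xi> j w \<in> affine hull A j" if "j \<in> J" for j w
    using piece.rng[OF A[OF that]] by (metis rangeI)
  have \<phi>\<xi>: "\<phi> (\<iota> (\<xi> j w)) = \<xi> j w" if "j \<in> J" for j w
    using \<phi>\<iota> \<xi>in[OF that] Asub[OF that] by blast
  have clo: "y \<in> closure Z \<longleftrightarrow> \<phi> y \<in> closure (\<phi> ` Z)" for y Z
    unfolding closure_approachable by (auto simp: S.iso)
  have SD: "\<phi> ` (\<phi> -` S) = S" by (rule S.image_D)
  have AD: "\<phi> ` (%w. \<iota> (\<xi> j w)) ` (\<xi> j -` A j) = A j" if "j \<in> J" for j
    using piece.image_D[OF A[OF that]] by (simp add: image_image \<phi>\<xi>[OF that])
  have BL: "S.B (adjoint S.B x) = x" if "S.L x = x" for x using that by (simp add: S.L_def)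
  have K: "open S.D" "bounded S.D" "convex S.D" "S.D \<noteq> {}"
    by (rule S.open_D S.bounded_D S.convex_D S.nonempty_D)+
  have inn: "adjoint S.B x \<bullet> (y - z) = x \<bullet> (\<phi> y - \<phi> z)" for x y z
  proof -
    have "S.B (y - z) = \<phi> y - \<phi> z" unfolding linear_diff[OF S.linear_B] by (simp add: S.B_def)
    then show ?thesis using adjoint_works[OF S.linear_B, of "y - z" x] by (simp add: inner_commute)
  qed
  interpret Q: faceted_domain S.D J "%j w. \<iota> (\<xi> j w)" "%j. \<xi> j -` A j" "%j. adjoint S.B (\<nu> j)" \<A>
  proof
    show "open S.D" "bounded S.D" "convex S.D" "S.D \<noteq> {}" "finite J" "finite \<A>" by fact+
    fix i assume i: "i \<in> J"
    show "dist (\<iota> (\<xi> i x)) (\<iota> (\<xi> i y)) = dist x y" for x y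
      using S.iso[of "\<iota> (\<xi> i x)" "\<iota> (\<xi> i y)"] piece.iso[OF A[OF i], of x y] by (simp add: \<phi>\<xi>[OF i])
    show "norm (adjoint S.B (\<nu> i)) = 1"
      using S.B_inner[of "adjoint S.B (\<nu> i)" "adjoint S.B (\<nu> i)"] BL[OF \<nu>(2)[OF i]] \<nu>(1)[OF i]
      by (simp add: norm_eq_1)
    show "adjoint S.B (\<nu> i) \<bullet> (\<iota> (\<xi> i x) - \<iota> (\<xi> i y)) = 0" for x y
      unfolding inn \<phi>\<xi>[OF i] by (rule perp[OF i \<xi>in[OF i] \<xi>in[OF i]])
    show "open (\<xi> i -` A i)" "bounded (\<xi> i -` A i)"
      using piece.open_D[OF A[OF i]] piece.bounded_D[OF A[OF i]] .
    show "adjoint S.B (\<nu> i) \<bullet> (z - \<iota> (\<xi> i x)) < 0" if "z \<in> S.D" for z x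
      unfolding inn \<phi>\<xi>[OF i] by (rule out[OF i \<xi>in[OF i]]) (use that in simp)
    show "closure ((%w. \<iota> (\<xi> i w)) ` (\<xi> i -` A i)) - (%w. \<iota> (\<xi> i w)) ` (\<xi> i -` A i) \<subseteq> \<Union> \<A>"
    proof
      fix y assume y: "y \<in> closure ((%w. \<iota> (\<xi> i w)) ` (\<xi> i -` A i)) - (%w. \<iota> (\<xi> i w)) ` (\<xi> i -` A i)"
      then have "\<phi> y \<in> closure (A i)" using clo AD[OF i] by auto
      moreover have "\<phi> y \<notin> A i"
      proof
        assume "\<phi> y \<in> A i"
        then have "\<phi> y \<in> \<phi> ` (%w. \<iota> (\<xi> i w)) ` (\<xi> i -` A i)" by (simp only: AD[OF i])
        then show False using y injphi by auto
      qed
      ultimately have "\<phi> y \<in> \<phi> ` \<Union>\<A>" using thin[OF i] by blast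
      then show "y \<in> \<Union>\<A>" using injphi by auto
    qed
  next
    show "frontier S.D = (\<Union>i\<in>J. closure ((%w. \<iota> (\<xi> i w)) ` (\<xi> i -` A i)))"
    proof (rule set_eqI)
      fix y
      have "y \<in> frontier S.D \<longleftrightarrow> \<phi> y \<in> closure S - S"
        using K(1) clo[of y S.D] SD by (simp add: frontier_def interior_open)
      also have "... \<longleftrightarrow> (\<exists>i\<in>J. \<phi> y \<in> closure (A i))" unfolding front by blast
      also have "... \<longleftrightarrow> y \<in> (\<Union>i\<in>J. closure ((%w. \<iota> (\<xi> i w)) ` (\<xi> i -` A i)))"
        using clo[of y] AD by auto
      finally show "y \<in> frontier S.D \<longleftrightarrow> y \<in> (\<Union>i\<in>J. closure ((%w. \<iota> (\<xi> i w)) ` (\<xi> i -` A i)))" .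
    qed
  next
    fix i j assume ij: "i \<in> J" "j \<in> J" "i \<noteq> j"
    show "(%w. \<iota> (\<xi> i w)) ` (\<xi> i -` A i) \<inter> (%w. \<iota> (\<xi> j w)) ` (\<xi> j -` A j) = {}"
    proof (rule ccontr)
      assume "\<not> ?thesis"
      then obtain y where y: "y \<in> (%w. \<iota> (\<xi> i w)) ` (\<xi> i -` A i)" "y \<in> (%w. \<iota> (\<xi> j w)) ` (\<xi> j -` A j)" by blast
      have "\<phi> y \<in> A i" using imageI[OF y(1), of \<phi>] AD[OF ij(1)] by simp
      moreover have "\<phi> y \<in> A j" using imageI[OF y(2), of \<phi>] AD[OF ij(2)] by simp
      ultimately show False using disj[OF ij] by blast
    qed
  qed (use \<A> dims in auto)
  have unit: "piece.I S \<phi> (%x. dderiv f v x) = (\<Sum>j\<in>J. (\<nu> j \<bullet> v) * piece.I (A j) (\<xi> j) f)"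
    if v: "piece.L \<phi> v = v" and n: "norm v = 1" for v
  proof -
    let ?v = "adjoint S.B v"
    have nv: "norm ?v = 1" using S.B_inner[of ?v ?v] BL[OF v] n by (simp add: norm_eq_1)
    have \<phi>v: "\<phi> (x + t *R ?v) = \<phi> x + t *R v" for x t
      using linear_add[OF S.linear_B, of x "t *R ?v"] BL[OF v]
      by (simp add: S.B_def[of x] S.B_def[of "x + _"] linear_cmul[OF S.linear_B])
    have cf: "cont f" "cont (%x. dderiv f v x)"
      using poly3_continuous[OF f] poly3_continuous[OF poly3_dderiv[OF f]] .
    have "integral S.D (%y. dderiv f v (\<phi> y)) =
      (\<Sum>j\<in>J. adjoint S.B (\<nu> j) \<bullet> ?v * integral (\<xi> j -` A j) (%w. f (\<phi> (\<iota> (\<xi> j w)))))"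
    proof (rule Q.divergence[OF nv])
      show "cont (%y. f (\<phi> y))" "cont (%y. dderiv f v (\<phi> y))"
        using continuous_on_compose2[OF cf(1) S.continuous_\<phi>] continuous_on_compose2[OF cf(2) S.continuous_\<phi>] by auto
      fix x t
      have "(f has_derivative frechet_derivative f (at (\<phi> x + t *R v))) (at (\<phi> x + t *R v))"
        by (rule poly3_has_dderiv[OF f])
      then have "((%t. f (\<phi> x + t *R v)) has_derivative (%s. dderiv f (s *R v) (\<phi> x + t *R v))) (at t)"
        by (rule has_derivative_compose[rotated]) (auto intro!: derivative_eq_intros)
      then show "((%t. f (\<phi> (x + t *R ?v))) has_real_derivative dderiv f v (\<phi> (x + t *R ?v))) (at t)"
        unfolding \<phi>v has_field_derivative_def
        by (simp add: linear_cmul[OF poly3_linear_dderiv[OF f]] mult_commute_abs)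
    qed
    also have "... = (\<Sum>j\<in>J. (\<nu> j \<bullet> v) * piece.I (A j) (\<xi> j) f)"
    proof (rule sum.cong[OF refl])
      fix j assume j: "j \<in> J"
      have "adjoint S.B (\<nu> j) \<bullet> ?v = S.B (adjoint S.B (\<nu> j)) \<bullet> S.B ?v" by (simp add: S.B_inner)
      also have "... = \<nu> j \<bullet> v" by (simp add: BL \<nu>(2)[OF j] v)
      finally show "adjoint S.B (\<nu> j) \<bullet> ?v * integral (\<xi> j -` A j) (%w. f (\<phi> (\<iota> (\<xi> j w)))) =
          (\<nu> j \<bullet> v) * piece.I (A j) (\<xi> j) f"
        by (simp add: piece.I_def[OF A[OF j]] \<phi>\<xi>[OF j])
    qed
    finally show ?thesis by (simp add: S.I_def)
  qed
  show ?thesis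
  proof (cases "v = 0")
    case True
    then show ?thesis using linear_0[OF poly3_linear_dderiv[OF f]] S.I_0 by simp
  next
    case False
    define u where "u = (1 / norm v) *R v"
    have vu: "v = norm v *R u" and nu: "norm u = 1" using False by (simp_all add: u_def)
    have "piece.L \<phi> u = u" unfolding u_def using v by (simp add: linear_cmul[OF S.linear_L])
    from unit[OF this nu] have "norm v * piece.I S \<phi> (%x. dderiv f u x) = norm v * (\<Sum>j\<in>J. (\<nu> j \<bullet> u) * piece.I (A j) (\<xi> j) f)"
      by simp
    then show ?thesis
      unfolding S.I_cmult[symmetric] by (subst (1 2) vu) (simp add: linear_cmul[OF poly3_linear_dderiv[OF f]] sum_distrib_left mult.assoc)
  qed
qed

subsection \<open>Charts of flat pieces\<close>

lemma isometric_chart_exists: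
  fixes X :: "point set"
  assumes "X \<noteq> {}" "aff_dim X = int DIM('a::euclidean_space)"
  shows "\<exists>\<phi> :: 'a => point. (\<forall>x y. dist (\<phi> x) (\<phi> y) = dist x y) \<and> range \<phi> = affine hull X"
proof -
  obtain a where a: "a \<in> affine hull X" using assms(1) by (metis ex_in_conv hull_inc)
  define S where "S = (%x. - a + x) ` (affine hull X)"
  have sub: "subspace S" unfolding S_def
    by (rule affine_diffs_subspace[OF affine_affine_hull a])
  have "aff_dim X = aff_dim S" unfolding S_def by (simp only: aff_dim_translation_eq aff_dim_affine_hull)
  then have dimS: "dim (UNIV :: 'a set) = dim S" using assms(2) aff_dim_subspace[OF sub] by simp
  obtain f :: "'a => point" and g where f: "linear f" "f ` UNIV = S" "!!x. x \<in> UNIV ==> norm (f x) = norm x"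
    using isometries_subspaces[OF subspace_UNIV sub dimS] by metis
  show ?thesis
  proof (intro exI[of _ "%x. a + f x"] conjI allI)
    show "dist (a + f x) (a + f y) = dist x y" for x y
      using f(3)[of "x - y"] by (simp add: dist_norm linear_diff[OF f(1)])
    have "range (%x. a + f x) = (%x. a + x) ` S" using f(2) by auto
    also have "... = affine hull X" unfolding S_def by (simp add: image_image)
    finally show "range (%x. a + f x) = affine hull X" .
  qed
qed

lemma isometric_chart:
  fixes X :: "point set"
  assumes "X \<noteq> {}" "aff_dim X = int DIM('a::euclidean_space)"
  shows "dist (isometric_chart X x) (isometric_chart X y) = dist x (y :: 'a)"
    and "range (isometric_chart X :: 'a => point) = affine hull X"
  using someI_ex[OF isometric_chart_exists[OF assms]] unfolding isometric_chart_def by blast+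

subsection \<open>Orthonormal frames\<close>

text \<open>The residual \<open>y\<close> is orthogonal to all three vectors. Lagrange's identity
  makes its cross product with \<open>cross3 n t\<close> zero, and for orthogonal vectors the norm
  of the cross product is the product of the norms.\<close>

lemma cross_frame:
  fixes n t x :: point
  assumes "norm n = 1" "norm t = 1" "n \<bullet> t = 0"
  shows "x = (x \<bullet> t) *R t + (x \<bullet> cross3 n t) *R cross3 n t + (x \<bullet> n) *R n"
    and "norm (cross3 n t) = 1"
proof -
  let ?w = "cross3 n t"
  have "(norm ?w)\<^sup>2 = 1" using norm_cross[of n t] assms by simp
  then show w: "norm ?w = 1" using norm_ge_zero[of ?w] by (simp add: power2_eq_1_iff)
  have o: "?w \<bullet> t = 0" "t \<bullet> ?w = 0" "?w \<bullet> n = 0" "n \<bullet> ?w = 0" "t \<bullet> n = 0"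
    using assms(3) by (simp_all add: dot_cross_self inner_commute)
  have nn: "n \<bullet> n = 1" "t \<bullet> t = 1" "?w \<bullet> ?w = 1" using assms w by (simp_all add: norm_eq_1)
  define y where "y = x - ((x \<bullet> t) *R t + (x \<bullet> ?w) *R ?w + (x \<bullet> n) *R n)"
  have y: "y \<bullet> t = 0" "y \<bullet> n = 0" "y \<bullet> ?w = 0"
    unfolding y_def using nn o assms(3) by (simp_all add: inner_diff_left inner_add_left)
  have "cross3 y ?w = 0" using Lagrange[of y n t] y by simp
  then have "(norm y)\<^sup>2 = 0" using norm_cross[of y ?w] y w by simp
  then have "y = 0" by simp
  then show "x = (x \<bullet> t) *R t + (x \<bullet> ?w) *R ?w + (x \<bullet> n) *R n" by (simp add: y_def)
qed

lemma unit_orthogonal_exists: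
  fixes n :: point
  shows "\<exists>t. norm t = 1 \<and> n \<bullet> t = 0"
proof -
  obtain y where y: "y \<noteq> 0" "orthogonal n y" using orthogonal_to_vector_exists[of n] by auto
  then show ?thesis by (intro exI[of _ "(1 / norm y) *R y"]) (simp add: orthogonal_def)
qed

lemma divg_frame:
  assumes r: "r differentiable at x" and n: "norm n = 1" "norm t = 1" "n \<bullet> t = 0"
  shows "divg r x = dderiv r t x \<bullet> t + dderiv r (cross3 n t) x \<bullet> cross3 n t + dderiv r n x \<bullet> n"
proof -
  note l = linear_dderiv[OF r]
  let ?w = "cross3 n t"
  have e: "dderiv r (axis i 1) x $ i =
      t $ i * dderiv r t x $ i + ?w $ i * dderiv r ?w x $ i + n $ i * dderiv r n x $ i" for i
  proof -
    have "axis i 1 = (t $ i) *R t + (?w $ i) *R ?w + (n $ i) *R n"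
      using cross_frame(1)[OF n, of "axis i 1"] by (simp add: inner_axis')
    then have "dderiv r (axis i 1) x = (t $ i) *R dderiv r t x + (?w $ i) *R dderiv r ?w x + (n $ i) *R dderiv r n x"
      by (simp only: linear_add[OF l] linear_cmul[OF l])
    then show ?thesis by simp
  qed
  show ?thesis unfolding divg_def e by (simp add: inner_vec_def sum.distrib mult.commute)
qed

subsection \<open>Outward normals\<close>

text \<open>The sign is a \<open>THE\<close>, so one choice has to point out of \<open>S\<close> and
  the other must not. The assumption \<open>dir\<close> makes the hull of \<open>A\<close> the full
  section of the hull of \<open>S\<close> by a hyperplane orthogonal to \<open>n\<close>. Because
  \<open>A\<close> lies in the closure of \<open>S\<close> but outside \<open>S\<close>, that
  hyperplane misses \<open>S\<close>, and convexity keeps \<open>S\<close> on one side of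
  it.\<close>

lemma outward_sign_unique:
  fixes S A :: "point set"
  assumes S: "rel_open S" "convex S" "S \<noteq> {}" and A: "rel_open A" "A \<noteq> {}" "A \<subseteq> closure S" "A \<inter> S = {}"
    and n: "norm n = 1" and nS: "\<exists>p\<in>affine hull S. \<exists>q\<in>affine hull S. n = p - q"
    and nA: "!!x y. x \<in> A ==> y \<in> A ==> n \<bullet> (x - y) = 0"
    and dir: "!!x p q. x \<in> A ==> p \<in> affine hull S ==> q \<in> affine hull S ==> n \<bullet> (p - q) = 0 ==> x + (p - q) \<in> affine hull A"
  shows "outward_sign n S A \<in> {-1, 1}"
    and "x \<in> affine hull A ==> y \<in> S ==> (outward_sign n S A *R n) \<bullet> (y - x) < 0"
proof -
  obtain x0 where x0: "x0 \<in> A" using A by blast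
  have nn: "n \<bullet> n = 1" using n by (simp add: norm_eq_1)
  have affA: "n \<bullet> x = n \<bullet> x0" if "x \<in> affine hull A" for x
  proof -
    have "n \<bullet> x = n \<bullet> x0" if "x \<in> A" for x using nA[OF that x0] by (simp add: inner_diff_right)
    then have "affine hull A \<subseteq> {x. n \<bullet> x = n \<bullet> x0}"
      by (intro hull_minimal subsetI CollectI) (auto intro: affine_hyperplane)
    then show ?thesis using that by auto
  qed
  have clS: "closure S \<subseteq> affine hull S" by (metis affine_affine_hull closed_affine_hull closure_minimal hull_subset)
  have Sin: "y \<in> affine hull S" if "y \<in> S" for y using that by (rule hull_inc)
  have Ain: "y \<in> affine hull S" if "y \<in> A" for y using that A(3) clS by blast
  note near = rel_open_segment[OF A(1)]
  \<comment> \<open>A point \<open>y\<close> of \<open>S\<close> on the hyperplane would lie in the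
    hull of \<open>A\<close>. The segment from \<open>y\<close> to \<open>x0\<close> then extends
    beyond \<open>x0\<close> to a point \<open>z\<close> of \<open>A\<close>, which is in the
    closure of \<open>S\<close>, and \<open>x0\<close> would be relatively interior to
    \<open>S\<close>.\<close>
  have nz: "n \<bullet> (y - x0) \<noteq> 0" if y: "y \<in> S" for y
  proof
    assume 0: "n \<bullet> (y - x0) = 0"
    have "y \<in> affine hull A" using dir[OF x0 Sin[OF y] Ain[OF x0] 0] by simp
    then obtain e where e: "e > 0" "\<forall>t. \<bar>t\<bar> < e \<longrightarrow> x0 + t *R (y - x0) \<in> A" using near[OF x0] by blast
    define z where "z = x0 + (- (e / 2)) *R (y - x0)"
    have "\<bar>- (e / 2)\<bar> < e" using e(1) by simp
    then have "z \<in> A" unfolding z_def using e(2) by blast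
    then have zc: "z \<in> closure S" using A(3) by blast
    have yr: "y \<in> rel_interior S" using y S(1) by (simp add: rel_open_def)
    have "z - (e / 2 / (1 + e / 2)) *R (z - y) \<in> rel_interior S"
      by (rule rel_interior_closure_convex_shrink[OF S(2) yr zc]) (use e(1) in "auto simp: field_simps")
    moreover have "z - (e / 2 / (1 + e / 2)) *R (z - y) = x0"
    proof -
      have "z - y = - (1 + e / 2) *R (y - x0)" unfolding z_def by (simp add: algebra_simps)
      moreover have "e / 2 / (1 + e / 2) * - (1 + e / 2) = - (e / 2)" using e(1) by (simp add: divide_simps)
      ultimately have "(e / 2 / (1 + e / 2)) *R (z - y) = (- (e / 2)) *R (y - x0)"
        by (simp only: scaleR_scaleR)
      then show ?thesis by (simp add: z_def)
    qed
    ultimately have "x0 \<in> S" using rel_interior_subset by blast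
    then show False using x0 A(4) by blast
  qed
  obtain y0 where y0: "y0 \<in> S" using S by blast
  define w :: real where "w = (if n \<bullet> (y0 - x0) < 0 then 1 else - 1)"
  have w: "w \<in> {-1, 1}" by (simp add: w_def)
  have neg: "(w *R n) \<bullet> (y - x0) < 0" if y: "y \<in> S" for y
  proof (rule ccontr)
    assume "\<not> ?thesis"
    then have pos: "(w *R n) \<bullet> (y - x0) > 0" using nz[OF y] w by auto
    have neg0: "(w *R n) \<bullet> (y0 - x0) < 0" using nz[OF y0] by (auto simp: w_def)
    define p where "p = (w *R n) \<bullet> (y - x0)"
    define q where "q = (w *R n) \<bullet> (y0 - x0)"
    \<comment> \<open>The weight at which the segment from \<open>y\<close> to \<open>y0\<close>
      crosses the hyperplane; the crossing point would contradict \<open>nz\<close>.\<close>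
    define s where "s = p / (p - q)"
    have pq: "p > 0" "q < 0" using pos neg0 by (auto simp: p_def q_def)
    have s: "0 \<le> s" "s \<le> 1" using pq by (auto simp: s_def divide_simps)
    define z where "z = (1 - s) *R y + s *R y0"
    have zS: "z \<in> S" unfolding z_def by (rule convexD[OF S(2) y y0]) (use s in auto)
    have "(w *R n) \<bullet> (z - x0) = (1 - s) * p + s * q"
      unfolding z_def p_def q_def by (simp add: inner_diff_right inner_add_right algebra_simps)
    also have "... = 0" using pq by (simp add: s_def field_simps)
    finally show False using nz[OF zS] w by auto
  qed
  have sep: "(w *R n) \<bullet> (y - x) < 0" if "x \<in> affine hull A" "y \<in> S" for x y
    using neg[OF that(2)] affA[OF that(1)] by (simp add: inner_diff_right)
  have "points_out_of (w *R n) S A"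
    unfolding points_out_of_def
  proof
    fix x assume x: "x \<in> A"
    have "S \<subseteq> {y. (w *R n) \<bullet> y \<le> (w *R n) \<bullet> x}"
    proof
      fix y assume "y \<in> S"
      then show "y \<in> {y. (w *R n) \<bullet> y \<le> (w *R n) \<bullet> x}"
        using sep[OF hull_inc[OF x] \<open>y \<in> S\<close>] by (auto simp only: inner_diff_right mem_Collect_eq diff_less_0_iff_less less_imp_le)
    qed
    then have cl: "closure S \<subseteq> {y. (w *R n) \<bullet> y \<le> (w *R n) \<bullet> x}"
      by (rule closure_minimal) (rule closed_halfspace_le)
    have outside: "x + s *R w *R n \<notin> closure S" if "s > 0" for s
    proof
      assume "x + s *R w *R n \<in> closure S"
      then have "(w *R n) \<bullet> (x + s *R w *R n) \<le> (w *R n) \<bullet> x" using cl by blast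
      moreover have "(w *R n) \<bullet> (s *R w *R n) = s" using w nn by auto
      ultimately show False using \<open>s > 0\<close> by (simp only: inner_add_right)
    qed
    show "\<forall>\<^sub>F s in at_right 0. x + s *R w *R n \<notin> closure S"
      using eventually_at_right_less[of "0::real"] by (rule eventually_mono) (rule outside)
  qed
  moreover have "\<not> points_out_of ((- w) *R n) S A"
  proof
    assume "points_out_of ((- w) *R n) S A"
    then have ev: "\<forall>\<^sub>F s in at_right 0. x0 + s *R (- w) *R n \<notin> closure S" using x0 by (auto simp: points_out_of_def)
    \<comment> \<open>The point \<open>x0\<close> moved by \<open>s\<close> against
      \<open>w *R n\<close> is a convex combination of \<open>y0\<close>, with weight
      \<open>\<mu> = s / \<beta>\<close>, and a point of \<open>A\<close>: as
      \<open>c = y0 - x0 + (\<beta> * w) *R n\<close> is parallel to \<open>A\<close>, the latter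
      must be \<open>x0\<close> shifted by \<open>- \<mu> / (1 - \<mu>)\<close> times
      \<open>c\<close>, which stays in \<open>A\<close> for small \<open>s\<close>.\<close>
    define \<beta> where "\<beta> = - ((w *R n) \<bullet> (y0 - x0))"
    have \<beta>: "\<beta> > 0" using neg[OF y0] by (simp add: \<beta>_def)
    define c where "c = y0 - x0 + (\<beta> * w) *R n"
    have ww: "w * w = 1" using w by auto
    have "n \<bullet> c = n \<bullet> (y0 - x0) + \<beta> * w" unfolding c_def by (simp add: inner_add_right nn)
    also have "\<beta> * w = - (w * w) * (n \<bullet> (y0 - x0))" unfolding \<beta>_def by simp
    finally have nc: "n \<bullet> c = 0" using ww by simp
    obtain p q where pq: "p \<in> affine hull S" "q \<in> affine hull S" "n = p - q" using nS by blast
    define p' where "p' = y0 + (\<beta> * w) *R (p - q)"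
    have p': "p' \<in> affine hull S" unfolding p'_def
      using mem_affine_3_minus[OF affine_affine_hull Sin[OF y0] pq(1,2)] .
    have cpq: "c = p' - x0" by (simp add: c_def p'_def pq(3))
    have "x0 + c \<in> affine hull A" using dir[OF x0 p' Ain[OF x0]] nc cpq by simp
    then obtain e where e: "e > 0" "!!t. \<bar>t\<bar> < e ==> x0 + t *R c \<in> A" using near[OF x0, of "x0 + c"] by auto
    have in_cl: "x0 + s *R (- w) *R n \<in> closure S" if s: "0 < s" "s < \<beta> / 2" "s < \<beta> * e / 2" for s
    proof -
      define \<mu> where "\<mu> = s / \<beta>"
      have \<mu>: "0 < \<mu>" "\<mu> < 1 / 2" "\<mu> < e / 2" using s \<beta> by (auto simp: \<mu>_def field_simps)
      have "\<mu> / (1 - \<mu>) < e"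
      proof -
        have "\<mu> < e * (1 - \<mu>)"
        proof -
          have "e * (1 / 2) \<le> e * (1 - \<mu>)" using e(1) \<mu> by (intro mult_left_mono) auto
          then show ?thesis using \<mu> by linarith
        qed
        then show ?thesis using \<mu> by (simp add: pos_divide_less_eq)
      qed
      then have "x0 + (- (\<mu> / (1 - \<mu>))) *R c \<in> A" using \<mu> by (intro e(2)) auto
      then have zc: "x0 + (- (\<mu> / (1 - \<mu>))) *R c \<in> closure S" using A(3) by blast
      have "(1 - \<mu>) *R (x0 + (- (\<mu> / (1 - \<mu>))) *R c) + \<mu> *R y0 \<in> closure S"
        by (rule convexD[OF convex_closure[OF S(2)] zc closure_subset[THEN subsetD, OF y0]]) (use \<mu> in auto)
      also have "(1 - \<mu>) *R (x0 + (- (\<mu> / (1 - \<mu>))) *R c) = (1 - \<mu>) *R x0 - \<mu> *R c"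
        using \<mu> by (simp add: scaleR_right_diff_distrib)
      also have "(1 - \<mu>) *R x0 - \<mu> *R c + \<mu> *R y0 = x0 - (\<mu> * (\<beta> * w)) *R n"
        unfolding c_def by (simp add: algebra_simps)
      also have "\<mu> * (\<beta> * w) = s * w" using \<beta> by (simp add: \<mu>_def)
      finally show ?thesis by simp
    qed
    define s0 where "s0 = min (\<beta> / 2) (\<beta> * e / 2)"
    have "s0 > 0" using \<beta> e(1) by (simp add: s0_def)
    then have "\<forall>\<^sub>F s in at_right 0. s \<in> {0<..<s0}" by (rule eventually_at_right_real)
    with ev have "\<forall>\<^sub>F s in at_right (0::real). False"
      by eventually_elim (use in_cl in "auto simp: s0_def")
    then show False by simp
  qed
  ultimately have "outward_sign n S A = w"
    unfolding outward_sign_def using w by (intro the_equality) auto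
  then show "outward_sign n S A \<in> {-1, 1}"
    and "x \<in> affine hull A ==> y \<in> S ==> (outward_sign n S A *R n) \<bullet> (y - x) < 0"
    using w sep by auto
qed

section \<open>Meshes\<close>

abbreviation face_chart :: "point set => real^2 => point" where "face_chart \<equiv> isometric_chart"

abbreviation edge_chart :: "point set => real => point" where "edge_chart \<equiv> isometric_chart"

abbreviation intT :: "point set => scalar_field => real" where "intT \<equiv> cell_integral"

abbreviation intF :: "point set => scalar_field => real" where "intF \<equiv> face_integral"

abbreviation intE :: "point set => scalar_field => real" where "intE \<equiv> edge_integral"

lemma open_segment_facts:
  fixes a b :: point
  assumes "a \<noteq> b"
  shows "rel_open (open_segment a b)" "aff_dim (open_segment a b) = 1"
    "closure (open_segment a b) = closed_segment a b" "open_segment a b \<noteq> {}"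
    "rel_frontier (open_segment a b) = {a, b}" "affine hull (open_segment a b) = affine hull {a, b}"
proof -
  show ro: "rel_open (open_segment a b)"
    using assms by (simp add: rel_open_def rel_interior_open_segment)
  show c: "closure (open_segment a b) = closed_segment a b" using assms by simp
  show "affine hull (open_segment a b) = affine hull {a, b}" using assms by simp
  then show "aff_dim (open_segment a b) = 1"
    using aff_dim_affine_hull[of "open_segment a b"] aff_dim_affine_hull[of "{a, b}"] assms by simp
  show "open_segment a b \<noteq> {}" using assms by simp
  have "closed_segment a b - open_segment a b = {a, b}" by (auto simp: open_segment_def)
  then show "rel_frontier (open_segment a b) = {a, b}"
    using ro c by (simp add: rel_frontier_def rel_open_def)
qed

locale hho_mesh =
  fixes \<Omega> :: "point set" and M :: mesh and \<rho> :: real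
  assumes domain: "polyhedral_domain \<Omega>" and mesh: "polyhedral_mesh \<Omega> M"
    and ori: "oriented M" and adm: "admissible_points \<rho> M"
begin

abbreviation "nF \<equiv> normal M"
abbreviation "tE \<equiv> tangent M"
abbreviation "nFE \<equiv> edge_normal M"
abbreviation "wTF \<equiv> omegaTF M"
abbreviation "wFE \<equiv> omegaFE M"
abbreviation "facesT \<equiv> cell_faces M"
abbreviation "edgesF \<equiv> face_edges M"
abbreviation "vertsE \<equiv> edge_verts M"

section \<open>Elementary geometry of cells, faces and edges\<close>

lemma finites: "finite (cells M)" "finite (faces M)" "finite (edges M)" "finite (verts M)"
  using mesh by (auto simp: polyhedral_mesh_def)

lemma finite_cell_faces: "finite (facesT T)" and finite_face_edges: "finite (edgesF F)"
  using finites by (auto simp: cell_faces_def face_edges_def)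

lemma cellD:
  assumes "T \<in> cells M"
  shows "T \<noteq> {}" "open T" "convex T" "bounded T" "affine hull T = UNIV"
proof -
  show T: "T \<noteq> {}" "open T" "convex T" using assms mesh by (auto simp: polyhedral_mesh_def)
  show "bounded T" using assms mesh polytope_imp_bounded closure_subset bounded_subset
    unfolding polyhedral_mesh_def by metis
  show "affine hull T = UNIV" by (rule affine_hull_open[OF T(2,1)])
qed

lemma faceD:
  assumes "F \<in> faces M"
  shows "F \<noteq> {}" "rel_open F" "convex F" "bounded F" "aff_dim F = 2"
proof -
  show F: "rel_open F" "convex F" "aff_dim F = 2" using assms mesh by (auto simp: polyhedral_mesh_def)
  show "F \<noteq> {}" using F by auto
  show "bounded F" using assms mesh polytope_imp_bounded closure_subset bounded_subset
    unfolding polyhedral_mesh_def by metis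
qed

lemma edge_ends:
  assumes "E \<in> edges M"
  obtains a b where "a \<in> verts M" "b \<in> verts M" "a \<noteq> b" "E = open_segment a b"
proof -
  have "\<forall>E\<in>edges M. \<exists>a\<in>verts M. \<exists>b\<in>verts M. a \<noteq> b \<and> E = open_segment a b"
    using mesh by (simp add: polyhedral_mesh_def)
  then show ?thesis using assms that by blast
qed

lemma edgeD:
  assumes "E \<in> edges M"
  shows "E \<noteq> {}" "rel_open E" "convex E" "bounded E" "aff_dim E = 1"
proof -
  obtain a b where E: "a \<noteq> b" "E = open_segment a b" using edge_ends[OF assms] by metis
  show "E \<noteq> {}" "rel_open E" "aff_dim E = 1" using open_segment_facts[OF E(1)] E(2) by simp_all
  show "convex E" "bounded E" unfolding E(2) by (simp_all add: convex_open_segment bounded_open_segment)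
qed

lemma disjoint_pieces:
  assumes "A \<in> cells M \<union> faces M \<union> edges M \<union> (%V. {V}) ` verts M"
    "B \<in> cells M \<union> faces M \<union> edges M \<union> (%V. {V}) ` verts M" "A \<noteq> B"
  shows "A \<inter> B = {}"
proof -
  have "pairwise disjnt (cells M \<union> faces M \<union> edges M \<union> (%V. {V}) ` verts M)"
    using mesh by (simp add: polyhedral_mesh_def)
  from pairwiseD[OF this assms] show ?thesis by (simp add: disjnt_def)
qed

lemma cell_dim: "T \<in> cells M ==> aff_dim T = 3"
  using cellD[of T] aff_dim_affine_hull[of T] by simp

lemma face_edge_disjoint: "F \<in> faces M ==> E \<in> edges M ==> F \<inter> E = {}"
  by (rule disjoint_pieces) (use faceD(5)[of F] edgeD(5)[of E] in auto)

lemma cell_face_disjoint: "T \<in> cells M ==> F \<in> faces M ==> T \<inter> F = {}"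
  by (rule disjoint_pieces) (use faceD(5)[of F] cell_dim[of T] in auto)

lemma edge_vert_disjoint: "E \<in> edges M ==> V \<in> verts M ==> V \<notin> E"
proof
  assume E: "E \<in> edges M" "V \<in> verts M" "V \<in> E"
  have "E \<noteq> {V}" using edgeD(5)[OF E(1)] by (metis aff_dim_sing zero_neq_one)
  then have "E \<inter> {V} = {}" by (intro disjoint_pieces) (use E in auto)
  then show False using E(3) by blast
qed

lemma face_vert_disjoint: "F \<in> faces M ==> V \<in> verts M ==> V \<notin> F"
proof
  assume F: "F \<in> faces M" "V \<in> verts M" "V \<in> F"
  have "F \<noteq> {V}" using faceD(5)[OF F(1)] by (metis aff_dim_sing zero_neq_numeral)
  then have "F \<inter> {V} = {}" by (intro disjoint_pieces) (use F in auto)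
  then show False using F(3) by blast
qed

lemma edge_verts_eq: "E \<in> edges M ==> E = open_segment a b ==> a \<noteq> b ==> vertsE E = {a, b}"
proof -
  assume E: "E \<in> edges M" "E = open_segment a b" "a \<noteq> b"
  obtain c d where cd: "c \<in> verts M" "d \<in> verts M" "c \<noteq> d" "E = open_segment c d"
    by (rule edge_ends[OF E(1)])
  have "{a, b} = {c, d}" using open_segment_facts(5)[OF E(3)] open_segment_facts(5)[OF cd(3)] E cd by simp
  then have "a \<in> verts M" "b \<in> verts M" using cd by auto
  then show ?thesis unfolding edge_verts_def E(2) open_segment_facts(5)[OF E(3)] by auto
qed

lemma edge_verts_rel_frontier: "E \<in> edges M ==> vertsE E = rel_frontier E"
  using edge_ends[of E] edge_verts_eq[of E] open_segment_facts(5) by metis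

lemma piece_cell: "T \<in> cells M ==> piece T (%x. x)"
  using cellD[of T] by unfold_locales (auto simp: rel_open_def rel_interior_open)

lemma piece_face: "F \<in> faces M ==> piece F (face_chart F)"
  using faceD[of F] isometric_chart[of F, where 'a = "real^2"] by unfold_locales auto

lemma piece_edge: "E \<in> edges M ==> piece E (edge_chart E)"
  using edgeD[of E] isometric_chart[of E, where 'a = real] by unfold_locales auto

lemma cell_I: "T \<in> cells M ==> piece.I T (%x. x) = intT T"
  by (rule ext) (simp add: piece.I_def[OF piece_cell] cell_integral_def)

lemma face_I: "F \<in> faces M ==> piece.I F (face_chart F) = intF F"
  by (rule ext) (simp add: piece.I_def[OF piece_face] face_integral_def)

lemma edge_I: "E \<in> edges M ==> piece.I E (edge_chart E) = intE E"
  by (rule ext) (simp add: piece.I_def[OF piece_edge] edge_integral_def)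

lemma cell_facesD: "F \<in> facesT T ==> F \<in> faces M" "F \<in> facesT T ==> F \<subseteq> frontier T"
  by (auto simp: cell_faces_def)

lemma face_edgesD: "E \<in> edgesF F ==> E \<in> edges M" "E \<in> edgesF F ==> E \<subseteq> rel_frontier F"
  by (auto simp: face_edges_def)

lemma rel_frontier_face: "F \<in> faces M ==> rel_frontier F = closure F - F"
  using faceD(2) by (simp add: rel_frontier_def rel_open_def)

lemma face_boundary: "F \<in> faces M ==> closure F - F = (\<Union>E\<in>edgesF F. closure E)"
  using mesh rel_frontier_face unfolding polyhedral_mesh_def by metis

lemma cell_boundary: "T \<in> cells M ==> closure T - T = (\<Union>F\<in>facesT T. closure F)"
  using mesh cellD(2) unfolding polyhedral_mesh_def by (metis frontier_def interior_open)

lemma normal_unit: "F \<in> faces M ==> norm (nF F) = 1"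
  using ori by (auto simp: oriented_def)

lemma tangent_unit: "E \<in> edges M ==> norm (tE E) = 1"
  using ori by (auto simp: oriented_def)

lemma normal_perp: "F \<in> faces M ==> x \<in> F ==> y \<in> F ==> nF F \<bullet> (x - y) = 0"
  using ori by (auto simp: oriented_def)

section \<open>Affine hulls, normals and tangents\<close>

lemma face_hull: "F \<in> faces M ==> x0 \<in> F ==> affine hull F = {x. nF F \<bullet> (x - x0) = 0}"
proof -
  assume F: "F \<in> faces M" "x0 \<in> F"
  have n0: "nF F \<noteq> 0" using normal_unit[OF F(1)] by auto
  have H: "{x. nF F \<bullet> (x - x0) = 0} = {x. nF F \<bullet> x = nF F \<bullet> x0}"
    by (auto simp: inner_diff_right)
  have sub: "F \<subseteq> {x. nF F \<bullet> x = nF F \<bullet> x0}"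
    using normal_perp[OF F(1) _ F(2)] by (auto simp: inner_diff_right)
  have sub': "affine hull F \<subseteq> {x. nF F \<bullet> x = nF F \<bullet> x0}"
    by (rule hull_minimal[OF sub]) (rule affine_hyperplane)
  have "affine hull F = {x. nF F \<bullet> x = nF F \<bullet> x0}"
    by (rule affine_dim_equal[OF affine_affine_hull affine_hyperplane _ sub'])
      (use F faceD(5)[OF F(1)] in "auto simp: aff_dim_hyperplane[OF n0]")
  then show ?thesis using H by simp
qed

lemma normal_perp_hull: "F \<in> faces M ==> x \<in> affine hull F ==> y \<in> affine hull F ==> nF F \<bullet> (x - y) = 0"
proof -
  assume F: "F \<in> faces M" "x \<in> affine hull F" "y \<in> affine hull F"
  obtain x0 where x0: "x0 \<in> F" using faceD(1)[OF F(1)] by blast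
  show ?thesis using F(2,3) unfolding face_hull[OF F(1) x0] by (simp add: inner_diff_right)
qed

lemma face_L: "F \<in> faces M ==> nF F \<bullet> v = 0 ==> piece.L (face_chart F) v = v"
proof -
  assume F: "F \<in> faces M" "nF F \<bullet> v = 0"
  interpret F: piece F "face_chart F" by (rule piece_face[OF F(1)])
  obtain x0 where x0: "x0 \<in> F" using faceD(1)[OF F(1)] by blast
  have "x0 + v \<in> affine hull F" unfolding face_hull[OF F(1) x0] using F(2) by simp
  from F.L_tangent[OF this hull_inc[OF x0]] show ?thesis by simp
qed

lemma tangent_edge:
  assumes E: "E \<in> edges M" "E = open_segment a b" "a \<noteq> b"
  shows "\<exists>s\<in>{-1, 1}. b - a = (s * norm (b - a)) *R tE E"
proof -
  let ?t = "tE E"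
  have "\<forall>x\<in>E. \<forall>y\<in>E. cross3 ?t (x - y) = 0" using ori E(1) by (auto simp: oriented_def)
  \<comment> \<open>\<open>oriented\<close> speaks about points of the open edge only, so two inner
    points are compared in place of the end points.\<close>
  moreover have "(1 - 1 / 3) *R a + (1 / 3) *R b \<in> E" "(1 - 2 / 3) *R a + (2 / 3) *R b \<in> E"
    unfolding E(2) in_segment
     by (intro conjI exI[of _ "1 / 3 :: real"]; use E(3) in simp)
       (intro conjI exI[of _ "2 / 3 :: real"]; use E(3) in simp)
  ultimately have "cross3 ?t (((1 - 2 / 3) *R a + (2 / 3) *R b) - ((1 - 1 / 3) *R a + (1 / 3) *R b)) = 0" by blast
  moreover have "((1 - 2 / 3) *R a + (2 / 3) *R b) - ((1 - 1 / 3) *R a + (1 / 3) *R b) = (1 / 3) *R (b - a)"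
    by (simp add: vec_eq_iff field_simps)
  ultimately have c: "cross3 ?t (b - a) = 0" by (simp add: cross_mult_right)
  define d where "d = ?t \<bullet> (b - a)"
  have t1: "?t \<bullet> ?t = 1" using tangent_unit[OF E(1)] by (simp add: norm_eq_1)
  have "cross3 ?t (cross3 ?t (b - a)) = d *R ?t - (b - a)"
    unfolding Lagrange d_def t1 by simp
  then have ba: "b - a = d *R ?t" using c by simp
  then have "norm (b - a) = \<bar>d\<bar>" using tangent_unit[OF E(1)] by simp
  then show ?thesis using ba by (cases "d \<ge> 0") (auto intro!: bexI[of _ 1] bexI[of _ "-1"])
qed

lemma edge_hull:
  assumes E: "E \<in> edges M" and x0: "x0 \<in> affine hull E"
  shows "affine hull E = range (%s. x0 + s *R tE E)"
proof -
  obtain a b where ab: "a \<noteq> b" "E = open_segment a b" using edge_ends[OF E] by metis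
  obtain s where s: "s \<in> {-1, 1}" "b - a = (s * norm (b - a)) *R tE E"
    using tangent_edge[OF E ab(2,1)] by blast
  define c where "c = s * norm (b - a)"
  have c: "c \<noteq> 0" "b - a = c *R tE E" using s ab by (auto simp: c_def)
  have h: "affine hull E = {a + u *R (b - a) | u. True}"
    unfolding ab(2) open_segment_facts(6)[OF ab(1)] by (simp add: affine_hull_2_alt full_SetCompr_eq)
  then obtain u0 where u0: "x0 = a + u0 *R (b - a)" using x0 by blast
  have 1: "a + u *R (b - a) = x0 + ((u - u0) * c) *R tE E" for u
    unfolding u0 c(2) by (simp add: algebra_simps)
  have 2: "x0 + s *R tE E = a + (u0 + s / c) *R (b - a)" for s
    unfolding u0 c(2) using c(1) by (simp add: algebra_simps)
  show ?thesis unfolding h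
  proof (intro equalityI subsetI)
    fix x assume "x \<in> {a + u *R (b - a) | u. True}"
    then obtain u where "x = a + u *R (b - a)" by blast
    then show "x \<in> range (%s. x0 + s *R tE E)" unfolding 1 by (rule range_eqI)
  next
    fix x assume "x \<in> range (%s. x0 + s *R tE E)"
    then obtain s where "x = x0 + s *R tE E" by blast
    then show "x \<in> {a + u *R (b - a) | u. True}" unfolding 2 by blast
  qed
qed

lemma edge_L: "E \<in> edges M ==> piece.L (edge_chart E) (tE E) = tE E"
proof -
  assume E: "E \<in> edges M"
  interpret E: piece E "edge_chart E" by (rule piece_edge[OF E])
  obtain x0 where x0: "x0 \<in> affine hull E" using edgeD(1)[OF E] by (metis ex_in_conv hull_inc)
  have "x0 + 1 *R tE E \<in> affine hull E" unfolding edge_hull[OF E x0] by blast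
  from E.L_tangent[OF this x0] show ?thesis by simp
qed

lemma edge_hull_diff: "E \<in> edges M ==> x \<in> affine hull E ==> y \<in> affine hull E ==> x - y = ((x - y) \<bullet> tE E) *R tE E"
proof -
  assume E: "E \<in> edges M" "x \<in> affine hull E" "y \<in> affine hull E"
  then obtain s where "x = y + s *R tE E" using edge_hull[OF E(1,3)] by blast
  moreover have "tE E \<bullet> tE E = 1" using tangent_unit[OF E(1)] by (simp add: norm_eq_1)
  ultimately show ?thesis by simp
qed

lemma edge_sub_face: "F \<in> faces M ==> E \<in> edgesF F ==> E \<subseteq> affine hull F"
proof -
  assume F: "F \<in> faces M" "E \<in> edgesF F"
  have "E \<subseteq> closure F" using face_edgesD(2)[OF F(2)] rel_frontier_face[OF F(1)] by auto
  also have "closure F \<subseteq> affine hull F" by (metis affine_affine_hull closed_affine_hull closure_minimal hull_subset)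
  finally show ?thesis .
qed

lemma edge_hull_sub_face: "F \<in> faces M ==> E \<in> edgesF F ==> affine hull E \<subseteq> affine hull F"
  using edge_sub_face by (metis affine_affine_hull hull_minimal)

lemma normal_tangent: "F \<in> faces M ==> E \<in> edgesF F ==> nF F \<bullet> tE E = 0"
proof -
  assume F: "F \<in> faces M" "E \<in> edgesF F"
  note E = face_edgesD(1)[OF F(2)]
  obtain x0 where x0: "x0 \<in> affine hull E" using edgeD(1)[OF E] by (metis ex_in_conv hull_inc)
  have "x0 + 1 *R tE E \<in> affine hull E" unfolding edge_hull[OF E x0] by blast
  then show ?thesis using normal_perp_hull[OF F(1), of "x0 + 1 *R tE E" x0] edge_hull_sub_face[OF F] x0 by auto
qed

section \<open>Outward signs in the mesh\<close>

lemma omegaTF_spec: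
  assumes T: "T \<in> cells M" and F: "F \<in> facesT T"
  shows "wTF T F \<in> {-1, 1}"
    and "x \<in> affine hull F ==> y \<in> T ==> (wTF T F *R nF F) \<bullet> (y - x) < 0"
proof -
  note f = cell_facesD(1)[OF F]
  have T': "rel_open T" using cellD[OF T] by (simp add: rel_open_def rel_interior_open)
  have fr: "F \<subseteq> closure T" "F \<inter> T = {}" using cell_facesD(2)[OF F] cell_face_disjoint[OF T f] by (auto simp: frontier_def)
  have nd: "\<exists>p\<in>affine hull T. \<exists>q\<in>affine hull T. nF F = p - q"
    using cellD(5)[OF T] by (intro bexI[of _ "nF F"] bexI[of _ 0]) auto
  have dir: "x + (p - q) \<in> affine hull F" if "x \<in> F" "nF F \<bullet> (p - q) = 0" for x p q
    unfolding face_hull[OF f that(1)] using that(2) by simp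
  note s = outward_sign_unique[OF T' cellD(3,1)[OF T] faceD(2,1)[OF f] fr normal_unit[OF f] nd normal_perp[OF f] dir]
  show "wTF T F \<in> {-1, 1}" unfolding omegaTF_def by (rule s(1))
  show "x \<in> affine hull F ==> y \<in> T ==> (wTF T F *R nF F) \<bullet> (y - x) < 0"
    unfolding omegaTF_def by (rule s(2))
qed

lemma edge_normal_facts:
  assumes F: "F \<in> faces M" and E: "E \<in> edgesF F"
  shows "norm (nFE F E) = 1" "nF F \<bullet> nFE F E = 0" "nFE F E \<bullet> tE E = 0"
    "x = (x \<bullet> tE E) *R tE E + (x \<bullet> nFE F E) *R nFE F E + (x \<bullet> nF F) *R nF F"
  using cross_frame[OF normal_unit[OF F] tangent_unit[OF face_edgesD(1)[OF E]] normal_tangent[OF F E]]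
  unfolding edge_normal_def by (auto simp: dot_cross_self)

lemma omegaFE_spec:
  assumes F: "F \<in> faces M" and E: "E \<in> edgesF F"
  shows "wFE F E \<in> {-1, 1}"
    and "x \<in> affine hull E ==> y \<in> F ==> (wFE F E *R nFE F E) \<bullet> (y - x) < 0"
proof -
  note e = face_edgesD(1)[OF E]
  note n = edge_normal_facts[OF F E]
  have fr: "E \<subseteq> closure F" "E \<inter> F = {}"
    using face_edgesD(2)[OF E] rel_frontier_face[OF F] face_edge_disjoint[OF F e] by auto
  obtain x0 where x0: "x0 \<in> F" using faceD(1)[OF F] by blast
  have "x0 + nFE F E \<in> affine hull F" unfolding face_hull[OF F x0] using n(2) by simp
  then have nd: "\<exists>p\<in>affine hull F. \<exists>q\<in>affine hull F. nFE F E = p - q"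
    using hull_inc[OF x0] by (intro bexI[of _ "x0 + nFE F E"] bexI[of _ x0]) auto
  have perp: "nFE F E \<bullet> (x - y) = 0" if "x \<in> E" "y \<in> E" for x y
    using edge_hull_diff[OF e hull_inc[OF that(1)] hull_inc[OF that(2)]] n(3) by (metis inner_scaleR_right mult_zero_right)
  have dir: "x + (p - q) \<in> affine hull E"
    if "x \<in> E" "p \<in> affine hull F" "q \<in> affine hull F" "nFE F E \<bullet> (p - q) = 0" for x p q
  proof -
    have "p - q = ((p - q) \<bullet> tE E) *R tE E"
      using n(4)[of "p - q"] that(4) normal_perp_hull[OF F that(2,3)] by (simp add: inner_commute)
    then show ?thesis unfolding edge_hull[OF e hull_inc[OF that(1)]] by (metis rangeI)
  qed
  note s = outward_sign_unique[OF faceD(2,3,1)[OF F] edgeD(2,1)[OF e] fr n(1) nd perp dir]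
  show "wFE F E \<in> {-1, 1}" unfolding omegaFE_def by (rule s(1))
  show "x \<in> affine hull E ==> y \<in> F ==> (wFE F E *R nFE F E) \<bullet> (y - x) < 0"
    unfolding omegaFE_def by (rule s(2))
qed

subsection \<open>Stokes formulas on faces and cells\<close>

lemma cell_divergence:
  assumes T: "T \<in> cells M" and f: "f \<in> poly3 l"
  shows "intT T (%x. dderiv f v x) =
    (\<Sum>F\<in>facesT T. wTF T F * (nF F \<bullet> v) * intF F f)"
proof -
  interpret T: piece T "%x. x" by (rule piece_cell[OF T])
  have L: "T.L v = v" for v
    using T.L_tangent[of v 0] cellD(5)[OF T] by simp
  have 1: "\<bar>wTF T F\<bar> = 1" if "F \<in> facesT T" for F using omegaTF_spec(1)[OF T that] by auto
  have "T.I (%x. dderiv f v x) = (\<Sum>F\<in>facesT T. ((wTF T F *R nF F) \<bullet> v) *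
      piece.I F (face_chart F) f)"
  \<comment> \<open>The relative boundaries of the faces lie in the lines carrying the edges, which
    have codimension two in space.\<close>
  proof (rule piece_divergence[OF T.piece_axioms, where \<A> = "(%E. affine hull E) ` edges M"])
    show "closure T - T = (\<Union>F\<in>facesT T. closure F)" by (rule cell_boundary[OF T])
    show "finite ((%E. affine hull E) ` edges M)" using finites by auto
    show "aff_dim Q + 2 \<le> int CARD(3)" if "Q \<in> (%E. affine hull E) ` edges M" for Q
      using that edgeD(5) by auto
    fix F assume F: "F \<in> facesT T"
    note f = cell_facesD(1)[OF F]
    show "piece F (face_chart F)" by (rule piece_face[OF f])
    show "norm (wTF T F *R nF F) = 1" using normal_unit[OF f] 1[OF F] by simp
    show "(wTF T F *R nF F) \<bullet> (x - y) = 0" if "x \<in> affine hull F" "y \<in> affine hull F" for x y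
      using normal_perp_hull[OF f that] by simp
    show "(wTF T F *R nF F) \<bullet> (y - x) < 0" if "x \<in> affine hull F" "y \<in> T" for x y
      by (rule omegaTF_spec(2)[OF T F that])
    show "closure F - F \<subseteq> (%x. x) ` \<Union> ((%E. affine hull E) ` edges M)"
    proof
      fix x assume "x \<in> closure F - F"
      then obtain E where E: "E \<in> edgesF F" "x \<in> closure E" using face_boundary[OF f] by blast
      have "closure E \<subseteq> affine hull E" by (metis affine_affine_hull closed_affine_hull closure_minimal hull_subset)
      then show "x \<in> (%x. x) ` \<Union> ((%E. affine hull E) ` edges M)" using E face_edgesD(1)[OF E(1)] by auto
    qed
  next
    fix F F' assume "F \<in> facesT T" "F' \<in> facesT T" "F \<noteq> F'"
    then show "F \<inter> F' = {}" using cell_facesD(1) by (intro disjoint_pieces) auto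
  qed (use f L finite_cell_faces in auto)
  also have "... = (\<Sum>F\<in>facesT T. wTF T F * (nF F \<bullet> v) * intF F f)"
    using cell_facesD(1) by (intro sum.cong) (simp_all add: face_I)
  finally show ?thesis by (simp add: cell_I[OF T])
qed

lemma face_divergence:
  assumes F: "F \<in> faces M" and f: "f \<in> poly3 l" and v: "nF F \<bullet> v = 0"
  shows "intF F (%x. dderiv f v x) =
    (\<Sum>E\<in>edgesF F. wFE F E * (nFE F E \<bullet> v) * intE E f)"
proof -
  interpret F: piece F "face_chart F" by (rule piece_face[OF F])
  have 1: "\<bar>wFE F E\<bar> = 1" if "E \<in> edgesF F" for E using omegaFE_spec(1)[OF F that] by auto
  \<comment> \<open>In the plane of a face the sets of codimension two are points: the mesh
    vertices, pulled back to chart coordinates.\<close>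
  define \<V> where "\<V> = (%V. {V}) ` ((face_chart F) -` (verts M))"
  have finV: "finite ((face_chart F) -` verts M)"
  proof (rule finite_vimageI[OF finites(4)])
    show "inj (face_chart F)" using F.iso by (metis dist_eq_0_iff injI)
  qed
  have "F.I (%x. dderiv f v x) = (\<Sum>E\<in>edgesF F. ((wFE F E *R nFE F E) \<bullet> v) *
      piece.I E (edge_chart E) f)"
  proof (rule piece_divergence[OF F.piece_axioms, where \<A> = \<V>])
    show "closure F - F = (\<Union>E\<in>edgesF F. closure E)" by (rule face_boundary[OF F])
    show "finite \<V>" unfolding \<V>_def using finV by auto
    show "aff_dim Q + 2 \<le> int CARD(2)" "affine Q" if "Q \<in> \<V>" for Q
      using that by (auto simp: \<V>_def)
    fix E assume E: "E \<in> edgesF F"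
    note e = face_edgesD(1)[OF E]
    note n = edge_normal_facts[OF F E]
    show "piece E (edge_chart E)" by (rule piece_edge[OF e])
    show "norm (wFE F E *R nFE F E) = 1" using n(1) 1[OF E] by simp
    show "F.L (wFE F E *R nFE F E) = wFE F E *R nFE F E"
      by (rule face_L[OF F]) (simp add: n(2))
    show "(wFE F E *R nFE F E) \<bullet> (x - y) = 0" if "x \<in> affine hull E" "y \<in> affine hull E" for x y
      by (subst edge_hull_diff[OF e that]) (simp add: n(3))
    show "(wFE F E *R nFE F E) \<bullet> (y - x) < 0" if "x \<in> affine hull E" "y \<in> F" for x y
      by (rule omegaFE_spec(2)[OF F E that])
    show "closure E - E \<subseteq> (face_chart F) ` \<Union> \<V>"
    proof
      fix x assume x: "x \<in> closure E - E"
      then have "x \<in> rel_frontier E" using edgeD(2)[OF e] by (simp add: rel_frontier_def rel_open_def)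
      then have xv: "x \<in> verts M" using edge_verts_rel_frontier[OF e] by (auto simp: edge_verts_def)
      have "x \<in> closure F" using face_boundary[OF F] E x by blast
      then have "x \<in> affine hull F" using closure_affine_hull by blast
      then obtain z :: "real^2" where "x = isometric_chart F z" using F.rng by (metis imageE)
      then show "x \<in> (face_chart F) ` \<Union> \<V>" using xv by (auto simp: \<V>_def)
    qed
  next
    fix E E' assume "E \<in> edgesF F" "E' \<in> edgesF F" "E \<noteq> E'"
    then show "E \<inter> E' = {}" using face_edgesD(1) by (intro disjoint_pieces) auto
  qed (use f face_L[OF F v] finite_face_edges in auto)
  also have "... = (\<Sum>E\<in>edgesF F. wFE F E * (nFE F E \<bullet> v) * intE E f)"
    using face_edgesD(1) by (intro sum.cong) (simp_all add: edge_I)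
  finally show ?thesis by (simp add: face_I[OF F])
qed

lemma cell_stokes:
  assumes T: "T \<in> cells M" and r: "r \<in> vpoly3 l"
  shows "intT T (divg r) =
    (\<Sum>F\<in>facesT T. wTF T F * intF F (%x. r x \<bullet> nF F))"
proof -
  interpret T: piece T "%x. x" by (rule piece_cell[OF T])
  have "intT T (divg r) = T.I (%x. \<Sum>i\<in>UNIV. dderiv (%x. r x $ i) (axis i 1) x)"
    unfolding cell_I[OF T, symmetric] by (rule arg_cong[of _ _ T.I]) (simp add: fun_eq_iff divg_nth[OF r])
  also have "... = (\<Sum>i\<in>UNIV. T.I (%x. dderiv (%x. r x $ i) (axis i 1) x))"
    by (rule T.I_sum) (auto intro: poly3_continuous[OF poly3_dderiv[OF vpoly3_nth[OF r]]])
  also have "... = (\<Sum>i\<in>UNIV. \<Sum>F\<in>facesT T. wTF T F * (nF F $ i) * intF F (%x. r x $ i))"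
    using cell_divergence[OF T vpoly3_nth[OF r]] by (simp add: cell_I[OF T] inner_axis)
  also have "... = (\<Sum>F\<in>facesT T. \<Sum>i\<in>UNIV. wTF T F * (nF F $ i) * intF F (%x. r x $ i))"
    by (rule sum.swap)
  also have "... = (\<Sum>F\<in>facesT T. wTF T F * intF F (%x. r x \<bullet> nF F))"
  proof (rule sum.cong[OF refl])
    fix F assume F: "F \<in> facesT T"
    interpret F: piece F "face_chart F" by (rule piece_face[OF cell_facesD(1)[OF F]])
    have "F.I (%x. r x \<bullet> nF F) = F.I (%x. \<Sum>i\<in>UNIV. nF F $ i * r x $ i)"
      by (simp add: inner_vec_def mult.commute)
    also have "... = (\<Sum>i\<in>UNIV. F.I (%x. nF F $ i * r x $ i))"
      by (rule F.I_sum) (auto intro: poly3_continuous[OF poly3_cmult[OF vpoly3_nth[OF r]]])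
    also have "... = (\<Sum>i\<in>UNIV. nF F $ i * F.I (%x. r x $ i))" by (simp add: F.I_cmult)
    finally show "(\<Sum>i\<in>UNIV. wTF T F * (nF F $ i) * intF F (%x. r x $ i)) =
        wTF T F * intF F (%x. r x \<bullet> nF F)"
      by (simp add: face_I[OF cell_facesD(1)[OF F]] sum_distrib_left mult.assoc)
  qed
  finally show ?thesis .
qed

lemma tPolyD:
  assumes F: "F \<in> faces M" and r: "r \<in> tPoly M l F"
  shows "r \<in> vPoly l F" "r x \<bullet> nF F = 0" "r \<in> vpoly3 l"
  using r piece.vPoly_vpoly3[OF piece_face[OF F]] by (auto simp: tPoly_def)

lemma face_L_normal: "F \<in> faces M ==> piece.L (face_chart F) (nF F) = 0"
proof -
  assume F: "F \<in> faces M"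
  interpret F: piece F "face_chart F" by (rule piece_face[OF F])
  have "nF F \<bullet> F.L v = 0" for v by (rule F.L_normal) (rule normal_perp[OF F])
  then have "F.L (nF F) \<bullet> F.L (nF F) = 0" unfolding F.L_inner F.L_idem by simp
  then show ?thesis by simp
qed

text \<open>The divergence is the trace of the derivative in the frame of the face, and its normal
  term disappears because a representative does not vary along \<open>n_F\<close>.\<close>

lemma divg_tangential:
  assumes F: "F \<in> faces M" and r: "r \<in> vPoly l F" and t: "norm t = 1" "nF F \<bullet> t = 0"
  shows "divg r x = dderiv (%x. r x \<bullet> t) t x + dderiv (%x. r x \<bullet> cross3 (nF F) t) (cross3 (nF F) t) x"
proof -
  interpret F: piece F "face_chart F" by (rule piece_face[OF F])
  have d: "r differentiable at x" by (rule F.vPoly_differentiable[OF r])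
  have "dderiv r (nF F) x = 0"
    using F.vPoly_dderiv_L[OF r, where v = "nF F" and x = x] linear_0[OF linear_dderiv[OF d]] by (simp add: face_L_normal[OF F])
  then show ?thesis
    unfolding divg_frame[OF d normal_unit[OF F] t] by (simp add: dderiv_inner[OF d])
qed

lemma face_stokes:
  assumes F: "F \<in> faces M" and r: "r \<in> tPoly M l F"
  shows "intF F (divg r) =
    (\<Sum>E\<in>edgesF F. wFE F E * intE E (%x. r x \<bullet> nFE F E))"
proof -
  interpret F: piece F "face_chart F" by (rule piece_face[OF F])
  note r' = tPolyD[OF F r]
  obtain t where t: "norm t = 1" "nF F \<bullet> t = 0" using unit_orthogonal_exists by blast
  let ?w = "cross3 (nF F) t"
  have w: "nF F \<bullet> ?w = 0" by (simp add: dot_cross_self)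
  have "intF F (divg r) = F.I (%x. dderiv (%x. r x \<bullet> t) t x + dderiv (%x. r x \<bullet> ?w) ?w x)"
    unfolding face_I[OF F, symmetric]
    by (rule arg_cong[of _ _ F.I]) (simp add: fun_eq_iff divg_tangential[OF F r'(1) t])
  also have "... = F.I (%x. dderiv (%x. r x \<bullet> t) t x) + F.I (%x. dderiv (%x. r x \<bullet> ?w) ?w x)"
    by (rule F.I_add) (rule poly3_continuous[OF poly3_dderiv[OF vpoly3_inner[OF r'(3)]]])+
  also have "... = (\<Sum>E\<in>edgesF F. wFE F E * (nFE F E \<bullet> t) * intE E (%x. r x \<bullet> t)) +
      (\<Sum>E\<in>edgesF F. wFE F E * (nFE F E \<bullet> ?w) * intE E (%x. r x \<bullet> ?w))"
    unfolding face_I[OF F] face_divergence[OF F vpoly3_inner[OF r'(3)] t(2)]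
      face_divergence[OF F vpoly3_inner[OF r'(3)] w] ..
  also have "... = (\<Sum>E\<in>edgesF F. wFE F E * intE E (%x. r x \<bullet> nFE F E))"
    unfolding sum.distrib[symmetric]
  proof (rule sum.cong[OF refl])
    fix E assume E: "E \<in> edgesF F"
    note e = face_edgesD(1)[OF E]
    interpret E: piece E "edge_chart E" by (rule piece_edge[OF e])
    let ?n = "nFE F E"
    have n: "?n = (?n \<bullet> t) *R t + (?n \<bullet> ?w) *R ?w"
      using cross_frame(1)[OF normal_unit[OF F] t, of ?n] edge_normal_facts(2)[OF F E] by (simp add: inner_commute)
    have "r x \<bullet> ?n = (?n \<bullet> t) * (r x \<bullet> t) + (?n \<bullet> ?w) * (r x \<bullet> ?w)" for x
      by (subst n) (simp only: inner_add_right inner_scaleR_right)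
    then have "E.I (%x. r x \<bullet> ?n) = E.I (%x. (?n \<bullet> t) * (r x \<bullet> t) + (?n \<bullet> ?w) * (r x \<bullet> ?w))" by simp
    also have "... = (?n \<bullet> t) * E.I (%x. r x \<bullet> t) + (?n \<bullet> ?w) * E.I (%x. r x \<bullet> ?w)"
      unfolding E.I_cmult[symmetric]
      by (rule E.I_add) (rule poly3_continuous[OF poly3_cmult[OF vpoly3_inner[OF r'(3)]]])+
    finally show "wFE F E * (?n \<bullet> t) * intE E (%x. r x \<bullet> t) +
        wFE F E * (?n \<bullet> ?w) * intE E (%x. r x \<bullet> ?w) =
        wFE F E * intE E (%x. r x \<bullet> ?n)"
      by (simp add: edge_I[OF e] algebra_simps)
  qed
  finally show ?thesis .
qed

end

section \<open>Polynomials on edges\<close>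

context hho_mesh
begin

section \<open>The signed length coordinate along an edge\<close>

lemma edge_coord_Poly:
  assumes E: "E \<in> edges M"
  shows "(%x. (x - a) \<bullet> tE E) \<in> Poly 1 E"
proof -
  interpret E: piece E "edge_chart E" by (rule piece_edge[OF E])
  have "(%x. x \<bullet> tE E + - (a \<bullet> tE E)) \<in> poly3 1"
    by (intro poly3_add poly3_inner poly3_const) auto
  moreover have "(hull_proj E x - x) \<bullet> tE E = 0" for x
  proof -
    have "E.L (hull_proj E x - x) = hull_proj E (hull_proj E x) - hull_proj E x" by (rule E.hull_proj_diff[symmetric])
    then have "E.L (hull_proj E x - x) = 0" by simp
    then show ?thesis using E.L_inner[of "hull_proj E x - x" "tE E"] edge_L[OF E] by simp
  qed
  then have "hull_proj E x \<bullet> tE E = x \<bullet> tE E" for x by (simp add: inner_diff_left)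
  ultimately show ?thesis unfolding E.Poly_iff by (simp add: inner_diff_left)
qed

text \<open>Carries questions on edges over to the algebra of one-variable polynomials. The
  alternative \<open>p = 0\<close> is needed because \<open>degree 0 = 0\<close> would otherwise
  exclude the zero function for negative \<open>l\<close>.\<close>

lemma edge_poly:
  assumes E: "E \<in> edges M" and a: "a \<in> affine hull E"
  shows "f \<in> Poly l E \<longleftrightarrow> (\<exists>p. (p = 0 \<or> int (degree p) \<le> l) \<and> f = (%x. poly p ((x - a) \<bullet> tE E)))"
proof
  interpret E: piece E "edge_chart E" by (rule piece_edge[OF E])
  let ?\<sigma> = "%x. (x - a) \<bullet> tE E"
  have \<sigma>: "?\<sigma> \<in> Poly 1 E" by (rule edge_coord_Poly[OF E])
  {
    assume f: "f \<in> Poly l E"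
    obtain p where p: "!!t. f (a + t *R tE E) = poly p t" "degree p \<le> nat l" "l < 0 \<longrightarrow> p = 0"
      using poly3_on_line[OF E.Poly_poly3[OF f], of a "tE E"] by blast
    have "f x = poly p (?\<sigma> x)" for x
    proof -
      have "hull_proj E x = a + ?\<sigma> (hull_proj E x) *R tE E"
        using edge_hull_diff[OF E E.hull_proj_in a, of x] by (simp add: algebra_simps)
      also have "?\<sigma> (hull_proj E x) = ?\<sigma> x" using E.Poly_hull_proj[OF \<sigma>] .
      finally have "f (hull_proj E x) = poly p (?\<sigma> x)" using p(1) by metis
      then show ?thesis by (simp add: E.Poly_hull_proj[OF f])
    qed
    moreover have "p = 0 \<or> int (degree p) \<le> l" using p(2,3) by linarith
    ultimately show "\<exists>p. (p = 0 \<or> int (degree p) \<le> l) \<and> f = (%x. poly p (?\<sigma> x))" by blast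
  next
    assume "\<exists>p. (p = 0 \<or> int (degree p) \<le> l) \<and> f = (%x. poly p (?\<sigma> x))"
    then obtain p where p: "p = 0 \<or> int (degree p) \<le> l" "f = (%x. poly p (?\<sigma> x))" by blast
    have "(%x. poly p (?\<sigma> x)) \<in> Poly l E" using p(1)
    proof (induction p arbitrary: l)
      case 0
      then show ?case by (simp add: E.Poly_0)
    next
      case (pCons c p)
      show ?case
      proof (cases "p = 0")
        case True
        with pCons have "0 \<le> l" by auto
        with True show ?thesis by (simp add: E.Poly_const)
      next
        case False
        then have l: "int (degree p) \<le> l - 1" using pCons.prems by auto
        then have "(%x. poly p (?\<sigma> x)) \<in> Poly (l - 1) E" by (intro pCons.IH) simp
        from E.Poly_mult[OF \<sigma> this] have "(%x. ?\<sigma> x * poly p (?\<sigma> x)) \<in> Poly l E" by simp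
        moreover have "(%x. c) \<in> Poly l E" using l by (intro E.Poly_const) linarith
        ultimately have "(%x. c + ?\<sigma> x * poly p (?\<sigma> x)) \<in> Poly l E" by (intro E.Poly_add)
        then show ?thesis by simp
      qed
    qed
    then show "f \<in> Poly l E" using p(2) by simp
  }
qed

lemma edge_coord_surj:
  assumes E: "E \<in> edges M"
  shows "((a + s *R tE E) - a) \<bullet> tE E = s"
  using tangent_unit[OF E] by (simp add: norm_eq_1)

lemma edge_poly_inj:
  assumes E: "E \<in> edges M" and "!!x. poly p ((x - a) \<bullet> tE E) = poly q ((x - a) \<bullet> tE E)"
  shows "p = q"
proof -
  have "poly p s = poly q s" for s
    using assms(2)[of "a + s *R tE E"] unfolding edge_coord_surj[OF E] .
  then show ?thesis by (simp add: poly_eq_poly_eq_iff[symmetric] fun_eq_iff)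
qed

lemma edge_poly_deriv:
  assumes E: "E \<in> edges M"
  shows "dderiv (%x. poly p ((x - a) \<bullet> tE E)) (tE E) x = poly (pderiv p) ((x - a) \<bullet> tE E)"
proof -
  have t: "tE E \<bullet> tE E = 1" using tangent_unit[OF E] by (simp add: norm_eq_1)
  have "((%x. (x - a) \<bullet> tE E) has_derivative (%v. v \<bullet> tE E)) (at x)"
    by (auto intro!: derivative_eq_intros)
  from DERIV_compose_FDERIV[OF poly_DERIV this, of p]
  have "((%x. poly p ((x - a) \<bullet> tE E)) has_derivative
      (%v. (v \<bullet> tE E) * poly (pderiv p) ((x - a) \<bullet> tE E))) (at x)" .
  from dderiv_eq[OF this, of "tE E"] show ?thesis by (simp add: t)
qed

text \<open>Integration raises the degree by at most one, constants of integration being allowed by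
  \<open>0 \<le> m\<close>. It will bound the degree of the difference of two face potentials along
  a common edge.\<close>

lemma edge_degree_of_deriv:
  assumes E: "E \<in> edges M" and f: "f \<in> Poly n E" and d: "(%x. dderiv f (tE E) x) \<in> Poly (m - 1) E" and m: "0 \<le> m"
  shows "f \<in> Poly m E"
proof -
  obtain a where a: "a \<in> affine hull E" using edgeD(1)[OF E] by (metis ex_in_conv hull_inc)
  obtain p where p: "f = (%x. poly p ((x - a) \<bullet> tE E))" using f edge_poly[OF E a] by blast
  obtain q where q: "q = 0 \<or> int (degree q) \<le> m - 1" "(%x. dderiv f (tE E) x) = (%x. poly q ((x - a) \<bullet> tE E))"
    using d edge_poly[OF E a] by blast
  have "poly (pderiv p) ((x - a) \<bullet> tE E) = poly q ((x - a) \<bullet> tE E)" for x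
    using fun_cong[OF q(2), of x] unfolding p edge_poly_deriv[OF E] .
  then have "pderiv p = q" by (rule edge_poly_inj[OF E])
  then have "int (degree p) \<le> m" using q(1) degree_pderiv[of p] pderiv_eq_0_iff[of p] m by auto
  then show ?thesis unfolding p edge_poly[OF E a] by blast
qed

lemma edge_deriv_zero_const:
  assumes E: "E \<in> edges M" and f: "f \<in> Poly n E" and d: "!!x. dderiv f (tE E) x = 0"
  shows "\<exists>c. f = (%x. c)"
proof -
  interpret E: piece E "edge_chart E" by (rule piece_edge[OF E])
  obtain a where a: "a \<in> affine hull E" using edgeD(1)[OF E] by (metis ex_in_conv hull_inc)
  have "(%x. dderiv f (tE E) x) \<in> Poly (0 - 1) E" unfolding d by (rule E.Poly_0)
  from edge_degree_of_deriv[OF E f this] have "f \<in> Poly 0 E" by simp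
  then obtain p where p: "p = 0 \<or> int (degree p) \<le> 0" "f = (%x. poly p ((x - a) \<bullet> tE E))"
    using edge_poly[OF E a] by blast
  then have "degree p = 0" by auto
  then obtain c where "p = [:c:]" by (rule degree_eq_zeroE)
  then show ?thesis using p(2) by auto
qed

lemma edge_FTC:
  assumes E: "E \<in> edges M" "E = open_segment a b" "a \<noteq> b" and s: "b - a = (s * norm (b - a)) *R tE E"
    and f: "f \<in> poly3 l"
  shows "intE E (%x. dderiv f (tE E) x) = s * (f b - f a)"
proof -
  interpret E: piece E "edge_chart E" by (rule piece_edge[OF E(1)])
  let ?\<phi> = "edge_chart E" and ?t = "tE E"
  define u where "u = E.B 1"
  have \<phi>: "?\<phi> y = ?\<phi> z + (y - z) *R u" for y z
  proof -
    have B: "E.B y = y *R u" for y unfolding u_def using linear_cmul[OF E.linear_B, of y 1] by simp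
    show ?thesis unfolding E.\<phi>_B[of y] E.\<phi>_B[of z] B by (simp add: algebra_simps)
  qed
  have ends: "a \<in> affine hull E" "b \<in> affine hull E"
    unfolding E(2) using E(3) by (simp_all add: hull_inc)
  then obtain wa wb where w: "?\<phi> wa = a" "?\<phi> wb = b" using E.rng by (metis imageE)
  have ba: "b - a = (wb - wa) *R u" using \<phi>[of wb wa] w by simp
  have wne: "wa \<noteq> wb" using w E(3) by auto
  have lenb: "norm (b - a) = \<bar>wb - wa\<bar>" using E.iso[of wb wa] w by (simp add: dist_norm)
  \<comment> \<open>The chart comes from a \<open>SOME\<close>, so its orientation is unknown:
    \<open>e\<close> is the sign with which it traverses the edge relative to \<open>t_E\<close>,
    and it drops out at the end by \<open>e * e = 1\<close>.\<close>
  define e where "e = s * \<bar>wb - wa\<bar> / (wb - wa)"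
  have ue: "u = e *R ?t"
  proof -
    have "(1 / (wb - wa)) *R (b - a) = u" using ba wne by simp
    then show ?thesis using s unfolding lenb e_def by simp
  qed
  have un: "norm u = 1" unfolding u_def using E.B_inner[of 1 1] by (simp add: norm_eq_1)
  have e1: "e * e = 1"
  proof -
    have "\<bar>e\<bar> = 1" using un tangent_unit[OF E(1)] unfolding ue by simp
    then show ?thesis by (metis abs_mult_self_eq mult_1)
  qed
  have D: "E.D = open_segment wa wb"
  proof (rule set_eqI)
    fix y
    have inj: "?\<phi> y = ?\<phi> z \<longleftrightarrow> y = z" for y z using E.iso[of y z] by (metis dist_eq_0_iff)
    have "(1 - v) *R a + v *R b = ?\<phi> ((1 - v) *R wa + v *R wb)" for v
    proof -
      have "(1 - v) *R wa + v *R wb - wa = v * (wb - wa)" by (simp add: algebra_simps)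
      then have "?\<phi> ((1 - v) *R wa + v *R wb) = a + v *R (b - a)"
        using \<phi>[of "(1 - v) *R wa + v *R wb" wa] unfolding w(1) ba scaleR_scaleR by simp
      then show ?thesis by (simp add: algebra_simps)
    qed
    note seg = this
    have "y \<in> E.D \<longleftrightarrow> (\<exists>u>0. u < 1 \<and> ?\<phi> y = (1 - u) *R a + u *R b)"
      using E(2,3) by (metis (no_types, lifting) in_segment(2) vimage_eq)
    also have "... \<longleftrightarrow> y \<in> open_segment wa wb"
      unfolding seg inj in_segment using wne by auto
    finally show "y \<in> E.D \<longleftrightarrow> y \<in> open_segment wa wb" .
  qed
  have der: "((%y. f (?\<phi> y)) has_vector_derivative e * dderiv f ?t (?\<phi> y)) (at y within S)" for y S
  proof -
    have "((%y. ?\<phi> 0 + y *R u) has_derivative (%h. h *R u)) (at y)" by (auto intro!: derivative_eq_intros)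
    from has_derivative_compose[OF this poly3_has_dderiv[OF f]]
    have "((%y. f (?\<phi> 0 + y *R u)) has_derivative (%h. dderiv f (h *R u) (?\<phi> 0 + y *R u))) (at y)" .
    moreover have e: "?\<phi> 0 + y *R u = ?\<phi> y" for y using \<phi>[of y 0] by simp
    ultimately have "((%y. f (?\<phi> y)) has_derivative (%h. dderiv f (h *R u) (?\<phi> y))) (at y)"
      by (simp only: e)
    moreover have "dderiv f (h *R u) (?\<phi> y) = h *R (e * dderiv f ?t (?\<phi> y))" for h
      unfolding ue by (simp add: linear_cmul[OF poly3_linear_dderiv[OF f]])
    ultimately show ?thesis unfolding has_vector_derivative_def by (auto intro: has_derivative_at_withinI)
  qed
  have int: "integral {lo..hi} (%y. e * dderiv f ?t (?\<phi> y)) = f (?\<phi> hi) - f (?\<phi> lo)" if "lo \<le> hi" for lo hi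
    by (rule integral_unique, rule fundamental_theorem_of_calculus[OF that der])
  have "e * intE E (%x. dderiv f ?t x) = integral (open_segment wa wb) (%y. e * dderiv f ?t (?\<phi> y))"
    unfolding edge_I[OF E(1), symmetric] E.I_def D by simp
  also have "... = e * s * (f b - f a)"
  proof (cases "wa < wb")
    case True
    then have "integral (open_segment wa wb) (%y. e * dderiv f ?t (?\<phi> y)) = f b - f a"
      using int[of wa wb] w by (simp add: open_segment_eq_real_ivl integral_open_interval_real)
    moreover have "e = s" using True by (simp add: e_def)
    ultimately show ?thesis using e1 by simp
  next
    case False
    then have "integral (open_segment wa wb) (%y. e * dderiv f ?t (?\<phi> y)) = f a - f b"
      using int[of wb wa] w wne by (simp add: open_segment_eq_real_ivl integral_open_interval_real)
    moreover have "e = - s" using False wne by (simp add: e_def divide_simps algebra_simps)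
    ultimately show ?thesis using e1 by (simp add: algebra_simps)
  qed
  finally have "e * (e * intE E (%x. dderiv f ?t x)) = e * (e * (s * (f b - f a)))" by simp
  then show ?thesis by (simp add: mult.assoc[symmetric] e1)
qed

section \<open>Unisolvence on an edge: moments together with the two end values\<close>

lemma edge_barycentric:
  assumes E: "E \<in> edges M" "E = open_segment a b" "a \<noteq> b"
  shows "\<exists>\<mu>\<in>Poly 1 E. \<mu> a = 0 \<and> \<mu> b = 1 \<and> (\<forall>x\<in>E. 0 < \<mu> x \<and> \<mu> x < 1) \<and>
      (\<forall>x. (x - a) \<bullet> tE E = ((b - a) \<bullet> tE E) * \<mu> x)"
    and "(b - a) \<bullet> tE E \<noteq> 0"
proof -
  interpret E: piece E "edge_chart E" by (rule piece_edge[OF E(1)])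
  obtain s where s: "s \<in> {-1, 1}" "b - a = (s * norm (b - a)) *R tE E" using tangent_edge[OF E] by blast
  have "(b - a) \<bullet> tE E = s * norm (b - a)"
    using s(2) tangent_unit[OF E(1)] by (metis inner_scaleR_left mult.right_neutral norm_eq_1)
  then show c: "(b - a) \<bullet> tE E \<noteq> 0" using s E(3) by auto
  define \<mu> where "\<mu> x = 1 / ((b - a) \<bullet> tE E) * ((x - a) \<bullet> tE E)" for x
  have P: "\<mu> \<in> Poly 1 E"
    unfolding \<mu>_def[abs_def] by (rule E.Poly_cmult[OF edge_coord_Poly[OF E(1)]])
  have "0 < \<mu> x \<and> \<mu> x < 1" if xE: "x \<in> E" for x
  proof -
    obtain u where u: "0 < u" "u < 1" "x = (1 - u) *R a + u *R b" using xE unfolding E(2) in_segment by blast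
    have "x - a = u *R (b - a)" unfolding u(3) by (simp add: algebra_simps)
    then have "\<mu> x = u" using c unfolding \<mu>_def by simp
    then show "0 < \<mu> x \<and> \<mu> x < 1" using u by simp
  qed
  with P c show "\<exists>\<mu>\<in>Poly 1 E. \<mu> a = 0 \<and> \<mu> b = 1 \<and> (\<forall>x\<in>E. 0 < \<mu> x \<and> \<mu> x < 1) \<and>
      (\<forall>x. (x - a) \<bullet> tE E = ((b - a) \<bullet> tE E) * \<mu> x)"
    by (intro bexI[of _ \<mu>]) (auto simp: \<mu>_def)
qed

text \<open>
  Writing the unknown as the linear interpolant of the end values plus a bubble times a polynomial \<open>w\<close>,
  the moment conditions determine \<open>w\<close> by the representation theorem in the bubble-weighted inner product.
\<close>

lemma edge_unisolvent:
  assumes E: "E \<in> edges M" "E = open_segment a b" "a \<noteq> b" and l: "-1 \<le> l" and \<psi>: "linear_on_space (Poly l E) \<psi>"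
  shows "\<exists>!p. p \<in> Poly (l + 2) E \<and> (\<forall>r\<in>Poly l E. intE E (%x. p x * r x) = \<psi> r) \<and> p a = \<alpha> \<and> p b = \<beta>"
proof -
  interpret E: piece E "edge_chart E" by (rule piece_edge[OF E(1)])
  obtain \<mu> where \<mu>: "\<mu> \<in> Poly 1 E" "\<mu> a = 0" "\<mu> b = 1" "!!x. x \<in> E ==> 0 < \<mu> x \<and> \<mu> x < 1"
      "!!x. (x - a) \<bullet> tE E = ((b - a) \<bullet> tE E) * \<mu> x"
    using edge_barycentric(1)[OF E] by blast
  note cne = edge_barycentric(2)[OF E]
  define bub where "bub x = \<mu> x * (1 - \<mu> x)" for x
  have one: "(%x. c) \<in> Poly 1 E" for c by (rule E.Poly_const) simp
  have bubP: "bub \<in> Poly 2 E"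
    using E.Poly_mult[OF \<mu>(1) E.Poly_diff[OF one[of 1] \<mu>(1)]] unfolding bub_def[abs_def] by simp
  have bubpos: "bub x > 0" if "x \<in> E" for x using \<mu>(4)[OF that] by (simp add: bub_def)
  have S: "E.test_space (Poly l E)" by (rule E.test_space_Poly[OF E.fdim_Poly subset_refl])
  define lin where "lin x = \<alpha> + (\<beta> - \<alpha>) * \<mu> x" for x
  have linP: "lin \<in> Poly 1 E" unfolding lin_def[abs_def] by (intro E.Poly_add one E.Poly_cmult \<mu>(1))
  have cl: "cont lin" "cont bub"
    using E.Poly_continuous linP bubP by auto
  have "linear_on_space (Poly l E) (%r. \<psi> r - E.I (%x. lin x \<bullet> r x))"
    by (rule linear_on_space_minus[OF \<psi> E.linear_on_space_I_id[OF S cl(1)]])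
  from E.weighted_riesz[OF S this cl(2) bubpos]
  obtain w where w: "w \<in> Poly l E" "!!r. r \<in> Poly l E ==> E.I (%x. bub x * (w x * r x)) = \<psi> r - E.I (%x. lin x * r x)"
    by (auto simp: inner_real_def)
  define p where "p x = lin x + bub x * w x" for x
  have "(%x. bub x * w x) \<in> Poly (l + 2) E" using E.Poly_mult[OF bubP w(1)] by (simp add: add.commute)
  moreover have "lin \<in> Poly (l + 2) E" by (rule E.Poly_mono[OF _ linP]) (use l in simp)
  ultimately have pP: "p \<in> Poly (l + 2) E" unfolding p_def[abs_def] by (intro E.Poly_add)
  have mom: "E.I (%x. p x * r x) = \<psi> r" if r: "r \<in> Poly l E" for r
  proof -
    have "E.I (%x. p x * r x) = E.I (%x. lin x * r x + bub x * (w x * r x))"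
      unfolding p_def by (simp add: algebra_simps)
    also have "... = E.I (%x. lin x * r x) + E.I (%x. bub x * (w x * r x))"
      using cl E.Poly_continuous[OF w(1)] E.Poly_continuous[OF r]
      by (intro E.I_add continuous_on_mult)
    finally show ?thesis using w(2)[OF r] by simp
  qed
  show ?thesis
  proof (rule ex1I[of _ p])
    show "p \<in> Poly (l + 2) E \<and> (\<forall>r\<in>Poly l E. intE E (%x. p x * r x) = \<psi> r) \<and> p a = \<alpha> \<and> p b = \<beta>"
      using pP mom \<mu> by (simp add: edge_I[OF E(1)] p_def lin_def bub_def)
    fix q assume q: "q \<in> Poly (l + 2) E \<and> (\<forall>r\<in>Poly l E. intE E (%x. q x * r x) = \<psi> r) \<and> q a = \<alpha> \<and> q b = \<beta>"
    define d where "d x = q x - p x" for x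
    have dP: "d \<in> Poly (l + 2) E" unfolding d_def[abs_def] using q pP E.Poly_diff by blast
    have d0: "d a = 0" "d b = 0" using q \<mu> by (simp_all add: d_def p_def lin_def bub_def)
    have dm: "E.I (%x. d x * r x) = 0" if r: "r \<in> Poly l E" for r
    proof -
      have "E.I (%x. d x * r x) = E.I (%x. q x * r x - p x * r x)" unfolding d_def by (simp add: algebra_simps)
      also have "... = E.I (%x. q x * r x) - E.I (%x. p x * r x)"
        using E.Poly_continuous[of q] E.Poly_continuous[OF pP] E.Poly_continuous[OF r] q
        by (intro E.I_diff continuous_on_mult) auto
      finally show ?thesis using mom[OF r] q r by (simp add: edge_I[OF E(1)])
    qed
    have a: "a \<in> affine hull E" unfolding E(2) using E(3) by (simp add: hull_inc)
    define c where "c = (b - a) \<bullet> tE E"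
    obtain P where P: "P = 0 \<or> int (degree P) \<le> l + 2" "d = (%x. poly P ((x - a) \<bullet> tE E))"
      using dP edge_poly[OF E(1) a] by blast
    \<comment> \<open>Measured from \<open>a\<close>, the end points have the coordinates 0 and
      \<open>c\<close>. Both are roots of \<open>P\<close>, so the difference of two solutions is,
      up to the factor \<open>- (c * c)\<close>, the bubble times a polynomial of degree at most
      \<open>l\<close>, which may be used as its own test function.\<close>
    have "poly P 0 = 0" using d0(1) P(2) by simp
    then obtain P1 where P1: "P = [:- 0, 1:] * P1" unfolding poly_eq_0_iff_dvd by (rule dvdE)
    have "poly P c = 0" using d0(2) P(2) by (simp add: c_def)
    then have "poly P1 c = 0" using cne unfolding P1 c_def by simp
    then obtain Q where Q: "P1 = [:- c, 1:] * Q" unfolding poly_eq_0_iff_dvd by (rule dvdE)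
    have "Q = 0 \<or> int (degree Q) \<le> l"
    proof (cases "Q = 0")
      case False
      then have "P1 \<noteq> 0" unfolding Q by (simp del: mult_pCons_left)
      then have "P \<noteq> 0" unfolding P1 by (simp del: mult_pCons_left)
      have "degree P = 1 + degree P1" unfolding P1 by (subst degree_mult_eq) (use \<open>P1 \<noteq> 0\<close> in auto)
      moreover have "degree P1 = 1 + degree Q" unfolding Q by (subst degree_mult_eq) (use False in auto)
      ultimately show ?thesis using P(1) \<open>P \<noteq> 0\<close> by linarith
    qed simp
    then have wP: "(%x. poly Q ((x - a) \<bullet> tE E)) \<in> Poly l E" (is "?w \<in> _") unfolding edge_poly[OF E(1) a] by blast
    have db: "d x = - (c * c) * (bub x * ?w x)" for x
    proof -
      have e: "(x - a) \<bullet> tE E = c * \<mu> x" unfolding c_def by (rule \<mu>(5))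
      have "d x = poly P (c * \<mu> x)" unfolding P(2) e ..
      also have "... = (c * \<mu> x) * ((c * \<mu> x - c) * poly Q (c * \<mu> x))"
        unfolding P1 Q by (simp add: left_diff_distrib)
      also have "... = - (c * c) * (\<mu> x * (1 - \<mu> x) * poly Q (c * \<mu> x))" by algebra
      finally show ?thesis unfolding e bub_def .
    qed
    have "0 = E.I (%x. - (c * c) * (bub x * (?w x * ?w x)))" using dm[OF wP] unfolding db by (simp add: mult.assoc)
    also have "... = - (c * c) * E.I (%x. bub x * (?w x * ?w x))" by (rule E.I_cmult)
    finally have "E.I (%x. bub x * (?w x * ?w x)) = 0" using cne by (simp add: c_def)
    note Iz = this
    have "bub x * (?w x * ?w x) = 0" if "x \<in> E" for x
    proof (rule E.I_definite[of "%x. bub x * (?w x * ?w x)"])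
      show "cont (%x. bub x * (?w x * ?w x))"
        by (intro continuous_on_mult cl(2) E.Poly_continuous[OF wP])
      show "0 \<le> bub x * (?w x * ?w x)" if "x \<in> E" for x using bubpos[OF that] by simp
    qed (use that Iz in auto)
    then have "?w x = 0" if "x \<in> E" for x using that bubpos by (metis mult_eq_0_iff order_less_irrefl)
    then have "d x = 0" if "x \<in> E" for x using db that by simp
    from E.Poly_zero[OF dP this] show "q = p" by (auto simp: d_def fun_eq_iff)
  qed
qed

lemma vPoly_I_inner_sum:
  assumes E: "E \<in> edges M" and f: "cont (f :: vector_field)" "cont (s :: vector_field)"
  shows "intE E (%x. f x \<bullet> s x) = (\<Sum>i\<in>UNIV. intE E (%x. f x $ i * s x $ i))"
proof -
  interpret E: piece E "edge_chart E" by (rule piece_edge[OF E])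
  show ?thesis unfolding edge_I[OF E, symmetric] inner_vec_def inner_real_def
    by (rule E.I_sum) (use f in "auto intro!: continuous_intros")
qed

lemma edge_L2_proj_iff:
  assumes E: "E \<in> edges M" and v: "v \<in> vPoly m E" and g: "g \<in> vPoly l E"
  shows "L2_proj (intE E) (vPoly l E) v = g \<longleftrightarrow>
    (\<forall>i. \<forall>r\<in>Poly l E. intE E (%x. v x $ i * r x) = intE E (%x. g x $ i * r x))"
proof -
  interpret E: piece E "edge_chart E" by (rule piece_edge[OF E])
  have S: "E.test_space (vPoly l E)" by (rule E.test_space_vPoly[OF E.fdim_vPoly subset_refl])
  note c = E.vPoly_continuous[OF v]
  show ?thesis
  proof
    assume h: "L2_proj (intE E) (vPoly l E) v = g"
    show "\<forall>i. \<forall>r\<in>Poly l E. intE E (%x. v x $ i * r x) = intE E (%x. g x $ i * r x)"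
    proof (intro allI ballI)
      fix i r assume "r \<in> Poly l E"
      then have "(%x. r x *R axis i 1) \<in> vPoly l E" by (rule E.vPoly_const_mult)
      from E.L2_proj_spec(2)[OF S c this] show "intE E (%x. v x $ i * r x) = intE E (%x. g x $ i * r x)"
        unfolding edge_I[OF E] h by (simp add: inner_axis mult.commute)
    qed
  next
    assume h: "\<forall>i. \<forall>r\<in>Poly l E. intE E (%x. v x $ i * r x) = intE E (%x. g x $ i * r x)"
    show "L2_proj (intE E) (vPoly l E) v = g"
      unfolding edge_I[OF E, symmetric]
    proof (rule E.L2_proj_eqI[OF S g])
      fix s assume s: "s \<in> vPoly l E"
      have "(%x. s x $ i) \<in> Poly l E" for i using s by (simp add: vPoly_def)
      then have "intE E (%x. v x $ i * s x $ i) = intE E (%x. g x $ i * s x $ i)" for i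
        by (rule h[rule_format])
      then show "E.I (%x. g x \<bullet> s x) = E.I (%x. v x \<bullet> s x)"
        unfolding edge_I[OF E] using vPoly_I_inner_sum[OF E] c E.vPoly_continuous[OF g] E.vPoly_continuous[OF s] by simp
    qed
  qed
qed

text \<open>The conditions decouple into the three Cartesian components, each covered by
  \<open>edge_unisolvent\<close>. Taken with \<open>l = k\<close> it serves
  \<open>grad_edge\<close>, with \<open>l = k + 1\<close> it serves
  \<open>curl_edge\<close>.\<close>

lemma edge_lift_ex1:
  assumes E: "E \<in> edges M" and l: "-1 \<le> l" and g: "g \<in> vPoly l E"
  shows "\<exists>!v. v \<in> vPoly (l + 2) E \<and> L2_proj (intE E) (vPoly l E) v = g \<and> (\<forall>V\<in>vertsE E. v V = val V)"
proof -
  interpret E: piece E "edge_chart E" by (rule piece_edge[OF E])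
  obtain a b where ab: "a \<noteq> b" "E = open_segment a b" using edge_ends[OF E] by metis
  note ev = edge_verts_eq[OF E ab(2,1)]
  have S: "E.test_space (Poly l E)" by (rule E.test_space_Poly[OF E.fdim_Poly subset_refl])
  have cg: "cont (%x. g x $ i)" for i using E.vPoly_continuous[OF g] by (intro continuous_intros)
  have ls: "linear_on_space (Poly l E) (%r. intE E (%x. g x $ i * r x))" for i
    using E.linear_on_space_I_id[OF S cg] unfolding edge_I[OF E] inner_real_def .
  note u = edge_unisolvent[OF E ab(2,1) l ls]
  define v where "v x = (\<chi> i. (THE p. p \<in> Poly (l + 2) E \<and> (\<forall>r\<in>Poly l E. intE E (%x. p x * r x) =
      intE E (%x. g x $ i * r x)) \<and> p a = val a $ i \<and> p b = val b $ i) x)" for x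
  have v: "(%x. v x $ i) \<in> Poly (l + 2) E \<and> (\<forall>r\<in>Poly l E. intE E (%x. v x $ i * r x) =
      intE E (%x. g x $ i * r x)) \<and> v a $ i = val a $ i \<and> v b $ i = val b $ i" for i
    using theI'[OF u[of i "val a $ i" "val b $ i"]] unfolding v_def vec_lambda_beta .
  have vP: "v \<in> vPoly (l + 2) E" unfolding vPoly_def using v by blast
  show ?thesis
  proof (rule ex1I[of _ v])
    show "v \<in> vPoly (l + 2) E \<and> L2_proj (intE E) (vPoly l E) v = g \<and> (\<forall>V\<in>vertsE E. v V = val V)"
      unfolding edge_L2_proj_iff[OF E vP g] ev using vP v by (simp add: vec_eq_iff)
    fix w assume w: "w \<in> vPoly (l + 2) E \<and> L2_proj (intE E) (vPoly l E) w = g \<and> (\<forall>V\<in>vertsE E. w V = val V)"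
    then have wP: "w \<in> vPoly (l + 2) E" by blast
    have "(%x. w x $ i) = (%x. v x $ i)" for i
    proof -
      define P where "P p \<longleftrightarrow> p \<in> Poly (l + 2) E \<and> (\<forall>r\<in>Poly l E. intE E (%x. p x * r x) =
        intE E (%x. g x $ i * r x)) \<and> p a = val a $ i \<and> p b = val b $ i" for p
      have "P (%x. w x $ i)"
        using w edge_L2_proj_iff[OF E wP g] wP unfolding P_def ev vPoly_def by simp
      moreover have "P (%x. v x $ i)" unfolding P_def by (rule v)
      moreover have "\<exists>!p. P p" unfolding P_def by (rule u)
      ultimately show ?thesis by blast
    qed
    then show "w = v" by (simp add: fun_eq_iff vec_eq_iff)
  qed
qed

end

section \<open>Density of polynomials\<close>

text \<open>Places the approximants of the Stone-Weierstrass theorem in some space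
  \<open>poly3 l\<close>.\<close>

lemma real_polynomial_function_poly3: "real_polynomial_function p ==> \<exists>l. p \<in> poly3 l" for p :: scalar_field
proof (induction p rule: real_polynomial_function.induct)
  case (linear f)
  then have "(%x. f x) \<in> poly3 1" by (intro poly3_linear) (auto dest: bounded_linear.linear)
  then show ?case by (intro exI[of _ 1]) simp
next
  case (const c)
  then show ?case by (intro exI[of _ 0] poly3_const) simp
next
  case (add f g)
  then obtain l m where "f \<in> poly3 l" "g \<in> poly3 m" by blast
  then have "f \<in> poly3 (max l m)" "g \<in> poly3 (max l m)" using poly3_mono by (metis max.cobounded1 max.cobounded2)+
  then show ?case by (intro exI[of _ "max l m"] poly3_add)
next
  case (mult f g)
  then show ?case using poly3_mult by blast
qed

text \<open>A hat function around \<open>m\<close> that vanishes on all other pieces is uniformly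
  approximated by polynomials, on which the combination of integrals is zero. So its integral over
  \<open>X j0\<close> times \<open>\<kappa> j0\<close> is arbitrarily small, although that integral
  is a fixed positive number.\<close>

lemma poly3_functionals_separate:
  fixes \<phi> :: "'i => 'a::euclidean_space => point"
  assumes fin: "finite J" and X: "!!j. j \<in> J ==> piece (X j) (\<phi> j)"
    and zero: "!!l p. p \<in> poly3 l ==> (\<Sum>j\<in>J. \<kappa> j * piece.I (X j) (\<phi> j) p) = 0"
    and j0: "j0 \<in> J" and m: "m \<in> X j0" "!!j. j \<in> J ==> j \<noteq> j0 ==> m \<notin> closure (X j)"
  shows "\<kappa> j0 = 0"
proof (rule ccontr)
  assume k: "\<kappa> j0 \<noteq> 0"
  define I where "I j = piece.I (X j) (\<phi> j)" for j
  define S where "S = closure (\<Union>j\<in>J. X j)"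
  have S: "compact S" unfolding S_def compact_closure using fin piece.bdd[OF X] by auto
  have XS: "X j \<subseteq> S" if "j \<in> J" for j unfolding S_def by (rule order_trans[OF _ closure_subset]) (use that in blast)
  define C where "C = (\<Union>j\<in>J - {j0}. closure (X j))"
  have "closed C" unfolding C_def using fin by auto
  moreover have "m \<notin> C" using m(2) by (auto simp: C_def)
  ultimately obtain d where d: "d > 0" "ball m d \<inter> C = {}"
    by (metis Compl_iff closed_def disjoint_eq_subset_Compl open_contains_ball)
  define g where "g x = max 0 (d - dist m x)" for x
  have cg: "cont g" unfolding g_def[abs_def] by (intro continuous_intros)
  have g0: "I j g = 0" if "j \<in> J" "j \<noteq> j0" for j
  proof -
    interpret X: piece "X j" "\<phi> j" by (rule X[OF that(1)])
    have "g x = 0" if "x \<in> X j" for x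
    proof -
      have "x \<in> C" unfolding C_def using that \<open>j \<in> J\<close> \<open>j \<noteq> j0\<close> closure_subset by blast
      then have "d \<le> dist m x" using d(2) by (metis disjoint_iff mem_ball not_le)
      then show ?thesis by (simp add: g_def)
    qed
    then have "X.I g = X.I (%x. 0)" by (rule X.I_cong)
    then show ?thesis using X.I_0 by (simp add: I_def)
  qed
  have gpos: "I j0 g > 0"
    unfolding I_def by (rule piece.I_pos[OF X[OF j0] cg _ m(1)]) (use d(1) in "auto simp: g_def")
  define A where "A = (\<Sum>j\<in>J. \<bar>\<kappa> j\<bar> * I j (%x. 1))"
  have bound: "\<bar>\<kappa> j0 * I j0 g\<bar> \<le> A * e" if e: "e > 0" for e
  proof -
    obtain p where p: "real_polynomial_function p" "!!x. x \<in> S ==> \<bar>g x - p x\<bar> < e"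
      using Stone_Weierstrass_real_polynomial_function[OF S continuous_on_subset[OF cg] e] by auto
    obtain l where pl: "p \<in> poly3 l" using real_polynomial_function_poly3[OF p(1)] by blast
    have "\<kappa> j0 * I j0 g = (\<Sum>j\<in>J. \<kappa> j * I j g)"
      using sum.remove[OF fin j0, of "%j. \<kappa> j * I j g"] g0 by simp
    also have "... = (\<Sum>j\<in>J. \<kappa> j * I j g) - (\<Sum>j\<in>J. \<kappa> j * I j p)"
      using zero[OF pl] by (simp add: I_def)
    also have "... = (\<Sum>j\<in>J. \<kappa> j * I j (%x. g x - p x))"
      unfolding sum_subtractf[symmetric]
    proof (rule sum.cong[OF refl])
      fix j assume "j \<in> J"
      from piece.I_diff[OF X[OF this] cg poly3_continuous[OF pl]]
      show "\<kappa> j * I j g - \<kappa> j * I j p = \<kappa> j * I j (%x. g x - p x)" by (simp add: I_def right_diff_distrib)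
    qed
    finally have "\<bar>\<kappa> j0 * I j0 g\<bar> = \<bar>\<Sum>j\<in>J. \<kappa> j * I j (%x. g x - p x)\<bar>" by simp
    also have "... \<le> (\<Sum>j\<in>J. \<bar>\<kappa> j * I j (%x. g x - p x)\<bar>)" by (rule sum_abs)
    also have "... \<le> (\<Sum>j\<in>J. \<bar>\<kappa> j\<bar> * (I j (%x. 1) * e))"
    proof (rule sum_mono)
      fix j assume j: "j \<in> J"
      have "\<bar>I j (%x. g x - p x)\<bar> \<le> I j (%x. 1) * e"
        unfolding I_def
        by (rule piece.I_bound[OF X[OF j] continuous_on_diff[OF cg poly3_continuous[OF pl]]])
          (use p(2) XS[OF j] in "auto simp: less_imp_le subset_iff")
      then show "\<bar>\<kappa> j * I j (%x. g x - p x)\<bar> \<le> \<bar>\<kappa> j\<bar> * (I j (%x. 1) * e)"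
        unfolding abs_mult by (rule mult_left_mono) simp
    qed
    also have "... = A * e" unfolding A_def by (simp add: sum_distrib_right mult.assoc)
    finally show ?thesis .
  qed
  have pos: "\<bar>\<kappa> j0 * I j0 g\<bar> > 0" using k gpos by simp
  have "A \<ge> 0" unfolding A_def I_def by (intro sum_nonneg mult_nonneg_nonneg) (auto simp: less_imp_le piece.I_1_pos[OF X])
  \<comment> \<open>With this choice of \<open>e\<close> the bound would be less than half of the
    quantity it is meant to dominate; \<open>A + 1\<close> keeps the denominator positive.\<close>
  then have "A * (\<bar>\<kappa> j0 * I j0 g\<bar> / (2 * (A + 1))) < \<bar>\<kappa> j0 * I j0 g\<bar>"
    using pos by (simp add: divide_simps)
  moreover have "\<bar>\<kappa> j0 * I j0 g\<bar> / (2 * (A + 1)) > 0" using pos \<open>A \<ge> 0\<close> by simp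
  ultimately show False using bound by (meson not_le)
qed

text \<open>The product of the squared distances to the points of \<open>V\<close>; each factor
  raises the degree by two.\<close>

lemma poly3_nonvanishing: "finite V ==> v \<notin> V ==> \<exists>l. \<exists>q\<in>poly3 l. (\<forall>w\<in>V. q w = 0) \<and> q v \<noteq> 0"
proof (induction V rule: finite_induct)
  case empty
  then show ?case using poly3_const[of 0 1] by (intro exI[of _ 0] bexI[of _ "%x. 1"]) auto
next
  case (insert w V)
  then obtain l q where q: "q \<in> poly3 l" "\<forall>w\<in>V. q w = 0" "q v \<noteq> 0" by auto
  have i: "(%x. - w + x) \<in> vpoly3 1" by (rule vpoly3_ident) simp
  have "(%x. ((- w + x) \<bullet> (- w + x)) * q x) \<in> poly3 (1 + 1 + l)"
    by (rule poly3_mult[OF vpoly3_dot[OF i i] q(1)])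
  then show ?case using q insert by (intro exI[of _ "1 + 1 + l"] bexI[of _ "%x. ((- w + x) \<bullet> (- w + x)) * q x"]) auto
qed

text \<open>Newton's scheme: the correction for a new point vanishes at all earlier ones.\<close>

lemma poly3_interpolation: "finite V ==> \<exists>l. \<exists>p\<in>poly3 l. \<forall>v\<in>V. p v = h v"
proof (induction V rule: finite_induct)
  case empty
  then show ?case using poly3_0 by blast
next
  case (insert v V)
  then obtain l p where p: "p \<in> poly3 l" "\<forall>v\<in>V. p v = h v" by blast
  obtain m q where q: "q \<in> poly3 m" "\<forall>w\<in>V. q w = 0" "q v \<noteq> 0" using poly3_nonvanishing[OF insert(1,2)] by blast
  have "(%x. p x + ((h v - p v) / q v) * q x) \<in> poly3 (max l m)"
    using poly3_mono[OF _ p(1)] poly3_mono[OF _ q(1)] by (intro poly3_add poly3_cmult) auto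
  then show ?case using p q by (intro exI[of _ "max l m"] bexI[of _ "%x. p x + ((h v - p v) / q v) * q x"]) auto
qed

section \<open>Euler operators\<close>

text \<open>The Taylor expansion about \<open>x0\<close> sorted by order. The homogeneous parts are
  eigenfunctions of the Euler operator, which can therefore be inverted order by order.\<close>

lemma poly3_homogeneous_parts:
  assumes "f \<in> poly3 l"
  shows "\<exists>h. (\<forall>j. h j \<in> poly3 (int j)) \<and> (\<forall>j. l < int j \<longrightarrow> h j = (%x. 0)) \<and> f = (%x. \<Sum>j\<le>nat l. h j x) \<and>
    (\<forall>j t y. h j (x0 + t *R y) = t ^ j * h j (x0 + y))"
  using assms
proof (induction l f rule: poly3_induct)
  case (const l c)
  show ?case
  proof (intro exI[of _ "%j x. if j = 0 then c else 0"] conjI allI impI)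
    show "(%x. if j = 0 then c else 0) \<in> poly3 (int j)" for j by (intro poly3_const) simp
    show "(%x. if j = 0 then c else 0) = (%x. 0)" if "l < int j" for j using const that by auto
  qed (auto simp: sum.delta)
next
  case (add l f g)
  obtain h where h: "!!j. h j \<in> poly3 (int j)" "!!j. l < int j ==> h j = (%x. 0)" "f = (%x. \<Sum>j\<le>nat l. h j x)"
    "!!j t y. h j (x0 + t *R y) = t ^ j * h j (x0 + y)" using add.IH(1) by blast
  obtain k where k: "!!j. k j \<in> poly3 (int j)" "!!j. l < int j ==> k j = (%x. 0)" "g = (%x. \<Sum>j\<le>nat l. k j x)"
    "!!j t y. k j (x0 + t *R y) = t ^ j * k j (x0 + y)" using add.IH(2) by blast
  show ?case
  proof (intro exI[of _ "%j x. h j x + k j x"] conjI allI impI)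
    show "(%x. h j x + k j x) \<in> poly3 (int j)" for j using h k by (intro poly3_add)
    show "(%x. h j x + k j x) = (%x. 0)" if "l < int j" for j using h(2)[OF that] k(2)[OF that] by simp
    show "(%x. f x + g x) = (%x. \<Sum>j\<le>nat l. h j x + k j x)" unfolding h(3) k(3) by (simp add: sum.distrib)
    show "h j (x0 + t *R y) + k j (x0 + t *R y) = t ^ j * (h j (x0 + y) + k j (x0 + y))" for j t y
      unfolding h(4) k(4) by (simp add: algebra_simps)
  qed
next
  case (mult l f i)
  obtain h where h: "!!j. h j \<in> poly3 (int j)" "!!j. l < int j ==> h j = (%x. 0)" "f = (%x. \<Sum>j\<le>nat l. h j x)"
    "!!j t y. h j (x0 + t *R y) = t ^ j * h j (x0 + y)" using mult.IH by blast
  \<comment> \<open>Splitting \<open>x $ i\<close> into \<open>x $ i - x0 $ i\<close>, homogeneous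
    of order one about \<open>x0\<close>, and the constant \<open>x0 $ i\<close>: the first shifts
    order \<open>j - 1\<close> to \<open>j\<close>, the second keeps the order.\<close>
  define k where "k j x = (if j = 0 then 0 else (x $ i + - x0 $ i) * h (j - 1) x) + x0 $ i * h j x" for j x
  have kS: "k (Suc j) x = (x $ i - x0 $ i) * h j x + x0 $ i * h (Suc j) x" for j x by (simp add: k_def)
  show ?case
  proof (intro exI[of _ k] conjI allI impI)
    have c: "(%x. x $ i + - x0 $ i) \<in> poly3 1" by (intro poly3_add poly3_coord poly3_const) auto
    show "k j \<in> poly3 (int j)" for j
    proof (cases j)
      case 0
      then show ?thesis using poly3_cmult[OF h(1)[of 0]] by (simp add: k_def[abs_def])
    next
      case (Suc m)
      have "(%x. (x $ i + - x0 $ i) * h m x + x0 $ i * h (Suc m) x) \<in> poly3 (int (Suc m))"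
        using poly3_mult[OF c h(1)[of m]] poly3_cmult[OF h(1)[of "Suc m"]] by (intro poly3_add) (auto simp: add.commute)
      then show ?thesis using Suc by (simp add: k_def[abs_def])
    qed
    show "k j = (%x. 0)" if "l + 1 < int j" for j
    proof (cases j)
      case (Suc m)
      then have "h m = (%x. 0)" "h (Suc m) = (%x. 0)" using that by (auto intro!: h(2))
      then show ?thesis using Suc by (simp add: k_def[abs_def])
    qed (use that mult.hyps in auto)
    have nl: "nat (l + 1) = Suc (nat l)" using mult.hyps by simp
    have top: "h (Suc (nat l)) x = 0" for x using h(2)[of "Suc (nat l)"] mult.hyps by (simp add: fun_eq_iff)
    have "(\<Sum>j\<le>nat (l + 1). k j x) = x $ i * f x" for x
    proof -
      have "(\<Sum>j\<le>nat (l + 1). k j x) = k 0 x + (\<Sum>j\<le>nat l. k (Suc j) x)"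
        unfolding nl by (rule sum.atMost_Suc_shift)
      also have "... = (x $ i - x0 $ i) * (\<Sum>j\<le>nat l. h j x) + x0 $ i * (h 0 x + (\<Sum>j\<le>nat l. h (Suc j) x))"
        unfolding kS by (simp add: k_def sum.distrib sum_distrib_left distrib_left)
      also have "h 0 x + (\<Sum>j\<le>nat l. h (Suc j) x) = (\<Sum>j\<le>Suc (nat l). h j x)" by (rule sum.atMost_Suc_shift[symmetric])
      also have "... = f x" by (simp add: h(3) top)
      finally show ?thesis unfolding h(3) by (simp add: algebra_simps)
    qed
    then show "(%x. x $ i * f x) = (%x. \<Sum>j\<le>nat (l + 1). k j x)" by simp
    show "k j (x0 + t *R y) = t ^ j * k j (x0 + y)" for j t y
      unfolding k_def h(4) by (cases j) (simp_all add: algebra_simps)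
  qed
qed

lemma has_derivative_along_ray:
  assumes "p \<in> poly3 l"
  shows "((%t. p (x0 + t *R y)) has_real_derivative dderiv p y (x0 + t *R y)) (at t)"
proof -
  have "((%t. x0 + t *R y) has_derivative (%h. h *R y)) (at t)" by (auto intro!: derivative_eq_intros)
  from has_derivative_compose[OF this poly3_has_dderiv[OF assms]]
  show ?thesis unfolding has_field_derivative_def
    by (simp add: linear_cmul[OF poly3_linear_dderiv[OF assms]] mult_commute_abs)
qed

lemma euler_homogeneous:
  assumes p: "p \<in> poly3 l" and h: "!!t y. p (x0 + t *R y) = t ^ j * p (x0 + y)"
  shows "dderiv p (x - x0) x = real j * p x"
proof -
  have 1: "((%t. p (x0 + t *R (x - x0))) has_real_derivative dderiv p (x - x0) x) (at 1)"
    using has_derivative_along_ray[OF p, of x0 "x - x0" 1] by simp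
  have "((%t. t ^ j * p x) has_real_derivative real j * p x) (at 1)"
    by (auto intro!: derivative_eq_intros)
  then have "((%t. p (x0 + t *R (x - x0))) has_real_derivative real j * p x) (at 1)"
    using h[of _ "x - x0"] by simp
  with 1 show ?thesis by (rule DERIV_unique)
qed

text \<open>Along each ray from \<open>x0\<close> the function
  \<open>t ^ c * p (x0 + t *R y)\<close> has derivative zero, and it vanishes at
  \<open>t = 0\<close> because \<open>c\<close> is positive.\<close>

lemma euler_injective:
  assumes p: "p \<in> poly3 l" and c: "0 < c" and z: "!!x. real c * p x + dderiv p (x - x0) x = 0"
  shows "p x = 0"
proof -
  define y where "y = x - x0"
  have d: "((%t. t ^ c * p (x0 + t *R y)) has_real_derivative 0) (at t)" for t
  proof -
    have "((%t. t ^ c * p (x0 + t *R y)) has_real_derivative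
        real c * t ^ (c - 1) * p (x0 + t *R y) + dderiv p y (x0 + t *R y) * t ^ c) (at t)"
      by (rule DERIV_mult[OF _ has_derivative_along_ray[OF p], THEN DERIV_cong]) (auto intro!: derivative_eq_intros)
    moreover have "real c * t ^ (c - 1) * p (x0 + t *R y) + dderiv p y (x0 + t *R y) * t ^ c =
        t ^ (c - 1) * (real c * p (x0 + t *R y) + dderiv p (t *R y) (x0 + t *R y))"
      using c by (simp add: linear_cmul[OF poly3_linear_dderiv[OF p]] power_eq_if algebra_simps)
    moreover have "real c * p (x0 + t *R y) + dderiv p (t *R y) (x0 + t *R y) = 0"
      using z[of "x0 + t *R y"] by simp
    ultimately show ?thesis by simp
  qed
  have "1 ^ c * p (x0 + 1 *R y) = 0 ^ c * p (x0 + 0 *R y)"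
    by (rule DERIV_isconst_all) (use d in blast)
  then show ?thesis using c by (simp add: y_def)
qed

lemma zero_dderiv_const:
  assumes p: "p \<in> poly3 l" and z: "!!v x. dderiv p v x = 0"
  shows "p x = p y"
proof -
  have "((%t. p (y + t *R (x - y))) has_real_derivative 0) (at t)" for t
    using has_derivative_along_ray[OF p, of y "x - y" t] z by simp
  then have "p (y + 1 *R (x - y)) = p (y + 0 *R (x - y))"
    by (intro DERIV_isconst_all) blast
  then show ?thesis by simp
qed

text \<open>The commutator of a directional derivative with the Euler operator is that derivative
  itself. This is the identity behind the homotopy construction of a potential.\<close>

lemma dderiv_euler:
  assumes p: "p \<in> poly3 l"
  shows "dderiv (%x. dderiv p (x - x0) x) v x = dderiv p v x + dderiv (%x. dderiv p v x) (x - x0) x"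
proof -
  have e: "dderiv p y x = (\<Sum>i\<in>UNIV. y $ i * dderiv p (axis i 1) x)" for y x
    using grad_inner[OF poly3_differentiable[OF p], of x y]
    by (simp add: grad_within_def inner_vec_def mult.commute)
  have d1: "(%x. dderiv p (axis i 1) x) differentiable at x" for i
    by (rule poly3_differentiable[OF poly3_dderiv[OF p]])
  have d2: "((%x. (x - x0) $ i * dderiv p (axis i 1) x) has_derivative
      (%v. (x - x0) $ i * dderiv (%x. dderiv p (axis i 1) x) v x + v $ i * dderiv p (axis i 1) x)) (at x)" for i
  proof (rule has_derivative_mult)
    have "((%x. x - x0) has_derivative (%v. v)) (at x)" by (auto intro!: derivative_eq_intros)
    then show "((%x. (x - x0) $ i) has_derivative (%v. v $ i)) (at x)"
      by (rule bounded_linear.has_derivative[OF bounded_linear_vec_nth])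
    show "((%x. dderiv p (axis i 1) x) has_derivative (%v. dderiv (%x. dderiv p (axis i 1) x) v x)) (at x)"
      using d1 by (simp add: frechet_derivative_works)
  qed
  have "((%x. \<Sum>i\<in>UNIV. (x - x0) $ i * dderiv p (axis i 1) x) has_derivative
      (%v. \<Sum>i\<in>UNIV. (x - x0) $ i * dderiv (%x. dderiv p (axis i 1) x) v x + v $ i * dderiv p (axis i 1) x)) (at x)"
    by (rule has_derivative_sum) (rule d2)
  moreover have "(%x. dderiv p (x - x0) x) = (%x. \<Sum>i\<in>UNIV. (x - x0) $ i * dderiv p (axis i 1) x)"
    by (rule ext) (rule e)
  ultimately have "dderiv (%x. dderiv p (x - x0) x) v x =
      (\<Sum>i\<in>UNIV. (x - x0) $ i * dderiv (%x. dderiv p (axis i 1) x) v x + v $ i * dderiv p (axis i 1) x)"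
    by (simp only:) (rule dderiv_eq)
  also have "... = (\<Sum>i\<in>UNIV. (x - x0) $ i * dderiv (%x. dderiv p v x) (axis i 1) x) + dderiv p v x"
    unfolding e[of x v] poly3_dderiv_commute[OF p, where w = v] by (simp add: sum.distrib)
  also have "(\<Sum>i\<in>UNIV. (x - x0) $ i * dderiv (%x. dderiv p v x) (axis i 1) x) = dderiv (%x. dderiv p v x) (x - x0) x"
    using grad_inner[OF poly3_differentiable[OF poly3_dderiv[OF p]], of v x "x - x0"]
    by (simp add: grad_within_def inner_vec_def mult.commute)
  finally show ?thesis by simp
qed

context piece
begin

text \<open>On the part of order \<open>j\<close> about \<open>x0\<close> the operator multiplies by
  \<open>c + j\<close>, so it is inverted by division. The only obstruction is \<open>c = 0\<close>
  on the constant part, which is \<open>g x0\<close>. Projecting the homogeneous parts onto the hull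
  keeps the solution in \<open>Poly l X\<close>.\<close>

lemma euler_surjective:
  assumes g: "g \<in> Poly l X" and x0: "x0 \<in> affine hull X" and c: "0 < c \<or> g x0 = 0"
  shows "\<exists>p\<in>Poly l X. \<forall>x. real c * p x + dderiv p (x - x0) x = g x"
proof -
  obtain h where h: "!!j. h j \<in> poly3 (int j)" "!!j. l < int j ==> h j = (%x. 0)" "g = (%x. \<Sum>j\<le>nat l. h j x)"
    "!!j t y. h j (x0 + t *R y) = t ^ j * h j (x0 + y)"
    using poly3_homogeneous_parts[OF Poly_poly3[OF g], of x0] by blast
  define k where "k j x = h j (hull_proj X x)" for j x
  have kP: "k j \<in> Poly (int j) X" for j unfolding k_def[abs_def] by (rule Poly_restrict[OF h(1)])
  have hp: "hull_proj X (x0 + t *R y) = x0 + t *R L y" for t y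
    using hull_proj_diff[of "x0 + t *R y" x0] hull_proj_id[OF x0] by (simp add: linear_cmul[OF linear_L] algebra_simps)
  have hp1: "hull_proj X (x0 + y) = x0 + L y" for y using hp[of 1 y] by simp
  have kh: "k j (x0 + t *R y) = t ^ j * k j (x0 + y)" for j t y
    by (simp only: k_def hp1 linear_cmul[OF linear_L] h(4))
  have gk: "g x = (\<Sum>j\<le>nat l. k j x)" for x
    using Poly_hull_proj[OF g, of x] unfolding h(3) k_def by simp
  have kl: "k j \<in> Poly l X" for j
  proof (cases "l < int j")
    case True
    then show ?thesis using h(2)[OF True] by (simp add: k_def[abs_def] Poly_0)
  next
    case False
    then show ?thesis by (intro Poly_mono[OF _ kP]) simp
  qed
  have k0: "k 0 x = 0" if "c = 0" for x
  proof -
    have "k j x0 = (if j = 0 then k 0 x else 0)" for j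
      using kh[of j 0 "x - x0"] by simp
    then have "g x0 = k 0 x" unfolding gk by (simp add: sum.delta)
    then show ?thesis using c that by simp
  qed
  \<comment> \<open>For \<open>c = j = 0\<close> the coefficient is \<open>1 / 0 = 0\<close>; by
    \<open>k0\<close> the corresponding part is zero anyway.\<close>
  define p where "p x = (\<Sum>j\<le>nat l. (1 / real (c + j)) * k j x)" for x
  have pP: "p \<in> Poly l X" unfolding p_def[abs_def] by (intro Poly_sum Poly_cmult kl)
  have "real c * p x + dderiv p (x - x0) x = g x" for x
  proof -
    have "dderiv p (x - x0) x = (\<Sum>j\<le>nat l. dderiv (%x. (1 / real (c + j)) * k j x) (x - x0) x)"
      unfolding p_def[abs_def] by (rule dderiv_sum) (rule Poly_differentiable[OF Poly_cmult[OF kP]])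
    also have "... = (\<Sum>j\<le>nat l. (1 / real (c + j)) * (real j * k j x))"
      by (rule sum.cong[OF refl], subst dderiv_cmult[OF Poly_differentiable[OF kP]])
        (simp add: euler_homogeneous[OF Poly_poly3[OF kP] kh])
    finally have D: "dderiv p (x - x0) x = (\<Sum>j\<le>nat l. (1 / real (c + j)) * (real j * k j x))" .
    have "real c * p x + dderiv p (x - x0) x = (\<Sum>j\<le>nat l. (1 / real (c + j)) * (real (c + j) * k j x))"
      unfolding D unfolding p_def sum_distrib_left sum.distrib[symmetric]
      by (rule sum.cong[OF refl]) (simp add: distrib_left distrib_right)
    also have "... = (\<Sum>j\<le>nat l. k j x)"
    proof (rule sum.cong[OF refl])
      fix j
      show "(1 / real (c + j)) * (real (c + j) * k j x) = k j x"
        using k0 by (cases "c + j = 0") auto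
    qed
    finally show ?thesis by (simp add: gk)
  qed
  with pP show ?thesis by blast
qed

end

section \<open>Decomposition of tangential polynomial fields\<close>

lemma linear_cross_left: "linear (%v. cross3 v n)"
  by (rule linearI) (simp_all add: cross_add_left cross_mult_left)

lemma linear_cross_right: "linear (%v. cross3 n v)"
  by (rule linearI) (simp_all add: cross_add_right cross_mult_right)

context hho_mesh
begin

section \<open>Rotated gradients and tangential traces on faces\<close>

lemma normal_sq: "F \<in> faces M ==> nF F \<bullet> nF F = 1"
  using normal_unit by (simp add: norm_eq_1)

lemma face_dderiv_normal: "F \<in> faces M ==> q \<in> Poly l F ==> dderiv q (nF F) x = 0"
proof -
  assume F: "F \<in> faces M" and q: "q \<in> Poly l F"
  interpret F: piece F "face_chart F" by (rule piece_face[OF F])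
  show ?thesis using F.Poly_dderiv_L[OF q, where v = "nF F" and x = x]
    by (simp add: face_L_normal[OF F] linear_0[OF poly3_linear_dderiv[OF F.Poly_poly3[OF q]]])
qed

lemma vrot_tPoly: "F \<in> faces M ==> q \<in> Poly l F ==> vrot (nF F) q \<in> tPoly M (l - 1) F"
proof -
  assume F: "F \<in> faces M" and q: "q \<in> Poly l F"
  interpret F: piece F "face_chart F" by (rule piece_face[OF F])
  show ?thesis unfolding tPoly_def vrot_def[abs_def]
    using F.vPoly_linear[OF F.grad_vPoly[OF q] linear_cross_left] by (simp add: dot_cross_self)
qed

lemma vrot_inner_cross:
  assumes F: "F \<in> faces M" and q: "q \<in> Poly l F" and t: "nF F \<bullet> t = 0"
  shows "vrot (nF F) q x \<bullet> cross3 (nF F) t = - dderiv q t x"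
    and "vrot (nF F) q x \<bullet> t = dderiv q (cross3 (nF F) t) x"
proof -
  interpret F: piece F "face_chart F" by (rule piece_face[OF F])
  note g = grad_inner[OF F.Poly_differentiable[OF q]]
  show "vrot (nF F) q x \<bullet> cross3 (nF F) t = - dderiv q t x"
    unfolding vrot_def dot_cross normal_sq[OF F] t g by simp
  show "vrot (nF F) q x \<bullet> t = dderiv q (cross3 (nF F) t) x"
    unfolding vrot_def g[symmetric] by (metis cross_triple inner_commute)
qed

lemma vrot_edge_normal:
  "F \<in> faces M ==> E \<in> edgesF F ==> q \<in> Poly l F ==>
    vrot (nF F) q x \<bullet> nFE F E = - dderiv q (tE E) x"
  unfolding edge_normal_def by (rule vrot_inner_cross(1)) (auto intro: normal_tangent)

lemma divg_vrot: "F \<in> faces M ==> q \<in> Poly l F ==> divg (vrot (nF F) q) x = 0"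
proof -
  assume F: "F \<in> faces M" and q: "q \<in> Poly l F"
  interpret F: piece F "face_chart F" by (rule piece_face[OF F])
  obtain t where t: "norm t = 1" "nF F \<bullet> t = 0" using unit_orthogonal_exists by blast
  have d: "(%x. dderiv q v x) differentiable at x" for v
    by (rule F.Poly_differentiable[OF F.Poly_dderiv[OF q]])
  have "dderiv (%x. - dderiv q t x) w x = - dderiv (%x. dderiv q t x) w x" for w
    using dderiv_cmult[OF d, of "-1" t w] by simp
  then show ?thesis
    unfolding divg_tangential[OF F tPolyD(1)[OF F vrot_tPoly[OF F q]] t] vrot_inner_cross[OF F q t(2)]
    using poly3_dderiv_commute[OF F.Poly_poly3[OF q]] by simp
qed

text \<open>Prepares Stokes' theorem for circulations: with \<open>face_stokes\<close>, the flux of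
  \<open>curl r\<close> through a face becomes the signed sum of the integrals of
  \<open>r \<bullet> t_E\<close> over its edges. The trace is extended constantly along the normal,
  which leaves tangential derivatives unchanged.\<close>

lemma tangential_trace:
  assumes F: "F \<in> faces M" and r: "r \<in> vpoly3 l"
  shows "(%x. cross3 (r (hull_proj F x)) (nF F)) \<in> tPoly M l F"
    and "x \<in> affine hull F ==> divg (%x. cross3 (r (hull_proj F x)) (nF F)) x = curl r x \<bullet> nF F"
    and "E \<in> edgesF F ==> cross3 v (nF F) \<bullet> nFE F E = - (v \<bullet> tE E)"
proof -
  interpret F: piece F "face_chart F" by (rule piece_face[OF F])
  let ?n = "nF F"
  let ?r = "%x. r (hull_proj F x)"
  have rP: "?r \<in> vPoly l F" by (rule F.vPoly_restrict[OF r])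
  show t1: "(%x. cross3 (r (hull_proj F x)) ?n) \<in> tPoly M l F"
    unfolding tPoly_def using F.vPoly_linear[OF rP linear_cross_left] by (simp add: dot_cross_self)
  show "cross3 v ?n \<bullet> nFE F E = - (v \<bullet> tE E)" if "E \<in> edgesF F"
    unfolding edge_normal_def dot_cross normal_sq[OF F] normal_tangent[OF F that] by simp
  assume x: "x \<in> affine hull F"
  obtain t where t: "norm t = 1" "?n \<bullet> t = 0" using unit_orthogonal_exists by blast
  let ?w = "cross3 ?n t"
  have tt: "t \<bullet> t = 1" using t(1) by (simp add: norm_eq_1)
  have nw: "cross3 t ?w = ?n" using t(2) tt by (simp add: Lagrange inner_commute)
  have c1: "cross3 u ?n \<bullet> t = u \<bullet> ?w" for u by (metis cross_triple inner_commute)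
  have c2: "cross3 u ?n \<bullet> ?w = - (u \<bullet> t)" for u unfolding dot_cross normal_sq[OF F] t(2) by simp
  have d: "?r differentiable at x" for x by (rule F.vPoly_differentiable[OF rP])
  have dv: "dderiv ?r v x = dderiv r v x" if "?n \<bullet> v = 0" for v
  proof -
    have "dderiv (%x. r ((isometric_chart F (0::real^2) - F.L (isometric_chart F (0::real^2))) + F.L x)) v x =
        dderiv r (F.L v) ((isometric_chart F (0::real^2) - F.L (isometric_chart F (0::real^2))) + F.L x)"
      by (rule dderiv_comp_affine[OF vpoly3_differentiable[OF r] F.linear_L])
    then show ?thesis unfolding F.hull_proj_affine[symmetric] F.hull_proj_id[OF x] face_L[OF F that] .
  qed
  have nw0: "?n \<bullet> ?w = 0" by (simp add: dot_cross_self)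
  have m: "dderiv (%x. - (?r x \<bullet> t)) ?w x = - dderiv (%x. ?r x \<bullet> t) ?w x"
    using dderiv_cmult[OF poly3_differentiable[OF vpoly3_inner[OF F.vPoly_vpoly3[OF rP]]], of "-1"] by simp
  have "divg (%x. cross3 (r (hull_proj F x)) ?n) x = dderiv ?r t x \<bullet> ?w - dderiv ?r ?w x \<bullet> t"
    unfolding divg_tangential[OF F tPolyD(1)[OF F t1] t] c1 c2 m by (simp add: dderiv_inner[OF d])
  also have "... = curl r x \<bullet> cross3 t ?w"
    unfolding curl_cross[OF vpoly3_differentiable[OF r]] dv[OF t(2)] dv[OF nw0] ..
  finally show "divg (%x. cross3 (r (hull_proj F x)) ?n) x = curl r x \<bullet> ?n" unfolding nw .
qed

lemma face_point_in: "F \<in> faces M ==> face_point M F \<in> affine hull F"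
  using adm hull_inc unfolding admissible_points_def by metis

lemma cell_point_in: "T \<in> cells M ==> cell_point M T \<in> affine hull T"
  using cellD(5) by simp

section \<open>Radial fields and their divergence\<close>

lemma face_radial:
  assumes F: "F \<in> faces M" and p: "p \<in> Poly l F"
  shows "(%x. p x *R (hull_proj F x - face_point M F)) \<in> tPoly M (l + 1) F"
    and "divg (%x. p x *R (hull_proj F x - face_point M F)) x = 2 * p x + dderiv p (x - face_point M F) x"
proof -
  interpret F: piece F "face_chart F" by (rule piece_face[OF F])
  let ?c = "face_point M F" and ?n = "nF F"
  note c = face_point_in[OF F]
  have tang: "(hull_proj F x - ?c) \<bullet> ?n = 0" for x
    using normal_perp_hull[OF F F.hull_proj_in c] by (simp add: inner_commute)
  show P: "(%x. p x *R (hull_proj F x - ?c)) \<in> tPoly M (l + 1) F"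
    unfolding tPoly_def using F.vPoly_radial[OF c p] tang by simp
  obtain t where t: "norm t = 1" "?n \<bullet> t = 0" using unit_orthogonal_exists by blast
  let ?w = "cross3 ?n t"
  have w: "?n \<bullet> ?w = 0" by (simp add: dot_cross_self)
  have hp: "(p x *R (hull_proj F x - ?c)) \<bullet> v = p x * ((x - ?c) \<bullet> v)" if "?n \<bullet> v = 0" for v x
  proof -
    have "(hull_proj F x - ?c) \<bullet> v = F.L (x - ?c) \<bullet> v" using F.hull_proj_diff[of x ?c] F.hull_proj_id[OF c] by simp
    also have "... = (x - ?c) \<bullet> v" unfolding F.L_inner face_L[OF F that] ..
    finally show ?thesis by simp
  qed
  have D: "dderiv (%x. p x * ((x - ?c) \<bullet> v)) v x = p x * (v \<bullet> v) + dderiv p v x * ((x - ?c) \<bullet> v)" for v x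
  proof -
    have "((%x. (x - ?c) \<bullet> v) has_derivative (%u. u \<bullet> v)) (at x)" by (auto intro!: derivative_eq_intros)
    from has_derivative_mult[OF poly3_has_dderiv[OF F.Poly_poly3[OF p]] this]
    show ?thesis by (rule dderiv_eq)
  qed
  have fr: "dderiv p (x - ?c) x = dderiv p t x * ((x - ?c) \<bullet> t) + dderiv p ?w x * ((x - ?c) \<bullet> ?w)"
  proof -
    note l = poly3_linear_dderiv[OF F.Poly_poly3[OF p]]
    have "dderiv p (x - ?c) x = dderiv p (((x - ?c) \<bullet> t) *R t + ((x - ?c) \<bullet> ?w) *R ?w + ((x - ?c) \<bullet> ?n) *R ?n) x"
      using cross_frame(1)[OF normal_unit[OF F] t, of "x - ?c"] by simp
    then show ?thesis unfolding linear_add[OF l] linear_cmul[OF l] face_dderiv_normal[OF F p] by simp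
  qed
  have "t \<bullet> t = 1" "?w \<bullet> ?w = 1" using t(1) cross_frame(2)[OF normal_unit[OF F] t] by (simp_all add: norm_eq_1)
  then show "divg (%x. p x *R (hull_proj F x - ?c)) x = 2 * p x + dderiv p (x - ?c) x"
    unfolding divg_tangential[OF F tPolyD(1)[OF F P] t] hp[OF t(2)] hp[OF w] D fr by simp
qed

lemma Rc_face_tPoly: "F \<in> faces M ==> s \<in> Rc_face M l F ==> s \<in> tPoly M l F"
  using face_radial(1)[of F _ "l - 1"] by (auto simp: Rc_face_def)

text \<open>The divergence of \<open>p\<close> times the radial field is the Euler operator with
  constant 2, the dimension of a face, applied to \<open>p\<close>; on cells the constant is 3. Both
  are positive, so the operator is bijective.\<close>

lemma Rc_face_div_surj:
  assumes F: "F \<in> faces M" and g: "g \<in> Poly (l - 1) F"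
  shows "\<exists>s\<in>Rc_face M l F. divg s = g"
proof -
  interpret F: piece F "face_chart F" by (rule piece_face[OF F])
  obtain p where p: "p \<in> Poly (l - 1) F" "!!x. real 2 * p x + dderiv p (x - face_point M F) x = g x"
    using F.euler_surjective[OF g face_point_in[OF F], of 2] by auto
  have "(%x. p x *R (hull_proj F x - face_point M F)) \<in> Rc_face M l F" unfolding Rc_face_def using p(1) by blast
  moreover have "divg (%x. p x *R (hull_proj F x - face_point M F)) = g"
    using face_radial(2)[OF F p(1)] p(2) by auto
  ultimately show ?thesis by blast
qed

lemma Rc_face_div_inj:
  assumes F: "F \<in> faces M" and s: "s \<in> Rc_face M l F" and z: "!!x. divg s x = 0"
  shows "s = (%x. 0)"
proof -
  interpret F: piece F "face_chart F" by (rule piece_face[OF F])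
  obtain p where p: "p \<in> Poly (l - 1) F" "s = (%x. p x *R (hull_proj F x - face_point M F))"
    using s unfolding Rc_face_def by blast
  have e: "real 2 * p x + dderiv p (x - face_point M F) x = 0" for x
    using z[of x] face_radial(2)[OF F p(1), of x] p(2) by simp
  have "p x = 0" for x by (rule euler_injective[OF F.Poly_poly3[OF p(1)] _ e]) simp
  then show ?thesis using p(2) by simp
qed

lemma cell_radial:
  assumes T: "T \<in> cells M" and p: "p \<in> poly3 l"
  shows "(%x. p x *R (x - a)) \<in> vpoly3 (l + 1)"
    and "divg (%x. p x *R (x - a)) x = 3 * p x + dderiv p (x - a) x"
proof -
  have i: "(%x. - a + x) \<in> vpoly3 1" by (rule vpoly3_ident) simp
  show P: "(%x. p x *R (x - a)) \<in> vpoly3 (l + 1)" using vpoly3_mult[OF p i] by simp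
  have "dderiv (%x. (p x *R (x - a)) $ i) (axis i 1) x = p x + dderiv p (axis i 1) x * (x - a) $ i" for i
  proof -
    have "((%x. x - a) has_derivative (%u. u)) (at x)" by (auto intro!: derivative_eq_intros)
    then have "((%x. (x - a) $ i) has_derivative (%u. u $ i)) (at x)"
      by (rule bounded_linear.has_derivative[OF bounded_linear_vec_nth])
    from has_derivative_mult[OF poly3_has_dderiv[OF p] this]
    have "dderiv (%x. p x * (x - a) $ i) (axis i 1) x = p x * axis i 1 $ i + dderiv p (axis i 1) x * (x - a) $ i"
      by (rule dderiv_eq)
    then show ?thesis by simp
  qed
  moreover have "dderiv p (x - a) x = (\<Sum>i\<in>UNIV. dderiv p (axis i 1) x * (x - a) $ i)"
    using grad_inner[OF poly3_differentiable[OF p], of x "x - a"] by (simp add: grad_within_def inner_vec_def)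
  ultimately show "divg (%x. p x *R (x - a)) x = 3 * p x + dderiv p (x - a) x"
    unfolding divg_nth[OF P] by (simp add: sum.distrib)
qed

lemma Rc_cell_vpoly3: "T \<in> cells M ==> s \<in> Rc_cell M l T ==> s \<in> vpoly3 l"
proof -
  assume T: "T \<in> cells M" and s: "s \<in> Rc_cell M l T"
  interpret T: piece T "%x. x" by (rule piece_cell[OF T])
  obtain p where "p \<in> Poly (l - 1) T" "s = (%x. p x *R (x - cell_point M T))" using s unfolding Rc_cell_def by blast
  then show ?thesis using cell_radial(1)[OF T T.Poly_poly3, of p "l - 1"] by simp
qed

lemma Rc_cell_div_surj:
  assumes T: "T \<in> cells M" and g: "g \<in> Poly (l - 1) T"
  shows "\<exists>s\<in>Rc_cell M l T. divg s = g"
proof -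
  interpret T: piece T "%x. x" by (rule piece_cell[OF T])
  obtain p where p: "p \<in> Poly (l - 1) T" "!!x. real 3 * p x + dderiv p (x - cell_point M T) x = g x"
    using T.euler_surjective[OF g cell_point_in[OF T], of 3] by auto
  have "(%x. p x *R (x - cell_point M T)) \<in> Rc_cell M l T" unfolding Rc_cell_def using p(1) by blast
  moreover have "divg (%x. p x *R (x - cell_point M T)) = g"
    using cell_radial(2)[OF T T.Poly_poly3[OF p(1)]] p(2) by auto
  ultimately show ?thesis by blast
qed

text \<open>
  A potential \<open>q\<close> of the rotated field \<open>n \<times> r\<close> is obtained by inverting the Euler operator on its radial
  component; it is a potential because \<open>n \<times> r\<close> has a symmetric tangential derivative.
\<close>

lemma divergence_free_is_rot:
  assumes F: "F \<in> faces M" and r: "r \<in> tPoly M l F" and z: "!!x. divg r x = 0"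
  shows "\<exists>q\<in>Poly (l + 1) F. r = vrot (nF F) q"
proof -
  interpret F: piece F "face_chart F" by (rule piece_face[OF F])
  let ?n = "nF F" and ?c = "face_point M F"
  note c = face_point_in[OF F]
  define w where "w x = cross3 ?n (r x)" for x
  note r' = tPolyD[OF F r]
  have wP: "w \<in> vPoly l F" unfolding w_def[abs_def] by (rule F.vPoly_linear[OF r'(1) linear_cross_right])
  have wn: "?n \<bullet> w x = 0" for x by (simp add: w_def dot_cross_self)
  define u where "u x = w x \<bullet> (x - ?c)" for x
  have uP: "u \<in> Poly (l + 1) F"
  proof -
    have e: "u x = w x \<bullet> (hull_proj F x - ?c)" for x
    proof -
      have "w x \<bullet> (hull_proj F x - ?c) = w x \<bullet> F.L (x - ?c)" using F.hull_proj_diff[of x ?c] F.hull_proj_id[OF c] by simp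
      also have "... = w x \<bullet> (x - ?c)" unfolding F.L_inner[symmetric] face_L[OF F wn] ..
      finally show ?thesis by (simp add: u_def)
    qed
    have "(%x. - ?c + hull_proj F x) \<in> vPoly 1 F" using F.vPoly_restrict[OF vpoly3_ident[of 1 "- ?c"]] by simp
    then have "(%x. w x \<bullet> (- ?c + hull_proj F x)) \<in> poly3 (l + 1)"
      by (intro vpoly3_dot F.vPoly_vpoly3 wP)
    then have "u \<in> poly3 (l + 1)" unfolding e[abs_def] by simp
    then show ?thesis unfolding F.Poly_iff by (simp add: e F.vPoly_hull_proj[OF wP])
  qed
  have "u ?c = 0" by (simp add: u_def)
  then obtain q where q: "q \<in> Poly (l + 1) F" "!!x. dderiv q (x - ?c) x = u x"
    using F.euler_surjective[OF uP c, of 0] by auto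
  note q3 = F.Poly_poly3[OF q(1)] and w3 = F.vPoly_vpoly3[OF wP]
  note dw = F.vPoly_differentiable[OF wP] and dr = F.vPoly_differentiable[OF r'(1)]
  obtain t where t: "norm t = 1" "?n \<bullet> t = 0" using unit_orthogonal_exists by blast
  let ?w = "cross3 ?n t"
  have Dw: "dderiv w v x = cross3 ?n (dderiv r v x)" for v x
    unfolding w_def[abs_def]
    by (rule dderiv_bounded_linear[OF dr]) (rule linear_conv_bounded_linear[THEN iffD1, OF linear_cross_right])
  have Dn: "dderiv w ?n x = 0" for x
    using F.vPoly_dderiv_L[OF wP, where v = ?n and x = x] linear_0[OF linear_dderiv[OF dw]] by (simp add: face_L_normal[OF F])
  \<comment> \<open>\<open>AB\<close> equates the two off-diagonal entries of the tangential
    derivative of \<open>w\<close>: rotation by \<open>n\<close> turns them into the two terms of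
    the divergence of \<open>r\<close>, one of them with a minus sign.\<close>
  have sym: "dderiv w v x \<bullet> y = dderiv w y x \<bullet> v" if v: "?n \<bullet> v = 0" for v x y
  proof -
    note l = linear_dderiv[OF dw]
    let ?A = "dderiv w t x" and ?B = "dderiv w ?w x"
    have An: "?A \<bullet> ?n = 0" "?B \<bullet> ?n = 0" by (simp_all add: Dw dot_cross_self)
    have AB: "?A \<bullet> ?w = ?B \<bullet> t"
    proof -
      have "?A \<bullet> ?w = dderiv r t x \<bullet> t" unfolding Dw dot_cross normal_sq[OF F] t(2) by simp
      moreover have "?B \<bullet> t = - (dderiv r ?w x \<bullet> ?w)"
        unfolding Dw by (metis cross_skew cross_triple inner_commute inner_minus_right)
      moreover have "dderiv r t x \<bullet> t + dderiv r ?w x \<bullet> ?w = 0"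
        using z[of x] unfolding divg_tangential[OF F r'(1) t] by (simp add: dderiv_inner[OF dr])
      ultimately show ?thesis by simp
    qed
    have fv: "v = (v \<bullet> t) *R t + (v \<bullet> ?w) *R ?w"
      using cross_frame(1)[OF normal_unit[OF F] t, of v] v by (simp add: inner_commute)
    have fy: "y = (y \<bullet> t) *R t + (y \<bullet> ?w) *R ?w + (y \<bullet> ?n) *R ?n"
      by (rule cross_frame(1)[OF normal_unit[OF F] t])
    have Dv: "dderiv w v x = (v \<bullet> t) *R ?A + (v \<bullet> ?w) *R ?B"
      by (subst fv) (simp only: linear_add[OF l] linear_cmul[OF l])
    have Dy: "dderiv w y x = (y \<bullet> t) *R ?A + (y \<bullet> ?w) *R ?B"
      by (subst fy) (simp only: linear_add[OF l] linear_cmul[OF l] Dn, simp)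
    have Ay: "a \<bullet> y = (y \<bullet> t) * (a \<bullet> t) + (y \<bullet> ?w) * (a \<bullet> ?w)" if "a \<bullet> ?n = 0" for a
      by (subst fy) (simp add: inner_add_right that)
    have Av: "a \<bullet> v = (v \<bullet> t) * (a \<bullet> t) + (v \<bullet> ?w) * (a \<bullet> ?w)" for a
      by (subst fv) (simp only: inner_add_right inner_scaleR_right)
    show ?thesis
      unfolding Dv Dy inner_add_left inner_scaleR_left Ay[OF An(1)] Ay[OF An(2)] Av[of ?A] Av[of ?B] AB
      by (simp add: algebra_simps)
  qed
  have pot: "dderiv q v x = w x \<bullet> v" if v: "?n \<bullet> v = 0" for v x
  proof -
    have e3: "(%x. dderiv q v x - w x \<bullet> v) \<in> poly3 l"
      using poly3_dderiv[OF q3] vpoly3_inner[OF w3] by (intro poly3_diff) auto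
    have "dderiv q v x - w x \<bullet> v = 0"
    \<comment> \<open>The defect \<open>D_v q - w \<bullet> v\<close> solves the homogeneous Euler
      equation with constant 1: differentiate the equation defining \<open>q\<close> along
      \<open>v\<close>, with the commutator relation on one side and the symmetry of the derivative
      of \<open>w\<close> on the other.\<close>
    proof (rule euler_injective[OF e3, of 1 ?c])
      fix x
      have "dderiv u v x = dderiv q v x + dderiv (%x. dderiv q v x) (x - ?c) x"
        using dderiv_euler[OF q3, of ?c x v] unfolding q(2) .
      moreover have "dderiv u v x = w x \<bullet> v + dderiv w v x \<bullet> (x - ?c)"
      proof -
        have "(w has_derivative (%v. dderiv w v x)) (at x)" using dw by (simp add: frechet_derivative_works)
        moreover have "((%x. x - ?c) has_derivative (%v. v)) (at x)" by (auto intro!: derivative_eq_intros)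
        ultimately have "((%x. w x \<bullet> (x - ?c)) has_derivative (%v. w x \<bullet> v + dderiv w v x \<bullet> (x - ?c))) (at x)"
          by (rule has_derivative_inner)
        then show ?thesis unfolding u_def[abs_def] by (rule dderiv_eq)
      qed
      moreover have "dderiv (%x. dderiv q v x - w x \<bullet> v) (x - ?c) x =
          dderiv (%x. dderiv q v x) (x - ?c) x - dderiv w (x - ?c) x \<bullet> v"
        unfolding dderiv_inner[OF dw]
        by (rule dderiv_diff) (rule poly3_differentiable[OF poly3_dderiv[OF q3]], rule poly3_differentiable[OF vpoly3_inner[OF w3]])
      ultimately show "real 1 * (dderiv q v x - w x \<bullet> v) + dderiv (%x. dderiv q v x - w x \<bullet> v) (x - ?c) x = 0"
        using sym[OF v, of x "x - ?c"] by simp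
    qed simp
    then show ?thesis by simp
  qed
  have "grad q x = w x" for x
  proof -
    note g = grad_inner[OF poly3_differentiable[OF q3]]
    have "grad q x \<bullet> t = w x \<bullet> t" "grad q x \<bullet> ?w = w x \<bullet> ?w" "grad q x \<bullet> ?n = w x \<bullet> ?n"
      unfolding g using pot t(2) face_dderiv_normal[OF F q(1)] wn by (simp_all add: dot_cross_self inner_commute)
    then show ?thesis
      using cross_frame(1)[OF normal_unit[OF F] t, of "grad q x"] cross_frame(1)[OF normal_unit[OF F] t, of "w x"] by simp
  qed
  moreover have "cross3 (w x) ?n = r x" for x
  proof -
    have "cross3 (w x) ?n = - cross3 ?n (cross3 ?n (r x))" unfolding w_def by (rule cross_skew)
    also have "... = r x" unfolding Lagrange normal_sq[OF F] using r'(2)[of x] by (simp add: inner_commute)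
    finally show ?thesis .
  qed
  ultimately have "r = vrot ?n q" by (simp add: vrot_def[abs_def])
  with q(1) show ?thesis by blast
qed

text \<open>Choose \<open>s\<close> with the divergence of \<open>r\<close>; the remainder is
  divergence free and hence a rotated gradient. The potential is normalised to mean zero, which
  stays in the space since \<open>-1 \<le> l\<close> puts constants into degree
  \<open>l + 1\<close>.\<close>

lemma tPoly_decomposition:
  assumes F: "F \<in> faces M" and l: "-1 \<le> l" and r: "r \<in> tPoly M l F"
  shows "\<exists>q\<in>Poly0_face (l + 1) F. \<exists>s\<in>Rc_face M l F. r = (%x. vrot (nF F) q x + s x)"
proof -
  interpret F: piece F "face_chart F" by (rule piece_face[OF F])
  note r' = tPolyD[OF F r]
  obtain s where s: "s \<in> Rc_face M l F" "divg s = divg r"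
    using Rc_face_div_surj[OF F F.divg_Poly[OF r'(1)]] by blast
  note s' = Rc_face_tPoly[OF F s(1)]
  have d: "(%x. r x - s x) \<in> tPoly M l F"
    using r s' F.vPoly_diff by (auto simp: tPoly_def inner_diff_left)
  have "divg (%x. r x - s x) x = divg r x - divg s x" for x
    unfolding divg_def using dderiv_diff[OF F.vPoly_differentiable[OF r'(1)] F.vPoly_differentiable[OF tPolyD(1)[OF F s']]]
    by (simp add: sum_subtractf)
  then have "divg (%x. r x - s x) x = 0" for x using s(2) by simp
  then obtain q where q: "q \<in> Poly (l + 1) F" "(%x. r x - s x) = vrot (nF F) q"
    using divergence_free_is_rot[OF F d] by blast
  define m where "m = F.I q / F.I (%x. 1)"
  have cP: "(%x. m) \<in> Poly (l + 1) F" by (rule F.Poly_const) (use l in simp)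
  have q0: "(%x. q x - m) \<in> Poly (l + 1) F" by (rule F.Poly_diff[OF q(1) cP])
  have "F.I (%x. q x - m) = F.I q - F.I (%x. m * 1)"
    using F.I_diff[OF F.Poly_continuous[OF q(1)] F.Poly_continuous[OF cP]] by simp
  also have "... = 0" unfolding F.I_cmult m_def using F.I_1_pos by simp
  finally have "(%x. q x - m) \<in> Poly0_face (l + 1) F" using q0 by (simp add: Poly0_face_def face_I[OF F])
  moreover have "grad (%x. q x - m) x = grad q x" for x
  proof -
    have "dderiv (%x. q x - m) v x = dderiv q v x" for v
      using dderiv_diff[OF F.Poly_differentiable[OF q(1)] F.Poly_differentiable[OF cP]] by (simp add: dderiv_const)
    then show ?thesis by (simp add: grad_within_def)
  qed
  then have "r = (%x. vrot (nF F) (%x. q x - m) x + s x)"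
    using fun_cong[OF q(2)] by (simp add: vrot_def fun_eq_iff algebra_simps)
  ultimately show ?thesis using s(1) by blast
qed

text \<open>Taking the divergence removes the rotated gradient, and the divergence is injective on
  the radial fields. What remains is a potential with zero gradient and zero mean.\<close>

lemma tPoly_decomposition_unique:
  assumes F: "F \<in> faces M" and q: "q \<in> Poly0_face m F" and s: "s \<in> Rc_face M l F"
    and z: "!!x. vrot (nF F) q x + s x = 0"
  shows "q = (%x. 0)" "s = (%x. 0)"
proof -
  interpret F: piece F "face_chart F" by (rule piece_face[OF F])
  let ?n = "nF F"
  have qP: "q \<in> Poly m F" and q0: "F.I q = 0" using q by (auto simp: Poly0_face_def face_I[OF F])
  have sv: "s = (%x. (-1) *R vrot ?n q x)" using z by (auto simp: fun_eq_iff eq_neg_iff_add_eq_0 add.commute)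
  have "divg s x = 0" for x
  proof -
    have "divg (%x. (-1) *R vrot ?n q x) x = - divg (vrot ?n q) x"
      unfolding divg_def dderiv_scaleR[OF F.vPoly_differentiable[OF tPolyD(1)[OF F vrot_tPoly[OF F qP]]]]
      by (simp add: sum_negf)
    then show ?thesis unfolding sv using divg_vrot[OF F qP] by simp
  qed
  then show s0: "s = (%x. 0)" by (rule Rc_face_div_inj[OF F s])
  then have v0: "vrot ?n q x = 0" for x using z[of x] by simp
  obtain t where t: "norm t = 1" "?n \<bullet> t = 0" using unit_orthogonal_exists by blast
  have "dderiv q v x = 0" for v x
  proof -
    have "dderiv q t x = 0" "dderiv q (cross3 ?n t) x = 0"
      using vrot_inner_cross[OF F qP t(2), of x] v0[of x] by simp_all
    then have "grad q x \<bullet> u = 0" if "u \<in> {t, cross3 ?n t, ?n}" for u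
      using that face_dderiv_normal[OF F qP] grad_inner[OF F.Poly_differentiable[OF qP]] by auto
    then have "grad q x = 0" using cross_frame(1)[OF normal_unit[OF F] t, of "grad q x"] by simp
    then show ?thesis using grad_inner[OF F.Poly_differentiable[OF qP], of x v] by simp
  qed
  then have c: "q x = q 0" for x by (rule zero_dderiv_const[OF F.Poly_poly3[OF qP]])
  then have "F.I q = F.I (%x. q 0 * 1)" by (intro F.I_cong) simp
  then have "q 0 = 0" using q0 F.I_1_pos unfolding F.I_cmult by simp
  then show "q = (%x. 0)" using c by (simp add: fun_eq_iff)
qed

section \<open>Incidence relations\<close>

text \<open>Stokes for the divergence-free rotated gradient of the trace of \<open>g\<close>: the
  increments of \<open>g\<close> around a face add up to zero. This takes the place of a cyclic
  ordering of the edges.\<close>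

lemma boundary_derivative_sum_global:
  assumes F: "F \<in> faces M" and g: "g \<in> poly3 l"
  shows "(\<Sum>E\<in>edgesF F. wFE F E * intE E (%x. dderiv g (tE E) x)) = 0"
proof -
  interpret F: piece F "face_chart F" by (rule piece_face[OF F])
  define q where "q x = g (hull_proj F x)" for x
  have q: "q \<in> Poly l F" unfolding q_def[abs_def] by (rule F.Poly_restrict[OF g])
  have "0 = intF F (divg (vrot (nF F) q))"
    unfolding divg_vrot[OF F q, abs_def] using F.I_0 by (simp add: face_I[OF F])
  also have "... = (\<Sum>E\<in>edgesF F. wFE F E * intE E (%x. vrot (nF F) q x \<bullet> nFE F E))"
    by (rule face_stokes[OF F vrot_tPoly[OF F q]])
  also have "... = (\<Sum>E\<in>edgesF F. - (wFE F E * intE E (%x. dderiv g (tE E) x)))"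
  proof (rule sum.cong[OF refl])
    fix E assume E: "E \<in> edgesF F"
    note e = face_edgesD(1)[OF E]
    interpret E: piece E "edge_chart E" by (rule piece_edge[OF e])
    have "vrot (nF F) q x \<bullet> nFE F E = (-1) * dderiv g (tE E) x" if "x \<in> E" for x
    proof -
      have xF: "x \<in> affine hull F" using edge_sub_face[OF F E] that by blast
      have "dderiv q (tE E) x = dderiv (%x. g ((isometric_chart F (0::real^2) - F.L (isometric_chart F (0::real^2))) + F.L x)) (tE E) x"
        unfolding q_def[abs_def] F.hull_proj_affine ..
      also have "... = dderiv g (F.L (tE E)) (hull_proj F x)"
        unfolding F.hull_proj_affine by (rule dderiv_comp_affine[OF poly3_differentiable[OF g] F.linear_L])
      finally show ?thesis
        unfolding vrot_edge_normal[OF F E q] F.hull_proj_id[OF xF] face_L[OF F normal_tangent[OF F E]] by simp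
    qed
    then have "E.I (%x. vrot (nF F) q x \<bullet> nFE F E) = E.I (%x. (-1) * dderiv g (tE E) x)"
      by (rule E.I_cong)
    then show "wFE F E * intE E (%x. vrot (nF F) q x \<bullet> nFE F E) =
        - (wFE F E * intE E (%x. dderiv g (tE E) x))"
      unfolding E.I_cmult by (simp add: edge_I[OF e])
  qed
  finally show ?thesis by (simp add: sum_negf)
qed

text \<open>
  Only the vertex values matter, and these can be interpolated by a single polynomial.
\<close>

lemma boundary_derivative_sum:
  assumes F: "F \<in> faces M" and f: "!!E. E \<in> edgesF F ==> f E \<in> poly3 (l E)"
    and comp: "!!E E' V. E \<in> edgesF F ==> E' \<in> edgesF F ==> V \<in> vertsE E ==> V \<in> vertsE E' ==> f E V = f E' V"
  shows "(\<Sum>E\<in>edgesF F. wFE F E * intE E (%x. dderiv (f E) (tE E) x)) = 0"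
proof -
  define h where "h V = f (SOME E. E \<in> edgesF F \<and> V \<in> vertsE E) V" for V
  have h: "f E V = h V" if E: "E \<in> edgesF F" "V \<in> vertsE E" for E V
  proof -
    have "(SOME E. E \<in> edgesF F \<and> V \<in> vertsE E) \<in> edgesF F \<and>
        V \<in> vertsE (SOME E. E \<in> edgesF F \<and> V \<in> vertsE E)"
      by (rule someI[of _ E]) (use E in blast)
    then show ?thesis unfolding h_def by (intro comp) (use E in auto)
  qed
  obtain m g where g: "g \<in> poly3 m" "\<forall>V\<in>verts M. g V = h V" using poly3_interpolation[OF finites(4)] by blast
  have "intE E (%x. dderiv (f E) (tE E) x) = intE E (%x. dderiv g (tE E) x)"
    if E: "E \<in> edgesF F" for E
  proof -
    note e = face_edgesD(1)[OF E]
    obtain a b where ab: "a \<in> verts M" "b \<in> verts M" "a \<noteq> b" "E = open_segment a b" by (rule edge_ends[OF e])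
    obtain s where s: "b - a = (s * norm (b - a)) *R tE E" using tangent_edge[OF e ab(4,3)] by blast
    have "f E a = g a" "f E b = g b" using h[OF E] edge_verts_eq[OF e ab(4,3)] ab g(2) by auto
    then show ?thesis using edge_FTC[OF e ab(4,3) s f[OF E]] edge_FTC[OF e ab(4,3) s g(1)] by simp
  qed
  then show ?thesis using boundary_derivative_sum_global[OF F g(1)] by simp
qed

text \<open>Any point of the open edge will do: by disjointness of the mesh entities it could meet
  the closure of another edge only in a vertex, and vertices do not lie in edges.\<close>

lemma edge_midpoint:
  assumes "E \<in> edges M"
  obtains m where "m \<in> E" "!!E'. E' \<in> edges M ==> E' \<noteq> E ==> m \<notin> closure E'"
proof -
  obtain m where m: "m \<in> E" using edgeD(1)[OF assms] by blast
  have "m \<notin> closure E'" if E': "E' \<in> edges M" "E' \<noteq> E" for E'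
  proof
    assume "m \<in> closure E'"
    moreover have "m \<notin> E'" using disjoint_pieces[of E E'] assms E' m by blast
    ultimately have "m \<in> rel_frontier E'" using edgeD(2)[OF E'(1)] by (simp add: rel_frontier_def rel_open_def)
    then have "m \<in> verts M" using edge_verts_rel_frontier[OF E'(1)] by (auto simp: edge_verts_def)
    then show False using edge_vert_disjoint[OF assms] m by blast
  qed
  with m that show ?thesis by blast
qed

lemma cell_boundary_sum_swap:
  fixes h :: "point set => real"
  shows "(\<Sum>F\<in>facesT T. wTF T F * (\<Sum>E\<in>edgesF F. wFE F E * h E)) =
    (\<Sum>E\<in>edges M. (\<Sum>F\<in>facesT T. if E \<in> edgesF F then wTF T F * wFE F E else 0) * h E)"
proof -
  have "(\<Sum>E\<in>edgesF F. wFE F E * h E) = (\<Sum>E\<in>edges M. if E \<in> edgesF F then wFE F E * h E else 0)" for F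
    using finites(3) by (intro sum.mono_neutral_cong_left) (auto simp: face_edges_def)
  note eq = this
  have "(\<Sum>F\<in>facesT T. wTF T F * (\<Sum>E\<in>edgesF F. wFE F E * h E)) =
      (\<Sum>F\<in>facesT T. \<Sum>E\<in>edges M. (if E \<in> edgesF F then wTF T F * wFE F E else 0) * h E)"
  proof (rule sum.cong[OF refl])
    fix F
    show "wTF T F * (\<Sum>E\<in>edgesF F. wFE F E * h E) =
        (\<Sum>E\<in>edges M. (if E \<in> edgesF F then wTF T F * wFE F E else 0) * h E)"
      unfolding eq[of F] sum_distrib_left by (rule sum.cong[OF refl]) auto
  qed
  also have "... = (\<Sum>E\<in>edges M. \<Sum>F\<in>facesT T. (if E \<in> edgesF F then wTF T F * wFE F E else 0) * h E)"
    by (rule sum.swap)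
  finally show ?thesis by (simp add: sum_distrib_right)
qed

text \<open>
  The coefficients vanish because \<open>\<integral>\<^sub>T div (curl r) = 0\<close> for all polynomial fields \<open>r\<close>, and polynomials
  separate the edges.
\<close>

lemma cell_edge_incidence:
  assumes T: "T \<in> cells M"
  shows "(\<Sum>F\<in>facesT T. wTF T F * (\<Sum>E\<in>edgesF F. wFE F E * h E)) = 0"
proof -
  define \<kappa> where "\<kappa> E = (\<Sum>F\<in>facesT T. if E \<in> edgesF F then wTF T F * wFE F E else 0)" for E
  interpret T: piece T "%x. x" by (rule piece_cell[OF T])
  have circ: "(\<Sum>E\<in>edges M. \<kappa> E * intE E (%x. r x \<bullet> tE E)) = 0" if r: "r \<in> vpoly3 l" for r l
  proof -
    have "0 = intT T (divg (curl r))"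
      unfolding divg_curl[OF r, abs_def] using T.I_0 by (simp add: cell_I[OF T])
    also have "... = (\<Sum>F\<in>facesT T. wTF T F * intF F (%x. curl r x \<bullet> nF F))"
      by (rule cell_stokes[OF T curl_vpoly3[OF r]])
    also have "... = (\<Sum>F\<in>facesT T. wTF T F * (\<Sum>E\<in>edgesF F. wFE F E * - intE E (%x. r x \<bullet> tE E)))"
    proof (rule sum.cong[OF refl])
      fix F assume "F \<in> facesT T"
      then have F: "F \<in> faces M" by (rule cell_facesD(1))
      interpret F: piece F "face_chart F" by (rule piece_face[OF F])
      let ?\<rho> = "%x. cross3 (r (hull_proj F x)) (nF F)"
      note tt = tangential_trace[OF F r]
      have "intF F (%x. curl r x \<bullet> nF F) = intF F (divg ?\<rho>)"
        unfolding face_I[OF F, symmetric] by (rule F.I_cong) (simp add: tt(2) hull_inc)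
      also have "... = (\<Sum>E\<in>edgesF F. wFE F E * intE E (%x. ?\<rho> x \<bullet> nFE F E))"
        by (rule face_stokes[OF F tt(1)])
      also have "... = (\<Sum>E\<in>edgesF F. wFE F E * - intE E (%x. r x \<bullet> tE E))"
      proof (rule sum.cong[OF refl])
        fix E assume E: "E \<in> edgesF F"
        note e = face_edgesD(1)[OF E]
        interpret E: piece E "edge_chart E" by (rule piece_edge[OF e])
        have "?\<rho> x \<bullet> nFE F E = (-1) * (r x \<bullet> tE E)" if "x \<in> E" for x
          using edge_sub_face[OF F E] that unfolding tt(3)[OF E] by (simp add: F.hull_proj_id subset_iff)
        then have "E.I (%x. ?\<rho> x \<bullet> nFE F E) = E.I (%x. (-1) * (r x \<bullet> tE E))" by (rule E.I_cong)
        then show "wFE F E * intE E (%x. ?\<rho> x \<bullet> nFE F E) =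
            wFE F E * - intE E (%x. r x \<bullet> tE E)"
          unfolding E.I_cmult by (simp add: edge_I[OF e])
      qed
      finally show "wTF T F * intF F (%x. curl r x \<bullet> nF F) =
          wTF T F * (\<Sum>E\<in>edgesF F. wFE F E * - intE E (%x. r x \<bullet> tE E))" by simp
    qed
    also have "... = (\<Sum>E\<in>edges M. \<kappa> E * - intE E (%x. r x \<bullet> tE E))"
      unfolding \<kappa>_def by (rule cell_boundary_sum_swap)
    finally show ?thesis by (simp add: sum_negf)
  qed
  have kz: "\<kappa> E0 = 0" if E0: "E0 \<in> edges M" for E0
  proof -
    obtain m where m: "m \<in> E0" "!!E'. E' \<in> edges M ==> E' \<noteq> E0 ==> m \<notin> closure E'" using edge_midpoint[OF E0] by blast
    \<comment> \<open>The fields \<open>p x *R t_E0\<close> with fixed direction \<open>t_E0\<close>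
      reduce the circulation identity to scalar functionals; at \<open>E0\<close> itself the
      additional factor is \<open>t_E0 \<bullet> t_E0 = 1\<close>.\<close>
    have int0: "(\<Sum>E\<in>edges M. \<kappa> E * (tE E0 \<bullet> tE E) * piece.I E (edge_chart E) p) = 0"
      if p: "p \<in> poly3 l" for l p
    proof -
      have "(\<Sum>E\<in>edges M. \<kappa> E * intE E (%x. (p x *R tE E0) \<bullet> tE E)) = 0"
        by (rule circ[OF vpoly3_const_mult[OF p]])
      moreover have "intE E (%x. (p x *R tE E0) \<bullet> tE E) = (tE E0 \<bullet> tE E) * intE E p"
        if "E \<in> edges M" for E
        using piece.I_cmult[OF piece_edge[OF that], of "tE E0 \<bullet> tE E" p] by (simp add: edge_I[OF that] mult.commute)
      ultimately show ?thesis by (simp add: edge_I mult.assoc)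
    qed
    have "\<kappa> E0 * (tE E0 \<bullet> tE E0) = 0"
      by (rule poly3_functionals_separate[where J = "edges M" and X = "%E. E" and \<phi> = "edge_chart"
            and \<kappa> = "%E. \<kappa> E * (tE E0 \<bullet> tE E)"]) (use E0 m finites piece_edge int0 in blast)+
    moreover have "tE E0 \<bullet> tE E0 = 1" using tangent_unit[OF E0] by (simp add: norm_eq_1)
    ultimately show ?thesis by (simp only: mult_1_right)
  qed
  show ?thesis unfolding cell_boundary_sum_swap \<kappa>_def[symmetric] by (rule sum.neutral) (simp add: kz)
qed

end

section \<open>The discrete operators are well defined\<close>

text \<open>For definitions in which the test functions occur only through \<open>A z\<close>: the
  divergence for \<open>grad_trace\<close>, the sum of a rotated gradient and a radial field for
  \<open>curl_trace\<close>, and the gradient for fluxes on a cell. Compatibility with sums and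
  multiples says that \<open>\<psi>\<close> descends to a linear functional on the image of
  \<open>A\<close>.\<close>

lemma (in piece) riesz_via_surj:
  fixes A :: "'z => point => 'b::real_inner" and \<psi> :: "'z => real"
  assumes S: "test_space S" "A ` Z = S"
    and add: "!!u v w. u \<in> Z ==> v \<in> Z ==> w \<in> Z ==> A w = (%x. A u x + A v x) ==> \<psi> w = \<psi> u + \<psi> v"
    and cmult: "!!c u w. u \<in> Z ==> w \<in> Z ==> A w = (%x. c *R A u x) ==> \<psi> w = c * \<psi> u"
  shows "\<exists>!g. g \<in> S \<and> (\<forall>z\<in>Z. I (%x. g x \<bullet> A z x) = \<psi> z)"
proof -
  have fd: "fdim S" using S(1) by (simp add: test_space_def)
  obtain m where m: "linear_on_space S m" "!!z. z \<in> Z ==> m (A z) = \<psi> z"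
    using linear_on_space_via_surj[of S A Z \<psi>, OF fd S(2) add cmult] by blast
  have "(\<forall>s\<in>S. I (%x. g x \<bullet> s x) = m s) \<longleftrightarrow> (\<forall>z\<in>Z. I (%x. g x \<bullet> A z x) = \<psi> z)" for g
    unfolding S(2)[symmetric] using m(2) by auto
  then show ?thesis using L2_riesz[OF S(1) m(1)] by simp
qed

section \<open>Linearity of the differential operators\<close>

lemma linear_into_grad:
  assumes "!!f x. f \<in> S ==> f differentiable at x"
  shows "linear_into S grad"
proof (rule linear_into_I)
  show "grad (%x. f x + g x) x = grad f x + grad g x" if "f \<in> S" "g \<in> S" for f g x
    by (simp add: vec_eq_iff grad_within_def dderiv_add assms that)
  show "grad (%x. c *R f x) x = c *R grad f x" if "f \<in> S" for c f x
    using dderiv_scaleR[OF assms[OF that], where c = c and x = x] by (simp add: vec_eq_iff grad_within_def)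
qed

lemma linear_into_divg:
  assumes "!!f x. f \<in> S ==> f differentiable at x"
  shows "linear_into S divg"
proof (rule linear_into_I)
  show "divg (%x. f x + g x) x = divg f x + divg g x" if "f \<in> S" "g \<in> S" for f g x
    by (simp add: divg_def dderiv_add assms that sum.distrib)
  show "divg (%x. c *R f x) x = c *R divg f x" if "f \<in> S" for c f x
    by (simp add: divg_def dderiv_scaleR assms that sum_distrib_left)
qed

lemma linear_into_curl:
  assumes "!!f x. f \<in> S ==> f differentiable at x"
  shows "linear_into S curl"
proof (rule linear_into_I)
  show "curl (%x. f x + g x) x = curl f x + curl g x" if "f \<in> S" "g \<in> S" for f g x
    by (simp add: curl_def Let_def dderiv_add assms that vec_eq_iff forall_3)
  show "curl (%x. c *R f x) x = c *R curl f x" if "f \<in> S" for c f x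
    by (simp add: curl_def Let_def dderiv_scaleR assms that vec_eq_iff forall_3 algebra_simps)
qed

lemma linear_into_compose_linear:
  assumes "linear_into S A" "linear L"
  shows "linear_into S (%f x. L (A f x))"
  by (rule linear_into_I) (simp_all add: linear_intoD[OF assms(1)] linear_add[OF assms(2)] linear_cmul[OF assms(2)])

lemma linear_into_id: "linear_into S (%f x. f x)"
  by (rule linear_into_I) auto

lemma linear_into_inner: "linear_into S A ==> linear_into S (%f x. A f x \<bullet> a)"
  by (rule linear_into_compose_linear) (auto intro: bounded_linear.linear bounded_linear_inner_left)

context hho_mesh
begin

lemma linear_face:
  assumes "F \<in> faces M" "linear_into S A" "cont u" "!!s. s \<in> S ==> cont (A s)"
  shows "linear_on_space S (%s. intF F (%x. u x \<bullet> A s x))"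
  using piece.linear_on_space_I[OF piece_face[OF assms(1)] assms(2-)] by (simp add: face_I[OF assms(1)])

lemma linear_edge:
  assumes "E \<in> edges M" "linear_into S A" "cont u" "!!s. s \<in> S ==> cont (A s)"
  shows "linear_on_space S (%s. intE E (%x. u x \<bullet> A s x))"
  using piece.linear_on_space_I[OF piece_edge[OF assms(1)] assms(2-)] by (simp add: edge_I[OF assms(1)])

lemma linear_cell:
  assumes "T \<in> cells M" "linear_into S A" "cont u" "!!s. s \<in> S ==> cont (A s)"
  shows "linear_on_space S (%s. intT T (%x. u x \<bullet> A s x))"
  using piece.linear_on_space_I[OF piece_cell[OF assms(1)] assms(2-)] by (simp add: cell_I[OF assms(1)])

lemma cell_Poly_iff: "T \<in> cells M ==> f \<in> Poly l T \<longleftrightarrow> f \<in> poly3 l"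
  using piece.Poly_iff[OF piece_cell] piece.hull_proj_id[OF piece_cell] cellD(5) by simp

lemma cell_vPoly_iff: "T \<in> cells M ==> f \<in> vPoly l T \<longleftrightarrow> f \<in> vpoly3 l"
  using piece.vPoly_iff[OF piece_cell] piece.hull_proj_id[OF piece_cell] cellD(5) by simp

lemma fdim_tPoly: "F \<in> faces M ==> fdim (tPoly M l F)"
proof -
  assume F: "F \<in> faces M"
  interpret F: piece F "face_chart F" by (rule piece_face[OF F])
  define P where "P = (%(r :: vector_field) x. r x - (r x \<bullet> nF F) *R nF F)"
  have "tPoly M l F = P ` vPoly l F"
  proof (intro equalityI subsetI)
    fix r assume r: "r \<in> tPoly M l F"
    then have "r = P r" by (auto simp: P_def tPoly_def)
    then show "r \<in> P ` vPoly l F" using tPolyD(1)[OF F r] by blast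
  next
    fix r assume "r \<in> P ` vPoly l F"
    then obtain r' where r': "r' \<in> vPoly l F" "r = P r'" by blast
    then show "r \<in> tPoly M l F"
      using F.vPoly_diff[OF r'(1) F.vPoly_const_mult[OF F.vPoly_inner[OF r'(1)]]] normal_sq[OF F]
      by (simp add: P_def tPoly_def inner_diff_left)
  qed
  moreover have "fdim (P ` vPoly l F)"
    by (rule fdim_image[OF F.fdim_vPoly]) (rule linear_into_I, auto simp: P_def algebra_simps)
  ultimately show ?thesis by simp
qed

text \<open>Every space on a face is a linear image of a space of polynomials or polynomial fields,
  hence finite-dimensional, and consists of invariant polynomials, hence is determined by its values
  on the face.\<close>

lemma face_test_spaces:
  assumes F: "F \<in> faces M"
  shows "piece.test_space F (tPoly M l F)" "piece.test_space F (Rface M l F)" "piece.test_space F (Rc_face M l F)"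
    "piece.test_space F (Gface l F)" "piece.test_space F (Gc_face M l F)" "piece.test_space F (Poly l F)"
    and "Rface M l F \<subseteq> tPoly M l F" "Rc_face M l F \<subseteq> tPoly M l F" "Gface l F \<subseteq> vPoly l F" "Gc_face M l F \<subseteq> vPoly l F"
proof -
  interpret F: piece F "face_chart F" by (rule piece_face[OF F])
  have tv: "tPoly M l F \<subseteq> vPoly l F" for l using tPolyD(1)[OF F] by blast
  show R: "Rface M l F \<subseteq> tPoly M l F" using vrot_tPoly[OF F, of _ "l + 1"] by (auto simp: Rface_def)
  show Rc: "Rc_face M l F \<subseteq> tPoly M l F" using Rc_face_tPoly[OF F] by blast
  show G: "Gface l F \<subseteq> vPoly l F" using F.grad_vPoly[of _ "l + 1"] by (auto simp: Gface_def)
  show Gc: "Gc_face M l F \<subseteq> vPoly l F"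
  proof
    fix s assume "s \<in> Gc_face M l F"
    then obtain p where p: "p \<in> Poly (l - 1) F" "s = (%x. p x *R cross3 (nF F) (hull_proj F x - face_point M F))"
      unfolding Gc_face_def by blast
    have "s = (%x. cross3 (nF F) (p x *R (hull_proj F x - face_point M F)))" by (simp add: p(2) cross_mult_right)
    then show "s \<in> vPoly l F"
      using F.vPoly_linear[OF F.vPoly_radial[OF face_point_in[OF F] p(1)] linear_cross_right] by simp
  qed
  show "F.test_space (tPoly M l F)" by (rule F.test_space_vPoly[OF fdim_tPoly[OF F] tv])
  show "F.test_space (Poly l F)" by (rule F.test_space_Poly[OF F.fdim_Poly subset_refl])
  have "fdim (Rface M l F)" unfolding Rface_def
  proof (rule fdim_image[OF F.fdim_Poly])
    show "linear_into (Poly (l + 1) F) (vrot (nF F))"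
      unfolding vrot_def[abs_def]
      by (rule linear_into_compose_linear[OF linear_into_grad linear_cross_left]) (rule F.Poly_differentiable)
  qed
  then show "F.test_space (Rface M l F)" using R tv by (intro F.test_space_vPoly) auto
  have "fdim (Rc_face M l F)" unfolding Rc_face_def
    by (rule fdim_image[OF F.fdim_Poly]) (rule linear_into_I, auto simp: scaleR_left_distrib)
  then show "F.test_space (Rc_face M l F)" using Rc tv by (intro F.test_space_vPoly) auto
  have "fdim (Gface l F)" unfolding Gface_def
    by (rule fdim_image[OF F.fdim_Poly linear_into_grad]) (rule F.Poly_differentiable)
  then show "F.test_space (Gface l F)" using G by (intro F.test_space_vPoly) auto
  have "fdim (Gc_face M l F)" unfolding Gc_face_def
    by (rule fdim_image[OF F.fdim_Poly]) (rule linear_into_I, auto simp: scaleR_left_distrib)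
  then show "F.test_space (Gc_face M l F)" using Gc by (intro F.test_space_vPoly) auto
qed

lemma cell_test_spaces:
  assumes T: "T \<in> cells M"
  shows "piece.test_space T (vPoly l T)" "piece.test_space T (Rcell l T)" "piece.test_space T (Rc_cell M l T)"
    "piece.test_space T (Gcell l T)" "piece.test_space T (Gc_cell M l T)" "piece.test_space T (Poly l T)"
    and "Rcell l T \<subseteq> vPoly l T" "Rc_cell M l T \<subseteq> vPoly l T" "Gcell l T \<subseteq> vPoly l T" "Gc_cell M l T \<subseteq> vPoly l T"
proof -
  interpret T: piece T "%x. x" by (rule piece_cell[OF T])
  show R: "Rcell l T \<subseteq> vPoly l T" using T.curl_vPoly[of _ "l + 1"] by (auto simp: Rcell_def)
  show Rc: "Rc_cell M l T \<subseteq> vPoly l T" using Rc_cell_vpoly3[OF T] cell_vPoly_iff[OF T] by blast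
  show G: "Gcell l T \<subseteq> vPoly l T" using T.grad_vPoly[of _ "l + 1"] by (auto simp: Gcell_def)
  show Gc: "Gc_cell M l T \<subseteq> vPoly l T"
  proof
    fix s assume "s \<in> Gc_cell M l T"
    then obtain p where p: "p \<in> vPoly (l - 1) T" "s = (%x. cross3 (x - cell_point M T) (p x))"
      unfolding Gc_cell_def by blast
    let ?y = "%x. - cell_point M T + x"
    have y: "?y \<in> vpoly3 1" by (rule vpoly3_ident) simp
    have p3: "p \<in> vpoly3 (l - 1)" using p(1) cell_vPoly_iff[OF T] by simp
    have m: "(%x. ?y x $ i * p x $ j) \<in> poly3 l" for i j
      using poly3_mult[OF vpoly3_nth[OF y] vpoly3_nth[OF p3]] by simp
    have "s = (%x. cross3 (?y x) (p x))" by (simp add: p(2))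
    then have "s \<in> vpoly3 l"
      by (simp only: vpoly3_def forall_3 cross3_nth mem_Collect_eq) (intro conjI poly3_diff m)
    then show "s \<in> vPoly l T" using cell_vPoly_iff[OF T] by simp
  qed
  show "T.test_space (vPoly l T)" by (rule T.test_space_vPoly[OF T.fdim_vPoly subset_refl])
  show "T.test_space (Poly l T)" by (rule T.test_space_Poly[OF T.fdim_Poly subset_refl])
  have "fdim (Rcell l T)" unfolding Rcell_def
    by (rule fdim_image[OF T.fdim_vPoly linear_into_curl]) (rule T.vPoly_differentiable)
  then show "T.test_space (Rcell l T)" using R by (intro T.test_space_vPoly) auto
  have "fdim (Rc_cell M l T)" unfolding Rc_cell_def
    by (rule fdim_image[OF T.fdim_Poly]) (rule linear_into_I, auto simp: scaleR_left_distrib)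
  then show "T.test_space (Rc_cell M l T)" using Rc by (intro T.test_space_vPoly) auto
  have "fdim (Gcell l T)" unfolding Gcell_def
    by (rule fdim_image[OF T.fdim_Poly linear_into_grad]) (rule T.Poly_differentiable)
  then show "T.test_space (Gcell l T)" using G by (intro T.test_space_vPoly) auto
  have "fdim (Gc_cell M l T)" unfolding Gc_cell_def
    by (rule fdim_image[OF T.fdim_vPoly]) (rule linear_into_I, auto simp: cross_add_right cross_mult_right)
  then show "T.test_space (Gc_cell M l T)" using Gc by (intro T.test_space_vPoly) auto
qed

lemma face_proj:
  assumes F: "F \<in> faces M" and S: "piece.test_space F S" and f: "cont f"
  shows "L2_proj (intF F) S f \<in> S"
    and "s \<in> S ==> intF F (%x. L2_proj (intF F) S f x \<bullet> s x) = intF F (%x. f x \<bullet> s x)"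
  using piece.L2_proj_spec[OF piece_face[OF F] S f] by (simp_all add: face_I[OF F])

lemma face_proj_eqI:
  assumes F: "F \<in> faces M" and S: "piece.test_space F S" and "p \<in> S"
    "!!s. s \<in> S ==> intF F (%x. p x \<bullet> s x) = intF F (%x. f x \<bullet> s x)"
  shows "L2_proj (intF F) S f = p"
  using piece.L2_proj_eqI[OF piece_face[OF F] S] assms(3,4) by (simp add: face_I[OF F])

lemma cell_proj:
  assumes T: "T \<in> cells M" and S: "piece.test_space T S" and f: "cont f"
  shows "L2_proj (intT T) S f \<in> S"
    and "s \<in> S ==> intT T (%x. L2_proj (intT T) S f x \<bullet> s x) = intT T (%x. f x \<bullet> s x)"
  using piece.L2_proj_spec[OF piece_cell[OF T] S f] by (simp_all add: cell_I[OF T])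

lemma cell_proj_eqI:
  assumes T: "T \<in> cells M" and S: "piece.test_space T S" and "p \<in> S"
    "!!s. s \<in> S ==> intT T (%x. p x \<bullet> s x) = intT T (%x. f x \<bullet> s x)"
  shows "L2_proj (intT T) S f = p"
  using piece.L2_proj_eqI[OF piece_cell[OF T] S] assms(3,4) by (simp add: cell_I[OF T])

lemma face_riesz:
  assumes F: "F \<in> faces M" and S: "piece.test_space F S" and l: "linear_on_space S \<psi>"
  shows "\<exists>!g. g \<in> S \<and> (\<forall>s\<in>S. intF F (%x. g x \<bullet> s x) = \<psi> s)"
  using piece.L2_riesz[OF piece_face[OF F] S l] by (simp add: face_I[OF F])

lemma cell_riesz:
  assumes T: "T \<in> cells M" and S: "piece.test_space T S" and l: "linear_on_space S \<psi>"
  shows "\<exists>!g. g \<in> S \<and> (\<forall>s\<in>S. intT T (%x. g x \<bullet> s x) = \<psi> s)"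
  using piece.L2_riesz[OF piece_cell[OF T] S l] by (simp add: cell_I[OF T])

section \<open>Degrees of freedom and continuity of the integrands\<close>

lemma XgradD:
  assumes "q \<in> Xgrad M k"
  shows "vertex_continuous M (q_E q)"
    "E \<in> edges M ==> q_E q E \<in> Poly (int k + 1) E"
    "E \<in> edges M ==> q_GE q E \<in> vPoly (int k) E" "E \<in> edges M ==> q_GE q E x \<bullet> tE E = 0"
    "F \<in> faces M ==> q_F q F \<in> Poly (int k - 1) F" "F \<in> faces M ==> q_GF q F \<in> Poly (int k - 1) F"
    "T \<in> cells M ==> q_T q T \<in> Poly (int k - 1) T"
  using assms by (auto simp: Xgrad_def PiE_iff)

lemma XcurlD:
  assumes "v \<in> Xcurl M k"
  shows "vertex_continuous M (v_E v)"
    "E \<in> edges M ==> v_E v E \<in> vPoly (int k + 2) E" "E \<in> edges M ==> v_RE v E \<in> vPoly (int k + 1) E"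
    "F \<in> faces M ==> v_RF v F \<in> Rface M (int k - 1) F" "F \<in> faces M ==> v_RcF v F \<in> Rc_face M (int k) F"
    "F \<in> faces M ==> v_F v F \<in> Poly (int k - 1) F" "F \<in> faces M ==> v_RGF v F \<in> Gface (int k) F"
    "F \<in> faces M ==> v_RGcF v F \<in> Gc_face M (int k) F"
    "T \<in> cells M ==> v_RT v T \<in> Rcell (int k - 1) T" "T \<in> cells M ==> v_RcT v T \<in> Rc_cell M (int k) T"
  using assms by (auto simp: Xcurl_def PiE_iff)

lemma XnablaD:
  assumes "w \<in> Xnabla M k"
  shows "F \<in> faces M ==> w_F w F \<in> Poly (int k) F" "T \<in> cells M ==> w_GT w T \<in> Gcell (int k - 1) T"
  using assms by (auto simp: Xnabla_def PiE_iff)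

lemmas face_Poly_cont = piece.Poly_continuous[OF piece_face]
lemmas face_vPoly_cont = piece.vPoly_continuous[OF piece_face]
lemmas edge_Poly_cont = piece.Poly_continuous[OF piece_edge]
lemmas edge_vPoly_cont = piece.vPoly_continuous[OF piece_edge]
lemmas cell_Poly_cont = piece.Poly_continuous[OF piece_cell]
lemmas cell_vPoly_cont = piece.vPoly_continuous[OF piece_cell]

lemma tPoly_cont: "F \<in> faces M ==> r \<in> tPoly M l F ==> cont r"
  using face_vPoly_cont tPolyD(1) by blast

lemma continuous_inner_const: "cont r ==> cont (%x. r x \<bullet> a)" for r :: "point => 'b::real_inner"
  by (intro continuous_intros)

lemma dof_edge_cont:
  shows "q \<in> Xgrad M k ==> E \<in> edges M ==> cont (q_E q E)"
    "q \<in> Xgrad M k ==> E \<in> edges M ==> cont (%x. q_GE q E x \<bullet> a)"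
    "v \<in> Xcurl M k ==> E \<in> edges M ==> cont (%x. v_E v E x \<bullet> a)"
  by (blast intro: edge_Poly_cont[OF _ XgradD(2)] continuous_inner_const[OF edge_vPoly_cont[OF _ XgradD(3)]]
      continuous_inner_const[OF edge_vPoly_cont[OF _ XcurlD(2)]])+

lemma tPoly_divg_cont: "F \<in> faces M ==> r \<in> tPoly M l F ==> cont (divg r)"
  using divg_poly3 poly3_continuous tPolyD(3) by blast

lemma linear_tPoly_divg: "F \<in> faces M ==> linear_into (tPoly M l F) divg"
  using tPolyD(3) vpoly3_differentiable by (intro linear_into_divg) blast

lemma linear_boundary_edges:
  assumes F: "F \<in> faces M" and A: "linear_into S A" and c: "!!s. s \<in> S ==> cont (A s)"
    and u: "!!E. E \<in> edges M ==> cont (u E)"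
  shows "linear_on_space S (%s. \<Sum>E\<in>edgesF F. wFE F E * intE E (%x. u E x * (A s x \<bullet> a E)))"
proof (intro linear_on_space_setsum linear_on_space_cmult)
  fix E assume "E \<in> edgesF F"
  then have e: "E \<in> edges M" by (rule face_edgesD(1))
  show "linear_on_space S (%s. intE E (%x. u E x * (A s x \<bullet> a E)))"
    using linear_edge[OF e linear_into_inner[OF A, of "a E"] u[OF e]] continuous_inner_const[OF c]
    by (simp add: inner_real_def)
qed

lemma linear_boundary_edges_scalar:
  assumes F: "F \<in> faces M" and A: "linear_into S A" and c: "!!s. s \<in> S ==> cont (A s)"
    and u: "!!E. E \<in> edges M ==> cont (u E)"
  shows "linear_on_space S (%s. \<Sum>E\<in>edgesF F. wFE F E * intE E (%x. u E x * A s x))"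
proof (intro linear_on_space_setsum linear_on_space_cmult)
  fix E assume "E \<in> edgesF F"
  then have e: "E \<in> edges M" by (rule face_edgesD(1))
  show "linear_on_space S (%s. intE E (%x. u E x * A s x))"
    using linear_edge[OF e A u[OF e] c] by (simp add: inner_real_def)
qed

subsection \<open>Discrete gradient\<close>

definition edge_gradient :: "dof_grad => point set => vector_field" where
  "edge_gradient q E x = edge_deriv M E (q_E q E) x *R tE E + q_GE q E x"

lemma edge_gradient_vPoly: "q \<in> Xgrad M k ==> E \<in> edges M ==> edge_gradient q E \<in> vPoly (int k) E"
proof -
  assume q: "q \<in> Xgrad M k" and E: "E \<in> edges M"
  interpret E: piece E "edge_chart E" by (rule piece_edge[OF E])
  show ?thesis unfolding edge_gradient_def[abs_def] edge_deriv_def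
    using E.vPoly_add[OF E.vPoly_const_mult[OF E.Poly_dderiv[OF XgradD(2)[OF q E]]], of "q_GE q E"] XgradD(3)[OF q E] by simp
qed

lemma grad_edge_spec:
  assumes q: "q \<in> Xgrad M k" and E: "E \<in> edges M"
  shows "grad_edge M k q E \<in> vPoly (int k + 2) E"
    and "L2_proj (intE E) (vPoly (int k) E) (grad_edge M k q E) = edge_gradient q E"
    and "V \<in> vertsE E ==> grad_edge M k q E V = q_GV q V"
  using theI'[OF edge_lift_ex1[OF E _ edge_gradient_vPoly[OF q E], of "q_GV q"]]
  unfolding grad_edge_def edge_gradient_def[abs_def] by simp_all

lemma edge_moment:
  assumes E: "E \<in> edges M" and v: "v \<in> vPoly m E" and g: "L2_proj (intE E) (vPoly l E) v = g" and r: "r \<in> Poly l E"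
  shows "intE E (%x. (v x \<bullet> a) * r x) = intE E (%x. (g x \<bullet> a) * r x)"
proof -
  interpret E: piece E "edge_chart E" by (rule piece_edge[OF E])
  have S: "E.test_space (vPoly l E)" by (rule E.test_space_vPoly[OF E.fdim_vPoly subset_refl])
  have "(%x. r x *R a) \<in> vPoly l E" by (rule E.vPoly_const_mult[OF r])
  from E.L2_proj_spec(2)[OF S E.vPoly_continuous[OF v] this] show ?thesis
    unfolding edge_I[OF E] g by (simp add: mult.commute)
qed

definition grad_face_rhs :: "dof_grad => point set => vector_field => real" where
  "grad_face_rhs q F r = - intF F (%x. q_F q F x * divg r x)
       + (\<Sum>E\<in>edgesF F. wFE F E * intE E (%x. q_E q E x * (r x \<bullet> nFE F E)))"

lemma linear_grad_face_rhs:
  assumes q: "q \<in> Xgrad M k" and F: "F \<in> faces M"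
  shows "linear_on_space (tPoly M l F) (grad_face_rhs q F)"
  unfolding grad_face_rhs_def[abs_def]
proof (intro linear_on_space_plus linear_on_space_uminus linear_boundary_edges[where A = "%r x. r x"])
  show "linear_on_space (tPoly M l F) (%r. intF F (%x. q_F q F x * divg r x))"
    using linear_face[OF F linear_tPoly_divg[OF F, of l] face_Poly_cont[OF F XgradD(5)[OF q F]] tPoly_divg_cont[OF F]]
    by (simp add: inner_real_def)
qed (use F in "auto intro: linear_into_id dof_edge_cont(1,2)[OF q] tPoly_cont[OF F]")

lemma grad_face_spec:
  assumes q: "q \<in> Xgrad M k" and F: "F \<in> faces M"
  shows "grad_face M k q F \<in> tPoly M (int k) F"
    and "r \<in> tPoly M (int k) F ==> intF F (%x. grad_face M k q F x \<bullet> r x) = grad_face_rhs q F r"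
  using theI'[OF face_riesz[OF F face_test_spaces(1)[OF F] linear_grad_face_rhs[OF q F]]]
  unfolding grad_face_def grad_face_rhs_def by blast+

definition grad_perp_rhs :: "dof_grad => point set => vector_field => real" where
  "grad_perp_rhs q F r = - intF F (%x. q_GF q F x * srot (nF F) r x)
       - (\<Sum>E\<in>edgesF F. wFE F E *
            intE E (%x. (q_GE q E x \<bullet> nF F) * (r x \<bullet> tE E)))"

lemma linear_srot: "F \<in> faces M ==> linear_into (tPoly M l F) (srot (nF F))"
  unfolding srot_def[abs_def] using tPolyD(3) vpoly3_differentiable by (intro linear_into_inner linear_into_curl) blast

lemma srot_cont: "F \<in> faces M ==> r \<in> tPoly M l F ==> cont (srot (nF F) r)"
  unfolding srot_def[abs_def] using tPolyD(3) curl_vpoly3 vpoly3_continuous by (intro continuous_inner_const) blast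

lemma grad_perp_face_spec:
  assumes q: "q \<in> Xgrad M k" and F: "F \<in> faces M"
  shows "grad_perp_face M k q F \<in> tPoly M (int k) F"
    and "r \<in> tPoly M (int k) F ==> intF F (%x. grad_perp_face M k q F x \<bullet> r x) = grad_perp_rhs q F r"
proof -
  have "linear_on_space (tPoly M (int k) F) (grad_perp_rhs q F)"
    unfolding grad_perp_rhs_def[abs_def]
  proof (intro linear_on_space_minus linear_on_space_uminus linear_boundary_edges[where A = "%r x. r x"])
    show "linear_on_space (tPoly M (int k) F) (%r. intF F (%x. q_GF q F x * srot (nF F) r x))"
      using linear_face[OF F linear_srot[OF F, of "int k"] face_Poly_cont[OF F XgradD(6)[OF q F]] srot_cont[OF F]]
      by (simp add: inner_real_def)
  qed (use F in "auto intro: linear_into_id dof_edge_cont(1,2)[OF q] tPoly_cont[OF F]")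
  from theI'[OF face_riesz[OF F face_test_spaces(1)[OF F] this]]
  show "grad_perp_face M k q F \<in> tPoly M (int k) F"
    and "r \<in> tPoly M (int k) F ==> intF F (%x. grad_perp_face M k q F x \<bullet> r x) = grad_perp_rhs q F r"
    unfolding grad_perp_face_def grad_perp_rhs_def by blast+
qed

text \<open>The divergence is injective on radial fields, so linear relations between divergences
  lift to the fields themselves, as \<open>riesz_via_surj\<close> requires.\<close>

lemma Rc_face_combination:
  assumes F: "F \<in> faces M" and u: "u \<in> Rc_face M l F" "v \<in> Rc_face M l F" "w \<in> Rc_face M l F"
  shows "divg w = (%x. divg u x + divg v x) ==> w = (%x. u x + v x)"
    and "divg w = (%x. c *R divg u x) ==> w = (%x. c *R u x)"
proof -
  have fd: "fdim (Rc_face M l F)"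
    using face_test_spaces(3)[OF F] by (simp add: piece.test_space_def[OF piece_face[OF F]])
  have lin: "linear_into (Rc_face M l F) divg"
    using Rc_face_tPoly[OF F] tPolyD(3)[OF F] vpoly3_differentiable by (intro linear_into_divg) blast
  note dif = linear_on_space_diff[OF _ fd]
  have eq: "w = z" if "z \<in> Rc_face M l F" "divg w = divg z" for z
  proof -
    have "divg (%x. w x - z x) x = divg w x - divg z x" for x
      by (rule dif) (use lin u that in "auto simp: linear_into_def")
    then have "divg (%x. w x - z x) x = 0" for x using that(2) by simp
    from Rc_face_div_inj[OF F fdim_diff[OF fd u(3) that(1)] this] show ?thesis by (simp add: fun_eq_iff)
  qed
  show "divg w = (%x. divg u x + divg v x) ==> w = (%x. u x + v x)"
    by (rule eq[OF fdim_add[OF fd u(1,2)]]) (simp add: linear_intoD(1)[OF lin u(1,2)])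
  show "divg w = (%x. c *R divg u x) ==> w = (%x. c *R u x)"
    by (rule eq[OF fdim_scaleR[OF fd u(1)]]) (simp add: linear_intoD(2)[OF lin u(1)])
qed

definition grad_trace_rhs :: "nat => dof_grad => point set => vector_field => real" where
  "grad_trace_rhs k q F r = - intF F (%x. grad_face M k q F x \<bullet> r x)
       + (\<Sum>E\<in>edgesF F. wFE F E *
            intE E (%x. q_E q E x * (r x \<bullet> nFE F E)))"

text \<open>The divergence maps \<open>R^{c,k+2}(F)\<close> bijectively onto the polynomials of
  degree \<open>k + 1\<close> on \<open>F\<close>, so the identity prescribes all moments of the
  trace in its own space.\<close>

lemma grad_trace_spec:
  assumes q: "q \<in> Xgrad M k" and F: "F \<in> faces M"
  shows "grad_trace M k q F \<in> Poly (int k + 1) F"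
    and "r \<in> Rc_face M (int k + 2) F ==> intF F (%x. grad_trace M k q F x * divg r x) = grad_trace_rhs k q F r"
proof -
  interpret F: piece F "face_chart F" by (rule piece_face[OF F])
  let ?Z = "Rc_face M (int k + 2) F"
  have Zt: "?Z \<subseteq> tPoly M (int k + 2) F" by (rule face_test_spaces(8)[OF F])
  have lin: "linear_on_space ?Z (grad_trace_rhs k q F)"
  proof (rule linear_on_space_subset[OF _ Zt])
    show "linear_on_space (tPoly M (int k + 2) F) (grad_trace_rhs k q F)"
      unfolding grad_trace_rhs_def[abs_def]
    proof (intro linear_on_space_plus linear_on_space_uminus linear_boundary_edges[where A = "%r x. r x"])
      show "linear_on_space (tPoly M (int k + 2) F) (%r. intF F (%x. grad_face M k q F x \<bullet> r x))"
        using linear_face[OF F linear_into_id tPoly_cont[OF F grad_face_spec(1)[OF q F]] tPoly_cont[OF F]] .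
    qed (use F in "auto intro: linear_into_id dof_edge_cont(1,2)[OF q] tPoly_cont[OF F]")
  qed
  have im: "divg ` ?Z = Poly (int k + 1) F"
  proof (intro equalityI subsetI)
    fix g assume "g \<in> divg ` ?Z"
    then obtain r where "r \<in> ?Z" "g = divg r" by blast
    then show "g \<in> Poly (int k + 1) F" using F.divg_Poly[of r "int k + 2"] Zt tPolyD(1)[OF F, of r "int k + 2"] by (auto simp: add.commute)
  next
    fix g assume "g \<in> Poly (int k + 1) F"
    then show "g \<in> divg ` ?Z" using Rc_face_div_surj[OF F, of g "int k + 2"] by (auto simp: add.commute)
  qed
  have "\<exists>!g. g \<in> Poly (int k + 1) F \<and> (\<forall>z\<in>?Z. F.I (%x. g x \<bullet> divg z x) = grad_trace_rhs k q F z)"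
  proof (rule F.riesz_via_surj[OF face_test_spaces(6)[OF F] im])
    show "grad_trace_rhs k q F w = grad_trace_rhs k q F u + grad_trace_rhs k q F v"
      if "u \<in> ?Z" "v \<in> ?Z" "w \<in> ?Z" "divg w = (%x. divg u x + divg v x)" for u v w
      using Rc_face_combination(1)[OF F that] linear_on_spaceD(1)[OF lin that(1,2)] by simp
    show "grad_trace_rhs k q F w = c * grad_trace_rhs k q F u"
      if "u \<in> ?Z" "w \<in> ?Z" "divg w = (%x. c *R divg u x)" for c u w
      using Rc_face_combination(2)[OF F that(1,1,2,3)] linear_on_spaceD(2)[OF lin that(1)] by simp
  qed
  from theI'[OF this[unfolded inner_real_def]]
  show "grad_trace M k q F \<in> Poly (int k + 1) F"
    and "r \<in> ?Z ==> intF F (%x. grad_trace M k q F x * divg r x) = grad_trace_rhs k q F r"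
    unfolding grad_trace_def grad_trace_rhs_def face_I[OF F] by blast+
qed

definition grad_cell_rhs :: "nat => dof_grad => point set => vector_field => real" where
  "grad_cell_rhs k q T r = - intT T (%x. q_T q T x * divg r x)
       + (\<Sum>F\<in>facesT T. wTF T F * intF F (%x. grad_trace M k q F x * (r x \<bullet> nF F)))"

lemma cell_vPoly_divg:
  assumes T: "T \<in> cells M"
  shows "linear_into (vPoly l T) divg" "linear_into (vPoly l T) curl"
    "r \<in> vPoly l T ==> cont (divg r)" "r \<in> vPoly l T ==> cont (curl r)"
proof -
  interpret T: piece T "%x. x" by (rule piece_cell[OF T])
  show "linear_into (vPoly l T) divg" "linear_into (vPoly l T) curl"
    using T.vPoly_differentiable by (intro linear_into_divg linear_into_curl; blast)+
  show "r \<in> vPoly l T ==> cont (divg r)" "r \<in> vPoly l T ==> cont (curl r)"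
    using T.divg_Poly T.curl_vPoly T.Poly_continuous T.vPoly_continuous by blast+
qed

lemma grad_cell_spec:
  assumes q: "q \<in> Xgrad M k" and T: "T \<in> cells M"
  shows "grad_cell M k q T \<in> vPoly (int k) T"
    and "r \<in> vPoly (int k) T ==> intT T (%x. grad_cell M k q T x \<bullet> r x) = grad_cell_rhs k q T r"
proof -
  have "linear_on_space (vPoly (int k) T) (grad_cell_rhs k q T)"
    unfolding grad_cell_rhs_def[abs_def]
  proof (intro linear_on_space_plus linear_on_space_uminus linear_on_space_setsum linear_on_space_cmult)
    show "linear_on_space (vPoly (int k) T) (%r. intT T (%x. q_T q T x * divg r x))"
      using linear_cell[OF T cell_vPoly_divg(1)[OF T] cell_Poly_cont[OF T XgradD(7)[OF q T]] cell_vPoly_divg(3)[OF T]]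
      by (simp add: inner_real_def)
    fix F assume "F \<in> facesT T"
    then have F: "F \<in> faces M" by (rule cell_facesD(1))
    show "linear_on_space (vPoly (int k) T) (%r. intF F (%x. grad_trace M k q F x * (r x \<bullet> nF F)))"
      using linear_face[OF F linear_into_inner[OF linear_into_id, of _ "nF F"] face_Poly_cont[OF F grad_trace_spec(1)[OF q F]]
          continuous_inner_const[OF cell_vPoly_cont[OF T]]]
      by (simp add: inner_real_def)
  qed
  from theI'[OF cell_riesz[OF T cell_test_spaces(1)[OF T] this]]
  show "grad_cell M k q T \<in> vPoly (int k) T"
    and "r \<in> vPoly (int k) T ==> intT T (%x. grad_cell M k q T x \<bullet> r x) = grad_cell_rhs k q T r"
    unfolding grad_cell_def grad_cell_rhs_def by blast+
qed

subsection \<open>Discrete curl\<close>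

definition edge_curl :: "dof_curl => point set => vector_field" where
  "edge_curl v E x = v_RE v E x - cross3 (edge_deriv M E (v_E v E) x) (tE E)"

lemma edge_deriv_cross_vPoly:
  assumes E: "E \<in> edges M" and v: "v \<in> vPoly (l + 1) E"
  shows "(%x. cross3 (edge_deriv M E v x) (tE E)) \<in> vPoly l E"
  unfolding edge_deriv_def
  using piece.vPoly_linear[OF piece_edge[OF E] piece.vPoly_dderiv[OF piece_edge[OF E] v] linear_cross_left] by simp

text \<open>The third claim covers the image of the gradient: the moments and the end values all
  vanish, and unisolvence leaves only the zero field.\<close>

lemma curl_edge_spec:
  assumes v: "v \<in> Xcurl M k" and E: "E \<in> edges M"
  shows "curl_edge M k v E \<in> vPoly (int k + 3) E"
    and "V \<in> vertsE E ==> curl_edge M k v E V = v_RV v V"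
    and "v_RE v E = (%x. cross3 (edge_deriv M E (v_E v E) x) (tE E)) ==> (!!V. V \<in> verts M ==> v_RV v V = 0) ==>
      curl_edge M k v E = (%x. 0)"
proof -
  interpret E: piece E "edge_chart E" by (rule piece_edge[OF E])
  have g: "edge_curl v E \<in> vPoly (int k + 1) E"
    unfolding edge_curl_def[abs_def]
    using XcurlD(3)[OF v E] edge_deriv_cross_vPoly[OF E, of "v_E v E" "int k + 1"] XcurlD(2)[OF v E]
    by (intro E.vPoly_diff) (auto simp: add.commute)
  have u: "\<exists>!c. c \<in> vPoly (int k + 3) E \<and> L2_proj (intE E) (vPoly (int k + 1) E) c = edge_curl v E \<and>
      (\<forall>V\<in>vertsE E. c V = v_RV v V)"
    using edge_lift_ex1[OF E _ g, of "v_RV v"] by (simp add: add.assoc)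
  have ce: "curl_edge M k v E = (THE c. c \<in> vPoly (int k + 3) E \<and>
      L2_proj (intE E) (vPoly (int k + 1) E) c = edge_curl v E \<and> (\<forall>V\<in>vertsE E. c V = v_RV v V))"
    unfolding curl_edge_def edge_curl_def[abs_def] ..
  show "curl_edge M k v E \<in> vPoly (int k + 3) E" "V \<in> vertsE E ==> curl_edge M k v E V = v_RV v V"
    using theI'[OF u] unfolding ce by blast+
  assume RE: "v_RE v E = (%x. cross3 (edge_deriv M E (v_E v E) x) (tE E))" and RV: "!!V. V \<in> verts M ==> v_RV v V = 0"
  have z: "edge_curl v E = (%x. 0)" using RE by (simp add: edge_curl_def[abs_def] fun_eq_iff)
  have S: "E.test_space (vPoly (int k + 1) E)" by (rule E.test_space_vPoly[OF E.fdim_vPoly subset_refl])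
  have "L2_proj (intE E) (vPoly (int k + 1) E) (%x. 0) = (%x. 0)"
    using E.L2_proj_eqI[OF S E.vPoly_0, of "%x. 0"] by (simp add: edge_I[OF E])
  moreover have "\<forall>V\<in>vertsE E. v_RV v V = 0" using RV by (auto simp: edge_verts_def)
  ultimately show "curl_edge M k v E = (%x. 0)"
    unfolding ce by (intro the1_equality[OF u]) (simp add: z E.vPoly_0)
qed

definition scurl_rhs :: "dof_curl => point set => scalar_field => real" where
  "scurl_rhs v F r = intF F (%x. v_RF v F x \<bullet> vrot (nF F) r x)
       - (\<Sum>E\<in>edgesF F. wFE F E * intE E (%x. (v_E v E x \<bullet> tE E) * r x))"

lemma scurl_face_spec:
  assumes v: "v \<in> Xcurl M k" and F: "F \<in> faces M"
  shows "scurl_face M k v F \<in> Poly (int k) F"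
    and "r \<in> Poly (int k) F ==> intF F (%x. scurl_face M k v F x * r x) = scurl_rhs v F r"
proof -
  interpret F: piece F "face_chart F" by (rule piece_face[OF F])
  have "linear_on_space (Poly (int k) F) (scurl_rhs v F)"
    unfolding scurl_rhs_def[abs_def]
  proof (intro linear_on_space_minus linear_boundary_edges_scalar[where A = "%r x. r x"])
    show "linear_on_space (Poly (int k) F) (%r. intF F (%x. v_RF v F x \<bullet> vrot (nF F) r x))"
    proof (rule linear_face[OF F])
      show "linear_into (Poly (int k) F) (vrot (nF F))"
        unfolding vrot_def[abs_def]
        by (rule linear_into_compose_linear[OF linear_into_grad linear_cross_left]) (rule F.Poly_differentiable)
      show "cont (v_RF v F)"
        using XcurlD(4)[OF v F] face_test_spaces(7)[OF F] tPoly_cont[OF F] by blast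
      show "cont (vrot (nF F) s)" if "s \<in> Poly (int k) F" for s
        using vrot_tPoly[OF F that] tPoly_cont[OF F] by blast
    qed
  qed (use F in "auto intro: linear_into_id dof_edge_cont(3)[OF v] F.Poly_continuous")
  from theI'[OF face_riesz[OF F face_test_spaces(6)[OF F] this, unfolded inner_real_def]]
  show "scurl_face M k v F \<in> Poly (int k) F"
    and "r \<in> Poly (int k) F ==> intF F (%x. scurl_face M k v F x * r x) = scurl_rhs v F r"
    unfolding scurl_face_def scurl_rhs_def by blast+
qed

definition vcurl_rhs :: "dof_curl => point set => vector_field => real" where
  "vcurl_rhs v F r = intF F (%x. v_F v F x * srot (nF F) r x)
       + (\<Sum>E\<in>edgesF F. wFE F E *
            intE E (%x. (v_E v E x \<bullet> nF F) * (r x \<bullet> tE E)))"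

lemma vcurl_face_spec:
  assumes v: "v \<in> Xcurl M k" and F: "F \<in> faces M"
  shows "vcurl_face M k v F \<in> tPoly M (int k) F"
    and "r \<in> tPoly M (int k) F ==> intF F (%x. vcurl_face M k v F x \<bullet> r x) = vcurl_rhs v F r"
proof -
  have "linear_on_space (tPoly M (int k) F) (vcurl_rhs v F)"
    unfolding vcurl_rhs_def[abs_def]
  proof (intro linear_on_space_plus linear_boundary_edges[where A = "%r x. r x"])
    show "linear_on_space (tPoly M (int k) F) (%r. intF F (%x. v_F v F x * srot (nF F) r x))"
      using linear_face[OF F linear_srot[OF F, of "int k"] face_Poly_cont[OF F XcurlD(6)[OF v F]] srot_cont[OF F]]
      by (simp add: inner_real_def)
  qed (use F in "auto intro: linear_into_id dof_edge_cont(3)[OF v] tPoly_cont[OF F]")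
  from theI'[OF face_riesz[OF F face_test_spaces(1)[OF F] this]]
  show "vcurl_face M k v F \<in> tPoly M (int k) F"
    and "r \<in> tPoly M (int k) F ==> intF F (%x. vcurl_face M k v F x \<bullet> r x) = vcurl_rhs v F r"
    unfolding vcurl_face_def vcurl_rhs_def by blast+
qed

definition curl_trace_rhs :: "nat => dof_curl => point set => scalar_field => real" where
  "curl_trace_rhs k v F r = intF F (%x. scurl_face M k v F x * r x)
          + (\<Sum>E\<in>edgesF F. wFE F E *
               intE E (%x. (v_E v E x \<bullet> tE E) * r x))"

lemma fdim_Poly0_face: "F \<in> faces M ==> q \<in> Poly0_face l F ==> r \<in> Poly0_face l F ==> (%x. q x + r x) \<in> Poly0_face l F"
  and Poly0_face_cmult: "F \<in> faces M ==> q \<in> Poly0_face l F ==> (%x. c * q x) \<in> Poly0_face l F"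
proof -
  assume F: "F \<in> faces M"
  interpret F: piece F "face_chart F" by (rule piece_face[OF F])
  show "q \<in> Poly0_face l F ==> r \<in> Poly0_face l F ==> (%x. q x + r x) \<in> Poly0_face l F"
    unfolding Poly0_face_def face_I[OF F, symmetric]
    using F.Poly_add F.I_add F.Poly_continuous by auto
  show "q \<in> Poly0_face l F ==> (%x. c * q x) \<in> Poly0_face l F"
    unfolding Poly0_face_def face_I[OF F, symmetric]
    using F.Poly_cmult F.I_cmult by auto
qed

text \<open>The pairs \<open>(r, s)\<close> of test functions correspond one to one to the
  tangential fields of degree \<open>k\<close>, by the direct decomposition. The mean-value
  condition on \<open>r\<close> is what makes this correspondence injective.\<close>

lemma curl_trace_spec:
  assumes v: "v \<in> Xcurl M k" and F: "F \<in> faces M"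
  shows "curl_trace M k v F \<in> tPoly M (int k) F"
    and "r \<in> Poly0_face (int k + 1) F ==> s \<in> Rc_face M (int k) F ==>
      intF F (%x. curl_trace M k v F x \<bullet> (vrot (nF F) r x + s x)) =
      curl_trace_rhs k v F r + intF F (%x. v_RcF v F x \<bullet> s x)"
proof -
  interpret F: piece F "face_chart F" by (rule piece_face[OF F])
  let ?P = "Poly0_face (int k + 1) F" and ?R = "Rc_face M (int k) F" and ?n = "nF F"
  define A where "A = (%(r, s) x. vrot ?n r x + (s :: vector_field) x)"
  define \<psi> where "\<psi> = (%(r, s). curl_trace_rhs k v F r + intF F (%x. v_RcF v F x \<bullet> s x))"
  have fdR: "fdim ?R" using face_test_spaces(3)[OF F] by (simp add: F.test_space_def)
  have P: "?P \<subseteq> Poly (int k + 1) F" by (auto simp: Poly0_face_def)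
  have lv: "linear_into (Poly (int k + 1) F) (vrot ?n)"
    unfolding vrot_def[abs_def]
    by (rule linear_into_compose_linear[OF linear_into_grad linear_cross_left]) (rule F.Poly_differentiable)
  have lP: "linear_on_space (Poly (int k + 1) F) (curl_trace_rhs k v F)"
    unfolding curl_trace_rhs_def[abs_def]
  proof (intro linear_on_space_plus linear_boundary_edges_scalar[where A = "%r x. r x"])
    show "linear_on_space (Poly (int k + 1) F) (%r. intF F (%x. scurl_face M k v F x * r x))"
      using linear_face[OF F linear_into_id F.Poly_continuous[OF scurl_face_spec(1)[OF v F]] F.Poly_continuous[where l = "int k + 1"]]
      by (simp add: inner_real_def)
  qed (use F in "auto intro: linear_into_id dof_edge_cont(3)[OF v] F.Poly_continuous")
  have lR: "linear_on_space ?R (%s. intF F (%x. v_RcF v F x \<bullet> s x))"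
  proof (rule linear_face[OF F linear_into_id])
    show "cont s" if "s \<in> ?R" for s using that Rc_face_tPoly[OF F] tPoly_cont[OF F] by blast
    then show "cont (v_RcF v F)" using XcurlD(5)[OF v F] by blast
  qed
  have im: "A ` (?P \<times> ?R) = tPoly M (int k) F"
  proof (intro equalityI subsetI)
    fix g assume "g \<in> A ` (?P \<times> ?R)"
    then obtain r s where rs: "r \<in> ?P" "s \<in> ?R" "g = (%x. vrot ?n r x + s x)" by (auto simp: A_def)
    have "vrot ?n r \<in> tPoly M (int k) F" using vrot_tPoly[OF F, of r "int k + 1"] rs(1) P by auto
    then show "g \<in> tPoly M (int k) F" unfolding rs(3) using Rc_face_tPoly[OF F rs(2)] fdim_add[OF fdim_tPoly[OF F]] by blast
  next
    fix g assume "g \<in> tPoly M (int k) F"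
    then obtain r s where "r \<in> ?P" "s \<in> ?R" "g = (%x. vrot ?n r x + s x)"
      using tPoly_decomposition[OF F, of "int k" g] by auto
    then show "g \<in> A ` (?P \<times> ?R)" by (intro image_eqI[of _ _ "(r, s)"]) (auto simp: A_def)
  qed
  \<comment> \<open>Turns the relations between fields that \<open>riesz_via_surj\<close> hands over
    into relations between pairs, on which the right-hand side is visibly linear.\<close>
  have uniq: "r = r' \<and> s = s'" if rs: "r \<in> ?P" "r' \<in> ?P" "s \<in> ?R" "s' \<in> ?R" "A (r, s) = A (r', s')" for r r' s s'
  proof -
    have d: "(%x. r x - r' x) \<in> ?P"
      using fdim_Poly0_face[OF F rs(1) Poly0_face_cmult[OF F rs(2), of "-1"]] by simp
    have rP: "r \<in> Poly (int k + 1) F" "r' \<in> Poly (int k + 1) F" using rs P by blast+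
    have v: "vrot ?n (%x. r x - r' x) x = vrot ?n r x - vrot ?n r' x" for x
      by (rule linear_on_space_diff[OF _ F.fdim_Poly rP]) (use lv in "simp add: linear_into_def")
    have e: "vrot ?n r x + s x = vrot ?n r' x + s' x" for x using fun_cong[OF rs(5), of x] by (simp add: A_def)
    have "s x - s' x = vrot ?n r' x - vrot ?n r x" for x using arg_cong[OF e, of "%z. z - s' x - vrot ?n r x" x] by simp
    then have "vrot ?n (%x. r x - r' x) x + (s x - s' x) = 0" for x unfolding v by simp
    from tPoly_decomposition_unique[OF F d fdim_diff[OF fdR rs(3,4)] this] show ?thesis
      by (simp add: fun_eq_iff)
  qed
  have "\<exists>!g. g \<in> tPoly M (int k) F \<and> (\<forall>z\<in>?P \<times> ?R. F.I (%x. g x \<bullet> A z x) = \<psi> z)"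
  proof (rule F.riesz_via_surj[OF face_test_spaces(1)[OF F] im])
    fix u' v' w' assume u': "u' \<in> ?P \<times> ?R" "v' \<in> ?P \<times> ?R" "w' \<in> ?P \<times> ?R" "A w' = (%x. A u' x + A v' x)"
    obtain r1 s1 r2 s2 r3 s3 where e: "u' = (r1, s1)" "v' = (r2, s2)" "w' = (r3, s3)" by (metis surj_pair)
    have m: "r1 \<in> ?P" "r2 \<in> ?P" "r3 \<in> ?P" "s1 \<in> ?R" "s2 \<in> ?R" "s3 \<in> ?R" using u' e by auto
    have rP: "r1 \<in> Poly (int k + 1) F" "r2 \<in> Poly (int k + 1) F" using m P by blast+
    have "A (r3, s3) = A (%x. r1 x + r2 x, %x. s1 x + s2 x)"
      using u'(4) unfolding e A_def linear_intoD(1)[OF lv rP] prod.case by (simp add: algebra_simps)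
    from uniq[OF m(3) fdim_Poly0_face[OF F m(1,2)] m(6) fdim_add[OF fdR m(4,5)] this]
    have "r3 = (%x. r1 x + r2 x)" "s3 = (%x. s1 x + s2 x)" by blast+
    then show "\<psi> w' = \<psi> u' + \<psi> v'"
      unfolding e \<psi>_def prod.case using linear_on_spaceD(1)[OF lP rP] linear_on_spaceD(1)[OF lR m(4,5)] by simp
  next
    fix c u' w' assume u': "u' \<in> ?P \<times> ?R" "w' \<in> ?P \<times> ?R" "A w' = (%x. c *R A u' x)"
    obtain r1 s1 r3 s3 where e: "u' = (r1, s1)" "w' = (r3, s3)" by (metis surj_pair)
    have m: "r1 \<in> ?P" "r3 \<in> ?P" "s1 \<in> ?R" "s3 \<in> ?R" using u' e by auto
    have rP: "r1 \<in> Poly (int k + 1) F" using m P by blast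
    have "A (r3, s3) = A (%x. c *R r1 x, %x. c *R s1 x)"
      using u'(3) unfolding e A_def linear_intoD(2)[OF lv rP] prod.case by (simp add: algebra_simps)
    moreover have "(%x. c *R r1 x) \<in> ?P" using Poly0_face_cmult[OF F m(1)] by simp
    ultimately have "r3 = (%x. c *R r1 x)" "s3 = (%x. c *R s1 x)"
      using uniq[OF m(2) _ m(4) fdim_scaleR[OF fdR m(3)]] by blast+
    then show "\<psi> w' = c * \<psi> u'"
      unfolding e \<psi>_def prod.case using linear_on_spaceD(2)[OF lP rP] linear_on_spaceD(2)[OF lR m(3)] by (simp add: distrib_left)
  qed
  then have ex: "\<exists>!g. g \<in> tPoly M (int k) F \<and> (\<forall>r\<in>?P. \<forall>s\<in>?R. intF F (%x. g x \<bullet> (vrot ?n r x + s x)) =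
      curl_trace_rhs k v F r + intF F (%x. v_RcF v F x \<bullet> s x))"
    by (simp add: A_def \<psi>_def face_I[OF F])
  from theI'[OF ex]
  show "curl_trace M k v F \<in> tPoly M (int k) F"
    and "r \<in> ?P ==> s \<in> ?R ==> intF F (%x. curl_trace M k v F x \<bullet> (vrot ?n r x + s x)) =
      curl_trace_rhs k v F r + intF F (%x. v_RcF v F x \<bullet> s x)"
    unfolding curl_trace_def curl_trace_rhs_def by blast+
qed

definition curl_cell_rhs :: "nat => dof_curl => point set => vector_field => real" where
  "curl_cell_rhs k v T r = intT T (%x. v_RT v T x \<bullet> curl r x)
       + (\<Sum>F\<in>facesT T. wTF T F *
            intF F (%x. curl_trace M k v F x \<bullet> cross3 (r x) (nF F)))"

lemma curl_cell_spec:
  assumes v: "v \<in> Xcurl M k" and T: "T \<in> cells M"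
  shows "curl_cell M k v T \<in> vPoly (int k) T"
    and "r \<in> vPoly (int k) T ==> intT T (%x. curl_cell M k v T x \<bullet> r x) = curl_cell_rhs k v T r"
proof -
  have "linear_on_space (vPoly (int k) T) (curl_cell_rhs k v T)"
    unfolding curl_cell_rhs_def[abs_def]
  proof (intro linear_on_space_plus linear_on_space_setsum linear_on_space_cmult)
    show "linear_on_space (vPoly (int k) T) (%r. intT T (%x. v_RT v T x \<bullet> curl r x))"
      using XcurlD(9)[OF v T] cell_test_spaces(7)[OF T] cell_vPoly_cont[OF T]
      by (intro linear_cell[OF T cell_vPoly_divg(2)[OF T] _ cell_vPoly_divg(4)[OF T]]) blast+
    fix F assume "F \<in> facesT T"
    then have F: "F \<in> faces M" by (rule cell_facesD(1))
    show "linear_on_space (vPoly (int k) T) (%r. intF F (%x. curl_trace M k v F x \<bullet> cross3 (r x) (nF F)))"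
    proof (rule linear_face[OF F linear_into_compose_linear[OF linear_into_id linear_cross_left] tPoly_cont[OF F curl_trace_spec(1)[OF v F]]])
      show "cont (%x. cross3 (s x) (nF F))" if "s \<in> vPoly (int k) T" for s
        using cell_vPoly_cont[OF T piece.vPoly_linear[OF piece_cell[OF T] that linear_cross_left]] .
    qed
  qed
  from theI'[OF cell_riesz[OF T cell_test_spaces(1)[OF T] this]]
  show "curl_cell M k v T \<in> vPoly (int k) T"
    and "r \<in> vPoly (int k) T ==> intT T (%x. curl_cell M k v T x \<bullet> r x) = curl_cell_rhs k v T r"
    unfolding curl_cell_def curl_cell_rhs_def by blast+
qed

subsection \<open>Discrete divergence\<close>

definition div_cell_rhs :: "dof_nabla => point set => scalar_field => real" where
  "div_cell_rhs w T q = - intT T (%x. w_GT w T x \<bullet> grad q x)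
       + (\<Sum>F\<in>facesT T. wTF T F * intF F (%x. w_F w F x * q x))"

lemma div_cell_ex1:
  assumes w: "w \<in> Xnabla M k" and T: "T \<in> cells M"
  shows "\<exists>!d. d \<in> Poly (int k) T \<and> (\<forall>q\<in>Poly (int k) T. intT T (%x. d x * q x) = div_cell_rhs w T q)"
proof -
  interpret T: piece T "%x. x" by (rule piece_cell[OF T])
  have "linear_on_space (Poly (int k) T) (div_cell_rhs w T)"
    unfolding div_cell_rhs_def[abs_def]
  proof (intro linear_on_space_plus linear_on_space_uminus linear_on_space_setsum linear_on_space_cmult)
    show "linear_on_space (Poly (int k) T) (%q. intT T (%x. w_GT w T x \<bullet> grad q x))"
    proof (rule linear_cell[OF T linear_into_grad])
      show "cont (w_GT w T)" using XnablaD(2)[OF w T] cell_test_spaces(9)[OF T] T.vPoly_continuous by blast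
      show "cont (grad s)" if "s \<in> Poly (int k) T" for s using T.grad_vPoly[OF that] T.vPoly_continuous by blast
    qed (rule T.Poly_differentiable)
    fix F assume "F \<in> facesT T"
    then have F: "F \<in> faces M" by (rule cell_facesD(1))
    show "linear_on_space (Poly (int k) T) (%q. intF F (%x. w_F w F x * q x))"
      using linear_face[OF F linear_into_id face_Poly_cont[OF F XnablaD(1)[OF w F]] T.Poly_continuous[where l = "int k"]]
      by (simp add: inner_real_def)
  qed
  from cell_riesz[OF T cell_test_spaces(6)[OF T] this] show ?thesis by (simp only: inner_real_def)
qed

lemma div_cell_spec:
  assumes w: "w \<in> Xnabla M k" and T: "T \<in> cells M"
  shows "div_cell M k w T \<in> Poly (int k) T"
    and "q \<in> Poly (int k) T ==> intT T (%x. div_cell M k w T x * q x) = div_cell_rhs w T q"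
    and "d \<in> Poly (int k) T ==> (!!q. q \<in> Poly (int k) T ==> intT T (%x. d x * q x) = div_cell_rhs w T q) ==>
      div_cell M k w T = d"
proof -
  note u = div_cell_ex1[OF w T]
  show "div_cell M k w T \<in> Poly (int k) T"
    and "q \<in> Poly (int k) T ==> intT T (%x. div_cell M k w T x * q x) = div_cell_rhs w T q"
    using theI'[OF u] unfolding div_cell_def div_cell_rhs_def by blast+
  show "div_cell M k w T = d" if "d \<in> Poly (int k) T"
      "!!q. q \<in> Poly (int k) T ==> intT T (%x. d x * q x) = div_cell_rhs w T q"
    unfolding div_cell_def div_cell_rhs_def[symmetric] by (rule the1_equality[OF u]) (use that in blast)
qed

end

section \<open>The complex property\<close>

context hho_mesh
begin

lemma face_integral_arith:
  assumes F: "F \<in> faces M"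
  shows "cont f ==> cont g ==> intF F (%x. f x + g x) = intF F f + intF F g"
    and "cont f ==> cont g ==> intF F (%x. f x - g x) = intF F f - intF F g"
    and "intF F (%x. c * f x) = c * intF F f" and "intF F (%x. 0) = 0"
    and "(!!x. x \<in> F ==> f x = g x) ==> intF F f = intF F g"
  using piece.I_add[OF piece_face[OF F]] piece.I_diff[OF piece_face[OF F]] piece.I_cmult[OF piece_face[OF F]]
    piece.I_0[OF piece_face[OF F]] piece.I_cong[OF piece_face[OF F]]
  unfolding face_I[OF F] by blast+

lemma edge_integral_arith:
  assumes E: "E \<in> edges M"
  shows "cont f ==> cont g ==> intE E (%x. f x + g x) = intE E f + intE E g"
    and "cont f ==> cont g ==> intE E (%x. f x - g x) = intE E f - intE E g"
    and "intE E (%x. c * f x) = c * intE E f" and "intE E (%x. 0) = 0"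
    and "(!!x. x \<in> E ==> f x = g x) ==> intE E f = intE E g"
  using piece.I_add[OF piece_edge[OF E]] piece.I_diff[OF piece_edge[OF E]] piece.I_cmult[OF piece_edge[OF E]]
    piece.I_0[OF piece_edge[OF E]] piece.I_cong[OF piece_edge[OF E]]
  unfolding edge_I[OF E] by blast+

lemma face_fdim: "F \<in> faces M ==> piece.test_space F S ==> fdim S"
  using piece.test_space_def[OF piece_face] by blast

lemma cell_fdim: "T \<in> cells M ==> piece.test_space T S ==> fdim S"
  using piece.test_space_def[OF piece_cell] by blast

lemma face_zero:
  assumes F: "F \<in> faces M" and S: "piece.test_space F S" and "c \<in> S" "!!s. s \<in> S ==> intF F (%x. c x \<bullet> s x) = 0"
  shows "c = (%x. 0)"
  using piece.test_space_unique[OF piece_face[OF F] S assms(3) fdim_0[OF face_fdim[OF F S]]] assms(4)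
  by (simp add: face_I[OF F] face_integral_arith(4)[OF F])

lemma cell_zero:
  assumes T: "T \<in> cells M" and S: "piece.test_space T S" and "c \<in> S" "!!s. s \<in> S ==> intT T (%x. c x \<bullet> s x) = 0"
  shows "c = (%x. 0)"
  using piece.test_space_unique[OF piece_cell[OF T] S assms(3) fdim_0[OF cell_fdim[OF T S]]] assms(4)
    piece.I_0[OF piece_cell[OF T]] by (simp add: cell_I[OF T])

lemma tPoly_mono: "F \<in> faces M ==> l \<le> m ==> r \<in> tPoly M l F ==> r \<in> tPoly M m F"
  using piece.vPoly_mono[OF piece_face] by (auto simp: tPoly_def)

lemma Rc_face_mono: "F \<in> faces M ==> l \<le> m ==> r \<in> Rc_face M l F ==> r \<in> Rc_face M m F"
  unfolding Rc_face_def using piece.Poly_mono[OF piece_face, of F "l - 1" "m - 1"] by auto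

section \<open>Components and ranges of the discrete gradient and curl\<close>

lemma discrete_grad_sel:
  "V \<in> verts M ==> v_RV (discrete_grad M k q) V = 0"
  "E \<in> edges M ==> v_E (discrete_grad M k q) E = grad_edge M k q E"
  "E \<in> edges M ==> v_RE (discrete_grad M k q) E = (%x. cross3 (edge_deriv M E (grad_edge M k q E) x) (tE E))"
  "F \<in> faces M ==> v_RF (discrete_grad M k q) F = L2_proj (intF F) (Rface M (int k - 1) F) (grad_face M k q F)"
  "F \<in> faces M ==> v_RcF (discrete_grad M k q) F = L2_proj (intF F) (Rc_face M (int k) F) (grad_face M k q F)"
  "F \<in> faces M ==> v_F (discrete_grad M k q) F = q_GF q F"
  "F \<in> faces M ==> v_RGF (discrete_grad M k q) F = L2_proj (intF F) (Gface (int k) F) (grad_perp_face M k q F)"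
  "F \<in> faces M ==> v_RGcF (discrete_grad M k q) F = L2_proj (intF F) (Gc_face M (int k) F) (grad_perp_face M k q F)"
  "T \<in> cells M ==> v_RT (discrete_grad M k q) T = L2_proj (intT T) (Rcell (int k - 1) T) (grad_cell M k q T)"
  by (simp_all add: discrete_grad_def)

lemma discrete_grad_in_Xcurl:
  assumes q: "q \<in> Xgrad M k"
  shows "discrete_grad M k q \<in> Xcurl M k"
proof -
  have "vertex_continuous M (v_E (discrete_grad M k q))"
    unfolding vertex_continuous_def by (auto simp: discrete_grad_sel(2) grad_edge_spec(3)[OF q])
  moreover have "(%x. cross3 (edge_deriv M E (grad_edge M k q E) x) (tE E)) \<in> vPoly (int k + 1) E" if "E \<in> edges M" for E
    by (rule edge_deriv_cross_vPoly[OF that]) (use grad_edge_spec(1)[OF q that] in "simp add: add.assoc")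
  moreover have "L2_proj (intF F) S (grad_face M k q F) \<in> S" "L2_proj (intF F) S (grad_perp_face M k q F) \<in> S"
    if "F \<in> faces M" "piece.test_space F S" for F S
    using face_proj(1)[OF that] tPoly_cont[OF that(1)] grad_face_spec(1)[OF q that(1)] grad_perp_face_spec(1)[OF q that(1)] by blast+
  moreover have "L2_proj (intT T) S (grad_cell M k q T) \<in> S" if "T \<in> cells M" "piece.test_space T S" for T S
    using cell_proj(1)[OF that] cell_vPoly_cont[OF that(1) grad_cell_spec(1)[OF q that(1)]] by blast
  ultimately show ?thesis
    unfolding Xcurl_def mem_Collect_eq
    by (intro conjI)
      (simp_all add: discrete_grad_def restrict_PiE_iff grad_edge_spec(1)[OF q] XgradD(6)[OF q] face_test_spaces cell_test_spaces)
qed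

lemma discrete_curl_sel:
  "F \<in> faces M ==> w_F (discrete_curl M k v) F = scurl_face M k v F"
  "T \<in> cells M ==> w_GT (discrete_curl M k v) T = L2_proj (intT T) (Gcell (int k - 1) T) (curl_cell M k v T)"
  by (simp_all add: discrete_curl_def)

lemma discrete_curl_in_Xnabla:
  assumes v: "v \<in> Xcurl M k"
  shows "discrete_curl M k v \<in> Xnabla M k"
proof -
  have "vertex_continuous M (w_E (discrete_curl M k v))"
    unfolding vertex_continuous_def by (auto simp: discrete_curl_def curl_edge_spec(2)[OF v])
  moreover have "(%x. L2_proj (intF F) S (vcurl_face M k v F) x + g x) \<in> S"
    if "F \<in> faces M" "piece.test_space F S" "g \<in> S" for F S g
    using fdim_add[OF face_fdim[OF that(1,2)] face_proj(1)[OF that(1,2)] that(3)] tPoly_cont[OF that(1)] vcurl_face_spec(1)[OF v that(1)] by blast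
  moreover have "L2_proj (intT T) S (curl_cell M k v T) \<in> S" if "T \<in> cells M" "piece.test_space T S" for T S
    using cell_proj(1)[OF that] cell_vPoly_cont[OF that(1) curl_cell_spec(1)[OF v that(1)]] by blast
  ultimately show ?thesis
    unfolding Xnabla_def mem_Collect_eq
    by (intro conjI)
      (simp_all add: discrete_curl_def restrict_PiE_iff curl_edge_spec(1)[OF v] scurl_face_spec(1)[OF v] XcurlD[OF v] face_test_spaces cell_test_spaces)
qed

subsection \<open>Curl of gradients\<close>

text \<open>Stated for polynomials in space, because the test functions on an edge arise as traces
  of functions given on a face or a cell. The bound \<open>k\<close> on the degree is the crucial
  restriction.\<close>

lemma grad_edge_moment:
  assumes q: "q \<in> Xgrad M k" and E: "E \<in> edges M" and r: "r \<in> poly3 (int k)"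
  shows "intE E (%x. (grad_edge M k q E x \<bullet> a) * r x) = intE E (%x. (edge_gradient q E x \<bullet> a) * r x)"
proof -
  interpret E: piece E "edge_chart E" by (rule piece_edge[OF E])
  have eq: "intE E (%x. h x * r x) = intE E (%x. h x * r (hull_proj E x))" for h
    by (rule edge_integral_arith(5)[OF E]) (simp add: E.hull_proj_X)
  show ?thesis unfolding eq[of "%x. grad_edge M k q E x \<bullet> a"] eq[of "%x. edge_gradient q E x \<bullet> a"]
    by (rule edge_moment[OF E grad_edge_spec(1,2)[OF q E] E.Poly_restrict[OF r]])
qed

lemma edge_gradient_tangent:
  assumes q: "q \<in> Xgrad M k" and E: "E \<in> edges M"
  shows "edge_gradient q E x \<bullet> tE E = dderiv (q_E q E) (tE E) x"
    and "n \<bullet> tE E = 0 ==> edge_gradient q E x \<bullet> n = q_GE q E x \<bullet> n"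
  using tangent_unit[OF E] XgradD(4)[OF q E, of x]
  by (simp_all add: edge_gradient_def edge_deriv_def inner_add_left inner_add_right norm_eq_1 inner_commute)

lemma edge_potential_product:
  assumes q: "q \<in> Xgrad M k" and E: "E \<in> edges M" and r: "r \<in> poly3 l"
  shows "intE E (%x. dderiv (%x. q_E q E x * r x) (tE E) x) =
    intE E (%x. q_E q E x * dderiv r (tE E) x) + intE E (%x. dderiv (q_E q E) (tE E) x * r x)"
proof -
  have p: "q_E q E \<in> poly3 (int k + 1)" using piece.Poly_poly3[OF piece_edge[OF E] XgradD(2)[OF q E]] .
  show ?thesis
    unfolding dderiv_mult[OF poly3_differentiable[OF p] poly3_differentiable[OF r]]
    by (intro edge_integral_arith(1)[OF E] continuous_on_mult poly3_continuous[OF p] poly3_continuous[OF r]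
        poly3_continuous[OF poly3_dderiv[OF p]] poly3_continuous[OF poly3_dderiv[OF r]])
qed

text \<open>\<open>q_E\<close> is single-valued at shared vertices by definition of
  \<open>Xgrad\<close>, so the products fit together around the face.\<close>

lemma edge_potential_boundary_sum:
  assumes q: "q \<in> Xgrad M k" and F: "F \<in> faces M" and r: "r \<in> poly3 l"
  shows "(\<Sum>E\<in>edgesF F. wFE F E * intE E (%x. dderiv (%x. q_E q E x * r x) (tE E) x)) = 0"
proof (rule boundary_derivative_sum[OF F, where l = "%_. int k + 1 + l"])
  fix E assume "E \<in> edgesF F"
  then have E: "E \<in> edges M" by (rule face_edgesD(1))
  show "(%x. q_E q E x * r x) \<in> poly3 (int k + 1 + l)"
    by (rule poly3_mult[OF piece.Poly_poly3[OF piece_edge[OF E] XgradD(2)[OF q E]] r])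
  fix E' V assume E': "E' \<in> edgesF F" and V: "V \<in> vertsE E" "V \<in> vertsE E'"
  have "q_E q E V = q_E q E' V"
    using XgradD(1)[OF q, unfolded vertex_continuous_def, rule_format, OF E face_edgesD(1)[OF E'] IntI[OF V]] .
  then show "q_E q E V * r V = q_E q E' V * r V" by simp
qed

text \<open>The test field \<open>vrot n_F r\<close> with \<open>r\<close> of degree
  \<open>k\<close> lies in the space onto which \<open>v_RF\<close> projects, so \<open>G_F\<close>
  itself may be inserted. Its divergence vanishes, and the edge terms combine to derivatives of
  \<open>q_E\<close> times \<open>r\<close>, which sum to zero around the face.\<close>

lemma scurl_face_grad:
  assumes q: "q \<in> Xgrad M k" and F: "F \<in> faces M"
  shows "scurl_face M k (discrete_grad M k q) F = (%x. 0)"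
proof -
  let ?v = "discrete_grad M k q" and ?n = "nF F"
  interpret F: piece F "face_chart F" by (rule piece_face[OF F])
  note v = discrete_grad_in_Xcurl[OF q]
  have z: "scurl_rhs ?v F r = 0" if r: "r \<in> Poly (int k) F" for r
  proof -
    note r3 = F.Poly_poly3[OF r]
    have R: "vrot ?n r \<in> Rface M (int k - 1) F" using r by (simp add: Rface_def)
    have t: "vrot ?n r \<in> tPoly M (int k) F" by (rule tPoly_mono[OF F _ vrot_tPoly[OF F r]]) simp
    have "intF F (%x. v_RF ?v F x \<bullet> vrot ?n r x) = grad_face_rhs q F (vrot ?n r)"
      unfolding discrete_grad_sel(4)[OF F] grad_face_spec(2)[OF q F t, symmetric]
      by (rule face_proj(2)[OF F face_test_spaces(2)[OF F] tPoly_cont[OF F grad_face_spec(1)[OF q F]] R])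
    also have "... = (\<Sum>E\<in>edgesF F. wFE F E * - intE E (%x. q_E q E x * dderiv r (tE E) x))"
    proof -
      have "intE E (%x. q_E q E x * (vrot ?n r x \<bullet> nFE F E)) = - intE E (%x. q_E q E x * dderiv r (tE E) x)"
        if "E \<in> edgesF F" for E
        using edge_integral_arith(3)[OF face_edgesD(1)[OF that], of "-1" "%x. q_E q E x * dderiv r (tE E) x"]
        by (simp add: vrot_edge_normal[OF F that r])
      then show ?thesis by (simp add: grad_face_rhs_def divg_vrot[OF F r] face_integral_arith(4)[OF F])
    qed
    finally have "scurl_rhs ?v F r = - (\<Sum>E\<in>edgesF F. wFE F E *
        (intE E (%x. q_E q E x * dderiv r (tE E) x) + intE E (%x. dderiv (q_E q E) (tE E) x * r x)))"
      using grad_edge_moment[OF q face_edgesD(1) r3] edge_gradient_tangent(1)[OF q face_edgesD(1)]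
      by (simp add: scurl_rhs_def discrete_grad_sel(2)[OF face_edgesD(1)] distrib_left sum.distrib sum_negf)
    also have "... = - (\<Sum>E\<in>edgesF F. wFE F E * intE E (%x. dderiv (%x. q_E q E x * r x) (tE E) x))"
      using edge_potential_product[OF q face_edgesD(1) r3] by simp
    finally show ?thesis using edge_potential_boundary_sum[OF q F r3] by simp
  qed
  show ?thesis
    by (rule face_zero[OF F face_test_spaces(6)[OF F] scurl_face_spec(1)[OF v F]])
      (simp add: inner_real_def scurl_face_spec(2)[OF v F] z)
qed

text \<open>The two right-hand sides are opposite: the face terms agree because \<open>v_F\<close>
  is \<open>q_GF\<close>, and the edge terms because \<open>grad_edge\<close> has the moments of the
  edge gradient up to degree \<open>k\<close>, whose component along \<open>n_F\<close> is that of
  \<open>q_GE\<close>.\<close>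

lemma vcurl_face_grad:
  assumes q: "q \<in> Xgrad M k" and F: "F \<in> faces M"
  shows "vcurl_face M k (discrete_grad M k q) F = (%x. - grad_perp_face M k q F x)"
proof -
  let ?v = "discrete_grad M k q" and ?n = "nF F"
  note v = discrete_grad_in_Xcurl[OF q]
  note S = face_test_spaces(1)[OF F, of "int k"]
  note c = vcurl_face_spec[OF v F] and g = grad_perp_face_spec[OF q F]
  have "(%x. vcurl_face M k ?v F x + grad_perp_face M k q F x) = (%x. 0)"
  proof (rule face_zero[OF F S fdim_add[OF fdim_tPoly[OF F] c(1) g(1)]])
    fix r assume r: "r \<in> tPoly M (int k) F"
    have e: "intE E (%x. (v_E ?v E x \<bullet> ?n) * (r x \<bullet> tE E)) = intE E (%x. (q_GE q E x \<bullet> ?n) * (r x \<bullet> tE E))"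
      if E: "E \<in> edgesF F" for E
    proof -
      note e = face_edgesD(1)[OF E]
      show ?thesis unfolding discrete_grad_sel(2)[OF e] grad_edge_moment[OF q e vpoly3_inner[OF tPolyD(3)[OF F r]]]
          edge_gradient_tangent(2)[OF q e normal_tangent[OF F E]] ..
    qed
    have "intF F (%x. (vcurl_face M k ?v F x + grad_perp_face M k q F x) \<bullet> r x) = vcurl_rhs ?v F r + grad_perp_rhs q F r"
      unfolding inner_add_left c(2)[OF r, symmetric] g(2)[OF r, symmetric]
      by (intro face_integral_arith(1)[OF F] continuous_on_inner tPoly_cont[OF F c(1)] tPoly_cont[OF F g(1)] tPoly_cont[OF F r])
    also have "... = 0" unfolding vcurl_rhs_def grad_perp_rhs_def discrete_grad_sel(6)[OF F] using e by simp
    finally show "intF F (%x. (vcurl_face M k ?v F x + grad_perp_face M k q F x) \<bullet> r x) = 0" .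
  qed
  then show ?thesis by (simp add: fun_eq_iff add_eq_0_iff2)
qed

lemma face_proj_uminus:
  assumes F: "F \<in> faces M" and S: "piece.test_space F S" and f: "cont f"
  shows "L2_proj (intF F) S (%x. - f x) = (%x. - L2_proj (intF F) S f x)"
proof (rule face_proj_eqI[OF F S])
  show "(%x. - L2_proj (intF F) S f x) \<in> S" using fdim_scaleR[OF face_fdim[OF F S] face_proj(1)[OF F S f], of "-1"] by simp
  fix s assume "s \<in> S"
  then show "intF F (%x. - L2_proj (intF F) S f x \<bullet> s x) = intF F (%x. - f x \<bullet> s x)"
    using face_proj(2)[OF F S f] face_integral_arith(3)[OF F, of "-1"] by simp
qed

lemma dderiv_edge_restrict:
  assumes E: "E \<in> edges M" and p: "p \<in> poly3 l"
  shows "dderiv (%x. p (hull_proj E x)) (tE E) x = dderiv p (tE E) (hull_proj E x)"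
proof -
  interpret E: piece E "edge_chart E" by (rule piece_edge[OF E])
  show ?thesis unfolding E.hull_proj_affine
    using dderiv_comp_affine[OF poly3_differentiable[OF p] E.linear_L] edge_L[OF E] by simp
qed

text \<open>On a straight edge the factor \<open>(x - x_F) \<bullet> n_FE\<close> is constant, so
  only the coefficient of the radial field contributes to the degree.\<close>

lemma Rc_face_edge_normal:
  assumes F: "F \<in> faces M" and E: "E \<in> edgesF F" and s: "s \<in> Rc_face M l F"
  shows "\<exists>g\<in>Poly (l - 1) E. \<forall>x\<in>E. s x \<bullet> nFE F E = g x"
proof -
  note e = face_edgesD(1)[OF E]
  interpret F: piece F "face_chart F" by (rule piece_face[OF F])
  interpret E: piece E "edge_chart E" by (rule piece_edge[OF e])
  obtain p where p: "p \<in> Poly (l - 1) F" "s = (%x. p x *R (hull_proj F x - face_point M F))"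
    using s unfolding Rc_face_def by blast
  obtain y where y: "y \<in> E" using edgeD(1)[OF e] by blast
  let ?c = "(y - face_point M F) \<bullet> nFE F E"
  have "(%x. ?c * p (hull_proj E x)) \<in> Poly (l - 1) E" by (intro E.Poly_cmult E.Poly_restrict F.Poly_poly3[OF p(1)])
  moreover have "s x \<bullet> nFE F E = ?c * p (hull_proj E x)" if x: "x \<in> E" for x
  proof -
    have "x - y = ((x - y) \<bullet> tE E) *R tE E" by (rule edge_hull_diff[OF e]) (use x y in "auto intro: hull_inc")
    from arg_cong[OF this, of "%z. z \<bullet> nFE F E"]
    have "(x - y) \<bullet> nFE F E = ((x - y) \<bullet> tE E) * (tE E \<bullet> nFE F E)" unfolding inner_scaleR_left .
    then have "(x - y) \<bullet> nFE F E = 0" using edge_normal_facts(3)[OF F E] by (simp add: inner_commute)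
    then have "(x - face_point M F) \<bullet> nFE F E = ?c" by (simp add: inner_diff_left)
    moreover have "hull_proj F x = x" "hull_proj E x = x"
      using x edge_sub_face[OF F E] by (auto simp: F.hull_proj_id E.hull_proj_X)
    ultimately show ?thesis by (simp add: p(2))
  qed
  ultimately show ?thesis by (intro bexI[of _ "%x. ?c * p (hull_proj E x)"] ballI)
qed

lemma tangential_potential_edge:
  assumes F: "F \<in> faces M" and E: "E \<in> edgesF F" and r: "r \<in> vpoly3 m" and p: "p \<in> Poly l F"
    and dec: "!!x. cross3 (r (hull_proj F x)) (nF F) = vrot (nF F) p x + s x" and x: "x \<in> E"
  shows "s x \<bullet> nFE F E = dderiv p (tE E) x - r x \<bullet> tE E"
proof -
  have "hull_proj F x = x" using x edge_sub_face[OF F E] piece.hull_proj_id[OF piece_face[OF F]] by blast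
  then have "s x = cross3 (r x) (nF F) - vrot (nF F) p x" using dec[of x] by simp
  then show ?thesis
    by (simp add: inner_diff_left tangential_trace(3)[OF F r E] vrot_edge_normal[OF F E p])
qed

text \<open>
  The potentials \<open>p\<close> and \<open>p'\<close> of the tangential traces on two faces sharing \<open>E\<close> have the same derivative
  along \<open>E\<close> up to degree \<open>k - 1\<close>, since \<open>s \<bullet> n_FE\<close> loses one degree on \<open>E\<close>.
\<close>

lemma potentials_differ_low_degree:
  assumes F: "F \<in> faces M" "E \<in> edgesF F" and F': "F' \<in> faces M" "E \<in> edgesF F'" and r: "r \<in> vpoly3 m"
    and p: "p \<in> Poly (int k + 1) F" "s \<in> Rc_face M (int k) F" "!!x. cross3 (r (hull_proj F x)) (nF F) = vrot (nF F) p x + s x"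
    and p': "p' \<in> Poly (int k + 1) F'" "s' \<in> Rc_face M (int k) F'" "!!x. cross3 (r (hull_proj F' x)) (nF F') = vrot (nF F') p' x + s' x"
  shows "(%x. p (hull_proj E x) - p' (hull_proj E x)) \<in> Poly (int k) E"
proof -
  note e = face_edgesD(1)[OF F(2)]
  interpret E: piece E "edge_chart E" by (rule piece_edge[OF e])
  note p3 = piece.Poly_poly3[OF piece_face[OF F(1)] p(1)] piece.Poly_poly3[OF piece_face[OF F'(1)] p'(1)]
  let ?d = "%x. p (hull_proj E x) - p' (hull_proj E x)"
  have d: "?d \<in> Poly (int k + 1) E" by (intro E.Poly_diff E.Poly_restrict p3)
  obtain g g' where g: "g \<in> Poly (int k - 1) E" "!!x. x \<in> E ==> s x \<bullet> nFE F E = g x"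
    "g' \<in> Poly (int k - 1) E" "!!x. x \<in> E ==> s' x \<bullet> nFE F' E = g' x"
    using Rc_face_edge_normal[OF F p(2)] Rc_face_edge_normal[OF F' p'(2)] by blast
  have "(%x. dderiv ?d (tE E) x) = (%x. g x - g' x)"
  proof (rule E.Poly_eqI)
    show "(%x. dderiv ?d (tE E) x) \<in> Poly (int k) E" using E.Poly_dderiv[OF d, of "tE E"] by simp
    show "(%x. g x - g' x) \<in> Poly (int k) E" by (rule E.Poly_mono[OF _ E.Poly_diff[OF g(1,3)]]) simp
    fix x assume x: "x \<in> E"
    have "dderiv ?d (tE E) x = dderiv p (tE E) x - dderiv p' (tE E) x"
      unfolding dderiv_diff[OF E.Poly_differentiable[OF E.Poly_restrict[OF p3(1)]] E.Poly_differentiable[OF E.Poly_restrict[OF p3(2)]]]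
        dderiv_edge_restrict[OF e p3(1)] dderiv_edge_restrict[OF e p3(2)] E.hull_proj_X[OF x] ..
    then show "dderiv ?d (tE E) x = g x - g' x"
      using tangential_potential_edge[OF F r p(1,3) x] tangential_potential_edge[OF F' r p'(1,3) x] g(2,4)[OF x] by simp
  qed
  then show ?thesis using edge_degree_of_deriv[OF e d, of "int k"] E.Poly_diff[OF g(1,3)] by simp
qed

text \<open>On the face \<open>curl r \<bullet> n_F\<close> equals the divergence of the radial part
  \<open>s\<close>, against which \<open>grad_trace\<close> may be tested. The terms
  \<open>G_F \<bullet> s\<close> from the two traces cancel, leaving edge terms; adding the
  vanishing sum of derivatives of \<open>q_E\<close> times \<open>p\<close> makes \<open>p\<close>
  appear only against the difference of \<open>grad_edge\<close> and the edge gradient.\<close>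

lemma curl_cell_grad_face:
  assumes q: "q \<in> Xgrad M k" and F: "F \<in> faces M" and r: "r \<in> vpoly3 (int k)"
    and p: "p \<in> Poly0_face (int k + 1) F" "s \<in> Rc_face M (int k) F"
    and dec: "!!x. cross3 (r (hull_proj F x)) (nF F) = vrot (nF F) p x + s x"
  shows "intF F (%x. grad_trace M k q F x * (curl r x \<bullet> nF F)) +
      intF F (%x. curl_trace M k (discrete_grad M k q) F x \<bullet> cross3 (r x) (nF F)) =
    (\<Sum>E\<in>edgesF F. wFE F E * (intE E (%x. ((grad_edge M k q E x - edge_gradient q E x) \<bullet> tE E) * p x)
      - intE E (%x. q_E q E x * (r x \<bullet> tE E))))"
proof -
  let ?v = "discrete_grad M k q" and ?n = "nF F"
  interpret F: piece F "face_chart F" by (rule piece_face[OF F])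
  note v = discrete_grad_in_Xcurl[OF q]
  have pP: "p \<in> Poly (int k + 1) F" using p(1) by (simp add: Poly0_face_def)
  note p3 = F.Poly_poly3[OF pP]
  have st: "s \<in> tPoly M (int k) F" by (rule Rc_face_tPoly[OF F p(2)])
  have ts: "vrot ?n p \<in> tPoly M (int k) F" using vrot_tPoly[OF F pP] by simp
  have div: "curl r x \<bullet> ?n = divg s x" if x: "x \<in> F" for x
  proof -
    have "divg (%x. cross3 (r (hull_proj F x)) ?n) x = divg (vrot ?n p) x + divg s x"
      unfolding dec
      using linear_intoD(1)[OF linear_tPoly_divg[OF F] ts st] by (simp add: fun_eq_iff)
    then show ?thesis using tangential_trace(2)[OF F r, of x] hull_inc[OF x] by (simp add: divg_vrot[OF F pP])
  qed
  have "intF F (%x. grad_trace M k q F x * (curl r x \<bullet> ?n)) = intF F (%x. grad_trace M k q F x * divg s x)"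
    by (rule face_integral_arith(5)[OF F]) (simp add: div)
  also have "... = grad_trace_rhs k q F s" by (rule grad_trace_spec(2)[OF q F Rc_face_mono[OF F _ p(2)]]) simp
  finally have g: "intF F (%x. grad_trace M k q F x * (curl r x \<bullet> ?n)) = grad_trace_rhs k q F s" .
  have "intF F (%x. curl_trace M k ?v F x \<bullet> cross3 (r x) ?n) = intF F (%x. curl_trace M k ?v F x \<bullet> (vrot ?n p x + s x))"
    by (rule face_integral_arith(5)[OF F]) (simp add: F.hull_proj_X dec[symmetric])
  also have "... = curl_trace_rhs k ?v F p + intF F (%x. v_RcF ?v F x \<bullet> s x)" by (rule curl_trace_spec(2)[OF v F p])
  also have "intF F (%x. v_RcF ?v F x \<bullet> s x) = intF F (%x. grad_face M k q F x \<bullet> s x)"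
    unfolding discrete_grad_sel(5)[OF F]
    by (rule face_proj(2)[OF F face_test_spaces(3)[OF F] tPoly_cont[OF F grad_face_spec(1)[OF q F]] p(2)])
  finally have "intF F (%x. grad_trace M k q F x * (curl r x \<bullet> ?n)) +
      intF F (%x. curl_trace M k ?v F x \<bullet> cross3 (r x) ?n) =
      (\<Sum>E\<in>edgesF F. wFE F E * (intE E (%x. q_E q E x * (s x \<bullet> nFE F E)) +
        intE E (%x. (grad_edge M k q E x \<bullet> tE E) * p x)))"
    unfolding g grad_trace_rhs_def curl_trace_rhs_def scurl_face_grad[OF q F]
    by (simp add: face_integral_arith(4)[OF F] discrete_grad_sel(2)[OF face_edgesD(1)] distrib_left sum.distrib)
  also have "... = (\<Sum>E\<in>edgesF F. wFE F E * (intE E (%x. ((grad_edge M k q E x - edge_gradient q E x) \<bullet> tE E) * p x)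
      - intE E (%x. q_E q E x * (r x \<bullet> tE E)))
      + wFE F E * intE E (%x. dderiv (%x. q_E q E x * p x) (tE E) x))"
  proof (rule sum.cong[OF refl])
    fix E assume E: "E \<in> edgesF F"
    note e = face_edgesD(1)[OF E]
    let ?t = "tE E"
    interpret E: piece E "edge_chart E" by (rule piece_edge[OF e])
    note cq = E.Poly_continuous[OF XgradD(2)[OF q e]] and cp = poly3_continuous[OF p3] poly3_continuous[OF poly3_dderiv[OF p3]]
      and cr = continuous_inner_const[OF vpoly3_continuous[OF r]] and cg = continuous_inner_const[OF E.vPoly_continuous[OF grad_edge_spec(1)[OF q e]]]
      and ce = continuous_inner_const[OF E.vPoly_continuous[OF edge_gradient_vPoly[OF q e]]]
    have "intE E (%x. q_E q E x * (s x \<bullet> nFE F E)) =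
        intE E (%x. q_E q E x * dderiv p ?t x - q_E q E x * (r x \<bullet> ?t))"
      by (rule edge_integral_arith(5)[OF e]) (simp add: tangential_potential_edge[OF F E r pP dec] right_diff_distrib)
    also have "... = intE E (%x. q_E q E x * dderiv p ?t x) - intE E (%x. q_E q E x * (r x \<bullet> ?t))"
      by (intro edge_integral_arith(2)[OF e] continuous_on_mult cq cp cr)
    finally have 1: "intE E (%x. q_E q E x * (s x \<bullet> nFE F E)) =
        intE E (%x. q_E q E x * dderiv p ?t x) - intE E (%x. q_E q E x * (r x \<bullet> ?t))" .
    have 2: "intE E (%x. ((grad_edge M k q E x - edge_gradient q E x) \<bullet> ?t) * p x) =
        intE E (%x. (grad_edge M k q E x \<bullet> ?t) * p x) - intE E (%x. dderiv (q_E q E) ?t x * p x)"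
      unfolding inner_diff_left left_diff_distrib edge_gradient_tangent(1)[OF q e, symmetric]
      by (intro edge_integral_arith(2)[OF e] continuous_on_mult cg ce cp)
    show "wFE F E * (intE E (%x. q_E q E x * (s x \<bullet> nFE F E)) +
        intE E (%x. (grad_edge M k q E x \<bullet> ?t) * p x)) =
      wFE F E * (intE E (%x. ((grad_edge M k q E x - edge_gradient q E x) \<bullet> ?t) * p x)
      - intE E (%x. q_E q E x * (r x \<bullet> ?t)))
      + wFE F E * intE E (%x. dderiv (%x. q_E q E x * p x) ?t x)"
      unfolding 1 2 edge_potential_product[OF q e p3] by (simp add: algebra_simps)
  qed
  finally show ?thesis unfolding sum.distrib edge_potential_boundary_sum[OF q F p3] by simp
qed

lemma curl_cell_grad:
  assumes q: "q \<in> Xgrad M k" and T: "T \<in> cells M"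
  shows "curl_cell M k (discrete_grad M k q) T = (%x. 0)"
proof -
  let ?v = "discrete_grad M k q"
  interpret T: piece T "%x. x" by (rule piece_cell[OF T])
  note v = discrete_grad_in_Xcurl[OF q]
  have z: "curl_cell_rhs k ?v T r = 0" if rT: "r \<in> vPoly (int k) T" for r
  proof -
    note r = T.vPoly_vpoly3[OF rT]
    define ps where "ps F = (SOME ps. fst ps \<in> Poly0_face (int k + 1) F \<and> snd ps \<in> Rc_face M (int k) F \<and>
      (\<forall>x. cross3 (r (hull_proj F x)) (nF F) = vrot (nF F) (fst ps) x + snd ps x))" for F
    have ps: "fst (ps F) \<in> Poly0_face (int k + 1) F" "snd (ps F) \<in> Rc_face M (int k) F"
      "cross3 (r (hull_proj F x)) (nF F) = vrot (nF F) (fst (ps F)) x + snd (ps F) x" if F: "F \<in> faces M" for F x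
    proof -
      obtain p s where "p \<in> Poly0_face (int k + 1) F" "s \<in> Rc_face M (int k) F"
        "(%x. cross3 (r (hull_proj F x)) (nF F)) = (%x. vrot (nF F) p x + s x)"
        using tPoly_decomposition[OF F _ tangential_trace(1)[OF F r]] by auto
      then have "\<exists>ps. fst ps \<in> Poly0_face (int k + 1) F \<and> snd ps \<in> Rc_face M (int k) F \<and>
        (\<forall>x. cross3 (r (hull_proj F x)) (nF F) = vrot (nF F) (fst ps) x + snd ps x)"
        by (intro exI[of _ "(p, s)"]) (simp add: fun_eq_iff)
      from someI_ex[OF this] show "fst (ps F) \<in> Poly0_face (int k + 1) F" "snd (ps F) \<in> Rc_face M (int k) F"
        "cross3 (r (hull_proj F x)) (nF F) = vrot (nF F) (fst (ps F)) x + snd (ps F) x"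
        unfolding ps_def by blast+
    qed
    define \<delta> where "\<delta> E x = (grad_edge M k q E x - edge_gradient q E x) \<bullet> tE E" for E x
    \<comment> \<open>Any face bounded by \<open>E\<close> can serve as reference, whether or not it
      belongs to \<open>T\<close>; the next claim is that the edge term computed from
      \<open>F\<close> agrees with the one computed from \<open>G E\<close>.\<close>
    define G where "G E = (SOME F. F \<in> faces M \<and> E \<in> edgesF F)" for E
    define h where "h E = intE E (%x. \<delta> E x * fst (ps (G E)) x) - intE E (%x. q_E q E x * (r x \<bullet> tE E))" for E
    have h: "intE E (%x. \<delta> E x * fst (ps F) x) - intE E (%x. q_E q E x * (r x \<bullet> tE E)) = h E"
      if F: "F \<in> faces M" and E: "E \<in> edgesF F" for E F
    proof -
      note e = face_edgesD(1)[OF E]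
      interpret E: piece E "edge_chart E" by (rule piece_edge[OF e])
      have G: "G E \<in> faces M" "E \<in> edgesF (G E)" unfolding G_def using someI[of "%F. F \<in> faces M \<and> E \<in> edgesF F" F] F E by blast+
      have P: "fst (ps F) \<in> Poly (int k + 1) F" if "F \<in> faces M" for F using ps(1)[OF that] by (simp add: Poly0_face_def)
      let ?p = "fst (ps F)" and ?p' = "fst (ps (G E))"
      let ?d = "%x. ?p (hull_proj E x) - ?p' (hull_proj E x)"
      have d: "?d \<in> Poly (int k) E"
        by (rule potentials_differ_low_degree[OF F E G r P[OF F] ps(2,3)[OF F] P[OF G(1)] ps(2,3)[OF G(1)]])
      note cd = continuous_inner_const[OF continuous_on_diff[OF E.vPoly_continuous[OF grad_edge_spec(1)[OF q e]] E.vPoly_continuous[OF edge_gradient_vPoly[OF q e]]]]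
      have "intE E (%x. \<delta> E x * ?p x) - intE E (%x. \<delta> E x * ?p' x) = intE E (%x. \<delta> E x * ?p x - \<delta> E x * ?p' x)"
        unfolding \<delta>_def
        by (rule edge_integral_arith(2)[OF e, symmetric]; intro continuous_on_mult cd face_Poly_cont[OF F P[OF F]] face_Poly_cont[OF G(1) P[OF G(1)]])
      also have "... = intE E (%x. (grad_edge M k q E x \<bullet> tE E) * ?d x - (edge_gradient q E x \<bullet> tE E) * ?d x)"
        by (rule edge_integral_arith(5)[OF e]) (simp add: E.hull_proj_X \<delta>_def inner_diff_left algebra_simps)
      also have "... = intE E (%x. (grad_edge M k q E x \<bullet> tE E) * ?d x) - intE E (%x. (edge_gradient q E x \<bullet> tE E) * ?d x)"
        by (intro edge_integral_arith(2)[OF e] continuous_on_mult E.Poly_continuous[OF d] continuous_inner_const[OF E.vPoly_continuous[OF grad_edge_spec(1)[OF q e]]]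
            continuous_inner_const[OF E.vPoly_continuous[OF edge_gradient_vPoly[OF q e]]])
      also have "... = 0" using grad_edge_moment[OF q e E.Poly_poly3[OF d], of "tE E"] by simp
      finally show ?thesis by (simp add: h_def)
    qed
    have crv: "curl r \<in> vPoly (int k - 1) T" by (rule T.curl_vPoly[OF rT])
    have "intT T (%x. v_RT ?v T x \<bullet> curl r x) = intT T (%x. grad_cell M k q T x \<bullet> curl r x)"
      unfolding discrete_grad_sel(9)[OF T]
      by (rule cell_proj(2)[OF T cell_test_spaces(2)[OF T] cell_vPoly_cont[OF T grad_cell_spec(1)[OF q T]]]) (use rT in "auto simp: Rcell_def")
    also have "... = grad_cell_rhs k q T (curl r)" by (rule grad_cell_spec(2)[OF q T T.vPoly_mono[OF _ crv]]) simp
    also have "... = (\<Sum>F\<in>facesT T. wTF T F * intF F (%x. grad_trace M k q F x * (curl r x \<bullet> nF F)))"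
      using T.I_0 by (simp add: grad_cell_rhs_def divg_curl[OF r] cell_I[OF T])
    finally have "curl_cell_rhs k ?v T r = (\<Sum>F\<in>facesT T. wTF T F *
        (intF F (%x. grad_trace M k q F x * (curl r x \<bullet> nF F)) + intF F (%x. curl_trace M k ?v F x \<bullet> cross3 (r x) (nF F))))"
      by (simp add: curl_cell_rhs_def distrib_left sum.distrib)
    also have "... = (\<Sum>F\<in>facesT T. wTF T F * (\<Sum>E\<in>edgesF F. wFE F E * h E))"
    proof (rule sum.cong[OF refl])
      fix F assume "F \<in> facesT T"
      then have F: "F \<in> faces M" by (rule cell_facesD(1))
      show "wTF T F * (intF F (%x. grad_trace M k q F x * (curl r x \<bullet> nF F)) +
          intF F (%x. curl_trace M k ?v F x \<bullet> cross3 (r x) (nF F))) = wTF T F * (\<Sum>E\<in>edgesF F. wFE F E * h E)"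
        unfolding curl_cell_grad_face[OF q F r ps[OF F]] \<delta>_def[symmetric] using h[OF F] by simp
    qed
    also have "... = 0" by (rule cell_edge_incidence[OF T])
    finally show ?thesis .
  qed
  show ?thesis
    by (rule cell_zero[OF T cell_test_spaces(1)[OF T] curl_cell_spec(1)[OF v T]]) (simp add: curl_cell_spec(2)[OF v T] z)
qed

theorem curl_grad_complex: "discrete_grad M k ` Xgrad M k \<subseteq> ker_curl M k"
proof (rule image_subsetI)
  fix q assume q: "q \<in> Xgrad M k"
  let ?v = "discrete_grad M k q"
  note v = discrete_grad_in_Xcurl[OF q]
  have 1: "curl_edge M k ?v E = (%x. 0)" if "E \<in> edges M" for E
    by (rule curl_edge_spec(3)[OF v that]) (simp_all add: discrete_grad_sel that)
  have 2: "L2_proj (intF F) S (vcurl_face M k ?v F) x + L2_proj (intF F) S (grad_perp_face M k q F) x = 0"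
    if "F \<in> faces M" "piece.test_space F S" for F S x
    unfolding vcurl_face_grad[OF q that(1)] face_proj_uminus[OF that tPoly_cont[OF that(1) grad_perp_face_spec(1)[OF q that(1)]]] by simp
  have 3: "L2_proj (intT T) S (curl_cell M k ?v T) = (%x. 0)" if "T \<in> cells M" "piece.test_space T S" for T S
    unfolding curl_cell_grad[OF q that(1)] by (rule cell_proj_eqI[OF that fdim_0[OF cell_fdim[OF that]]]) simp
  have "discrete_curl M k ?v = zero_nabla M"
    unfolding discrete_curl_def zero_nabla_def dof_nabla.simps
    by (intro conjI restrict_ext ext refl dof_nabla.equality)
      (simp_all add: 1 2 3 scurl_face_grad[OF q] discrete_grad_sel face_test_spaces cell_test_spaces cong: restrict_cong)
  then show "?v \<in> ker_curl M k" using v by (simp add: ker_curl_def)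
qed

subsection \<open>Divergence of curls\<close>

text \<open>Restriction to the face removes the normal part of the gradient, and so does the cross
  product with \<open>n_F\<close>.\<close>

lemma vrot_restrict:
  assumes F: "F \<in> faces M" and q: "q \<in> poly3 l"
  shows "vrot (nF F) (%x. q (hull_proj F x)) x = cross3 (grad q (hull_proj F x)) (nF F)"
proof -
  interpret F: piece F "face_chart F" by (rule piece_face[OF F])
  let ?n = "nF F" and ?y = "hull_proj F x"
  note dq = poly3_differentiable[OF q]
  have L: "F.L w = w - (w \<bullet> ?n) *R ?n" for w
  proof -
    have "F.L (w - (w \<bullet> ?n) *R ?n) = w - (w \<bullet> ?n) *R ?n"
      by (rule face_L[OF F]) (simp add: inner_diff_right inner_commute normal_sq[OF F])
    then show ?thesis using linear_diff[OF F.linear_L] linear_scale[OF F.linear_L] face_L_normal[OF F] by simp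
  qed
  have "grad (%x. q (hull_proj F x)) x = grad q ?y - (grad q ?y \<bullet> ?n) *R ?n"
  proof (rule vector_eq_rdot[THEN iffD1, rule_format])
    fix w
    have "grad (%x. q (hull_proj F x)) x \<bullet> w = dderiv (%x. q (hull_proj F x)) w x"
      by (rule grad_inner[OF F.Poly_differentiable[OF F.Poly_restrict[OF q]]])
    also have "... = dderiv q (F.L w) ?y"
      unfolding F.hull_proj_affine by (rule dderiv_comp_affine[OF dq F.linear_L])
    also have "... = grad q ?y \<bullet> F.L w" by (rule grad_inner[OF dq, symmetric])
    finally show "grad (%x. q (hull_proj F x)) x \<bullet> w = (grad q ?y - (grad q ?y \<bullet> ?n) *R ?n) \<bullet> w"
      by (simp add: L inner_diff_left inner_diff_right inner_commute)
  qed
  then show ?thesis by (simp add: vrot_def left_diff_distrib cross_mult_left Cross3.left_diff_distrib)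
qed

text \<open>\<open>grad q \<times> n_F\<close> is the rotated gradient of the trace of
  \<open>q\<close>, so this is the definition of the tangential trace with zero radial part. That
  definition tests with potentials of mean zero; for the mean \<open>c\<close> itself the right-hand
  side vanishes by definition of \<open>scurl_face\<close>, so it can be added back.\<close>

lemma curl_trace_grad:
  assumes v: "v \<in> Xcurl M k" and F: "F \<in> faces M" and q: "q \<in> poly3 (int k)"
  shows "intF F (%x. curl_trace M k v F x \<bullet> cross3 (grad q x) (nF F)) =
    intF F (%x. scurl_face M k v F x * q x) +
    (\<Sum>E\<in>edgesF F. wFE F E * intE E (%x. (v_E v E x \<bullet> tE E) * q x))"
proof -
  let ?n = "nF F"
  interpret F: piece F "face_chart F" by (rule piece_face[OF F])
  define p where "p x = q (hull_proj F x)" for x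
  have p: "p \<in> Poly (int k) F" unfolding p_def[abs_def] by (rule F.Poly_restrict[OF q])
  have p1: "p \<in> Poly (int k + 1) F" by (rule F.Poly_mono[OF _ p]) simp
  define c where "c = intF F p / intF F (%x. 1)"
  have one: "intF F (%x. 1) > 0" using F.I_1_pos by (simp add: face_I[OF F])
  have cc: "(%x. c) \<in> Poly (int k) F" by (rule F.Poly_const) simp
  have sc: "cont (scurl_face M k v F)" by (rule F.Poly_continuous[OF scurl_face_spec(1)[OF v F]])
  define r where "r x = p x - c" for x
  have "intF F r = 0"
    unfolding r_def[abs_def] face_integral_arith(2)[OF F F.Poly_continuous[OF p] continuous_on_const]
    using face_integral_arith(3)[OF F, of c "%x. 1"] one by (simp add: c_def)
  moreover have "r \<in> Poly (int k + 1) F" unfolding r_def[abs_def] by (rule F.Poly_diff[OF p1 F.Poly_const]) simp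
  ultimately have r: "r \<in> Poly0_face (int k + 1) F" by (simp add: Poly0_face_def)
  have dr: "dderiv r w x = dderiv p w x" for w x
    unfolding r_def[abs_def] dderiv_diff[OF F.Poly_differentiable[OF p] differentiable_const] by (simp add: dderiv_const)
  have vr: "vrot ?n r x = cross3 (grad q (hull_proj F x)) ?n" for x
    unfolding vrot_restrict[OF F q, symmetric] p_def[symmetric, abs_def] vrot_def by (simp add: grad_within_def dr)
  have zero: "(%x. 0) \<in> Rc_face M (int k) F" by (rule fdim_0[OF face_fdim[OF F face_test_spaces(3)[OF F]]])
  have "intF F (%x. curl_trace M k v F x \<bullet> cross3 (grad q x) ?n) = intF F (%x. curl_trace M k v F x \<bullet> (vrot ?n r x + 0))"
    by (rule face_integral_arith(5)[OF F]) (simp add: vr F.hull_proj_X)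
  also have "... = curl_trace_rhs k v F r"
    unfolding curl_trace_spec(2)[OF v F r zero] by (simp add: face_integral_arith(4)[OF F])
  finally have 1: "intF F (%x. curl_trace M k v F x \<bullet> cross3 (grad q x) ?n) = curl_trace_rhs k v F r" .
  have "vrot ?n (%x. c) x = 0" for x by (simp add: vrot_def grad_within_def vec_eq_iff dderiv_const cross3_nth forall_3)
  then have 2: "intF F (%x. scurl_face M k v F x * c) = - (\<Sum>E\<in>edgesF F. wFE F E * intE E (%x. (v_E v E x \<bullet> tE E) * c))"
    unfolding scurl_face_spec(2)[OF v F cc] by (simp add: scurl_rhs_def face_integral_arith(4)[OF F])
  have 3: "intF F (%x. scurl_face M k v F x * r x) = intF F (%x. scurl_face M k v F x * q x) - intF F (%x. scurl_face M k v F x * c)"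
  proof -
    have "intF F (%x. scurl_face M k v F x * r x) = intF F (%x. scurl_face M k v F x * q x - scurl_face M k v F x * c)"
      by (rule face_integral_arith(5)[OF F]) (simp add: r_def p_def F.hull_proj_X right_diff_distrib)
    also have "... = intF F (%x. scurl_face M k v F x * q x) - intF F (%x. scurl_face M k v F x * c)"
      by (intro face_integral_arith(2)[OF F] continuous_on_mult sc poly3_continuous[OF q] continuous_on_const)
    finally show ?thesis .
  qed
  have 4: "intE E (%x. (v_E v E x \<bullet> tE E) * r x) =
      intE E (%x. (v_E v E x \<bullet> tE E) * q x) - intE E (%x. (v_E v E x \<bullet> tE E) * c)"
    if E: "E \<in> edgesF F" for E
  proof -
    note e = face_edgesD(1)[OF E]
    have "intE E (%x. (v_E v E x \<bullet> tE E) * r x) = intE E (%x. (v_E v E x \<bullet> tE E) * q x - (v_E v E x \<bullet> tE E) * c)"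
      by (rule edge_integral_arith(5)[OF e]) (use edge_sub_face[OF F E] F.hull_proj_id in "auto simp: r_def p_def right_diff_distrib")
    also have "... = intE E (%x. (v_E v E x \<bullet> tE E) * q x) - intE E (%x. (v_E v E x \<bullet> tE E) * c)"
      by (intro edge_integral_arith(2)[OF e] continuous_on_mult dof_edge_cont(3)[OF v e] poly3_continuous[OF q] continuous_on_const)
    finally show ?thesis .
  qed
  show ?thesis unfolding 1 curl_trace_rhs_def 3 2 by (simp add: 4 right_diff_distrib sum_subtractf)
qed

theorem div_curl_complex: "discrete_curl M k ` Xcurl M k \<subseteq> ker_div M k"
proof (rule image_subsetI)
  fix v assume v: "v \<in> Xcurl M k"
  let ?w = "discrete_curl M k v"
  note w = discrete_curl_in_Xnabla[OF v]
  have "div_cell M k ?w T = (%x. 0)" if T: "T \<in> cells M" for T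
  proof (rule div_cell_spec(3)[OF w T])
    interpret T: piece T "%x. x" by (rule piece_cell[OF T])
    show "(%x. 0) \<in> Poly (int k) T" by (rule T.Poly_0)
    fix q assume q: "q \<in> Poly (int k) T"
    note q3 = T.Poly_poly3[OF q]
    have gq: "grad q \<in> vPoly (int k) T" by (rule T.vPoly_mono[OF _ T.grad_vPoly[OF q]]) simp
    have "intT T (%x. w_GT ?w T x \<bullet> grad q x) = intT T (%x. curl_cell M k v T x \<bullet> grad q x)"
      unfolding discrete_curl_sel(2)[OF T]
      by (rule cell_proj(2)[OF T cell_test_spaces(4)[OF T] cell_vPoly_cont[OF T curl_cell_spec(1)[OF v T]]]) (use q in "auto simp: Gcell_def")
    also have "... = (\<Sum>F\<in>facesT T. wTF T F * intF F (%x. curl_trace M k v F x \<bullet> cross3 (grad q x) (nF F)))"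
      unfolding curl_cell_spec(2)[OF v T gq] curl_cell_rhs_def using T.I_0 by (simp add: curl_grad[OF q3] cell_I[OF T])
    also have "... = (\<Sum>F\<in>facesT T. wTF T F * intF F (%x. w_F ?w F x * q x)) +
        (\<Sum>F\<in>facesT T. wTF T F * (\<Sum>E\<in>edgesF F. wFE F E * intE E (%x. (v_E v E x \<bullet> tE E) * q x)))"
      by (simp add: curl_trace_grad[OF v cell_facesD(1) q3] discrete_curl_sel(1)[OF cell_facesD(1)] distrib_left sum.distrib)
    finally show "intT T (%x. 0 * q x) = div_cell_rhs ?w T q"
      unfolding div_cell_rhs_def cell_edge_incidence[OF T] using T.I_0 by (simp add: cell_I[OF T])
  qed
  then have "discrete_div M k ?w = zero_L2 M" unfolding discrete_div_def zero_L2_def by (intro restrict_ext)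
  then show "?w \<in> ker_div M k" using w by (simp add: ker_div_def)
qed

end

section \<open>Surjectivity of the divergence\<close>

text \<open>Project \<open>b\<close> orthogonally onto the column space: the residual is annihilated
  by every column, so injectivity of the transposed system makes it zero.\<close>

lemma finite_system_solvable:
  fixes a :: "'i => 'j => real"
  assumes fin: "finite I" "finite J" and inj: "!!y. (!!j. j \<in> J ==> (\<Sum>i\<in>I. y i * a i j) = 0) ==> \<forall>i\<in>I. y i = 0"
  shows "\<exists>x. \<forall>i\<in>I. (\<Sum>j\<in>J. a i j * x j) = b i"
proof -
  define e where "e j i = (if i \<in> I then a i j else 0)" for j i
  define S where "S = {%i. \<Sum>j\<in>J. x j *R e j i | x. True}"
  have fd: "fdim S" unfolding S_def by (rule fdim_span_family[OF fin(2)])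
  have zero: "f i = 0" if "f \<in> S" "i \<notin> I" for f i using that by (auto simp: S_def e_def)
  have "\<exists>!p. p \<in> S \<and> (\<forall>s\<in>S. (\<Sum>i\<in>I. p i * s i) = (\<Sum>i\<in>I. b i * s i))"
  proof (rule riesz[OF fd])
    show "f = (%i. 0)" if f: "f \<in> S" "(\<Sum>i\<in>I. f i * f i) = 0" for f
    proof
      fix i show "f i = 0"
        using f(2) sum_nonneg_eq_0_iff[OF fin(1), of "%i. f i * f i"] zero[OF f(1)] by (cases "i \<in> I") auto
    qed
  qed (auto simp: linear_on_space_def algebra_simps sum.distrib sum_distrib_left)
  then obtain p where p: "p \<in> S" "!!s. s \<in> S ==> (\<Sum>i\<in>I. p i * s i) = (\<Sum>i\<in>I. b i * s i)" by blast
  have "\<forall>i\<in>I. b i - p i = 0"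
  proof (rule inj)
    fix j assume j: "j \<in> J"
    have "(\<Sum>j'\<in>J. (if j' = j then 1 else 0) *R e j' i) = (\<Sum>j'\<in>J. if j' = j then e j' i else 0)" for i by (rule sum.cong) auto
    then have "(%i. \<Sum>j'\<in>J. (if j' = j then 1 else 0) *R e j' i) = e j" using j fin(2) by (simp add: fun_eq_iff)
    then have "e j \<in> S" unfolding S_def by (intro CollectI exI[of _ "%j'. if j' = j then 1 else 0"]) simp
    from p(2)[OF this] show "(\<Sum>i\<in>I. (b i - p i) * a i j) = 0"
      by (simp add: e_def left_diff_distrib sum_subtractf)
  qed
  moreover obtain x where "p = (%i. \<Sum>j\<in>J. x j *R e j i)" using p(1) by (auto simp: S_def)
  ultimately show ?thesis by (intro exI[of _ x]) (simp add: e_def mult.commute)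
qed

context hho_mesh
begin

lemma cell_outside_closure: "T \<in> cells M ==> T' \<in> cells M ==> T \<noteq> T' ==> T \<inter> closure T' = {}"
  using open_Int_closure_eq_empty[OF cellD(2)] disjoint_pieces[of T T'] by blast

lemma face_area_pos: "F \<in> faces M ==> intF F (%x. 1) > 0"
  using piece.I_1_pos[OF piece_face] by (simp add: face_I)

text \<open>
  A cell function annihilated by the adjoint of the flux balance annihilates \<open>\<integral>\<^sub>T div r\<close> for all polynomial
  fields, hence all integrals of polynomials.
\<close>

lemma constant_flux_balance:
  shows "\<exists>\<phi>. \<forall>T\<in>cells M. (\<Sum>F\<in>facesT T. wTF T F * intF F (%x. \<phi> F)) = b T"
proof -
  define a where "a T F = (if F \<in> facesT T then wTF T F * intF F (%x. 1) else 0)" for T F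
  have sub: "facesT T \<subseteq> faces M" for T by (auto simp: cell_faces_def)
  have swap: "(\<Sum>F\<in>facesT T. g F) = (\<Sum>F\<in>faces M. if F \<in> facesT T then g F else 0)" for T and g :: "point set => real"
    by (rule sum.mono_neutral_cong_left[OF finites(2) sub]) auto
  have "\<exists>\<phi>. \<forall>T\<in>cells M. (\<Sum>F\<in>faces M. a T F * \<phi> F) = b T"
  proof (rule finite_system_solvable[OF finites(1,2)])
    fix y assume y: "!!F. F \<in> faces M ==> (\<Sum>T\<in>cells M. y T * a T F) = 0"
    have y0: "(\<Sum>T\<in>cells M. if F \<in> facesT T then y T * wTF T F else 0) = 0" if F: "F \<in> faces M" for F
    proof -
      have "(\<Sum>T\<in>cells M. y T * a T F) = (\<Sum>T\<in>cells M. if F \<in> facesT T then y T * wTF T F else 0) * intF F (%x. 1)"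
        unfolding sum_distrib_right a_def by (rule sum.cong) auto
      then show ?thesis using y[OF F] face_area_pos[OF F] by simp
    qed
    have zero: "(\<Sum>T\<in>cells M. y T * piece.I T (%x. x) p) = 0" if p: "p \<in> poly3 l" for l p
    proof (cases "cells M = {}")
      case False
      then obtain T0 where T0: "T0 \<in> cells M" by blast
      \<comment> \<open>The cell \<open>T0\<close> only provides the centre of the radial field.
        Both \<open>p\<close> and \<open>s\<close> are polynomials on the whole space, so Stokes'
        formula applies to \<open>s\<close> on every cell.\<close>
      obtain s where "s \<in> Rc_cell M (l + 1) T0" "divg s = p"
        using Rc_cell_div_surj[OF T0, of p "l + 1"] p cell_Poly_iff[OF T0] by auto
      then have s: "s \<in> vpoly3 (l + 1)" "divg s = p" using Rc_cell_vpoly3[OF T0] by auto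
      have "(\<Sum>T\<in>cells M. y T * piece.I T (%x. x) p) =
          (\<Sum>T\<in>cells M. \<Sum>F\<in>faces M. if F \<in> facesT T then y T * wTF T F * intF F (%x. s x \<bullet> nF F) else 0)"
        unfolding s(2)[symmetric] by (simp add: cell_I cell_stokes[OF _ s(1)] sum_distrib_left swap if_distrib mult.assoc cong: sum.cong if_cong)
      also have "... = (\<Sum>F\<in>faces M. \<Sum>T\<in>cells M. if F \<in> facesT T then y T * wTF T F * intF F (%x. s x \<bullet> nF F) else 0)"
        by (rule sum.swap)
      also have "... = (\<Sum>F\<in>faces M. (\<Sum>T\<in>cells M. if F \<in> facesT T then y T * wTF T F else 0) * intF F (%x. s x \<bullet> nF F))"
        unfolding sum_distrib_right by (intro sum.cong refl) auto
      also have "... = 0" by (rule sum.neutral) (simp add: y0)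
      finally show ?thesis .
    qed simp
    show "\<forall>T\<in>cells M. y T = 0"
    proof
      fix T0 assume T0: "T0 \<in> cells M"
      obtain m where m: "m \<in> T0" using cellD(1)[OF T0] by blast
      show "y T0 = 0"
        by (rule poly3_functionals_separate[where J = "cells M" and X = "%T. T" and \<phi> = "%_ x. x" and \<kappa> = y,
              OF finites(1) piece_cell zero T0 m]) (use cell_outside_closure[OF T0] m in auto)
    qed
  qed
  then obtain \<phi> where \<phi>: "!!T. T \<in> cells M ==> (\<Sum>F\<in>faces M. a T F * \<phi> F) = b T" by blast
  have "(\<Sum>F\<in>facesT T. wTF T F * intF F (%x. \<phi> F)) = (\<Sum>F\<in>faces M. a T F * \<phi> F)" for T
  proof -
    have "(\<Sum>F\<in>facesT T. wTF T F * intF F (%x. \<phi> F)) = (\<Sum>F\<in>facesT T. a T F * \<phi> F)"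
    proof (rule sum.cong[OF refl])
      fix F assume F: "F \<in> facesT T"
      show "wTF T F * intF F (%x. \<phi> F) = a T F * \<phi> F"
        using face_integral_arith(3)[OF cell_facesD(1)[OF F], of "\<phi> F" "%x. 1"] F by (simp add: a_def)
    qed
    also have "... = (\<Sum>F\<in>faces M. a T F * \<phi> F)"
      unfolding swap by (rule sum.cong) (auto simp: a_def)
    finally show ?thesis .
  qed
  then show ?thesis using \<phi> by (intro exI[of _ \<phi>]) simp
qed

text \<open>The balance says that the functional to be represented vanishes on constants, so it
  depends on \<open>grad q\<close> only and is given by a gradient, in the representation
  transported along \<open>grad\<close>.\<close>

lemma cell_gradient_flux:
  assumes T: "T \<in> cells M" and u: "u \<in> Poly (int k) T"
    and bal: "(\<Sum>F\<in>facesT T. wTF T F * intF F (%x. \<phi> F)) = intT T u"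
  shows "\<exists>g\<in>Gcell (int k - 1) T. \<forall>q\<in>Poly (int k) T. intT T (%x. u x * q x) =
    - intT T (%x. g x \<bullet> grad q x) + (\<Sum>F\<in>facesT T. wTF T F * intF F (%x. \<phi> F * q x))"
proof -
  interpret T: piece T "%x. x" by (rule piece_cell[OF T])
  let ?Z = "Poly (int k) T"
  define \<psi> where "\<psi> q = (\<Sum>F\<in>facesT T. wTF T F * intF F (%x. \<phi> F * q x)) - intT T (%x. u x * q x)" for q
  have lin: "linear_on_space ?Z \<psi>" unfolding \<psi>_def[abs_def]
  proof (intro linear_on_space_minus linear_on_space_setsum linear_on_space_cmult)
    show "linear_on_space ?Z (%q. intT T (%x. u x * q x))"
      using linear_cell[OF T linear_into_id T.Poly_continuous[OF u] T.Poly_continuous[where l = "int k"]] by (simp add: inner_real_def)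
    fix F assume "F \<in> facesT T"
    then have F: "F \<in> faces M" by (rule cell_facesD(1))
    show "linear_on_space ?Z (%q. intF F (%x. \<phi> F * q x))"
      using linear_face[OF F linear_into_id continuous_on_const T.Poly_continuous[where l = "int k"]] by (simp add: inner_real_def)
  qed
  have const: "\<psi> (%x. c) = 0" for c
  proof -
    have "(\<Sum>F\<in>facesT T. wTF T F * intF F (%x. \<phi> F * c)) = c * (\<Sum>F\<in>facesT T. wTF T F * intF F (%x. \<phi> F))"
      unfolding sum_distrib_left
    proof (rule sum.cong[OF refl])
      fix F assume F: "F \<in> facesT T"
      show "wTF T F * intF F (%x. \<phi> F * c) = c * (wTF T F * intF F (%x. \<phi> F))"
        using face_integral_arith(3)[OF cell_facesD(1)[OF F], of c "%x. \<phi> F"] by (simp add: mult.commute)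
    qed
    then show ?thesis using T.I_cmult[of c u] bal by (simp add: \<psi>_def cell_I[OF T] mult.commute)
  qed
  have grad_lin: "linear_into ?Z grad" by (rule linear_into_grad) (rule T.Poly_differentiable)
  have eq: "\<psi> w = \<psi> z" if w: "w \<in> ?Z" "z \<in> ?Z" "grad w = grad z" for w z
  proof -
    define d where "d x = w x - z x" for x
    have d: "d \<in> ?Z" unfolding d_def[abs_def] by (rule T.Poly_diff[OF w(1,2)])
    have "dderiv d v x = 0" for v x
      unfolding d_def[abs_def] dderiv_diff[OF T.Poly_differentiable[OF w(1)] T.Poly_differentiable[OF w(2)]]
        grad_inner[OF T.Poly_differentiable[OF w(1)], symmetric] grad_inner[OF T.Poly_differentiable[OF w(2)], symmetric] w(3) by simp
    then have "d x = d 0" for x by (rule zero_dderiv_const[OF T.Poly_poly3[OF d]])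
    then have "d = (%x. d 0)" by (rule ext)
    from arg_cong[OF this, of \<psi>] have "\<psi> d = 0" by (rule trans) (rule const)
    moreover have "\<psi> d = \<psi> w - \<psi> z" unfolding d_def[abs_def] by (rule linear_on_space_diff[OF lin T.fdim_Poly w(1,2)])
    ultimately show ?thesis by simp
  qed
  have "\<exists>!g. g \<in> Gcell (int k - 1) T \<and> (\<forall>z\<in>?Z. T.I (%x. g x \<bullet> grad z x) = \<psi> z)"
  proof (rule T.riesz_via_surj[OF cell_test_spaces(4)[OF T]])
    show "grad ` ?Z = Gcell (int k - 1) T" by (simp add: Gcell_def)
    show "\<psi> w = \<psi> z + \<psi> v" if "z \<in> ?Z" "v \<in> ?Z" "w \<in> ?Z" "grad w = (%x. grad z x + grad v x)" for z v w
      using eq[OF that(3) T.Poly_add[OF that(1,2)]] that(4) linear_intoD(1)[OF grad_lin that(1,2)] linear_on_spaceD(1)[OF lin that(1,2)] by simp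
    show "\<psi> w = c * \<psi> z" if "z \<in> ?Z" "w \<in> ?Z" "grad w = (%x. c *R grad z x)" for c z w
      using eq[OF that(2) T.Poly_cmult[OF that(1), of c]] that(3) linear_intoD(2)[OF grad_lin that(1), of c] linear_on_spaceD(2)[OF lin that(1), of c] by simp
  qed
  then obtain g where "g \<in> Gcell (int k - 1) T" "!!z. z \<in> ?Z ==> intT T (%x. g x \<bullet> grad z x) = \<psi> z"
    unfolding cell_I[OF T] by blast
  then show ?thesis by (intro bexI[of _ g]) (simp_all add: \<psi>_def)
qed

theorem discrete_div_surj: "discrete_div M k ` Xnabla M k = XL2 M k"
proof (intro equalityI image_subsetI subsetI)
  fix w assume "w \<in> Xnabla M k"
  then show "discrete_div M k w \<in> XL2 M k" by (simp add: discrete_div_def XL2_def restrict_PiE_iff div_cell_spec(1))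
next
  fix u assume u: "u \<in> XL2 M k"
  then have uT: "u T \<in> Poly (int k) T" if "T \<in> cells M" for T using that by (auto simp: XL2_def)
  obtain \<phi> where \<phi>: "!!T. T \<in> cells M ==> (\<Sum>F\<in>facesT T. wTF T F * intF F (%x. \<phi> F)) = intT T (u T)"
    using constant_flux_balance[of "%T. intT T (u T)"] by blast
  have "\<forall>T\<in>cells M. \<exists>g. g \<in> Gcell (int k - 1) T \<and> (\<forall>q\<in>Poly (int k) T. intT T (%x. u T x * q x) =
    - intT T (%x. g x \<bullet> grad q x) + (\<Sum>F\<in>facesT T. wTF T F * intF F (%x. \<phi> F * q x)))"
    using cell_gradient_flux[OF _ uT \<phi>] by blast
  from bchoice[OF this] obtain g where g: "!!T. T \<in> cells M ==> g T \<in> Gcell (int k - 1) T"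
    "!!T q. T \<in> cells M ==> q \<in> Poly (int k) T ==> intT T (%x. u T x * q x) =
    - intT T (%x. g T x \<bullet> grad q x) + (\<Sum>F\<in>facesT T. wTF T F * intF F (%x. \<phi> F * q x))" by blast
  define w where "w = zero_nabla M \<lparr>w_F := (\<lambda>F\<in>faces M. %x. \<phi> F), w_GT := (\<lambda>T\<in>cells M. g T)\<rparr>"
  have z: "(%x. 0) \<in> Gface (int k) F" "(%x. 0) \<in> Gc_face M (int k) F" if "F \<in> faces M" for F
    using fdim_0[OF face_fdim[OF that]] face_test_spaces[OF that] by blast+
  have zT: "(%x. 0) \<in> Gc_cell M (int k) T" if "T \<in> cells M" for T
    using fdim_0[OF cell_fdim[OF that]] cell_test_spaces[OF that] by blast
  have w: "w \<in> Xnabla M k"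
    unfolding Xnabla_def mem_Collect_eq w_def
    by (intro conjI) (simp_all add: zero_nabla_def restrict_PiE_iff vertex_continuous_def g(1) z zT
        piece.vPoly_0[OF piece_edge] piece.Poly_const[OF piece_face])
  have "div_cell M k w T = u T" if T: "T \<in> cells M" for T
  proof (rule div_cell_spec(3)[OF w T uT[OF T]])
    fix q assume "q \<in> Poly (int k) T"
    then show "intT T (%x. u T x * q x) = div_cell_rhs w T q"
      unfolding g(2)[OF T \<open>q \<in> Poly (int k) T\<close>] div_cell_rhs_def using T cell_facesD(1) by (simp add: w_def)
  qed
  then have "discrete_div M k w = restrict u (cells M)" unfolding discrete_div_def by (intro restrict_ext)
  also have "... = u" using u by (simp add: XL2_def PiE_restrict)
  finally show "u \<in> discrete_div M k ` Xnabla M k" using w by (intro image_eqI) auto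
qed

subsection \<open>Broken polynomials\<close>

text \<open>The squared difference is continuous with zero integral, hence zero on all of
  \<open>T\<close>. This settles the \<open>THE\<close> in \<open>restrictions\<close>.\<close>

lemma AE_eq_Poly_unique:
  assumes T: "T \<in> cells M" and p: "p \<in> Poly l T" "q \<in> Poly l T" and ae: "AE x in lebesgue_on T. p x = q x"
  shows "p = q"
proof (rule piece.Poly_eqI[OF piece_cell[OF T] p])
  interpret T: piece T "%x. x" by (rule piece_cell[OF T])
  have Tm: "T \<in> sets lebesgue" using cellD(2)[OF T] by (simp add: borel_open)
  have "AE x in lebesgue. x \<in> T \<longrightarrow> p x = q x" using ae AE_restrict_space_iff[of T lebesgue] Tm by simp
  then obtain N where N: "{x. \<not> (x \<in> T \<longrightarrow> p x = q x)} \<subseteq> N" "N \<in> null_sets lebesgue"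
    by (auto simp: eventually_ae_filter)
  have "integral T (%x. (p x - q x)\<^sup>2) = integral T (%x. 0)"
    by (rule integral_spike[of N]) (use N in "auto simp: negligible_iff_null_sets")
  then have z: "T.I (%x. (p x - q x)\<^sup>2) = 0" by (simp add: T.I_def)
  have "(p x - q x)\<^sup>2 = 0" if "x \<in> T" for x
    by (rule T.I_definite[OF _ _ z that]) (auto intro!: continuous_intros T.Poly_continuous[OF p(1)] T.Poly_continuous[OF p(2)])
  then show "p x = q x" if "x \<in> T" for x using that by simp
qed

text \<open>A preimage of \<open>u\<close> is glued from the cell polynomials and set to zero off
  the open cells; it is bounded, and on a domain of finite measure this gives square
  integrability.\<close>

theorem restrictions_broken: "restrictions M k ` broken_Poly \<Omega> M k = XL2 M k"
proof (intro equalityI image_subsetI subsetI)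
  fix q assume q: "q \<in> broken_Poly \<Omega> M k"
  have "(THE p. p \<in> Poly (int k) T \<and> (AE x in lebesgue_on T. q x = p x)) \<in> Poly (int k) T" if T: "T \<in> cells M" for T
  proof -
    obtain p where p: "p \<in> Poly (int k) T" "AE x in lebesgue_on T. q x = p x" using q T by (auto simp: broken_Poly_def)
    have "(THE p. p \<in> Poly (int k) T \<and> (AE x in lebesgue_on T. q x = p x)) = p"
    proof (rule the_equality)
      fix p' assume p': "p' \<in> Poly (int k) T \<and> (AE x in lebesgue_on T. q x = p' x)"
      have "AE x in lebesgue_on T. p' x = p x" using conjunct2[OF p'] p(2) by eventually_elim simp
      then show "p' = p" using AE_eq_Poly_unique[OF T] p' p(1) by blast
    qed (use p in blast)
    then show ?thesis using p by simp
  qed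
  then show "restrictions M k q \<in> XL2 M k" by (simp add: restrictions_def XL2_def restrict_PiE_iff)
next
  fix u assume u: "u \<in> XL2 M k"
  then have uT: "u T \<in> Poly (int k) T" if "T \<in> cells M" for T using that by (auto simp: XL2_def)
  define q where "q x = (\<Sum>T\<in>cells M. indicator T x * u T x)" for x
  have qT: "q x = u T x" if T: "T \<in> cells M" and x: "x \<in> T" for x T
  proof -
    have "(\<Sum>T'\<in>cells M. indicator T' x * u T' x) = (\<Sum>T'\<in>cells M. if T' = T then u T x else 0)"
    proof (rule sum.cong[OF refl])
      fix T' assume "T' \<in> cells M"
      then have "T' \<noteq> T ==> x \<notin> T'" using disjoint_pieces[of T' T] T x by blast
      then show "indicator T' x * u T' x = (if T' = T then u T x else 0)" using x by (simp add: indicator_def)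
    qed
    then show ?thesis unfolding q_def using finites(1) T by simp
  qed
  have "q \<in> borel_measurable borel"
    unfolding q_def[abs_def]
  proof (intro borel_measurable_sum borel_measurable_times)
    fix T assume T: "T \<in> cells M"
    show "(indicator T :: point => real) \<in> borel_measurable borel" using cellD(2)[OF T] by simp
    show "u T \<in> borel_measurable borel" by (rule borel_measurable_continuous_onI[OF cell_Poly_cont[OF T uT[OF T]]])
  qed
  then have "q \<in> borel_measurable lebesgue" by (intro measurable_completion) simp
  then have qm: "q \<in> borel_measurable (lebesgue_on \<Omega>)" by (rule measurable_restrict_space1)
  have "\<exists>B. \<forall>x\<in>T. \<bar>u T x\<bar> \<le> B" if T: "T \<in> cells M" for T
  proof -
    have "compact (u T ` closure T)"
      using cellD(4)[OF T] cell_Poly_cont[OF T uT[OF T]] by (intro compact_continuous_image) (auto intro: continuous_on_subset)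
    from compact_imp_bounded[OF this] obtain B where "\<forall>y\<in>u T ` closure T. norm y \<le> B" unfolding bounded_iff by blast
    then show ?thesis using closure_subset[of T] by (intro exI[of _ B]) auto
  qed
  then have "\<forall>T\<in>cells M. \<exists>B. \<forall>x\<in>T. \<bar>u T x\<bar> \<le> B" by blast
  from bchoice[OF this] obtain B where B: "!!T x. T \<in> cells M ==> x \<in> T ==> \<bar>u T x\<bar> \<le> B T" by blast
  have bound: "\<bar>q x\<bar> \<le> (\<Sum>T\<in>cells M. \<bar>B T\<bar>)" for x
    unfolding q_def
  proof (rule order_trans[OF sum_abs sum_mono])
    fix T assume "T \<in> cells M"
    then show "\<bar>indicator T x * u T x\<bar> \<le> \<bar>B T\<bar>" using B[of T x] by (auto simp: indicator_def)
  qed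
  have "finite_measure (lebesgue_on \<Omega>)"
    using domain by (intro finite_measure_lebesgue_on lmeasurable_open) (auto simp: polyhedral_domain_def)
  then have int: "integrable (lebesgue_on \<Omega>) (%x. (q x)\<^sup>2)"
  proof (rule finite_measure.integrable_const_bound)
    show "AE x in lebesgue_on \<Omega>. norm ((q x)\<^sup>2) \<le> (\<Sum>T\<in>cells M. \<bar>B T\<bar>)\<^sup>2"
      using power_mono[OF bound abs_ge_zero, of _ 2] by (intro AE_I2) simp
    show "(%x. (q x)\<^sup>2) \<in> borel_measurable (lebesgue_on \<Omega>)" using qm by (rule borel_measurable_power)
  qed
  have ae: "AE x in lebesgue_on T. q x = u T x" if T: "T \<in> cells M" for T
    by (rule AE_I2) (simp add: qT[OF T])
  have "q \<in> broken_Poly \<Omega> M k" unfolding broken_Poly_def using qm int ae uT by blast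
  moreover have "restrictions M k q = u"
  proof -
    have "(THE p. p \<in> Poly (int k) T \<and> (AE x in lebesgue_on T. q x = p x)) = u T" if T: "T \<in> cells M" for T
    proof (rule the_equality)
      fix p' assume p': "p' \<in> Poly (int k) T \<and> (AE x in lebesgue_on T. q x = p' x)"
      have "AE x in lebesgue_on T. p' x = u T x" using conjunct2[OF p'] ae[OF T] by eventually_elim simp
      then show "p' = u T" using AE_eq_Poly_unique[OF T] p' uT[OF T] by blast
    qed (use ae[OF T] uT[OF T] in blast)
    then have "restrictions M k q = restrict u (cells M)" unfolding restrictions_def by (intro restrict_ext)
    then show ?thesis using u by (simp add: XL2_def PiE_restrict)
  qed
  ultimately show "u \<in> restrictions M k ` broken_Poly \<Omega> M k" by (intro image_eqI) auto
qed

end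

section \<open>The kernel of the gradient\<close>

text \<open>The members carrying one value and the members carrying other values form two closed
  sets that cover \<open>S\<close> without meeting, so one of them is empty.\<close>

lemma connected_cover_constant:
  assumes S: "connected S" "finite I" "S = (\<Union>i\<in>I. C i)" and C: "!!i. i \<in> I ==> closed (C i)" "!!i. i \<in> I ==> C i \<noteq> {}"
    and f: "!!i j x. i \<in> I ==> j \<in> I ==> i \<noteq> j ==> x \<in> C i ==> x \<in> C j ==> f i = f j"
  shows "\<exists>c. \<forall>i\<in>I. f i = c"
proof (cases "I = {}")
  case False
  then obtain i where i: "i \<in> I" by blast
  let ?A = "\<Union>j\<in>{j \<in> I. f j = f i}. C j" and ?B = "\<Union>j\<in>{j \<in> I. f j \<noteq> f i}. C j"
  have "?A \<inter> S = {} \<or> ?B \<inter> S = {}"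
  proof (rule connected_closedD[OF S(1)])
    show "?A \<inter> ?B \<inter> S = {}" using f by (auto, metis)
    show "S \<subseteq> ?A \<union> ?B" unfolding S(3) by blast
    show "closed ?A" "closed ?B" using S(2) C(1) by (auto intro!: closed_UN)
  qed
  moreover have "?A \<inter> S \<noteq> {}" using C(2)[OF i] i unfolding S(3) by blast
  moreover have "f j = f i" if "j \<in> I" "?B \<inter> S = {}" for j using that C(2)[OF that(1)] unfolding S(3) by blast
  ultimately show ?thesis by blast
qed simp

text \<open>At a boundary point \<open>frechet_derivative\<close> within \<open>S\<close> is
  meaningful only if derivatives there are unique. The segments from \<open>x\<close> into the open
  convex set \<open>T\<close> stay in \<open>S\<close> and provide enough directions.\<close>

lemma grad_within_const:
  assumes T: "convex T" "open T" "T \<noteq> {}" "T \<subseteq> S" and x: "x \<in> closure T" "x \<in> S"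
  shows "grad_within S (%x. c) x = 0"
proof -
  define D where "D = frechet_derivative (%x :: point. c :: real) (at x within S)"
  have D: "((%x. c) has_derivative D) (at x within S)"
    unfolding D_def frechet_derivative_works[symmetric] by (rule differentiable_const)
  have lin: "linear D" using D by (rule has_derivative_linear)
  have z: "D (y - x) = 0" if y: "y \<in> T" for y
  proof -
    let ?g = "%t :: real. x + t *R (y - x)"
    have "?g t \<in> S" if t: "t \<in> {0..1}" for t
    proof (cases "t = 0 \<or> x = y \<or> t = 1")
      case False
      then have "?g t \<in> open_segment y x"
        using t unfolding in_segment by (intro conjI exI[of _ "1 - t"]) (auto simp: algebra_simps)
      then show ?thesis
        using in_interior_closure_convex_segment[OF T(1) _ x(1), of y] y T(2,4) interior_open[OF T(2)] by blast
    qed (use x(2) y T(4) in auto)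
    then have "?g ` {0..1} \<subseteq> S" by blast
    with D have "((%x. c) has_derivative D) (at (?g 0) within ?g ` {0..1})" by (auto intro: has_derivative_subset)
    moreover have "(?g has_derivative (%t. t *R (y - x))) (at 0 within {0..1})"
      by (auto intro!: derivative_eq_intros)
    ultimately have 1: "((%t. c) has_derivative (%t. D (t *R (y - x)))) (at 0 within {0..1})"
      by (rule has_derivative_in_compose[rotated])
    have "(%t. D (t *R (y - x))) = (%t. 0)"
      by (rule frechet_derivative_unique_within_closed_interval[of "0::real" 1 0 "%t. c"]) (use 1 in "auto simp: cbox_interval")
    from fun_cong[OF this, of 1] show ?thesis by simp
  qed
  \<comment> \<open>Since \<open>T\<close> is open, a small multiple of \<open>v\<close> is the
    difference of two points of \<open>T\<close>, and \<open>D\<close> vanishes on the vectors from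
    \<open>x\<close> to both.\<close>
  have D0: "D v = 0" for v
  proof -
    obtain y e where y: "y \<in> T" and e: "0 < e" "ball y e \<subseteq> T" using T(2,3) by (meson ex_in_conv openE)
    define N where "N = norm v + 1"
    have N: "0 < N" "norm v < N" using norm_ge_zero[of v] unfolding N_def by linarith+
    define s where "s = e / (2 * N)"
    have s: "0 < s" "s * N < e" using e(1) N(1) by (simp_all add: s_def)
    have "s * norm v \<le> s * N" using s(1) N(2) by (intro mult_left_mono) auto
    also have "... < e" by (rule s(2))
    finally have "y + s *R v \<in> T" using e(2) s(1) by (auto simp: dist_norm subset_iff)
    from z[OF this] z[OF y] have "D ((y + s *R v - x) - (y - x)) = 0" by (simp only: linear_diff[OF lin] diff_self)
    then have "s * D v = 0" using linear_scale[OF lin, of s v] by simp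
    then show ?thesis using s(1) by simp
  qed
  show ?thesis unfolding grad_within_def vec_eq_iff by (simp add: D_def[symmetric] D0)
qed

context hho_mesh
begin

lemma mesh_incidence:
  shows "\<forall>F\<in>faces M. \<exists>T\<in>cells M. F \<in> facesT T" "\<forall>E\<in>edges M. \<exists>F\<in>faces M. E \<in> edgesF F"
    "\<forall>V\<in>verts M. \<exists>E\<in>edges M. V \<in> vertsE E" "closure \<Omega> = (\<Union>T\<in>cells M. closure T)"
proof -
  note m = mesh[unfolded polyhedral_mesh_def]
  show "\<forall>F\<in>faces M. \<exists>T\<in>cells M. F \<in> facesT T" using m by (elim conjE)
  show "\<forall>E\<in>edges M. \<exists>F\<in>faces M. E \<in> edgesF F" using m by (elim conjE)
  show "\<forall>V\<in>verts M. \<exists>E\<in>edges M. V \<in> vertsE E" using m by (elim conjE)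
  show "closure \<Omega> = (\<Union>T\<in>cells M. closure T)" using m by (elim conjE)
qed

lemmas cell_has_face = mesh_incidence(1)[rule_format]
lemmas face_has_edge = mesh_incidence(2)[rule_format]
lemmas edge_has_vert = mesh_incidence(3)[rule_format]
lemmas closure_domain = mesh_incidence(4)

lemma grad_const_closure: "T \<in> cells M ==> x \<in> closure T ==> grad_within (closure \<Omega>) (%x. c) x = 0"
  by (rule grad_within_const[OF cellD(3,2,1)]) (use closure_domain closure_subset[of T] in auto)

lemma mesh_in_cell_closure:
  shows "F \<in> faces M ==> \<exists>T\<in>cells M. closure F \<subseteq> closure T"
    and "E \<in> edges M ==> \<exists>T\<in>cells M. closure E \<subseteq> closure T"
    and "V \<in> verts M ==> \<exists>T\<in>cells M. V \<in> closure T"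
proof -
  show 1: "\<exists>T\<in>cells M. closure F \<subseteq> closure T" if F: "F \<in> faces M" for F
    using cell_has_face[OF F] cell_boundary by blast
  show 2: "\<exists>T\<in>cells M. closure E \<subseteq> closure T" if E: "E \<in> edges M" for E
  proof -
    obtain F where F: "F \<in> faces M" "E \<in> edgesF F" using face_has_edge[OF E] by blast
    then have "closure E \<subseteq> closure F" using face_boundary[OF F(1)] by blast
    then show ?thesis using 1[OF F(1)] by blast
  qed
  show "\<exists>T\<in>cells M. V \<in> closure T" if V: "V \<in> verts M"
  proof -
    obtain E where E: "E \<in> edges M" "V \<in> vertsE E" using edge_has_vert[OF V] by blast
    then have "V \<in> closure E" using edge_verts_rel_frontier[OF E(1)] by (auto simp: rel_frontier_def)
    then show ?thesis using 2[OF E(1)] by blast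
  qed
qed

lemma grad_const_zero:
  shows "F \<in> faces M ==> x \<in> F ==> grad_within (closure \<Omega>) (%x. c) x = 0"
    and "E \<in> edges M ==> x \<in> E ==> grad_within (closure \<Omega>) (%x. c) x = 0"
    and "V \<in> verts M ==> grad_within (closure \<Omega>) (%x. c) V = 0"
  using mesh_in_cell_closure(1)[of F] mesh_in_cell_closure(2)[of E] mesh_in_cell_closure(3)[of V]
    closure_subset[of F] closure_subset[of E] grad_const_closure by blast+

subsection \<open>Connectivity of the edge skeleton\<close>

lemma closure_edge_cases: "E \<in> edges M ==> x \<in> closure E ==> x \<in> E \<or> x \<in> vertsE E"
  using edge_verts_rel_frontier[of E] edgeD(2)[of E] by (auto simp: rel_frontier_def rel_open_def)

text \<open>Values spread from edges to faces, to cells and to the domain, using in turn that the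
  relative boundary of a face, the boundary of a cell and the closure of the domain are connected.
  By disjointness of the mesh entities, distinct closed edges meet in vertices, distinct closed
  faces meet in points of closed edges, and distinct closed cells meet in points of closed faces, so
  the common point always has neighbours to compare one dimension lower.\<close>

lemma vertex_compatible_constant:
  assumes touch: "!!E E' V. E \<in> edges M ==> E' \<in> edges M ==> V \<in> vertsE E ==> V \<in> vertsE E' ==> \<kappa> E = \<kappa> E'"
  shows "\<exists>c. \<forall>E\<in>edges M. \<kappa> E = c"
proof -
  have verts: "V \<in> verts M" if "V \<in> vertsE E" for V E using that by (simp add: edge_verts_def)
  have e: "\<kappa> E = \<kappa> E'" if "E \<in> edges M" "E' \<in> edges M" "E \<noteq> E'" "x \<in> closure E" "x \<in> closure E'" for E E' x
  proof -
    have "x \<notin> E \<or> x \<notin> E'" using disjoint_pieces[of E E'] that by blast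
    then have "x \<in> vertsE E \<and> x \<in> vertsE E'"
      using closure_edge_cases[OF that(1,4)] closure_edge_cases[OF that(2,5)] edge_vert_disjoint[OF that(1) verts] edge_vert_disjoint[OF that(2) verts] by blast
    then show ?thesis using touch that(1,2) by blast
  qed
  have "\<forall>F\<in>faces M. \<exists>g. \<forall>E\<in>edgesF F. \<kappa> E = g"
  proof
    fix F assume F: "F \<in> faces M"
    show "\<exists>g. \<forall>E\<in>edgesF F. \<kappa> E = g"
    proof (rule connected_cover_constant[where S = "rel_frontier F" and C = closure])
      show "connected (rel_frontier F)" using faceD[OF F] by (intro connected_sphere_gen) auto
      show "rel_frontier F = (\<Union>E\<in>edgesF F. closure E)" using rel_frontier_face[OF F] face_boundary[OF F] by simp
    qed (use finite_face_edges face_edgesD(1) edgeD(1) e in auto)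
  qed
  from bchoice[OF this] obtain g where g: "!!F E. F \<in> faces M ==> E \<in> edgesF F ==> \<kappa> E = g F" by blast
  have f: "g F = g F'" if F: "F \<in> faces M" "F' \<in> faces M" "F \<noteq> F'" "x \<in> closure F" "x \<in> closure F'" for F F' x
  proof -
    have not: "x \<notin> F" if H: "F \<in> faces M" "F' \<in> faces M" "F \<noteq> F'" "x \<in> closure F'" for F F'
    proof
      assume xF: "x \<in> F"
      then have "x \<in> closure F' - F'" using disjoint_pieces[of F F'] H by blast
      then obtain E where E: "E \<in> edgesF F'" "x \<in> closure E" using face_boundary[OF H(2)] by blast
      note e' = face_edgesD(1)[OF E(1)]
      show False using closure_edge_cases[OF e' E(2)] face_edge_disjoint[OF H(1) e'] face_vert_disjoint[OF H(1) verts] xF by blast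
    qed
    have "x \<in> closure F - F" "x \<in> closure F' - F'" using not[OF F(1,2,3,5)] not[OF F(2,1) _ F(4)] F by auto
    then obtain E E' where E: "E \<in> edgesF F" "x \<in> closure E" "E' \<in> edgesF F'" "x \<in> closure E'"
      using face_boundary[OF F(1)] face_boundary[OF F(2)] by blast
    have "\<kappa> E = \<kappa> E'" using e[OF face_edgesD(1)[OF E(1)] face_edgesD(1)[OF E(3)] _ E(2,4)] by blast
    then show ?thesis using g[OF F(1) E(1)] g[OF F(2) E(3)] by simp
  qed
  have "\<forall>T\<in>cells M. \<exists>d. \<forall>F\<in>facesT T. g F = d"
  proof
    fix T assume T: "T \<in> cells M"
    show "\<exists>d. \<forall>F\<in>facesT T. g F = d"
    proof (rule connected_cover_constant[where S = "rel_frontier T" and C = closure])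
      show "connected (rel_frontier T)" using cellD[OF T] cell_dim[OF T] by (intro connected_sphere_gen) auto
      show "rel_frontier T = (\<Union>F\<in>facesT T. closure F)"
        using cell_boundary[OF T] rel_interior_open[OF cellD(2)[OF T]] by (simp add: rel_frontier_def)
    qed (use finite_cell_faces cell_facesD(1) faceD(1) f in auto)
  qed
  from bchoice[OF this] obtain d where d: "!!T F. T \<in> cells M ==> F \<in> facesT T ==> g F = d T" by blast
  have "\<exists>c. \<forall>T\<in>cells M. d T = c"
  proof (rule connected_cover_constant[where S = "closure \<Omega>" and C = closure])
    show "connected (closure \<Omega>)" using domain by (auto simp: polyhedral_domain_def intro: connected_imp_connected_closure)
    fix T T' x assume T: "T \<in> cells M" "T' \<in> cells M" "T \<noteq> T'" "x \<in> closure T" "x \<in> closure T'"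
    have "x \<in> closure T - T" "x \<in> closure T' - T'"
      using cell_outside_closure[OF T(1,2,3)] cell_outside_closure[OF T(2,1) T(3)[symmetric]] T(4,5) by blast+
    then obtain F F' where F: "F \<in> facesT T" "x \<in> closure F" "F' \<in> facesT T'" "x \<in> closure F'"
      using cell_boundary[OF T(1)] cell_boundary[OF T(2)] by blast
    have "g F = g F'" using f[OF cell_facesD(1)[OF F(1)] cell_facesD(1)[OF F(3)] _ F(2,4)] by blast
    then show "d T = d T'" using d[OF T(1) F(1)] d[OF T(2) F(3)] by simp
  qed (use finites(1) closure_domain cellD(1) in auto)
  then obtain c where c: "!!T. T \<in> cells M ==> d T = c" by blast
  have "\<kappa> E = c" if E: "E \<in> edges M" for E
  proof -
    obtain F where F: "F \<in> faces M" "E \<in> edgesF F" using face_has_edge[OF E] by blast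
    obtain T where "T \<in> cells M" "F \<in> facesT T" using cell_has_face[OF F(1)] by blast
    then show ?thesis using g[OF F] d c by simp
  qed
  then show ?thesis by blast
qed

subsection \<open>Interpolated constants\<close>

text \<open>The projections cannot be replaced by \<open>c\<close>: for \<open>k = 0\<close> the
  spaces of degree \<open>k - 1\<close> are zero and so are these components.\<close>

definition const_dof :: "nat => real => dof_grad" where
  "const_dof k c = \<lparr>
     q_GV = (\<lambda>V\<in>verts M. 0), q_E = (\<lambda>E\<in>edges M. %x. c), q_GE = (\<lambda>E\<in>edges M. %x. 0),
     q_F = (\<lambda>F\<in>faces M. L2_proj (intF F) (Poly (int k - 1) F) (%x. c)),
     q_GF = (\<lambda>F\<in>faces M. %x. 0),
     q_T = (\<lambda>T\<in>cells M. L2_proj (intT T) (Poly (int k - 1) T) (%x. c))\<rparr>"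

text \<open>Unisolvence with moments up to degree \<open>k - 1\<close>; for \<open>k = 0\<close>
  there are no moments and the two end values alone determine an affine function.\<close>

lemma interp_edge_const:
  assumes E: "E \<in> edges M"
  shows "interp_edge M k (%x. c) E = (%x. c)"
  unfolding interp_edge_def
proof (rule the_equality)
  interpret E: piece E "edge_chart E" by (rule piece_edge[OF E])
  let ?P = "Poly (int k - 1) E"
  note S = E.test_space_Poly[OF E.fdim_Poly subset_refl, of "int k - 1"]
  have C: "(%x. c) \<in> Poly (int k + 1) E" by (rule E.Poly_const) simp
  then show "(%x. c) \<in> Poly (int k + 1) E \<and> L2_proj (intE E) ?P (%x. c) = L2_proj (intE E) ?P (%x. c) \<and>
      (\<forall>V\<in>vertsE E. c = c)" by simp
  fix p assume p: "p \<in> Poly (int k + 1) E \<and> L2_proj (intE E) ?P p = L2_proj (intE E) ?P (%x. c) \<and>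
      (\<forall>V\<in>vertsE E. p V = c)"
  obtain a b where ab: "a \<noteq> b" "E = open_segment a b" using edge_ends[OF E] by metis
  have V: "vertsE E = {a, b}" by (rule edge_verts_eq[OF E ab(2,1)])
  have mom: "intE E (%x. p x * r x) = intE E (%x. c * r x)" if r: "r \<in> ?P" for r
    using E.L2_proj_spec(2)[OF S E.Poly_continuous[OF conjunct1[OF p]] r] E.L2_proj_spec(2)[OF S continuous_on_const r, of c] p
    by (simp add: edge_I[OF E])
  have lin: "linear_on_space ?P (%r. intE E (%x. c * r x))"
    using linear_edge[OF E linear_into_id continuous_on_const[where c = c] E.Poly_continuous[where l = "int k - 1"]] by (simp add: inner_real_def)
  let ?Q = "%p. p \<in> Poly (int k + 1) E \<and> (\<forall>r\<in>?P. intE E (%x. p x * r x) = intE E (%x. c * r x)) \<and> p a = c \<and> p b = c"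
  have "\<exists>!p. ?Q p" using edge_unisolvent[OF E ab(2,1) _ lin, where \<alpha> = c and \<beta> = c] by (simp add: add.commute)
  then obtain z where z: "\<forall>y. ?Q y \<longrightarrow> y = z" by (rule ex1E) blast
  have "p = z" by (rule z[rule_format]) (use p mom V in simp)
  moreover have "(%x. c) = z" by (rule z[rule_format]) (use C in simp)
  ultimately show "p = (%x. c)" by (rule trans[OF _ sym])
qed

lemma interp_const: "interp_grad \<Omega> M k (%x. c) = const_dof k c"
proof -
  have E: "L2_proj (intE E) (vPoly (int k) E)
      (%x. cross3 (tE E) (cross3 (grad_within (closure \<Omega>) (%x. c) x) (tE E))) = (%x. 0)" if E: "E \<in> edges M" for E
  proof -
    interpret E: piece E "edge_chart E" by (rule piece_edge[OF E])
    have "E.I (%x. 0 \<bullet> s x) = E.I (%x. cross3 (tE E) (cross3 (grad_within (closure \<Omega>) (%x. c) x) (tE E)) \<bullet> s x)" for s :: vector_field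
      by (rule E.I_cong) (simp add: grad_const_zero(2)[OF E])
    then show ?thesis
      using E.L2_proj_eqI[OF E.test_space_vPoly[OF E.fdim_vPoly subset_refl] E.vPoly_0] by (simp add: edge_I[OF E])
  qed
  have F: "L2_proj (intF F) (Poly (int k - 1) F) (%x. grad_within (closure \<Omega>) (%x. c) x \<bullet> nF F) = (%x. 0)"
    if F: "F \<in> faces M" for F
    by (rule face_proj_eqI[OF F face_test_spaces(6)[OF F] piece.Poly_0[OF piece_face[OF F]]], rule face_integral_arith(5)[OF F])
      (simp add: grad_const_zero(1)[OF F])
  show ?thesis
    unfolding interp_grad_def const_dof_def Let_def
    by (simp add: E F interp_edge_const grad_const_zero(3) cong: restrict_cong)
qed

lemma const_dof_Xgrad: "const_dof k c \<in> Xgrad M k"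
  using face_proj(1)[OF _ face_test_spaces(6) continuous_on_const] cell_proj(1)[OF _ cell_test_spaces(6) continuous_on_const]
  unfolding Xgrad_def mem_Collect_eq const_dof_def
  by (intro conjI) (auto simp: vertex_continuous_def edge_verts_def piece.Poly_const[OF piece_edge] piece.vPoly_0[OF piece_edge] piece.Poly_0[OF piece_face])

lemma const_boundary:
  assumes F: "F \<in> faces M" and q: "\<forall>E\<in>edgesF F. q_E q E = (%x. c)" and r: "r \<in> tPoly M l F"
  shows "(\<Sum>E\<in>edgesF F. wFE F E * intE E (%x. q_E q E x * (r x \<bullet> nFE F E))) = c * intF F (divg r)"
  unfolding face_stokes[OF F r] sum_distrib_left
proof (rule sum.cong[OF refl])
  fix E assume E: "E \<in> edgesF F"
  show "wFE F E * intE E (%x. q_E q E x * (r x \<bullet> nFE F E)) =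
      c * (wFE F E * intE E (%x. r x \<bullet> nFE F E))"
    unfolding q[rule_format, OF E] edge_integral_arith(3)[OF face_edgesD(1)[OF E]] by simp
qed

text \<open>By Stokes the edge terms are \<open>c\<close> times the integral of the divergence. They
  cancel the face term in \<open>grad_face\<close>, and they are all that remains in the identity
  for \<open>grad_trace\<close>. Both inclusions for the kernel rely on this.\<close>

lemma grad_face_const:
  assumes q: "q \<in> Xgrad M k" and F: "F \<in> faces M" and e: "\<forall>E\<in>edgesF F. q_E q E = (%x. c)"
    and f: "q_F q F = L2_proj (intF F) (Poly (int k - 1) F) (%x. c)"
  shows "grad_face M k q F = (%x. 0)" and "grad_trace M k q F = (%x. c)"
proof -
  interpret F: piece F "face_chart F" by (rule piece_face[OF F])
  show g: "grad_face M k q F = (%x. 0)"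
  proof (rule face_zero[OF F face_test_spaces(1)[OF F] grad_face_spec(1)[OF q F]])
    fix r assume r: "r \<in> tPoly M (int k) F"
    have "divg r \<in> Poly (int k - 1) F" by (rule F.divg_Poly[OF tPolyD(1)[OF F r]])
    from face_proj(2)[OF F face_test_spaces(6)[OF F] continuous_on_const this, of c]
    have "intF F (%x. q_F q F x * divg r x) = c * intF F (divg r)"
      unfolding f by (simp add: face_integral_arith(3)[OF F])
    then show "intF F (%x. grad_face M k q F x \<bullet> r x) = 0"
      unfolding grad_face_spec(2)[OF q F r] grad_face_rhs_def const_boundary[OF F e r] by simp
  qed
  have c: "(%x. c) \<in> Poly (int k + 1) F" by (rule F.Poly_const) simp
  have "(%x. grad_trace M k q F x - c) = (%x. 0)"
  proof (rule face_zero[OF F face_test_spaces(6)[OF F] F.Poly_diff[OF grad_trace_spec(1)[OF q F] c]])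
    fix s assume s: "s \<in> Poly (int k + 1) F"
    obtain r where r: "r \<in> Rc_face M (int k + 2) F" "divg r = s" using Rc_face_div_surj[OF F, of s "int k + 2"] s by (auto simp: add.commute)
    have "intF F (%x. grad_trace M k q F x * s x) = c * intF F s"
      using grad_trace_spec(2)[OF q F r(1)] unfolding grad_trace_rhs_def g const_boundary[OF F e Rc_face_tPoly[OF F r(1)]] r(2)
      by (simp add: face_integral_arith(4)[OF F])
    then show "intF F (%x. (grad_trace M k q F x - c) \<bullet> s x) = 0"
      using face_integral_arith(2)[OF F continuous_on_mult[OF F.Poly_continuous[OF grad_trace_spec(1)[OF q F]] F.Poly_continuous[OF s]]
          continuous_on_mult[OF continuous_on_const F.Poly_continuous[OF s]], of c]
      by (simp add: left_diff_distrib face_integral_arith(3)[OF F])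
  qed
  then show "grad_trace M k q F = (%x. c)" by (simp add: fun_eq_iff)
qed

lemma const_cell_boundary:
  assumes T: "T \<in> cells M" and g: "\<forall>F\<in>facesT T. grad_trace M k q F = (%x. c)" and r: "r \<in> vpoly3 l"
  shows "(\<Sum>F\<in>facesT T. wTF T F * intF F (%x. grad_trace M k q F x * (r x \<bullet> nF F))) = c * intT T (divg r)"
  unfolding cell_stokes[OF T r] sum_distrib_left
proof (rule sum.cong[OF refl])
  fix F assume F: "F \<in> facesT T"
  show "wTF T F * intF F (%x. grad_trace M k q F x * (r x \<bullet> nF F)) =
      c * (wTF T F * intF F (%x. r x \<bullet> nF F))"
    unfolding g[rule_format, OF F] face_integral_arith(3)[OF cell_facesD(1)[OF F]] by simp
qed

lemma grad_cell_const:
  assumes q: "q \<in> Xgrad M k" and T: "T \<in> cells M" and g: "\<forall>F\<in>facesT T. grad_trace M k q F = (%x. c)"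
    and t: "q_T q T = L2_proj (intT T) (Poly (int k - 1) T) (%x. c)"
  shows "grad_cell M k q T = (%x. 0)"
proof (rule cell_zero[OF T cell_test_spaces(1)[OF T] grad_cell_spec(1)[OF q T]])
  interpret T: piece T "%x. x" by (rule piece_cell[OF T])
  fix r assume r: "r \<in> vPoly (int k) T"
  from cell_proj(2)[OF T cell_test_spaces(6)[OF T] continuous_on_const T.divg_Poly[OF r], of c]
  have "intT T (%x. q_T q T x * divg r x) = c * intT T (divg r)"
    unfolding t using T.I_cmult[of c "divg r"] by (simp add: cell_I[OF T])
  then show "intT T (%x. grad_cell M k q T x \<bullet> r x) = 0"
    unfolding grad_cell_spec(2)[OF q T r] grad_cell_rhs_def const_cell_boundary[OF T g T.vPoly_vpoly3[OF r]] by simp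
qed

lemma edge_L2_proj_zero: "E \<in> edges M ==> L2_proj (intE E) (vPoly l E) (%x. 0) = (%x. 0)"
  using piece.L2_proj_eqI[OF piece_edge piece.test_space_vPoly[OF piece_edge piece.fdim_vPoly[OF piece_edge] subset_refl] piece.vPoly_0[OF piece_edge]]
  by (simp add: edge_I)

lemma const_dof_kernel: "const_dof k c \<in> ker_grad M k"
proof -
  let ?q = "const_dof k c"
  note q = const_dof_Xgrad[of k c]
  have sel: "E \<in> edges M ==> q_E ?q E = (%x. c)" "E \<in> edges M ==> q_GE ?q E = (%x. 0)"
    "F \<in> faces M ==> q_F ?q F = L2_proj (intF F) (Poly (int k - 1) F) (%x. c)" "F \<in> faces M ==> q_GF ?q F = (%x. 0)"
    "T \<in> cells M ==> q_T ?q T = L2_proj (intT T) (Poly (int k - 1) T) (%x. c)" for E F T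
    by (simp_all add: const_dof_def)
  have e: "grad_edge M k ?q E = (%x. 0)" if E: "E \<in> edges M" for E
  proof -
    have g: "edge_gradient ?q E = (%x. 0)" by (rule ext) (simp add: edge_gradient_def edge_deriv_def sel E dderiv_const)
    have V: "q_GV ?q V = 0" if "V \<in> vertsE E" for V using that by (simp add: const_dof_def edge_verts_def)
    show ?thesis
      unfolding grad_edge_def
      by (rule the1_equality[OF edge_lift_ex1[OF E _ edge_gradient_vPoly[OF q E], of "q_GV ?q", unfolded edge_gradient_def[abs_def]]])
        (use g V edge_L2_proj_zero[OF E] piece.vPoly_0[OF piece_edge[OF E]] in "simp_all add: edge_gradient_def[abs_def]")
  qed
  have p: "grad_perp_face M k ?q F = (%x. 0)" if F: "F \<in> faces M" for F
  proof (rule face_zero[OF F face_test_spaces(1)[OF F] grad_perp_face_spec(1)[OF q F]])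
    fix r assume r: "r \<in> tPoly M (int k) F"
    show "intF F (%x. grad_perp_face M k ?q F x \<bullet> r x) = 0"
      unfolding grad_perp_face_spec(2)[OF q F r] grad_perp_rhs_def
      by (simp add: sel(4)[OF F] sel(2)[OF face_edgesD(1)] face_integral_arith(4)[OF F] edge_integral_arith(4)[OF face_edgesD(1)])
  qed
  have f: "grad_face M k ?q F = (%x. 0)" "grad_trace M k ?q F = (%x. c)" if F: "F \<in> faces M" for F
    using grad_face_const[OF q F _ sel(3)[OF F]] sel(1)[OF face_edgesD(1)] by blast+
  have t: "grad_cell M k ?q T = (%x. 0)" if T: "T \<in> cells M" for T
    by (rule grad_cell_const[OF q T _ sel(5)[OF T]]) (use f(2)[OF cell_facesD(1)] in blast)
  have pf: "L2_proj (intF F) S (%x. 0) = (%x. 0)" if "F \<in> faces M" "piece.test_space F S" for F and S :: "vector_field set"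
    by (rule face_proj_eqI[OF that fdim_0[OF face_fdim[OF that]]]) simp
  have pc: "L2_proj (intT T) S (%x. 0) = (%x. 0)" if "T \<in> cells M" "piece.test_space T S" for T and S :: "vector_field set"
    by (rule cell_proj_eqI[OF that fdim_0[OF cell_fdim[OF that]]]) simp
  have "discrete_grad M k ?q = zero_curl M"
    unfolding discrete_grad_def zero_curl_def
    by (intro dof_curl.equality; simp)
      (intro restrict_ext; simp add: e p f(1) t pf pc sel face_test_spaces cell_test_spaces edge_deriv_def dderiv_const)+
  then show ?thesis using q by (simp add: ker_grad_def)
qed

text \<open>A vanishing edge component makes \<open>q_E\<close> constant on each edge, and
  connectivity makes the constants equal. With the boundary values known, testing \<open>G_F\<close>
  with radial fields recovers the moments of \<open>q_F\<close>, because their divergences fill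
  degree \<open>k - 1\<close>; then the face traces are constant and the same argument recovers
  \<open>q_T\<close>.\<close>

lemma kernel_is_const:
  assumes q: "q \<in> ker_grad M k"
  shows "\<exists>c. q = const_dof k c"
proof -
  have X: "q \<in> Xgrad M k" and z: "discrete_grad M k q = zero_curl M" using q by (auto simp: ker_grad_def)
  have e: "grad_edge M k q E = (%x. 0)" if "E \<in> edges M" for E
    using discrete_grad_sel(2)[OF that, of k q] unfolding z by (simp add: zero_curl_def that)
  have gr: "edge_gradient q E = (%x. 0)" if E: "E \<in> edges M" for E
    using grad_edge_spec(2)[OF X E] unfolding e[OF E] edge_L2_proj_zero[OF E] by simp
  have d: "dderiv (q_E q E) (tE E) x = 0" if E: "E \<in> edges M" for E x
    using edge_gradient_tangent(1)[OF X E, of x] gr[OF E] by simp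
  have ge: "q_GE q E = (%x. 0)" if E: "E \<in> edges M" for E
    using fun_cong[OF gr[OF E]] d[OF E] by (simp add: edge_gradient_def edge_deriv_def fun_eq_iff)
  have gv: "q_GV q V = 0" if V: "V \<in> verts M" for V
  proof -
    obtain E where E: "E \<in> edges M" "V \<in> vertsE E" using edge_has_vert[OF V] by blast
    show ?thesis using grad_edge_spec(3)[OF X E] e[OF E(1)] by simp
  qed
  have "\<forall>E\<in>edges M. \<exists>c. q_E q E = (%x. c)"
    using edge_deriv_zero_const[OF _ XgradD(2)[OF X] d] by blast
  from bchoice[OF this] obtain \<kappa> where \<kappa>: "!!E. E \<in> edges M ==> q_E q E = (%x. \<kappa> E)" by blast
  have "\<exists>c. \<forall>E\<in>edges M. \<kappa> E = c"
  proof (rule vertex_compatible_constant)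
    fix E E' V assume E: "E \<in> edges M" "E' \<in> edges M" "V \<in> vertsE E" "V \<in> vertsE E'"
    have "q_E q E V = q_E q E' V" using XgradD(1)[OF X, unfolded vertex_continuous_def, rule_format, OF E(1,2) IntI[OF E(3,4)]] .
    then show "\<kappa> E = \<kappa> E'" by (simp add: \<kappa> E)
  qed
  then obtain c where c: "!!E. E \<in> edges M ==> q_E q E = (%x. c)" using \<kappa> by auto
  have cF: "\<forall>E\<in>edgesF F. q_E q E = (%x. c)" for F using c face_edgesD(1) by blast
  have gf: "q_GF q F = (%x. 0)" if "F \<in> faces M" for F
    using discrete_grad_sel(6)[OF that, of k q] unfolding z by (simp add: zero_curl_def that)
  have qf: "q_F q F = L2_proj (intF F) (Poly (int k - 1) F) (%x. c)" if F: "F \<in> faces M" for F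
  proof (rule face_proj_eqI[OF F face_test_spaces(6)[OF F] XgradD(5)[OF X F], symmetric])
    fix s assume s: "s \<in> Poly (int k - 1) F"
    \<comment> \<open>The field is taken from \<open>Rc_face M (int k) F\<close>, on which the
      kernel condition controls the projection of \<open>grad_face\<close>.\<close>
    obtain r where r: "r \<in> Rc_face M (int k) F" "divg r = s" using Rc_face_div_surj[OF F s] by blast
    note rt = Rc_face_tPoly[OF F r(1)]
    have "L2_proj (intF F) (Rc_face M (int k) F) (grad_face M k q F) = (%x. 0)"
      using discrete_grad_sel(5)[OF F, of k q] unfolding z by (simp add: zero_curl_def F)
    then have "intF F (%x. grad_face M k q F x \<bullet> r x) = 0"
      using face_proj(2)[OF F face_test_spaces(3)[OF F] tPoly_cont[OF F grad_face_spec(1)[OF X F]] r(1)] by (simp add: face_integral_arith(4)[OF F])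
    then have "intF F (%x. q_F q F x * s x) = c * intF F s"
      unfolding grad_face_spec(2)[OF X F rt] grad_face_rhs_def const_boundary[OF F cF rt] r(2) by simp
    then show "intF F (%x. q_F q F x \<bullet> s x) = intF F (%x. c \<bullet> s x)" by (simp add: face_integral_arith(3)[OF F])
  qed
  have tr: "\<forall>F\<in>facesT T. grad_trace M k q F = (%x. c)" for T
    using grad_face_const(2)[OF X _ cF qf] cell_facesD(1) by blast
  have qt: "q_T q T = L2_proj (intT T) (Poly (int k - 1) T) (%x. c)" if T: "T \<in> cells M" for T
  proof (rule cell_proj_eqI[OF T cell_test_spaces(6)[OF T] XgradD(7)[OF X T], symmetric])
    interpret T: piece T "%x. x" by (rule piece_cell[OF T])
    fix s assume s: "s \<in> Poly (int k - 1) T"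
    obtain r where r: "r \<in> Rc_cell M (int k) T" "divg r = s" using Rc_cell_div_surj[OF T s] by blast
    note r3 = Rc_cell_vpoly3[OF T r(1)]
    have rv: "r \<in> vPoly (int k) T" using r3 by (simp add: cell_vPoly_iff[OF T])
    have "L2_proj (intT T) (Rc_cell M (int k) T) (grad_cell M k q T) = v_RcT (discrete_grad M k q) T"
      by (simp add: discrete_grad_def T)
    then have "L2_proj (intT T) (Rc_cell M (int k) T) (grad_cell M k q T) = (%x. 0)"
      unfolding z by (simp add: zero_curl_def T)
    then have "intT T (%x. grad_cell M k q T x \<bullet> r x) = 0"
      using cell_proj(2)[OF T cell_test_spaces(3)[OF T] cell_vPoly_cont[OF T grad_cell_spec(1)[OF X T]] r(1)] T.I_0 by (simp add: cell_I[OF T])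
    then have "intT T (%x. q_T q T x * s x) = c * intT T s"
      unfolding grad_cell_spec(2)[OF X T rv] grad_cell_rhs_def const_cell_boundary[OF T tr r3] r(2) by simp
    then show "intT T (%x. q_T q T x \<bullet> s x) = intT T (%x. c \<bullet> s x)"
      using T.I_cmult[of c s] by (simp add: cell_I[OF T])
  qed
  have ext: "f = restrict g A" if "f \<in> extensional A" "!!x. x \<in> A ==> f x = g x" for f g :: "'x => 'y" and A
    using that by (auto simp: extensional_def fun_eq_iff restrict_def)
  have Xe: "q_GV q \<in> extensional (verts M)" "q_E q \<in> extensional (edges M)" "q_GE q \<in> extensional (edges M)"
    "q_F q \<in> extensional (faces M)" "q_GF q \<in> extensional (faces M)" "q_T q \<in> extensional (cells M)"
    using X by (auto simp: Xgrad_def PiE_def)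
  have "q = const_dof k c"
    unfolding const_dof_def
    by (intro dof_grad.equality) (simp_all add: ext[OF Xe(1) gv] ext[OF Xe(2) c] ext[OF Xe(3) ge] ext[OF Xe(4) qf] ext[OF Xe(5) gf] ext[OF Xe(6) qt])
  then show ?thesis by blast
qed

theorem kernel_grad: "interp_grad \<Omega> M k ` {%x. c | c. True} = ker_grad M k"
proof (intro equalityI subsetI)
  fix q assume "q \<in> interp_grad \<Omega> M k ` {%x. c | c. True}"
  then obtain c where "q = interp_grad \<Omega> M k (%x. c)" by blast
  then show "q \<in> ker_grad M k" unfolding interp_const using const_dof_kernel by simp
next
  fix q assume "q \<in> ker_grad M k"
  then obtain c where "q = const_dof k c" using kernel_is_const by blast
  then show "q \<in> interp_grad \<Omega> M k ` {%x. c | c. True}" unfolding interp_const[symmetric] by blast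
qed

end

text \<open>Claim (d) is expressed by the last two conjuncts: the image of the divergence is
  \<open>XL2\<close>, and \<open>restrictions\<close> maps the broken polynomials onto the same
  space.\<close>

theorem theorem27:
  fixes \<Omega> :: "point set" and \<rho> :: real and \<H> :: "real set" and \<M> :: "real \<Rightarrow> mesh" and k :: nat
  assumes "polyhedral_domain \<Omega>"
    and "0 < \<rho>" and "\<rho> < 1"
    and "regular_mesh_sequence \<Omega> \<rho> \<H> \<M>"
  shows "\<forall>h\<in>\<H>.
    interp_grad \<Omega> (\<M> h) k ` {\<lambda>x. c | c. True} = ker_grad (\<M> h) k \<and>
    discrete_grad (\<M> h) k ` Xgrad (\<M> h) k \<subseteq> ker_curl (\<M> h) k \<and>
    discrete_curl (\<M> h) k ` Xcurl (\<M> h) k \<subseteq> ker_div (\<M> h) k \<and>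
    discrete_div (\<M> h) k ` Xnabla (\<M> h) k = XL2 (\<M> h) k \<and>
    restrictions (\<M> h) k ` broken_Poly \<Omega> (\<M> h) k = XL2 (\<M> h) k"
proof
  fix h assume "h \<in> \<H>"
  then interpret hho_mesh \<Omega> "\<M> h" \<rho>
    using assms unfolding regular_mesh_sequence_def by unfold_locales blast+
  show "interp_grad \<Omega> (\<M> h) k ` {\<lambda>x. c | c. True} = ker_grad (\<M> h) k \<and>
    discrete_grad (\<M> h) k ` Xgrad (\<M> h) k \<subseteq> ker_curl (\<M> h) k \<and>
    discrete_curl (\<M> h) k ` Xcurl (\<M> h) k \<subseteq> ker_div (\<M> h) k \<and>
    discrete_div (\<M> h) k ` Xnabla (\<M> h) k = XL2 (\<M> h) k \<and>
    restrictions (\<M> h) k ` broken_Poly \<Omega> (\<M> h) k = XL2 (\<M> h) k"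
    by (intro conjI kernel_grad curl_grad_complex div_curl_complex discrete_div_surj restrictions_broken)
qed

end
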